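(* Let $1+\frac1n<p<1+\frac{3}{2n}$ and $f(\xi)=|\xi|^{p-1}\xi$. Let $u_0\in L^1_1(\mathbb R^n)\cap L^\infty(\mathbb R^n)$ and let $u$ be the global solution with initial datum $u_0$. Then for every $q\in[1,\infty]$, $$\lim_{t\to\infty}t^{\frac n2(1-\frac1q)+2\sigma}\|u(t)-\mathcal A_{0,1}(t)\|_q=\|\mathcal R^*_{0,2}\|_q,$$ where $\mathcal R^*_{0,2}=\int_0^1a\cdot\nabla e^{(1-\theta)\Delta}\big((\mathcal A_{0,1}(\theta)-\mathcal A_0(\theta))f'(\mathcal A_0(\theta))\big)d\theta=f(\mathcal M_0(u_0))f'(\mathcal M_0(u_0))\int_0^1a\cdot\nabla e^{(1-\theta)\Delta}\Big(G_\theta^{p-1}\int_0^\theta a\cdot\nabla e^{(\theta-\tau)\Delta}G_\tau^p\,d\tau\Big)d\theta.$ In particular, if $f(\mathcal M_0(u_0))f'(\mathcal M_0(u_0))\ne0$, then $\mathcal R^*_{0,2}\not\equiv0$ and $t^{\frac n2(1-\frac1q)}\|u(t)-\mathcal A_{0,1}(t)\|_q=t^{-2\sigma}\|\mathcal R^*_{0,2}\|_q(1+o(1))$ as $t\to\infty$ for all $q\in[1,\infty]$.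
   Context: Let $n\ge1$, $a=(a_1,\dots,a_n)\in\mathbb R^n\setminus\{0\}$. $\|\cdot\|_q$ is the $L^q(\mathbb R^n)$ norm; $L^1_1=\{\varphi\in L^1: x_j\varphi\in L^1\ \forall j\}$. $G_t(x)=(4\pi t)^{-n/2}e^{-|x|^2/(4t)}$, $e^{t\Delta}\varphi=G_t*\varphi$. The global solution for $u_0\in L^1\cap L^\infty$ is the unique $u\in (C\cap L^\infty)([0,\infty);L^1)\cap(C\cap L^\infty)((0,\infty);L^\infty)$ with $u(t)=e^{t\Delta}u_0+\int_0^ta\cdot\nabla e^{(t-s)\Delta}f(u(s))ds$ for all $t>0$ (solution of $\partial_tu-\Delta u=a\cdot\nabla f(u)$, $u(0)=u_0$). $\mathcal M_0(\varphi)=\int\varphi$; $\mathcal A_0(t)=\mathcal M_0(u_0)G_t$; $\sigma=\frac n2(p-1)-\frac12$; $\mathcal A_{0,1}(t)=\mathcal A_0(t)+\int_0^ta\cdot\nabla e^{(t-s)\Delta}f(\mathcal A_0(s))ds$ for $t>0$. *)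

theory Defs
  imports "HOL-Analysis.Analysis"
begin

definition inv_exp :: "ereal \<Rightarrow> real" where
  "inv_exp q = (if q = \<infinity> then 0 else 1 / real_of_ereal q)"

definition Lq_norm :: "ereal \<Rightarrow> ('a::euclidean_space \<Rightarrow> real) \<Rightarrow> ennreal" where
  "Lq_norm q g =
     (if q = \<infinity> then Inf {C::ennreal. AE x in lborel. ennreal \<bar>g x\<bar> \<le> C}
      else (let I = (\<integral>\<^sup>+ x. ennreal (\<bar>g x\<bar> powr real_of_ereal q) \<partial>lborel)
            in if I = \<infinity> then \<infinity> else ennreal (enn2real I powr (1 / real_of_ereal q))))"

definition gauss :: "real \<Rightarrow> 'a::euclidean_space \<Rightarrow> real" where
  "gauss t x = (4 * pi * t) powr (- real DIM('a) / 2) * exp (- (norm x)\<^sup>2 / (4 * t))"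

definition heat :: "real \<Rightarrow> ('a::euclidean_space \<Rightarrow> real) \<Rightarrow> 'a \<Rightarrow> real" where
  "heat t \<phi> x = (\<integral> y. gauss t (x - y) * \<phi> y \<partial>lborel)"

definition adgrad :: "'a::euclidean_space \<Rightarrow> real \<Rightarrow> ('a \<Rightarrow> real) \<Rightarrow> 'a \<Rightarrow> real" where
  "adgrad a t \<phi> x = frechet_derivative (heat t \<phi>) (at x) a"

definition fnl :: "real \<Rightarrow> real \<Rightarrow> real" where
  "fnl p \<xi> = \<bar>\<xi>\<bar> powr (p - 1) * \<xi>"

definition sigma :: "real \<Rightarrow> real \<Rightarrow> real" where
  "sigma n p = n / 2 * (p - 1) - 1 / 2"

definition mass :: "('a::euclidean_space \<Rightarrow> real) \<Rightarrow> real" where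
  "mass \<phi> = (\<integral> x. \<phi> x \<partial>lborel)"

definition A0 :: "('a::euclidean_space \<Rightarrow> real) \<Rightarrow> real \<Rightarrow> 'a \<Rightarrow> real" where
  "A0 u0 t x = mass u0 * gauss t x"

definition A01 :: "'a::euclidean_space \<Rightarrow> real \<Rightarrow> ('a \<Rightarrow> real) \<Rightarrow> real \<Rightarrow> 'a \<Rightarrow> real" where
  "A01 a p u0 t x = A0 u0 t x +
     set_lebesgue_integral lborel {0..t} (\<lambda>s. adgrad a (t - s) (\<lambda>y. fnl p (A0 u0 s y)) x)"

definition Rstar :: "'a::euclidean_space \<Rightarrow> real \<Rightarrow> ('a \<Rightarrow> real) \<Rightarrow> 'a \<Rightarrow> real" where
  "Rstar a p u0 x = set_lebesgue_integral lborel {0..1} (\<lambda>\<theta>.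
     adgrad a (1 - \<theta>) (\<lambda>y. (A01 a p u0 \<theta> y - A0 u0 \<theta> y) * deriv (fnl p) (A0 u0 \<theta> y)) x)"

definition Rstar2 :: "'a::euclidean_space \<Rightarrow> real \<Rightarrow> ('a \<Rightarrow> real) \<Rightarrow> 'a \<Rightarrow> real" where
  "Rstar2 a p u0 x = fnl p (mass u0) * deriv (fnl p) (mass u0) *
     set_lebesgue_integral lborel {0..1} (\<lambda>\<theta>.
       adgrad a (1 - \<theta>) (\<lambda>y. gauss \<theta> y powr (p - 1) *
          set_lebesgue_integral lborel {0..\<theta>} (\<lambda>\<tau>. adgrad a (\<theta> - \<tau>) (\<lambda>z. gauss \<tau> z powr p) y)) x)"

text \<open>u is the global solution with datum u0 in the class
  (C \<inter> L\<infinity>)([0,\<infinity>);L^1) \<inter> (C \<inter> L\<infinity>)((0,\<infinity>);L\<infinity>) of the Duhamel equation.\<close>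
definition global_solution :: "'a::euclidean_space \<Rightarrow> real \<Rightarrow> ('a \<Rightarrow> real) \<Rightarrow> (real \<Rightarrow> 'a \<Rightarrow> real) \<Rightarrow> bool" where
  "global_solution a p u0 u \<longleftrightarrow>
     (\<forall>t\<ge>0. u t \<in> borel_measurable lborel) \<and>
     (\<forall>t\<ge>0. ((\<lambda>s. Lq_norm 1 (\<lambda>x. u s x - u t x)) \<longlongrightarrow> 0) (at t within {0..})) \<and>
     (SUP t\<in>{0..}. Lq_norm 1 (u t)) < \<infinity> \<and>
     (\<forall>t>0. ((\<lambda>s. Lq_norm \<infinity> (\<lambda>x. u s x - u t x)) \<longlongrightarrow> 0) (at t within {0<..})) \<and>
     (SUP t\<in>{0<..}. Lq_norm \<infinity> (u t)) < \<infinity> \<and>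
     (AE x in lborel. u 0 x = u0 x) \<and>
     (\<forall>t>0. AE x in lborel. u t x = heat t u0 x +
         set_lebesgue_integral lborel {0..t} (\<lambda>s. adgrad a (t - s) (\<lambda>y. fnl p (u s y)) x))"

end

theory Submission
  imports Defs "HOL-Probability.Distributions"
begin

text \<open>The heart of the matter is the a priori bound \<open>\<bar>u(t)\<bar> \<le> C (1 + t)\<^bsup>-n/2\<^esup>\<close> for a solution that is
  only known to be bounded in \<open>L\<^sup>1\<close> and \<open>L\<^sup>\<infinity>\<close>. It starts from the energy: over a time step \<open>h\<close> the solution is
  compared with the heat flow. The flux does no work on a mollified function, and the Hoelder
  regularity of exponent 3/4 provided by Duhamel's formula makes the commutator error \<open>O(h\<^bsup>5/4\<^esup>)\<close>, which disappears
  in the limit \<open>h \<rightarrow> 0\<close>. Along the heat flow the energy is convex and bounded by \<open>C h\<^bsup>-n/2\<^esup>\<close>; this yields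
  algebraic decay in \<open>L\<^sup>2\<close>. Interpolating between \<open>L\<^sup>1\<close> and \<open>L\<^sup>\<infinity>\<close> in Duhamel's formula upgrades it first to some
  algebraic decay in \<open>L\<^sup>\<infinity>\<close> and then, as \<open>p > 1 + 1/n\<close>, to the optimal rate.

  Afterwards a function at time \<open>t\<close> is said to have size \<open>C\<close> if its \<open>L\<^sup>1\<close> norm is at most \<open>C\<close> and its supremum at
  most \<open>C t\<^bsup>-n/2\<^esup>\<close>. Duhamel's integral turns a forcing of size \<open>s\<^bsup>-b\<^esup>\<close>, \<open>b < 1\<close>, into a function of size \<open>t\<^bsup>1/2-b\<^esup>\<close>.
  Applied three times this gives \<open>u - A\<^sub>0 = O(t\<^bsup>-\<sigma>\<^esup>)\<close>, \<open>u - A\<^sub>0\<^sub>1 = O(t\<^bsup>-2\<sigma>\<^esup>)\<close> and, by expanding the nonlinearity to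
  second order, \<open>u - A\<^sub>0\<^sub>1 - D = O(t\<^bsup>-2\<sigma>-\<delta>\<^esup>)\<close>, where \<open>D\<close> is the Duhamel integral of \<open>f'(A\<^sub>0) (A\<^sub>0\<^sub>1 - A\<^sub>0)\<close>. The term
  \<open>D\<close> is exactly self-similar with profile \<open>R\<^sup>*\<close>, and \<open>R\<^sup>*\<close> does not vanish at the origin because its
  integrand has a constant sign there.\<close>

text \<open>No time derivative of the solution is available, so the energy identity is replaced by a
  discrete step. The obstacle is that two kernel gradients cost s^(-1), which just fails to be
  integrable; all such estimates are interpolated slightly below this endpoint, to s^(-7/8). Hence
  the exponents: a gradient mollified at time h grows like h^(-1/8), increments in L1 are
  O(h^(3/8)), and integrating the product over a step gives h^(1 - 1/8 + 3/8) = h^(5/4). An order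
  above 1 is all that is needed, since of the order of 1/h such errors add up to O(h^(1/4)); their
  constants may depend on the time horizon, which is fixed while h tends to 0. The given
  \<open>u\<close> is measurable in x for each single t only, so integrals over s and x cannot be
  exchanged. This is why a jointly measurable version, satisfying the equation at every point, is
  constructed first. The lower bound on p means \<sigma> > 0. The upper bound means \<sigma> < 1/4:
  then the forcing of D, of size s^(-2\<sigma> - 1/2), is integrable at s = 0, and the error
  t^(-1/2) between the heat flow and A0 is o(t^(-2\<sigma>)).\<close>

abbreviation jmeas :: "('b::euclidean_space \<Rightarrow> 'a::euclidean_space \<Rightarrow> real) \<Rightarrow> bool" where
  "jmeas F \<equiv> case_prod F \<in> borel_measurable (borel \<Otimes>\<^sub>M borel)"

lemma jmeas_compose:
  assumes F: "jmeas F" and [measurable]: "f \<in> borel_measurable M" "g \<in> borel_measurable M"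
  shows "(\<lambda>x. F (f x) (g x)) \<in> borel_measurable M"
proof -
  have "(\<lambda>x. (f x, g x)) \<in> M \<rightarrow>\<^sub>M borel \<Otimes>\<^sub>M borel" by measurable
  from measurable_compose[OF this F] show ?thesis by simp
qed

lemma jmeas_lborel: "jmeas F \<longleftrightarrow> case_prod F \<in> borel_measurable (lborel \<Otimes>\<^sub>M lborel)"
proof -
  have "sets (borel \<Otimes>\<^sub>M borel) = sets (lborel \<Otimes>\<^sub>M (lborel :: 'b measure) :: ('a \<times> 'b) measure)"
    by (rule sets_pair_measure_cong) auto
  then show ?thesis by (simp cong: measurable_cong_sets)
qed

subsection \<open>Affine substitution and Fubini with a norm bound\<close>

lemma nn_integral_lborel_affine:
  fixes t :: "'a::euclidean_space"
  assumes [measurable]: "f \<in> borel_measurable borel" and c: "c \<noteq> 0"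
  shows "(\<integral>\<^sup>+x. f x \<partial>lborel) = ennreal (\<bar>c\<bar> ^ DIM('a)) * (\<integral>\<^sup>+x. f (t + c *\<^sub>R x) \<partial>lborel)"
  by (subst lborel_affine[OF c, of t])
     (simp add: nn_integral_density nn_integral_distr nn_integral_cmult ennreal_power)

lemma integrable_lborel_affine:
  fixes t :: "'a::euclidean_space" and f :: "'a \<Rightarrow> real"
  assumes f: "integrable lborel f" and c: "c \<noteq> 0"
  shows "integrable lborel (\<lambda>x. f (t + c *\<^sub>R x))"
proof -
  have [measurable]: "f \<in> borel_measurable borel" using borel_measurable_integrable[OF f] by simp
  show ?thesis
    using f c nn_integral_lborel_affine[of "\<lambda>x. ennreal (norm (f x))" c t]
    unfolding integrable_iff_bounded by (auto simp: ennreal_mult_less_top)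
qed

lemma integral_lborel_affine:
  fixes t :: "'a::euclidean_space" and f :: "'a \<Rightarrow> real"
  assumes [measurable]: "f \<in> borel_measurable borel" and c: "c \<noteq> 0"
  shows "(\<integral>x. f x \<partial>lborel) = \<bar>c\<bar> ^ DIM('a) * (\<integral>x. f (t + c *\<^sub>R x) \<partial>lborel)"
  by (subst lborel_affine[OF c, of t])
     (simp add: integral_density integral_distr)

lemma
  fixes c :: "'a::euclidean_space" and f :: "'a \<Rightarrow> real"
  assumes m [measurable]: "f \<in> borel_measurable borel"
  shows integral_lborel_shift: "(\<integral>x. f (x - c) \<partial>lborel) = (\<integral>x. f x \<partial>lborel)"
    and integral_lborel_reflect: "(\<integral>x. f (c - x) \<partial>lborel) = (\<integral>x. f x \<partial>lborel)"
  using integral_lborel_affine[of f 1 "-c"] integral_lborel_affine[of f "-1" c]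
  by (auto simp: algebra_simps)

lemma
  fixes c :: "'a::euclidean_space" and f :: "'a \<Rightarrow> real"
  assumes "integrable lborel f"
  shows integrable_lborel_shift: "integrable lborel (\<lambda>x. f (x - c))"
    and integrable_lborel_reflect: "integrable lborel (\<lambda>x. f (c - x))"
  using integrable_lborel_affine[of f 1 "-c"] integrable_lborel_affine[of f "-1" c] assms
  by (auto simp: algebra_simps)

lemma borel_measurable_integrable_lborel:
  "integrable lborel f \<Longrightarrow> f \<in> borel_measurable borel"
  using borel_measurable_integrable by force

text \<open>Fubini's theorem together with Minkowski's integral inequality in L1: an integrable
  bound \<open>k\<close> for the L1 norms of the slices gives integrability, the norm bound and the
  exchange of integrals. The variables integrated out this way are times, shifts and convolution
  variables.\<close>

lemma
  fixes F :: "'b::euclidean_space \<Rightarrow> 'a::euclidean_space \<Rightarrow> real"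
  assumes F: "jmeas F" and Fi: "AE s in lborel. integrable lborel (F s) \<and> (\<integral>x. \<bar>F s x\<bar> \<partial>lborel) \<le> k s"
    and k: "integrable lborel k"
  shows fubini_integrable: "integrable lborel (\<lambda>x. \<integral>s. F s x \<partial>lborel)"
    and fubini_bound: "(\<integral>x. \<bar>\<integral>s. F s x \<partial>lborel\<bar> \<partial>lborel) \<le> (\<integral>s. k s \<partial>lborel)"
    and fubini_swap: "(\<integral>x. (\<integral>s. F s x \<partial>lborel) \<partial>lborel) = (\<integral>s. (\<integral>x. F s x \<partial>lborel) \<partial>lborel)"
proof -
  have Fm [measurable]: "case_prod F \<in> borel_measurable (lborel \<Otimes>\<^sub>M lborel)"
    using F by (simp add: jmeas_lborel)
  have i1: "integrable lborel (\<lambda>s. \<integral>x. norm (case_prod F (s, x)) \<partial>lborel)"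
  proof (rule Bochner_Integration.integrable_bound[OF k])
    show "AE s in lborel. norm (\<integral>x. norm (case_prod F (s, x)) \<partial>lborel) \<le> norm (k s)"
      using Fi by eventually_elim (auto intro: order_trans[OF _ abs_ge_self])
  qed measurable
  have P: "integrable (lborel \<Otimes>\<^sub>M lborel) (case_prod F)"
    by (rule lborel_pair.Fubini_integrable[OF Fm i1]) (use Fi in auto)
  show swap: "(\<integral>x. (\<integral>s. F s x \<partial>lborel) \<partial>lborel) = (\<integral>s. (\<integral>x. F s x \<partial>lborel) \<partial>lborel)"
    by (rule lborel_pair.Fubini_integral[OF P])
  show I: "integrable lborel (\<lambda>x. \<integral>s. F s x \<partial>lborel)"
    using lborel_pair.integrable_snd[of F] P by simp
  have PA: "integrable (lborel \<Otimes>\<^sub>M lborel) (\<lambda>(s,x). \<bar>F s x\<bar>)"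
    using integrable_abs[OF P] by (simp add: case_prod_unfold)
  have "(\<integral>x. \<bar>\<integral>s. F s x \<partial>lborel\<bar> \<partial>lborel) \<le> (\<integral>x. (\<integral>s. \<bar>F s x\<bar> \<partial>lborel) \<partial>lborel)"
  proof (rule integral_mono_AE)
    show "integrable lborel (\<lambda>x. \<bar>\<integral>s. F s x \<partial>lborel\<bar>)" using I by (rule integrable_abs)
    show "integrable lborel (\<lambda>x. \<integral>s. \<bar>F s x\<bar> \<partial>lborel)"
      using lborel_pair.integrable_snd[OF PA] .
    show "AE x in lborel. \<bar>\<integral>s. F s x \<partial>lborel\<bar> \<le> (\<integral>s. \<bar>F s x\<bar> \<partial>lborel)"
      using integral_norm_bound[of lborel "\<lambda>s. F s _"] by (auto simp: real_norm_def)
  qed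
  also have "\<dots> = (\<integral>s. (\<integral>x. \<bar>F s x\<bar> \<partial>lborel) \<partial>lborel)"
    by (rule lborel_pair.Fubini_integral[OF PA])
  also have "\<dots> \<le> (\<integral>s. k s \<partial>lborel)"
    by (rule integral_mono_AE) (use lborel_pair.integrable_fst[OF PA] k Fi in auto)
  finally show "(\<integral>x. \<bar>\<integral>s. F s x \<partial>lborel\<bar> \<partial>lborel) \<le> (\<integral>s. k s \<partial>lborel)" .
qed

subsection \<open>Convolution\<close>

definition conv :: "('a::euclidean_space \<Rightarrow> real) \<Rightarrow> ('a \<Rightarrow> real) \<Rightarrow> 'a \<Rightarrow> real" where
  "conv k \<phi> x = (\<integral>y. k (x - y) * \<phi> y \<partial>lborel)"

lemma conv_commute:
  assumes [measurable]: "k \<in> borel_measurable borel" "\<phi> \<in> borel_measurable borel"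
  shows "conv k \<phi> = conv \<phi> k"
proof
  fix x
  show "conv k \<phi> x = conv \<phi> k x"
    unfolding conv_def using integral_lborel_reflect[of "\<lambda>y. k (x - y) * \<phi> y" x]
    by (simp add: mult.commute)
qed

lemma borel_measurable_conv [measurable]:
  assumes [measurable]: "k \<in> borel_measurable borel" "\<phi> \<in> borel_measurable borel"
  shows "conv k \<phi> \<in> borel_measurable borel"
  unfolding conv_def by measurable

lemma conv_integrand_bounded_kernel:
  fixes k \<phi> :: "'a::euclidean_space \<Rightarrow> real"
  assumes [measurable]: "k \<in> borel_measurable borel" and k: "\<And>x. \<bar>k x\<bar> \<le> B" and \<phi>: "integrable lborel \<phi>"
  shows "integrable lborel (\<lambda>y. k (x - y) * \<phi> y)"
proof (rule Bochner_Integration.integrable_bound)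
  note borel_measurable_integrable_lborel[OF \<phi>, measurable]
  show "integrable lborel (\<lambda>y. B * \<phi> y)" using \<phi> by simp
  show "(\<lambda>y. k (x - y) * \<phi> y) \<in> borel_measurable lborel" by measurable
  show "AE y in lborel. norm (k (x - y) * \<phi> y) \<le> norm (B * \<phi> y)"
    using k by (auto simp: abs_mult intro!: mult_right_mono order_trans[OF k])
qed

lemma conv_sup_kernel:
  assumes [measurable]: "k \<in> borel_measurable borel" and k: "\<And>x. \<bar>k x\<bar> \<le> B" and \<phi>: "integrable lborel \<phi>"
  shows "\<bar>conv k \<phi> x\<bar> \<le> B * (\<integral>y. \<bar>\<phi> y\<bar> \<partial>lborel)"
proof -
  have "\<bar>conv k \<phi> x\<bar> \<le> (\<integral>y. \<bar>k (x - y) * \<phi> y\<bar> \<partial>lborel)"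
    unfolding conv_def using integral_norm_bound[of lborel "\<lambda>y. k (x - y) * \<phi> y"] by simp
  also have "\<dots> \<le> (\<integral>y. B * \<bar>\<phi> y\<bar> \<partial>lborel)"
  proof (rule integral_mono)
    show "integrable lborel (\<lambda>y. \<bar>k (x - y) * \<phi> y\<bar>)"
      using conv_integrand_bounded_kernel[OF assms] by simp
  qed (use k \<phi> in \<open>auto simp: abs_mult intro!: mult_right_mono\<close>)
  finally show ?thesis by simp
qed

lemma conv_sup_fun:
  assumes [measurable]: "\<phi> \<in> borel_measurable borel" and \<phi>: "\<And>x. \<bar>\<phi> x\<bar> \<le> B" and k: "integrable lborel k"
  shows "\<bar>conv k \<phi> x\<bar> \<le> B * (\<integral>y. \<bar>k y\<bar> \<partial>lborel)"
  using conv_sup_kernel[OF assms, of x] conv_commute[of k \<phi>] borel_measurable_integrable_lborel[OF k]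
  by simp

lemma
  assumes k: "integrable lborel k" and \<phi>: "integrable lborel \<phi>"
  shows integrable_conv: "integrable lborel (conv k \<phi>)"
    and conv_L1: "(\<integral>x. \<bar>conv k \<phi> x\<bar> \<partial>lborel) \<le> (\<integral>y. \<bar>k y\<bar> \<partial>lborel) * (\<integral>y. \<bar>\<phi> y\<bar> \<partial>lborel)"
proof -
  note borel_measurable_integrable_lborel[OF \<phi>, measurable] borel_measurable_integrable_lborel[OF k, measurable]
  have j: "jmeas (\<lambda>y x. k (x - y) * \<phi> y)" by measurable
  have b: "AE y in lborel. integrable lborel (\<lambda>x. k (x - y) * \<phi> y) \<and>
     (\<integral>x. \<bar>k (x - y) * \<phi> y\<bar> \<partial>lborel) \<le> (\<integral>y. \<bar>k y\<bar> \<partial>lborel) * \<bar>\<phi> y\<bar>"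
    using integral_lborel_shift[of "\<lambda>x. \<bar>k x\<bar>"] integrable_lborel_shift[OF k]
    by (auto simp: abs_mult)
  have i: "integrable lborel (\<lambda>y. (\<integral>y. \<bar>k y\<bar> \<partial>lborel) * \<bar>\<phi> y\<bar>)" using \<phi> by simp
  show "integrable lborel (conv k \<phi>)"
    using fubini_integrable[OF j b i] unfolding conv_def .
  show "(\<integral>x. \<bar>conv k \<phi> x\<bar> \<partial>lborel) \<le> (\<integral>y. \<bar>k y\<bar> \<partial>lborel) * (\<integral>y. \<bar>\<phi> y\<bar> \<partial>lborel)"
    using fubini_bound[OF j b i] unfolding conv_def by simp
qed

text \<open>The outer kernel is bounded and the other two factors are integrable, so the double
  integrand is dominated by \<open>B\<close> |l(y - z)| |\<phi>(z)|. In this form the semigroup law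
  is applied, with the heat kernel or its derivative outside.\<close>

lemma conv_assoc:
  assumes [measurable]: "k \<in> borel_measurable borel" and k: "\<And>x. \<bar>k x\<bar> \<le> B"
    and l: "integrable lborel l" and \<phi>: "integrable lborel \<phi>"
  shows "conv k (conv l \<phi>) = conv (conv k l) \<phi>"
proof
  fix x
  note borel_measurable_integrable_lborel[OF \<phi>, measurable] borel_measurable_integrable_lborel[OF l, measurable]
  let ?F = "\<lambda>z y. k (x - y) * (l (y - z) * \<phi> z)"
  have j: "jmeas ?F" by measurable
  have li: "integrable lborel (\<lambda>y. l (y - z) * \<phi> z)" for z using integrable_lborel_shift[OF l] by simp
  have b: "AE z in lborel. integrable lborel (?F z) \<and>
     (\<integral>y. \<bar>?F z y\<bar> \<partial>lborel) \<le> B * (\<integral>y. \<bar>l y\<bar> \<partial>lborel) * \<bar>\<phi> z\<bar>"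
  proof (intro AE_I2 conjI)
    fix z
    show 1: "integrable lborel (?F z)"
      by (rule conv_integrand_bounded_kernel[OF _ k li]) measurable
    have "(\<integral>y. \<bar>?F z y\<bar> \<partial>lborel) \<le> (\<integral>y. B * \<bar>l (y - z) * \<phi> z\<bar> \<partial>lborel)"
      by (rule integral_mono[OF integrable_abs[OF 1]])
         (use integrable_abs[OF li[of z]] k in \<open>auto simp: abs_mult[of "k _"] intro!: mult_right_mono\<close>)
    also have "\<dots> = B * (\<integral>y. \<bar>l y\<bar> \<partial>lborel) * \<bar>\<phi> z\<bar>"
      using integral_lborel_shift[of "\<lambda>x. \<bar>l x\<bar>"] by (simp add: abs_mult)
    finally show "(\<integral>y. \<bar>?F z y\<bar> \<partial>lborel) \<le> B * (\<integral>y. \<bar>l y\<bar> \<partial>lborel) * \<bar>\<phi> z\<bar>" .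
  qed
  have i: "integrable lborel (\<lambda>z. B * (\<integral>y. \<bar>l y\<bar> \<partial>lborel) * \<bar>\<phi> z\<bar>)" using \<phi> by simp
  have "conv k (conv l \<phi>) x = (\<integral>y. (\<integral>z. ?F z y \<partial>lborel) \<partial>lborel)"
    unfolding conv_def by simp
  also have "\<dots> = (\<integral>z. (\<integral>y. ?F z y \<partial>lborel) \<partial>lborel)"
    by (rule fubini_swap[OF j b i])
  also have "\<dots> = (\<integral>z. conv k l (x - z) * \<phi> z \<partial>lborel)"
  proof (rule Bochner_Integration.integral_cong[OF refl])
    fix z
    have "(\<integral>y. ?F z y \<partial>lborel) = (\<integral>y. k (x - y) * l (y - z) \<partial>lborel) * \<phi> z"
      by (simp add: mult.assoc[symmetric])
    also have "(\<integral>y. k (x - y) * l (y - z) \<partial>lborel) = (\<integral>y. k (x - z - y) * l y \<partial>lborel)"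
      using integral_lborel_shift[of "\<lambda>y. k (x - z - y) * l y" z] by (simp add: algebra_simps)
    finally show "(\<integral>y. ?F z y \<partial>lborel) = conv k l (x - z) * \<phi> z" by (simp add: conv_def)
  qed
  finally show "conv k (conv l \<phi>) x = conv (conv k l) \<phi> x" by (simp add: conv_def)
qed

text \<open>The transpose of convolution with \<open>k\<close> is convolution with the reflected
  kernel. The heat kernel is even, hence self-adjoint; its directional derivative is odd, hence
  skew, which produces the minus sign in \<open>Rem_dual\<close>.\<close>

lemma conv_dual:
  assumes k: "integrable lborel k" and \<phi>: "integrable lborel \<phi>"
    and [measurable]: "g \<in> borel_measurable borel" and g: "\<And>x. \<bar>g x\<bar> \<le> B"
  shows "(\<integral>x. g x * conv k \<phi> x \<partial>lborel) = (\<integral>y. conv (\<lambda>z. k (- z)) g y * \<phi> y \<partial>lborel)"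
proof -
  note borel_measurable_integrable_lborel[OF \<phi>, measurable] borel_measurable_integrable_lborel[OF k, measurable]
  let ?F = "\<lambda>y x. g x * (k (x - y) * \<phi> y)"
  have j: "jmeas ?F" by measurable
  have li: "integrable lborel (\<lambda>x. k (x - y) * \<phi> y)" for y using integrable_lborel_shift[OF k] by simp
  have b: "AE y in lborel. integrable lborel (?F y) \<and>
     (\<integral>x. \<bar>?F y x\<bar> \<partial>lborel) \<le> B * (\<integral>y. \<bar>k y\<bar> \<partial>lborel) * \<bar>\<phi> y\<bar>"
  proof (intro AE_I2 conjI)
    fix y
    show 1: "integrable lborel (?F y)"
      using conv_integrand_bounded_kernel[of "\<lambda>x. g (-x)", OF _ g li, of 0] by simp
    have "(\<integral>x. \<bar>?F y x\<bar> \<partial>lborel) \<le> (\<integral>x. B * \<bar>k (x - y) * \<phi> y\<bar> \<partial>lborel)"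
      by (rule integral_mono[OF integrable_abs[OF 1]])
         (use integrable_abs[OF li[of y]] g in \<open>auto simp: abs_mult[of "g _"] intro!: mult_right_mono\<close>)
    also have "\<dots> = B * (\<integral>y. \<bar>k y\<bar> \<partial>lborel) * \<bar>\<phi> y\<bar>"
      using integral_lborel_shift[of "\<lambda>x. \<bar>k x\<bar>"] by (simp add: abs_mult)
    finally show "(\<integral>x. \<bar>?F y x\<bar> \<partial>lborel) \<le> B * (\<integral>y. \<bar>k y\<bar> \<partial>lborel) * \<bar>\<phi> y\<bar>" .
  qed
  have i: "integrable lborel (\<lambda>z. B * (\<integral>y. \<bar>k y\<bar> \<partial>lborel) * \<bar>\<phi> z\<bar>)" using \<phi> by simp
  have "(\<integral>x. g x * conv k \<phi> x \<partial>lborel) = (\<integral>x. (\<integral>y. ?F y x \<partial>lborel) \<partial>lborel)"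
    unfolding conv_def by simp
  also have "\<dots> = (\<integral>y. (\<integral>x. ?F y x \<partial>lborel) \<partial>lborel)"
    by (rule fubini_swap[OF j b i])
  also have "\<dots> = (\<integral>y. conv (\<lambda>z. k (- z)) g y * \<phi> y \<partial>lborel)"
  proof (rule Bochner_Integration.integral_cong[OF refl])
    fix y
    have "(\<integral>x. ?F y x \<partial>lborel) = (\<integral>x. g x * k (x - y) \<partial>lborel) * \<phi> y"
      by (simp add: mult.assoc[symmetric])
    then show "(\<integral>x. ?F y x \<partial>lborel) = conv (\<lambda>z. k (- z)) g y * \<phi> y"
      by (simp add: conv_def mult.commute)
  qed
  finally show ?thesis .
qed

lemma conv_diff_kernel:
  assumes "k \<in> borel_measurable borel" "l \<in> borel_measurable borel" "\<And>x. \<bar>k x\<bar> \<le> B" "\<And>x. \<bar>l x\<bar> \<le> B'" "integrable lborel \<phi>"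
  shows "conv (\<lambda>x. k x - l x) \<phi> x = conv k \<phi> x - conv l \<phi> x"
  unfolding conv_def left_diff_distrib
  by (rule Bochner_Integration.integral_diff; rule conv_integrand_bounded_kernel) (use assms in auto)

lemma conv_diff:
  assumes "k \<in> borel_measurable borel" "\<And>x. \<bar>k x\<bar> \<le> B" "integrable lborel \<phi>" "integrable lborel \<psi>"
  shows "conv k (\<lambda>x. \<phi> x - \<psi> x) x = conv k \<phi> x - conv k \<psi> x"
  unfolding conv_def right_diff_distrib
  by (rule Bochner_Integration.integral_diff; rule conv_integrand_bounded_kernel) (use assms in auto)

lemma conv_cong_AE:
  assumes "k \<in> borel_measurable borel" "\<phi> \<in> borel_measurable borel" "\<psi> \<in> borel_measurable borel"
    and "AE x in lborel. \<phi> x = \<psi> x"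
  shows "conv k \<phi> = conv k \<psi>"
proof
  fix x show "conv k \<phi> x = conv k \<psi> x"
    unfolding conv_def by (rule integral_cong_AE) (use assms in auto)
qed

subsection \<open>The heat kernel and its directional derivative\<close>

text \<open>This is the directional derivative a . grad G_t. It vanishes at t = 0, which matches the
  value of \<open>adgrad\<close> there.\<close>

definition dgauss :: "'a::euclidean_space \<Rightarrow> real \<Rightarrow> 'a \<Rightarrow> real" where
  "dgauss a t x = - ((a \<bullet> x) / (2 * t)) * gauss t x"

text \<open>Ratio of the normalising constants of G_t and G_{2t}: the price of giving up half of the
  exponential decay.\<close>

abbreviation gcon :: "'a::euclidean_space itself \<Rightarrow> real" where
  "gcon TYPE('a) \<equiv> 2 powr (real DIM('a) / 2)"

lemma gauss_nonneg [simp]: "0 \<le> gauss t x"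
  by (simp add: gauss_def)

lemma gauss_pos: "0 < t \<Longrightarrow> 0 < gauss t x"
  by (simp add: gauss_def)

lemma gauss_zero_time [simp]: "gauss 0 x = 0" "dgauss a 0 x = 0"
  by (simp_all add: gauss_def dgauss_def)

lemma gauss_minus [simp]: "gauss t (- x) = gauss t x" "dgauss a t (- x) = - dgauss a t x"
  by (simp_all add: gauss_def dgauss_def)

lemma borel_measurable_gauss [measurable (raw)]:
  assumes [measurable]: "f \<in> borel_measurable M" "g \<in> borel_measurable M"
  shows "(\<lambda>x. gauss (f x) (g x)) \<in> borel_measurable M"
    and "(\<lambda>x. dgauss a (f x) (g x)) \<in> borel_measurable M"
  unfolding gauss_def dgauss_def by measurable

lemma gauss_le:
  fixes x :: "'a::euclidean_space"
  assumes t: "0 < t"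
  shows "gauss t x \<le> t powr (- real DIM('a) / 2)"
proof -
  have "(4 * pi * t) powr (- real DIM('a) / 2) \<le> t powr (- real DIM('a) / 2)"
  proof (rule powr_mono2')
    have "1 * t \<le> 4 * pi * t" using t pi_gt3 by (intro mult_right_mono) auto
    then show "t \<le> 4 * pi * t" by simp
  qed (use t in auto)
  moreover have "exp (- (norm x)\<^sup>2 / (4 * t)) \<le> 1" using t by simp
  ultimately have "(4 * pi * t) powr (- real DIM('a) / 2) * exp (- (norm x)\<^sup>2 / (4 * t)) \<le> t powr (- real DIM('a) / 2) * 1"
    by (intro mult_mono) auto
  then show ?thesis by (simp add: gauss_def)
qed

lemma gauss_two_le:
  fixes x :: "'a::euclidean_space"
  assumes t: "0 < t"
  shows "gauss (2 * t) x \<le> t powr (- real DIM('a) / 2)"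
proof -
  have "gauss (2 * t) x \<le> (2 * t) powr (- real DIM('a) / 2)" using gauss_le[of "2 * t" x] t by simp
  also have "\<dots> \<le> t powr (- real DIM('a) / 2)" by (rule powr_mono2') (use t in auto)
  finally show ?thesis .
qed

lemma nn_integral_gauss:
  assumes t: "0 < t"
  shows "(\<integral>\<^sup>+x. ennreal (gauss t (x::'a::euclidean_space)) \<partial>lborel) = 1"
proof -
  \<comment> \<open>The kernel is a product of centred normal densities of variance 2t, one for each
    coordinate.\<close>
  have eq: "ennreal (gauss t x) = (\<Prod>b\<in>Basis. ennreal (normal_density 0 (sqrt (2 * t)) (x \<bullet> b)))" for x :: 'a
  proof -
    have "(norm x)\<^sup>2 = (\<Sum>b\<in>Basis. (x \<bullet> b)\<^sup>2)"
      unfolding power2_norm_eq_inner by (subst euclidean_inner) (simp add: power2_eq_square)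
    moreover have "(4 * pi * t) powr (- real DIM('a) / 2) = (1 / sqrt (4 * pi * t)) ^ DIM('a)"
    proof -
      have "(1 / sqrt (4 * pi * t)) = (4 * pi * t) powr (- 1 / 2)"
        using t by (simp add: powr_minus_divide powr_half_sqrt[symmetric])
      then show ?thesis using t by (simp add: powr_power)
    qed
    ultimately have "gauss t x = (\<Prod>b\<in>(Basis::'a set). normal_density 0 (sqrt (2 * t)) (x \<bullet> b))"
      using t unfolding gauss_def normal_density_def prod.distrib
      by (simp add: exp_sum[symmetric] sum_divide_distrib[symmetric] sum_negf mult.commute mult.left_commute power_one_over)
    then show ?thesis by (simp add: prod_ennreal)
  qed
  have "(\<integral>\<^sup>+x. ennreal (gauss t (x::'a)) \<partial>lborel)
      = (\<Prod>b\<in>(Basis::'a set). (\<integral>\<^sup>+y. ennreal (normal_density 0 (sqrt (2 * t)) y) \<partial>lborel))"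
    unfolding eq by (subst nn_integral_lborel_prod) auto
  also have "\<dots> = 1"
    by (subst nn_integral_eq_integral) (use t in auto)
  finally show ?thesis .
qed

lemma integrable_gauss: "0 < t \<Longrightarrow> integrable lborel (gauss t :: 'a::euclidean_space \<Rightarrow> real)"
  and integral_gauss: "0 < t \<Longrightarrow> (\<integral>x. gauss t (x::'a) \<partial>lborel) = 1"
  using integrableI_nn_integral_finite[of "gauss t" lborel 1] nn_integral_gauss[of t]
    integral_eq_nn_integral[of "gauss t :: 'a \<Rightarrow> real" lborel] by auto

text \<open>The linear factor is absorbed by half of the exponent: completing a square gives |x| <=
  2 sqrt(t) exp(|x|^2/(8t)), and the remaining half is the Gaussian at time 2t.\<close>

lemma norm_mult_gauss_le:
  fixes x :: "'a::euclidean_space"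
  assumes t: "0 < t"
  shows "norm x * gauss t x \<le> 2 * sqrt t * gcon TYPE('a) * gauss (2 * t) x"
proof -
  define y where "y = (norm x)\<^sup>2 / (8 * t)"
  have "0 \<le> (norm x / (2 * sqrt t) - 1)\<^sup>2" by simp
  also have "\<dots> = (norm x)\<^sup>2 / (4 * t) - norm x / sqrt t + 1"
    using t by (simp add: power2_diff power_divide power_mult_distrib)
  finally have "norm x / sqrt t \<le> 2 * y + 1" unfolding y_def by simp
  also have "\<dots> \<le> 2 * (1 + y)" by simp
  also have "\<dots> \<le> 2 * exp y" by (intro mult_left_mono exp_ge_add_one_self) simp
  finally have "norm x \<le> 2 * sqrt t * exp y" using t by (simp add: field_simps)
  then have "norm x * exp (- (2 * y)) \<le> 2 * sqrt t * exp y * exp (- (2 * y))"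
    by (rule mult_right_mono) simp
  also have "\<dots> = 2 * sqrt t * exp (- y)" by (simp add: exp_add[symmetric])
  finally have 1: "norm x * exp (- (norm x)\<^sup>2 / (4 * t)) \<le> 2 * sqrt t * exp (- (norm x)\<^sup>2 / (4 * (2 * t)))"
    unfolding y_def using t by (simp add: field_simps)
  have 2: "(4 * pi * t) powr (- real DIM('a) / 2) = gcon TYPE('a) * (4 * pi * (2 * t)) powr (- real DIM('a) / 2)"
  proof -
    have "(4 * pi * (2 * t)) powr (- real DIM('a) / 2) = 2 powr (- real DIM('a) / 2) * (4 * pi * t) powr (- real DIM('a) / 2)"
      using t by (subst powr_mult[symmetric]) (auto simp: algebra_simps)
    then show ?thesis by (simp add: powr_minus field_simps)
  qed
  show ?thesis
    unfolding gauss_def 2 using mult_left_mono[OF 1, of "gcon TYPE('a) * (4 * pi * (2 * t)) powr (- real DIM('a) / 2)"]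
    by (simp add: algebra_simps)
qed

lemma dgauss_le:
  fixes x :: "'a::euclidean_space"
  assumes t: "0 < t"
  shows "\<bar>dgauss a t x\<bar> \<le> norm a * gcon TYPE('a) * t powr (- 1 / 2) * gauss (2 * t) x"
proof -
  have "\<bar>dgauss a t x\<bar> = \<bar>a \<bullet> x\<bar> / (2 * t) * gauss t x"
    using t by (simp add: dgauss_def abs_mult)
  also have "\<dots> \<le> (norm a * norm x) / (2 * t) * gauss t x"
    using t by (intro mult_right_mono divide_right_mono Cauchy_Schwarz_ineq2) auto
  also have "\<dots> = norm a / (2 * t) * (norm x * gauss t x)" by simp
  also have "\<dots> \<le> norm a / (2 * t) * (2 * sqrt t * gcon TYPE('a) * gauss (2 * t) x)"
    using t by (intro mult_left_mono norm_mult_gauss_le) auto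
  also have "\<dots> = norm a * gcon TYPE('a) * (sqrt t / t) * gauss (2 * t) x" by simp
  also have "sqrt t / t = t powr (- 1 / 2)"
    using t by (simp add: powr_minus_divide powr_half_sqrt field_simps)
  finally show ?thesis .
qed

lemma dgauss_sup:
  fixes x :: "'a::euclidean_space"
  assumes t: "0 < t"
  shows "\<bar>dgauss a t x\<bar> \<le> norm a * gcon TYPE('a) * t powr (- 1 / 2) * t powr (- real DIM('a) / 2)"
  by (rule order_trans[OF dgauss_le[OF t]], rule mult_left_mono) (use gauss_two_le[OF t, of x] in auto)

lemma
  assumes t: "0 < t"
  shows integrable_dgauss: "integrable lborel (dgauss a t :: 'a::euclidean_space \<Rightarrow> real)"
    and dgauss_L1: "(\<integral>x. \<bar>dgauss a t (x::'a)\<bar> \<partial>lborel) \<le> norm a * gcon TYPE('a) * t powr (- 1 / 2)"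
proof -
  let ?c = "norm a * gcon TYPE('a) * t powr (- 1 / 2)"
  have i: "integrable lborel (\<lambda>x. ?c * gauss (2 * t) (x::'a))"
    using integrable_gauss[of "2 * t", where 'a='a] t by simp
  show j: "integrable lborel (dgauss a t :: 'a \<Rightarrow> real)"
    by (rule Bochner_Integration.integrable_bound[OF i]) (use dgauss_le[OF t, of a] in auto)
  have "(\<integral>x. \<bar>dgauss a t (x::'a)\<bar> \<partial>lborel) \<le> (\<integral>x. ?c * gauss (2 * t) (x::'a) \<partial>lborel)"
    by (rule integral_mono[OF integrable_abs[OF j] i dgauss_le[OF t]])
  also have "\<dots> = ?c" using integral_gauss[of "2 * t", where 'a = 'a] t by simp
  finally show "(\<integral>x. \<bar>dgauss a t (x::'a)\<bar> \<partial>lborel) \<le> ?c" .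
qed

text \<open>Completing the square: for fixed x the product is, as a function of y, a multiple of a
  Gaussian with mean t/(s + t) x and time st/(s + t). Integrating over y leaves the semigroup
  law.\<close>

lemma gauss_mult_gauss:
  fixes x y :: "'a::euclidean_space"
  assumes s: "0 < s" and t: "0 < t"
  shows "gauss s (x - y) * gauss t y = gauss (s + t) x * gauss (s * t / (s + t)) (y - (t / (s + t)) *\<^sub>R x)"
proof -
  have e: "- (norm (x - y))\<^sup>2 / (4 * s) + - (norm y)\<^sup>2 / (4 * t)
    = - (norm x)\<^sup>2 / (4 * (s + t)) + - (norm (y - (t / (s + t)) *\<^sub>R x))\<^sup>2 / (4 * (s * t / (s + t)))"
  proof -
    define X Y Z where "X = x \<bullet> x" and "Y = y \<bullet> y" and "Z = x \<bullet> y"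
    have 1: "(norm (x - y))\<^sup>2 = X - 2 * Z + Y" "(norm y)\<^sup>2 = Y" "(norm x)\<^sup>2 = X"
      by (simp_all add: power2_norm_eq_inner X_def Y_def Z_def inner_diff_left inner_diff_right inner_commute)
    have 2: "(norm (y - (t / (s + t)) *\<^sub>R x))\<^sup>2 = Y - 2 * (t / (s + t)) * Z + (t / (s + t))\<^sup>2 * X"
      unfolding power2_norm_eq_inner
      by (simp add: X_def Y_def Z_def inner_diff_left inner_diff_right inner_commute power2_eq_square)
    have "s + t \<noteq> 0" using s t by simp
    then show ?thesis unfolding 1 2 using s t
      by (simp add: divide_simps power2_eq_square) (simp add: algebra_simps)
  qed
  have c: "(4 * pi * s) powr (- real DIM('a) / 2) * (4 * pi * t) powr (- real DIM('a) / 2)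
    = (4 * pi * (s + t)) powr (- real DIM('a) / 2) * (4 * pi * (s * t / (s + t))) powr (- real DIM('a) / 2)"
  proof -
    have "(4 * pi * s) * (4 * pi * t) = (4 * pi * (s + t)) * (4 * pi * (s * t / (s + t)))"
      using s t by (simp add: add_pos_pos less_imp_neq[symmetric])
    then have "((4 * pi * s) * (4 * pi * t)) powr (- real DIM('a) / 2)
       = ((4 * pi * (s + t)) * (4 * pi * (s * t / (s + t)))) powr (- real DIM('a) / 2)" by simp
    then show ?thesis using s t by (subst (asm) (1 2) powr_mult) auto
  qed
  have "gauss s (x - y) * gauss t y
     = ((4 * pi * s) powr (- real DIM('a) / 2) * (4 * pi * t) powr (- real DIM('a) / 2))
        * exp (- (norm (x - y))\<^sup>2 / (4 * s) + - (norm y)\<^sup>2 / (4 * t))"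
    unfolding gauss_def exp_add by simp
  also have "\<dots> = gauss (s + t) x * gauss (s * t / (s + t)) (y - (t / (s + t)) *\<^sub>R x)"
    unfolding e c gauss_def exp_add by simp
  finally show ?thesis .
qed

lemma conv_gauss_gauss:
  assumes s: "0 < s" and t: "0 < t"
  shows "conv (gauss s) (gauss t) = (gauss (s + t) :: 'a::euclidean_space \<Rightarrow> real)"
proof
  fix x :: 'a
  have "0 < s * t / (s + t)" using s t by simp
  then have "(\<integral>y. gauss (s * t / (s + t)) (y - (t / (s + t)) *\<^sub>R x) \<partial>lborel) = 1"
    using integral_gauss integral_lborel_shift[of "gauss (s * t / (s + t))" "(t / (s + t)) *\<^sub>R x"] by simp
  then show "conv (gauss s) (gauss t) x = gauss (s + t) x"
    unfolding conv_def gauss_mult_gauss[OF s t] by simp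
qed

lemma has_derivative_gauss:
  assumes t: "0 < t"
  shows "(gauss t has_derivative (\<lambda>h. dgauss h t x)) (at (x::'a::euclidean_space))"
proof -
  have "((\<lambda>x. (4 * pi * t) powr (- real DIM('a) / 2) * exp (- (x \<bullet> x) / (4 * t)))
     has_derivative (\<lambda>h. dgauss h t x)) (at x)"
    using t by (auto intro!: derivative_eq_intros simp: fun_eq_iff dgauss_def gauss_def power2_norm_eq_inner inner_commute field_simps)
  then show ?thesis by (simp add: gauss_def[abs_def] power2_norm_eq_inner)
qed

text \<open>The second derivative along the segment is bounded uniformly in z, because y exp(-y) <=
  1 absorbs the quadratic factor. A remainder uniform in z can be convolved with any integrable
  function.\<close>

lemma gauss_taylor:
  fixes z h :: "'a::euclidean_space"
  assumes t: "0 < t"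
  shows "\<bar>gauss t (z + h) - gauss t z - dgauss h t z\<bar> \<le> (4 * pi * t) powr (- real DIM('a) / 2) * (2 / t) * (norm h)\<^sup>2"
proof -
  let ?c = "(4 * pi * t) powr (- real DIM('a) / 2)"
  define g where "g = (\<lambda>r::real. ?c * exp (- (z \<bullet> z + 2 * r * (z \<bullet> h) + r\<^sup>2 * (h \<bullet> h)) / (4 * t)))"
  define g1 where "g1 = (\<lambda>r. - ((z \<bullet> h + r * (h \<bullet> h)) / (2 * t)) * g r)"
  define g2 where "g2 = (\<lambda>r. ((z \<bullet> h + r * (h \<bullet> h))\<^sup>2 / (4 * t\<^sup>2) - (h \<bullet> h) / (2 * t)) * g r)"
  have d1: "(g has_real_derivative g1 r) (at r)" for r
    unfolding g_def g1_def
    using t by (auto intro!: derivative_eq_intros simp: field_simps)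
  have d2: "(g1 has_real_derivative g2 r) (at r)" for r
    unfolding g1_def g2_def
    using t by (auto intro!: derivative_eq_intros d1 simp: g1_def field_simps power2_eq_square)
  have geq: "g r = gauss t (z + r *\<^sub>R h)" for r
  proof -
    have "(norm (z + r *\<^sub>R h))\<^sup>2 = z \<bullet> z + 2 * r * (z \<bullet> h) + r\<^sup>2 * (h \<bullet> h)"
      unfolding power2_norm_eq_inner
      by (simp add: inner_add_left inner_add_right inner_commute power2_eq_square algebra_simps)
    then show ?thesis by (simp add: g_def gauss_def)
  qed
  have bound: "\<bar>g2 r\<bar> \<le> ?c * (2 / t) * (norm h)\<^sup>2" for r
  proof -
    define y where "y = (norm (z + r *\<^sub>R h))\<^sup>2 / (4 * t)"
    have y0: "0 \<le> y" using t by (simp add: y_def)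
    have "y \<le> exp y" using exp_ge_add_one_self[of y] by linarith
    then have ye: "y * exp (- y) \<le> 1" by (simp add: exp_minus field_simps)
    have e1: "exp (- y) \<le> 1" using y0 by simp
    have "(z \<bullet> h + r * (h \<bullet> h))\<^sup>2 = ((z + r *\<^sub>R h) \<bullet> h)\<^sup>2" by (simp add: inner_add_left)
    also have "\<dots> \<le> (norm (z + r *\<^sub>R h))\<^sup>2 * (norm h)\<^sup>2"
      using Cauchy_Schwarz_ineq2[of "z + r *\<^sub>R h" h] by (metis abs_ge_zero power2_abs power_mono power_mult_distrib)
    finally have "(z \<bullet> h + r * (h \<bullet> h))\<^sup>2 / (4 * t\<^sup>2) \<le> ((norm (z + r *\<^sub>R h))\<^sup>2 * (norm h)\<^sup>2) / (4 * t\<^sup>2)"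
      by (rule divide_right_mono) simp
    also have "\<dots> = y * ((norm h)\<^sup>2 / t)" using t by (simp add: y_def power2_eq_square)
    finally have A: "(z \<bullet> h + r * (h \<bullet> h))\<^sup>2 / (4 * t\<^sup>2) * exp (- y) \<le> (norm h)\<^sup>2 / t"
    proof -
      assume "(z \<bullet> h + r * (h \<bullet> h))\<^sup>2 / (4 * t\<^sup>2) \<le> y * ((norm h)\<^sup>2 / t)"
      then have "(z \<bullet> h + r * (h \<bullet> h))\<^sup>2 / (4 * t\<^sup>2) * exp (- y) \<le> y * ((norm h)\<^sup>2 / t) * exp (- y)"
        by (rule mult_right_mono) simp
      also have "\<dots> = (y * exp (- y)) * ((norm h)\<^sup>2 / t)" by simp
      also have "\<dots> \<le> 1 * ((norm h)\<^sup>2 / t)" using ye t by (intro mult_right_mono) auto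
      finally show ?thesis by simp
    qed
    have B: "(h \<bullet> h) / (2 * t) * exp (- y) \<le> (norm h)\<^sup>2 / t"
    proof -
      have "(h \<bullet> h) / (2 * t) * exp (- y) \<le> (h \<bullet> h) / (2 * t) * 1" using t e1 by (intro mult_left_mono) auto
      also have "\<dots> \<le> (norm h)\<^sup>2 / t" using t by (simp add: power2_norm_eq_inner field_simps)
      finally show ?thesis .
    qed
    have B0: "0 \<le> (h \<bullet> h) / (2 * t) * exp (- y)" "0 \<le> (z \<bullet> h + r * (h \<bullet> h))\<^sup>2 / (4 * t\<^sup>2) * exp (- y)" using t by auto
    have "\<bar>g2 r\<bar> = ?c * \<bar>(z \<bullet> h + r * (h \<bullet> h))\<^sup>2 / (4 * t\<^sup>2) * exp (- y) - (h \<bullet> h) / (2 * t) * exp (- y)\<bar>"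
      unfolding g2_def geq gauss_def y_def left_diff_distrib[symmetric] abs_mult by simp
    also have "\<dots> \<le> ?c * (2 * ((norm h)\<^sup>2 / t))"
    proof (rule mult_left_mono)
      show "\<bar>(z \<bullet> h + r * (h \<bullet> h))\<^sup>2 / (4 * t\<^sup>2) * exp (- y) - (h \<bullet> h) / (2 * t) * exp (- y)\<bar> \<le> 2 * ((norm h)\<^sup>2 / t)"
        using A B B0 by linarith
    qed simp
    finally show ?thesis by simp
  qed
  obtain \<xi> where \<xi>: "0 < \<xi>" "\<xi> < 1" "g 1 - g 0 = (1 - 0) * g1 \<xi>"
    using MVT2[of 0 1 g g1] d1 by auto
  obtain \<eta> where \<eta>: "g1 \<xi> - g1 0 = (\<xi> - 0) * g2 \<eta>"
    using MVT2[of 0 \<xi> g1 g2] d2 \<xi> by auto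
  have "gauss t (z + h) - gauss t z - dgauss h t z = g 1 - g 0 - g1 0"
    using geq[of 0] geq[of 1] by (simp add: g1_def dgauss_def inner_commute)
  also have "\<dots> = \<xi> * g2 \<eta>" using \<xi> \<eta> by simp
  finally have "\<bar>gauss t (z + h) - gauss t z - dgauss h t z\<bar> = \<xi> * \<bar>g2 \<eta>\<bar>" using \<xi> by (simp add: abs_mult)
  also have "\<dots> \<le> 1 * (?c * (2 / t) * (norm h)\<^sup>2)" using \<xi> bound[of \<eta>] by (intro mult_mono) auto
  finally show ?thesis by simp
qed

lemma heat_eq_conv: "heat t \<phi> = conv (gauss t) \<phi>"
  by (rule ext) (simp add: heat_def conv_def)

lemma heat_zero_time: "heat 0 \<phi> = (\<lambda>x. 0)"
  by (rule ext) (simp add: heat_def)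

text \<open>Convolving the uniform Taylor remainder of the kernel with \<phi> leaves an error
  quadratic in the increment. The full derivative is established because \<open>adgrad\<close> is
  defined by \<open>frechet_derivative\<close>.\<close>

lemma has_derivative_heat:
  fixes \<phi> :: "'a::euclidean_space \<Rightarrow> real"
  assumes t: "0 < t" and \<phi>: "integrable lborel \<phi>"
  shows "(heat t \<phi> has_derivative (\<lambda>h. conv (dgauss h t) \<phi> x)) (at x)"
proof (rule has_derivativeI_sandwich)
  let ?C = "(4 * pi * t) powr (- real DIM('a) / 2) * (2 / t)"
  note borel_measurable_integrable_lborel[OF \<phi>, measurable]
  have igd: "integrable lborel (\<lambda>y. dgauss h t (x - y) * \<phi> y)" for h x
    by (rule conv_integrand_bounded_kernel[OF _ dgauss_sup[OF t] \<phi>]) simp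
  have ig: "integrable lborel (\<lambda>y. gauss t (x - y) * \<phi> y)" for x
    by (rule conv_integrand_bounded_kernel[OF _ _ \<phi>, of _ "t powr (- real DIM('a) / 2)"]) (use gauss_le[OF t] in auto)
  show "bounded_linear (\<lambda>h. conv (dgauss h t) \<phi> x)"
  proof (rule bounded_linear_intro[where K="gcon TYPE('a) * t powr (- 1 / 2) * t powr (- real DIM('a) / 2) * (\<integral>y. \<bar>\<phi> y\<bar> \<partial>lborel)"])
    fix h k :: 'a and r :: real
    have "dgauss (h + k) t z = dgauss h t z + dgauss k t z" for z
      by (simp add: dgauss_def inner_add_left add_divide_distrib algebra_simps)
    then show "conv (dgauss (h + k) t) \<phi> x = conv (dgauss h t) \<phi> x + conv (dgauss k t) \<phi> x"
      unfolding conv_def by (simp add: distrib_right igd)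
    have "dgauss (r *\<^sub>R h) t z = r * dgauss h t z" for z by (simp add: dgauss_def)
    then show "conv (dgauss (r *\<^sub>R h) t) \<phi> x = r *\<^sub>R conv (dgauss h t) \<phi> x"
      unfolding conv_def by (simp add: mult.assoc)
    have "\<bar>conv (dgauss h t) \<phi> x\<bar> \<le> norm h * gcon TYPE('a) * t powr (- 1 / 2) * t powr (- real DIM('a) / 2) * (\<integral>y. \<bar>\<phi> y\<bar> \<partial>lborel)"
      by (rule conv_sup_kernel[OF _ dgauss_sup[OF t] \<phi>]) simp
    then show "norm (conv (dgauss h t) \<phi> x) \<le> norm h * (gcon TYPE('a) * t powr (- 1 / 2) * t powr (- real DIM('a) / 2) * (\<integral>y. \<bar>\<phi> y\<bar> \<partial>lborel))"
      by (simp add: mult.assoc)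
  qed
  show "((\<lambda>y. ?C * norm (y - x) * (\<integral>y. \<bar>\<phi> y\<bar> \<partial>lborel)) \<longlongrightarrow> 0) (at x within UNIV)"
    using t by (auto intro!: tendsto_eq_intros)
  fix y assume y: "y \<noteq> x"
  define h where "h = y - x"
  let ?k = "\<lambda>z. gauss t (z + h) - gauss t z - dgauss h t z"
  have "heat t \<phi> y - heat t \<phi> x - conv (dgauss (y - x) t) \<phi> x
     = (\<integral>z. gauss t (y - z) * \<phi> z - gauss t (x - z) * \<phi> z - dgauss h t (x - z) * \<phi> z \<partial>lborel)"
    unfolding heat_def conv_def h_def by (simp add: ig igd)
  also have "\<dots> = conv ?k \<phi> x"
    unfolding conv_def h_def by (rule Bochner_Integration.integral_cong) (auto simp: algebra_simps)
  finally have eq: "heat t \<phi> y - heat t \<phi> x - conv (dgauss (y - x) t) \<phi> x = conv ?k \<phi> x" .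
  have "norm (heat t \<phi> y - heat t \<phi> x - conv (dgauss (y - x) t) \<phi> x) \<le> ?C * (norm h)\<^sup>2 * (\<integral>y. \<bar>\<phi> y\<bar> \<partial>lborel)"
    unfolding eq real_norm_def by (rule conv_sup_kernel[OF _ gauss_taylor[OF t] \<phi>]) simp
  also have "\<dots> = ?C * norm (y - x) * (\<integral>y. \<bar>\<phi> y\<bar> \<partial>lborel) * norm (y - x)"
    by (simp add: h_def power2_eq_square)
  finally show "norm (heat t \<phi> y - heat t \<phi> x - conv (dgauss (y - x) t) \<phi> x) / norm (y - x) \<le> ?C * norm (y - x) * (\<integral>y. \<bar>\<phi> y\<bar> \<partial>lborel)"
    using y by (subst pos_divide_le_eq) auto
qed (rule zero_less_one)

lemma adgrad_eq_conv:
  assumes "integrable lborel \<phi>" "0 \<le> t"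
  shows "adgrad a t \<phi> x = conv (dgauss a t) \<phi> x"
proof (cases "t = 0")
  case True
  \<comment> \<open>Since \<open>0 powr _\<close> is 0, the kernel at time 0 is 0: here
    \<open>heat 0\<close> is the zero function and not the identity, and both sides vanish.\<close>
  have "frechet_derivative (\<lambda>x::'a. 0::real) (at x) = (\<lambda>h. 0)"
    by (rule frechet_derivative_at[symmetric]) simp
  then show ?thesis using True by (simp add: adgrad_def heat_zero_time conv_def)
next
  case False
  then have "frechet_derivative (heat t \<phi>) (at x) = (\<lambda>h. conv (dgauss h t) \<phi> x)"
    by (intro frechet_derivative_at[symmetric] has_derivative_heat) (use assms in auto)
  then show ?thesis by (simp add: adgrad_def)
qed

text \<open>Both sides are derivatives of the same function, by the semigroup law for G; uniqueness
  of the derivative replaces the computation of an integral.\<close>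

lemma conv_dgauss_gauss:
  fixes a :: "'a::euclidean_space"
  assumes s: "0 < s" and t: "0 < t"
  shows "conv (dgauss a s) (gauss t) = dgauss a (s + t)"
proof
  fix x :: 'a
  have "(heat s (gauss t) has_derivative (\<lambda>h. conv (dgauss h s) (gauss t) x)) (at x)"
    by (rule has_derivative_heat[OF s integrable_gauss[OF t]])
  then have "(gauss (s + t) has_derivative (\<lambda>h. conv (dgauss h s) (gauss t) x)) (at x)"
    by (simp add: heat_eq_conv conv_gauss_gauss[OF s t])
  then have "(\<lambda>h. conv (dgauss h s) (gauss t) x) = (\<lambda>h. dgauss h (s + t) x)"
    by (rule has_derivative_unique) (use s t in \<open>simp add: has_derivative_gauss\<close>)
  then show "conv (dgauss a s) (gauss t) x = dgauss a (s + t) x" by (rule fun_cong)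
qed

lemma conv_gauss_dgauss:
  assumes s: "0 < s" and t: "0 < t"
  shows "conv (gauss s) (dgauss a t) = dgauss a (s + t)"
  using conv_dgauss_gauss[OF t s, of a] conv_commute[of "gauss s" "dgauss a t"]
  by (simp add: add.commute)

text \<open>The difference is the integral of - y . grad G_t over the segment from x to x - y, and
  the kernel bounds apply under the integral. Together with a first moment of the datum this yields
  the rate t^(-1/2) for the heat flow.\<close>

lemma
  fixes y :: "'a::euclidean_space"
  assumes t: "0 < t"
  shows gauss_shift_L1: "(\<integral>x. \<bar>gauss t (x - y) - gauss t x\<bar> \<partial>lborel) \<le> norm y * gcon TYPE('a) * t powr (- 1 / 2)"
    and gauss_shift_sup: "\<bar>gauss t (x - y) - gauss t x\<bar>
        \<le> norm y * gcon TYPE('a) * t powr (- 1 / 2) * t powr (- real DIM('a) / 2)"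
proof -
  let ?F = "\<lambda>r x. indicator {0..1::real} r * - dgauss y t (x - r *\<^sub>R y)"
  let ?c = "norm y * gcon TYPE('a) * t powr (- 1 / 2)"
  have j: "jmeas ?F" by measurable
  have eq: "gauss t (x - y) - gauss t x = (\<integral>r. ?F r x \<partial>lborel)" for x
  proof -
    have "(\<integral>r. indicator {0..1::real} r *\<^sub>R (- dgauss y t (x - r *\<^sub>R y)) \<partial>lborel)
        = gauss t (x - 1 *\<^sub>R y) - gauss t (x - 0 *\<^sub>R y)"
    proof (rule integral_FTC_atLeastAtMost)
      fix r :: real
      have "((\<lambda>r. gauss t (x - r *\<^sub>R y)) has_derivative (\<lambda>s. dgauss (- (s *\<^sub>R y)) t (x - r *\<^sub>R y))) (at r within {0..1})"
        by (rule has_derivative_compose[OF _ has_derivative_gauss[OF t]]) (auto intro!: derivative_eq_intros)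
      then show "((\<lambda>r. gauss t (x - r *\<^sub>R y)) has_vector_derivative - dgauss y t (x - r *\<^sub>R y)) (at r within {0..1})"
        by (rule has_derivative_eq_rhs[THEN has_vector_derivative_def[THEN iffD2]]) (auto simp: dgauss_def fun_eq_iff)
    next
      show "continuous_on {0..1} (\<lambda>r. - dgauss y t (x - r *\<^sub>R y))"
        unfolding dgauss_def gauss_def using t by (auto intro!: continuous_intros)
    qed simp
    then show ?thesis by simp
  qed
  have b: "AE r in lborel. integrable lborel (?F r) \<and> (\<integral>x. \<bar>?F r x\<bar> \<partial>lborel) \<le> indicator {0..1} r * ?c"
  proof (intro AE_I2 conjI)
    fix r :: real
    show "integrable lborel (?F r)" using integrable_lborel_shift[OF integrable_dgauss[OF t, of y]] by simp
    have "(\<integral>x. \<bar>?F r x\<bar> \<partial>lborel) = indicator {0..1} r * (\<integral>x. \<bar>dgauss y t x\<bar> \<partial>lborel)"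
      using integral_lborel_shift[of "\<lambda>x. \<bar>dgauss y t x\<bar>"] by (simp add: abs_mult)
    also have "\<dots> \<le> indicator {0..1} r * ?c" by (rule mult_left_mono[OF dgauss_L1[OF t]]) simp
    finally show "(\<integral>x. \<bar>?F r x\<bar> \<partial>lborel) \<le> indicator {0..1} r * ?c" .
  qed
  have i: "integrable lborel (\<lambda>r. indicator {0..1::real} r * ?c)" by simp
  show "(\<integral>x. \<bar>gauss t (x - y) - gauss t x\<bar> \<partial>lborel) \<le> ?c"
    using fubini_bound[OF j b i] unfolding eq[symmetric] by simp
  have "\<bar>\<integral>r. ?F r x \<partial>lborel\<bar> \<le> (\<integral>r. indicator {0..1::real} r * (?c * t powr (- real DIM('a) / 2)) \<partial>lborel)"
  proof (rule integral_abs_bound_integral)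
    have "set_integrable lborel {0..1} (\<lambda>r. - dgauss y t (x - r *\<^sub>R y))"
      unfolding dgauss_def gauss_def using t
      by (intro borel_integrable_atLeastAtMost') (auto intro!: continuous_intros)
    then show "integrable lborel (\<lambda>r. ?F r x)" by (simp add: set_integrable_def)
    show "integrable lborel (\<lambda>r. indicator {0..1::real} r * (?c * t powr (- real DIM('a) / 2)))" by simp
    show "\<bar>?F r x\<bar> \<le> indicator {0..1} r * (?c * t powr (- real DIM('a) / 2))" for r
      using dgauss_sup[OF t, of y "x - r *\<^sub>R y"] by (simp add: indicator_def)
  qed
  then show "\<bar>gauss t (x - y) - gauss t x\<bar> \<le> ?c * t powr (- real DIM('a) / 2)"
    unfolding eq by simp
qed

lemma integrable_gauss_diff:
  "0 < t \<Longrightarrow> 0 < s \<Longrightarrow> integrable lborel (\<lambda>x::'a::euclidean_space. gauss t x - gauss s x)"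
  by (intro Bochner_Integration.integrable_diff integrable_gauss)

text \<open>G_{t+s} - G_s is the average of the shifts G_s(x - z) - G_s(x) with weight G_t(z), and
  the average of |z| is of order sqrt(t). So the modulus of continuity in space gives the one in
  time.\<close>

lemma gauss_time_L1:
  assumes t: "0 < t" and s: "0 < s"
  shows "(\<integral>x. \<bar>gauss (t + s) x - gauss s (x::'a::euclidean_space)\<bar> \<partial>lborel)
     \<le> 2 * (gcon TYPE('a))\<^sup>2 * sqrt t * s powr (- 1 / 2)"
proof -
  let ?F = "\<lambda>z x. gauss t z * (gauss s (x - z) - gauss s (x::'a))"
  let ?k = "\<lambda>z::'a. (2 * (gcon TYPE('a))\<^sup>2 * sqrt t * s powr (- 1 / 2)) * gauss (2 * t) z"
  have j: "jmeas ?F" by measurable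
  have isd: "integrable lborel (\<lambda>x::'a. gauss s (x - z) - gauss s x)" for z
    by (intro Bochner_Integration.integrable_diff integrable_gauss integrable_lborel_shift s)
  have b: "AE z in lborel. integrable lborel (?F z) \<and> (\<integral>x. \<bar>?F z x\<bar> \<partial>lborel) \<le> ?k z"
  proof (intro AE_I2 conjI)
    fix z :: 'a
    show "integrable lborel (?F z)" using isd by simp
    have "(\<integral>x. \<bar>?F z x\<bar> \<partial>lborel) = gauss t z * (\<integral>x. \<bar>gauss s (x - z) - gauss s x\<bar> \<partial>lborel)"
      by (simp add: abs_mult)
    also have "\<dots> \<le> gauss t z * (norm z * gcon TYPE('a) * s powr (- 1 / 2))"
      by (rule mult_left_mono[OF gauss_shift_L1[OF s]]) simp
    also have "\<dots> = (gcon TYPE('a) * s powr (- 1 / 2)) * (norm z * gauss t z)" by simp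
    also have "\<dots> \<le> (gcon TYPE('a) * s powr (- 1 / 2)) * (2 * sqrt t * gcon TYPE('a) * gauss (2 * t) z)"
      by (rule mult_left_mono[OF norm_mult_gauss_le[OF t]]) simp
    also have "\<dots> = ?k z" by (simp add: power2_eq_square)
    finally show "(\<integral>x. \<bar>?F z x\<bar> \<partial>lborel) \<le> ?k z" .
  qed
  have i: "integrable lborel ?k" using integrable_gauss[of "2 * t", where 'a='a] t by simp
  have eq: "(\<integral>z. ?F z x \<partial>lborel) = gauss (t + s) x - gauss s x" for x
  proof -
    have i1: "integrable lborel (\<lambda>z. gauss s (x - z) * gauss t z)"
      by (rule conv_integrand_bounded_kernel[OF _ _ integrable_gauss[OF t], of _ "s powr (- real DIM('a) / 2)"]) (use gauss_le[OF s] in auto)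
    have "(\<integral>z. ?F z x \<partial>lborel) = (\<integral>z. gauss s (x - z) * gauss t z - gauss s x * gauss t z \<partial>lborel)"
      by (simp add: algebra_simps)
    also have "\<dots> = conv (gauss s) (gauss t) x - gauss s x * (\<integral>z. gauss t (z::'a) \<partial>lborel)"
      unfolding conv_def using i1 integrable_gauss[OF t, where 'a='a] by (subst Bochner_Integration.integral_diff) auto
    finally show ?thesis using s t by (simp add: conv_gauss_gauss integral_gauss add.commute)
  qed
  show ?thesis
    using fubini_bound[OF j b i] unfolding eq using integral_gauss[of "2 * t", where 'a='a] t by simp
qed

text \<open>Bounding each kernel separately gives t^(-1/2) s^(-1/2). Handing half of the time s to
  the first kernel gives (t + s/2)^(-1/2) (s/2)^(-1/2), and the exponent 1/2 = 1/8 + 3/8 of the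
  first factor is shared between t and s: only a mild singularity in t remains, at the price of
  s^(-7/8), which is still integrable.\<close>

lemma conv_dgauss_dgauss_L1:
  fixes a :: "'a::euclidean_space"
  assumes t: "0 < t" and s: "0 < s"
  shows "(\<integral>x. \<bar>conv (dgauss a t) (dgauss a s) x\<bar> \<partial>lborel)
     \<le> 2 * (norm a * gcon TYPE('a))\<^sup>2 * (t powr (- 1 / 8) * s powr (- 7 / 8))"
proof -
  let ?c = "norm a * gcon TYPE('a)"
  have s2: "0 < s / 2" using s by simp
  have "conv (dgauss a t) (dgauss a s) = conv (dgauss a t) (conv (gauss (s / 2)) (dgauss a (s / 2)))"
    using conv_gauss_dgauss[OF s2 s2, of a] by simp
  also have "\<dots> = conv (conv (dgauss a t) (gauss (s / 2))) (dgauss a (s / 2))"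
    by (rule conv_assoc[OF _ dgauss_sup[OF t] integrable_gauss[OF s2] integrable_dgauss[OF s2]]) simp
  also have "\<dots> = conv (dgauss a (t + s / 2)) (dgauss a (s / 2))"
    by (simp add: conv_dgauss_gauss[OF t s2])
  finally have "(\<integral>x. \<bar>conv (dgauss a t) (dgauss a s) x\<bar> \<partial>lborel)
     \<le> (\<integral>x. \<bar>dgauss a (t + s / 2) x\<bar> \<partial>lborel) * (\<integral>x. \<bar>dgauss a (s / 2) x\<bar> \<partial>lborel)"
    using conv_L1[OF integrable_dgauss[of "t + s / 2"] integrable_dgauss[OF s2]] t s by simp
  also have "\<dots> \<le> (?c * (t + s / 2) powr (- 1 / 2)) * (?c * (s / 2) powr (- 1 / 2))"
    using t s by (intro mult_mono dgauss_L1) auto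
  also have "\<dots> = ?c\<^sup>2 * ((t + s / 2) powr (- 1 / 2) * (s / 2) powr (- 1 / 2))"
    by (simp add: power2_eq_square)
  also have "\<dots> \<le> ?c\<^sup>2 * (2 * (t powr (- 1 / 8) * s powr (- 7 / 8)))"
  proof (rule mult_left_mono)
    have e: "(t + s / 2) powr (- 1 / 2) = (t + s / 2) powr (- 1 / 8) * (t + s / 2) powr (- 3 / 8)"
      using t s by (simp add: powr_add[symmetric])
    have "(t + s / 2) powr (- 1 / 8) \<le> t powr (- 1 / 8)" "(t + s / 2) powr (- 3 / 8) \<le> (s / 2) powr (- 3 / 8)"
      using t s by (auto intro!: powr_mono2')
    then have "(t + s / 2) powr (- 1 / 2) * (s / 2) powr (- 1 / 2) \<le> t powr (- 1 / 8) * (s / 2) powr (- 3 / 8) * (s / 2) powr (- 1 / 2)"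
      unfolding e by (intro mult_mono) auto
    also have "\<dots> = t powr (- 1 / 8) * (s / 2) powr (- 7 / 8)"
      using s by (simp add: powr_add[symmetric] mult.assoc)
    also have "(s / 2) powr (- 7 / 8) = 2 powr (7 / 8) * s powr (- 7 / 8)"
      using s by (simp add: powr_divide powr_minus divide_simps)
    also have "t powr (- 1 / 8) * (2 powr (7 / 8) * s powr (- 7 / 8)) \<le> t powr (- 1 / 8) * (2 * s powr (- 7 / 8))"
      using powr_mono[of "7/8" 1 "2::real"] by (intro mult_left_mono mult_right_mono) auto
    finally show "(t + s / 2) powr (- 1 / 2) * (s / 2) powr (- 1 / 2) \<le> 2 * (t powr (- 1 / 8) * s powr (- 7 / 8))"
      by simp
  qed simp
  finally show ?thesis by simp
qed

lemma min_le_geometric_mean: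
  fixes A B :: real
  assumes "0 \<le> A" "0 \<le> B" "x \<le> A" "x \<le> B" "0 \<le> l" "l \<le> 1" "0 \<le> x"
  shows "x \<le> A powr l * B powr (1 - l)"
proof (cases "x = 0")
  case False
  then have "x = x powr l * x powr (1 - l)" using assms by (simp add: powr_add[symmetric])
  also have "\<dots> \<le> A powr l * B powr (1 - l)"
    using assms by (intro mult_mono powr_mono2) auto
  finally show ?thesis .
qed simp

text \<open>Two bounds compete: the triangle inequality gives s^(-1/2), while the time modulus of
  the heat kernel combined with one derivative gives sqrt(t)/s, not integrable in s. Their geometric
  mean with weight 3/4 on the second is t^(3/8) s^(-7/8), which is integrable.\<close>

lemma dgauss_time_L1:
  fixes a :: "'a::euclidean_space"
  assumes t: "0 < t" and s: "0 < s"
  shows "(\<integral>x. \<bar>dgauss a (t + s) x - dgauss a s x\<bar> \<partial>lborel)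
     \<le> 4 * norm a * gcon TYPE('a) * (1 + (gcon TYPE('a))\<^sup>2) * (t powr (3 / 8) * s powr (- 7 / 8))"
proof -
  let ?c = "norm a * gcon TYPE('a)" and ?g = "gcon TYPE('a)"
  have s2: "0 < s / 2" using s by simp
  let ?I = "\<integral>x. \<bar>dgauss a (t + s) x - dgauss a s x\<bar> \<partial>lborel"
  have id: "integrable lborel (dgauss a (t + s))" "integrable lborel (dgauss a s)"
    using integrable_dgauss[of _ a] t s by auto
  have "?I \<le> (\<integral>x. \<bar>dgauss a (t + s) x\<bar> + \<bar>dgauss a s x\<bar> \<partial>lborel)"
    by (rule integral_mono) (use id in auto)
  also have "\<dots> = (\<integral>x. \<bar>dgauss a (t + s) x\<bar> \<partial>lborel) + (\<integral>x. \<bar>dgauss a s x\<bar> \<partial>lborel)"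
    using id by simp
  also have "\<dots> \<le> ?c * (t + s) powr (- 1 / 2) + ?c * s powr (- 1 / 2)"
    using t s by (intro add_mono dgauss_L1) auto
  also have "\<dots> \<le> ?c * s powr (- 1 / 2) + ?c * s powr (- 1 / 2)"
    using t s by (intro add_mono mult_left_mono powr_mono2') auto
  also have "\<dots> \<le> 4 * ?c * (1 + ?g\<^sup>2) * s powr (- 1 / 2)"
  proof -
    have "?c * s powr (- 1 / 2) * 2 \<le> ?c * s powr (- 1 / 2) * (4 * (1 + ?g\<^sup>2))" by (rule mult_left_mono) auto
    then show ?thesis by (simp add: algebra_simps)
  qed
  finally have A: "?I \<le> 4 * ?c * (1 + ?g\<^sup>2) * s powr (- 1 / 2)" .
  have k: "dgauss a (t + s) x - dgauss a s x = conv (\<lambda>x. gauss (t + s / 2) x - gauss (s / 2) x) (dgauss a (s / 2)) x" for x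
  proof -
    have "conv (\<lambda>x. gauss (t + s / 2) x - gauss (s / 2) x) (dgauss a (s / 2)) x
      = conv (gauss (t + s / 2)) (dgauss a (s / 2)) x - conv (gauss (s / 2)) (dgauss a (s / 2)) x"
      by (rule conv_diff_kernel[of _ _ "(t + s / 2) powr (- real DIM('a) / 2)" "(s / 2) powr (- real DIM('a) / 2)"])
         (use gauss_le[of "t + s / 2", where 'a='a] gauss_le[OF s2, where 'a='a] t s integrable_dgauss[OF s2] in auto)
    then show ?thesis using conv_gauss_dgauss[of "t + s / 2" "s / 2" a] conv_gauss_dgauss[OF s2 s2, of a] t s
      by (simp add: add.assoc)
  qed
  have "?I \<le> (\<integral>x. \<bar>gauss (t + s / 2) x - gauss (s / 2) (x::'a)\<bar> \<partial>lborel) * (\<integral>x. \<bar>dgauss a (s / 2) x\<bar> \<partial>lborel)"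
    unfolding k using t s by (intro conv_L1 integrable_gauss_diff integrable_dgauss) auto
  also have "\<dots> \<le> (2 * ?g\<^sup>2 * sqrt t * (s / 2) powr (- 1 / 2)) * (?c * (s / 2) powr (- 1 / 2))"
    using t s by (intro mult_mono dgauss_L1 gauss_time_L1) auto
  also have "\<dots> = 2 * ?c * ?g\<^sup>2 * sqrt t * ((s / 2) powr (- 1 / 2) * (s / 2) powr (- 1 / 2))" by simp
  also have "(s / 2) powr (- 1 / 2) * (s / 2) powr (- 1 / 2) = 2 / s"
    using s by (simp add: powr_add[symmetric] powr_minus_divide)
  also have "2 * ?c * ?g\<^sup>2 * sqrt t * (2 / s) = 4 * ?c * (sqrt t / s) * ?g\<^sup>2" by simp
  also have "\<dots> \<le> 4 * ?c * (sqrt t / s) * (1 + ?g\<^sup>2)" using t s by (intro mult_left_mono) auto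
  also have "\<dots> = 4 * ?c * (1 + ?g\<^sup>2) * (sqrt t / s)" by simp
  finally have B: "?I \<le> 4 * ?c * (1 + ?g\<^sup>2) * (sqrt t / s)" .
  let ?d = "4 * ?c * (1 + ?g\<^sup>2)"
  have d0: "0 \<le> ?d" by simp
  have "?I \<le> (?d * (sqrt t / s)) powr (3 / 4) * (?d * s powr (- 1 / 2)) powr (1 - 3 / 4)"
    by (rule min_le_geometric_mean) (use A B t s in auto)
  also have "\<dots> = (?d powr (3 / 4) * ?d powr (1 / 4)) * ((sqrt t / s) powr (3 / 4) * (s powr (- 1 / 2)) powr (1 / 4))"
    using t s d0 by (simp add: powr_mult powr_divide del: powr_powr)
  also have "?d powr (3 / 4) * ?d powr (1 / 4) = ?d"
    using d0 by (cases "?d = 0") (simp_all add: powr_add[symmetric])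
  also have "(sqrt t / s) powr (3 / 4) * (s powr (- 1 / 2)) powr (1 / 4) = t powr (3 / 8) * s powr (- 7 / 8)"
    using t s by (simp add: powr_divide powr_half_sqrt[symmetric] powr_powr powr_minus divide_simps powr_add[symmetric])
  finally show ?thesis by (simp add: mult.assoc)
qed

subsection \<open>The Duhamel integral\<close>

text \<open>The open interval keeps the kernel at positive times. Its end points are null, so this
  agrees with the integrals over closed intervals in the definitions
  (\<open>set_integral_Icc_eq_Ioo\<close>).\<close>

definition Du :: "'a::euclidean_space \<Rightarrow> (real \<Rightarrow> 'a \<Rightarrow> real) \<Rightarrow> real \<Rightarrow> 'a \<Rightarrow> real" where
  "Du a \<phi> t x = (\<integral>s. indicator {0<..<t} s * conv (dgauss a (t - s)) (\<phi> s) x \<partial>lborel)"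

text \<open>The L1 norm of a . grad G_t is at most \<open>kap a\<close> t^(-1/2).\<close>

abbreviation kap :: "'a::euclidean_space \<Rightarrow> real" where
  "kap a \<equiv> norm a * gcon TYPE('a)"

lemma borel_measurable_conv_param:
  assumes "jmeas \<phi>" and [measurable]: "f \<in> borel_measurable M" "g \<in> borel_measurable M" "h \<in> borel_measurable M"
  shows "(\<lambda>w. conv (dgauss a (f w)) (\<phi> (g w)) (h w)) \<in> borel_measurable M"
proof -
  note jmeas_compose[OF assms(1), measurable (raw)]
  show ?thesis unfolding conv_def by measurable
qed

lemma borel_measurable_indicator_Ioo [measurable (raw)]:
  fixes f g :: "_ \<Rightarrow> real"
  assumes [measurable]: "f \<in> borel_measurable M" "g \<in> borel_measurable M" "h \<in> borel_measurable M"
  shows "(\<lambda>w. indicator {f w<..<g w} (h w) :: real) \<in> borel_measurable M"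
proof -
  have "(\<lambda>w. indicator {f w<..<g w} (h w) :: real) = (\<lambda>w. if f w < h w \<and> h w < g w then 1 else 0)"
    by (auto simp: indicator_def)
  then show ?thesis by simp
qed

lemma borel_measurable_Du:
  assumes "jmeas \<phi>" and [measurable]: "f \<in> borel_measurable M" "g \<in> borel_measurable M"
  shows "(\<lambda>w. Du a \<phi> (f w) (g w)) \<in> borel_measurable M"
proof -
  note borel_measurable_conv_param[OF assms(1), measurable (raw)]
  show ?thesis unfolding Du_def by measurable
qed

lemma has_bochner_integral_powr:
  fixes t b :: real
  assumes t: "0 < t" and b: "b < 1"
  shows "has_bochner_integral lborel (\<lambda>s. indicator {0<..<t} s * s powr (- b)) (t powr (1 - b) / (1 - b))"
proof -
  have "((\<lambda>s. s powr (- b)) has_integral (t powr (1 - b) / (1 - b))) {0..t}"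
    using has_integral_powr_from_0[of "- b" t] t b by simp
  then have "((\<lambda>s. s powr (- b)) has_integral (t powr (1 - b) / (1 - b))) {0<..<t}"
    by (simp add: has_integral_Icc_iff_Ioo)
  then have "((\<lambda>s. if s \<in> {0<..<t} then s powr (- b) else 0) has_integral (t powr (1 - b) / (1 - b))) UNIV"
    by (subst has_integral_restrict_UNIV)
  then have h: "((\<lambda>s. indicator {0<..<t} s * s powr (- b)) has_integral (t powr (1 - b) / (1 - b))) UNIV"
    by (rule has_integral_eq[rotated]) (auto simp: indicator_def)
  have "integral\<^sup>N lborel (\<lambda>s. indicator {0<..<t} s * s powr (- b)) = t powr (1 - b) / (1 - b)"
    by (rule nn_integral_has_integral_lborel[OF _ _ h]) auto
  then show ?thesis
    by (intro has_bochner_integral_nn_integral) (use b in auto)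
qed

lemma has_bochner_integral_powr_reflect:
  fixes t b :: real
  assumes t: "0 < t" and b: "b < 1"
  shows "has_bochner_integral lborel (\<lambda>s. indicator {0<..<t} s * (t - s) powr (- b)) (t powr (1 - b) / (1 - b))"
proof -
  have "(\<lambda>s. indicator {0<..<t} (t + - 1 * s) * (t + - 1 * s) powr (- b)) = (\<lambda>s. indicator {0<..<t} s * (t - s) powr (- b))"
    by (auto simp: indicator_def fun_eq_iff)
  then show ?thesis
    using lborel_has_bochner_integral_real_affine_iff[of "-1" "\<lambda>s. indicator {0<..<t} s * s powr (- b)" _ t]
      has_bochner_integral_powr[OF assms] by simp
qed

lemma has_bochner_integral_powr_sum:
  fixes t b c A1 A2 :: real
  assumes t: "0 < t" and b: "b < 1" and c: "c < 1"
  shows "has_bochner_integral lborel (\<lambda>s. indicator {0<..<t} s * (A1 * s powr (- b) + A2 * (t - s) powr (- c)))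
     (A1 * (t powr (1 - b) / (1 - b)) + A2 * (t powr (1 - c) / (1 - c)))"
  using has_bochner_integral_add[OF
      has_bochner_integral_mult_right[OF has_bochner_integral_powr[OF t b], of A1]
      has_bochner_integral_mult_right[OF has_bochner_integral_powr_reflect[OF t c], of A2]]
  by (auto simp: algebra_simps)

lemma
  assumes j: "jmeas \<phi>"
    and b: "\<And>s. 0 < s \<Longrightarrow> s < t \<Longrightarrow> \<bar>conv (dgauss a (t - s)) (\<phi> s) x\<bar> \<le> k s"
    and k: "has_bochner_integral lborel (\<lambda>s. indicator {0<..<t} s * k s) I"
  shows Du_integrable: "integrable lborel (\<lambda>s. indicator {0<..<t} s * conv (dgauss a (t - s)) (\<phi> s) x)"
    and Du_bound: "\<bar>Du a \<phi> t x\<bar> \<le> I"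
proof -
  note borel_measurable_conv_param[OF j, measurable (raw)]
  have ki: "integrable lborel (\<lambda>s. indicator {0<..<t} s * k s)" "(\<integral>s. indicator {0<..<t} s * k s \<partial>lborel) = I"
    using k by (auto simp: has_bochner_integral_iff)
  have le: "\<bar>indicator {0<..<t} s * conv (dgauss a (t - s)) (\<phi> s) x\<bar> \<le> indicator {0<..<t} s * k s" for s
    using b[of s] by (auto simp: indicator_def)
  show i: "integrable lborel (\<lambda>s. indicator {0<..<t} s * conv (dgauss a (t - s)) (\<phi> s) x)"
    by (rule Bochner_Integration.integrable_bound[OF ki(1)]) (auto intro: order_trans[OF le abs_ge_self])
  show "\<bar>Du a \<phi> t x\<bar> \<le> I"
    unfolding Du_def ki(2)[symmetric] real_norm_def[symmetric]
    by (rule Bochner_Integration.integral_norm_bound_integral[OF i ki(1)]) (use le in auto)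
qed

text \<open>Half of the time is kept as plain heat flow, so continuity of the differentiated
  convolution follows from differentiability of the undifferentiated one.\<close>

lemma conv_dgauss_split:
  assumes t: "0 < t" and \<phi>: "integrable lborel \<phi>"
  shows "conv (dgauss a t) \<phi> = heat (t / 2) (conv (dgauss a (t / 2)) \<phi>)"
proof -
  have t2: "0 < t / 2" using t by simp
  have "conv (gauss (t / 2)) (conv (dgauss a (t / 2)) \<phi>) = conv (conv (gauss (t / 2)) (dgauss a (t / 2))) \<phi>"
    by (rule conv_assoc[OF _ _ integrable_dgauss[OF t2] \<phi>, of _ "(t / 2) powr (- real DIM('a) / 2)"]) (use gauss_le[OF t2] in auto)
  then show ?thesis by (simp add: heat_eq_conv conv_gauss_dgauss[OF t2 t2])
qed

lemma
  fixes \<phi> :: "'a::euclidean_space \<Rightarrow> real"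
  assumes t: "0 < t" and \<phi>: "integrable lborel \<phi>"
  shows isCont_heat: "isCont (heat t \<phi>) x"
    and isCont_conv_dgauss: "isCont (conv (dgauss a t) \<phi>) x"
proof -
  have 1: "isCont (heat t \<phi>) x" if "0 < t" "integrable lborel \<phi>" for t \<phi> and x :: 'a
    using has_derivative_continuous[OF has_derivative_heat[OF that]] .
  show "isCont (heat t \<phi>) x" by (rule 1[OF assms])
  show "isCont (conv (dgauss a t) \<phi>) x"
    unfolding conv_dgauss_split[OF assms] by (rule 1) (use t \<phi> in \<open>auto intro!: integrable_conv integrable_dgauss\<close>)
qed

text \<open>Dominated convergence along sequences. Continuity in space is what later turns almost
  everywhere bounds into bounds at every point.\<close>

lemma isCont_Du:
  assumes j: "jmeas \<phi>"
    and \<phi>: "\<And>s. 0 < s \<Longrightarrow> s < t \<Longrightarrow> integrable lborel (\<phi> s)"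
    and b: "\<And>s x. 0 < s \<Longrightarrow> s < t \<Longrightarrow> \<bar>conv (dgauss a (t - s)) (\<phi> s) x\<bar> \<le> k s"
    and k: "has_bochner_integral lborel (\<lambda>s. indicator {0<..<t} s * k s) I"
  shows "isCont (Du a \<phi> t) x"
proof -
  note borel_measurable_conv_param[OF j, measurable (raw)]
  show ?thesis
    unfolding continuous_at_sequentially o_def
  proof (intro allI impI)
    fix X assume X: "X \<longlonglongrightarrow> x"
    show "(\<lambda>n. Du a \<phi> t (X n)) \<longlonglongrightarrow> Du a \<phi> t x"
      unfolding Du_def
    proof (rule integral_dominated_convergence)
      show "integrable lborel (\<lambda>s. indicator {0<..<t} s * k s)" using k by (simp add: has_bochner_integral_iff)
      show "AE s in lborel. (\<lambda>n. indicator {0<..<t} s * conv (dgauss a (t - s)) (\<phi> s) (X n))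
         \<longlonglongrightarrow> indicator {0<..<t} s * conv (dgauss a (t - s)) (\<phi> s) x"
      proof (intro AE_I2)
        fix s
        show "(\<lambda>n. indicator {0<..<t} s * conv (dgauss a (t - s)) (\<phi> s) (X n))
         \<longlonglongrightarrow> indicator {0<..<t} s * conv (dgauss a (t - s)) (\<phi> s) x"
        proof (cases "0 < s \<and> s < t")
          case True
          then show ?thesis
            by (intro tendsto_mult tendsto_const isCont_tendsto_compose[OF isCont_conv_dgauss X] \<phi>) auto
        qed auto
      qed
      show "AE s in lborel. norm (indicator {0<..<t} s * conv (dgauss a (t - s)) (\<phi> s) (X n)) \<le> indicator {0<..<t} s * k s" for n
        using b by (auto simp: indicator_def)
    qed measurable
  qed
qed

lemma conv_dgauss_L1:
  assumes t: "0 < t" and \<phi>: "integrable lborel \<phi>"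
  shows "(\<integral>x. \<bar>conv (dgauss a t) \<phi> x\<bar> \<partial>lborel) \<le> kap a * t powr (- 1 / 2) * (\<integral>x. \<bar>\<phi> x\<bar> \<partial>lborel)"
  by (rule order_trans[OF conv_L1[OF integrable_dgauss[OF t] \<phi>]], rule mult_right_mono[OF dgauss_L1[OF t]]) simp

lemma
  assumes j: "jmeas \<phi>"
    and \<phi>: "\<And>s. 0 < s \<Longrightarrow> s < t \<Longrightarrow> integrable lborel (\<phi> s)"
    and b: "\<And>s. 0 < s \<Longrightarrow> s < t \<Longrightarrow> (t - s) powr (- 1 / 2) * (\<integral>x. \<bar>\<phi> s x\<bar> \<partial>lborel) \<le> k s"
    and k: "has_bochner_integral lborel (\<lambda>s. indicator {0<..<t} s * k s) I"
  shows integrable_Du: "integrable lborel (Du a \<phi> t)"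
    and Du_L1: "(\<integral>x. \<bar>Du a \<phi> t x\<bar> \<partial>lborel) \<le> kap a * I"
proof -
  note borel_measurable_conv_param[OF j, measurable (raw)]
  let ?F = "\<lambda>s x. indicator {0<..<t} s * conv (dgauss a (t - s)) (\<phi> s) x"
  have jF: "jmeas ?F" by measurable
  have bF: "AE s in lborel. integrable lborel (?F s) \<and> (\<integral>x. \<bar>?F s x\<bar> \<partial>lborel) \<le> kap a * (indicator {0<..<t} s * k s)"
  proof (intro AE_I2)
    fix s
    show "integrable lborel (?F s) \<and> (\<integral>x. \<bar>?F s x\<bar> \<partial>lborel) \<le> kap a * (indicator {0<..<t} s * k s)"
    proof (cases "0 < s \<and> s < t")
      case True
      then have i: "integrable lborel (conv (dgauss a (t - s)) (\<phi> s))"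
        by (intro integrable_conv integrable_dgauss \<phi>) auto
      have "(\<integral>x. \<bar>conv (dgauss a (t - s)) (\<phi> s) x\<bar> \<partial>lborel) \<le> kap a * (t - s) powr (- 1 / 2) * (\<integral>x. \<bar>\<phi> s x\<bar> \<partial>lborel)"
        using True by (intro conv_dgauss_L1 \<phi>) auto
      also have "\<dots> \<le> kap a * k s"
        unfolding mult.assoc using b[of s] True by (intro mult_left_mono) (auto simp: mult.assoc)
      finally show ?thesis using i True by (simp add: abs_mult)
    qed auto
  qed
  have iF: "integrable lborel (\<lambda>s. kap a * (indicator {0<..<t} s * k s))"
    using k by (auto simp: has_bochner_integral_iff)
  show "integrable lborel (Du a \<phi> t)" using fubini_integrable[OF jF bF iF] by (simp add: Du_def[abs_def])
  show "(\<integral>x. \<bar>Du a \<phi> t x\<bar> \<partial>lborel) \<le> kap a * I"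
    using fubini_bound[OF jF bF iF] k by (simp add: Du_def has_bochner_integral_iff)
qed

text \<open>Up to constants the kernel maps L1 to bounded functions with norm t^(-1/2 - n/2), and
  bounded functions to bounded functions with norm t^(-1/2); the exponent \<open>l\<close>
  interpolates between the two.\<close>

lemma conv_dgauss_sup:
  fixes a :: "'a::euclidean_space"
  assumes t: "0 < t" and \<phi>: "integrable lborel \<phi>" and \<alpha>: "(\<integral>x. \<bar>\<phi> x\<bar> \<partial>lborel) \<le> \<alpha>" and \<beta>: "\<And>x. \<bar>\<phi> x\<bar> \<le> \<beta>"
    and l: "0 \<le> l" "l \<le> 1"
  shows "\<bar>conv (dgauss a t) \<phi> x\<bar> \<le> kap a * t powr (- 1 / 2 - real DIM('a) * l / 2) * (\<alpha> powr l * \<beta> powr (1 - l))"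
proof -
  note borel_measurable_integrable_lborel[OF \<phi>, measurable]
  have \<alpha>0: "0 \<le> \<alpha>" using order_trans[OF integral_nonneg_AE \<alpha>] by simp
  have \<beta>0: "0 \<le> \<beta>" using \<beta>[of 0] by simp
  have 1: "\<bar>conv (dgauss a t) \<phi> x\<bar> \<le> kap a * t powr (- 1 / 2) * t powr (- real DIM('a) / 2) * \<alpha>"
    by (rule order_trans[OF conv_sup_kernel[OF _ dgauss_sup[OF t] \<phi>]]) (auto intro!: mult_left_mono \<alpha>)
  have 2: "\<bar>conv (dgauss a t) \<phi> x\<bar> \<le> kap a * t powr (- 1 / 2) * \<beta>"
  proof -
    have "\<bar>conv (dgauss a t) \<phi> x\<bar> \<le> \<beta> * (\<integral>y. \<bar>dgauss a t y\<bar> \<partial>lborel)"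
      by (rule conv_sup_fun[OF _ \<beta> integrable_dgauss[OF t]]) simp
    also have "\<dots> \<le> \<beta> * (kap a * t powr (- 1 / 2))" by (intro mult_left_mono dgauss_L1 t \<beta>0)
    finally show ?thesis by (simp add: mult_ac)
  qed
  have "\<bar>conv (dgauss a t) \<phi> x\<bar> \<le> (kap a * t powr (- 1 / 2) * t powr (- real DIM('a) / 2) * \<alpha>) powr l * (kap a * t powr (- 1 / 2) * \<beta>) powr (1 - l)"
    by (rule min_le_geometric_mean) (use 1 2 l \<alpha>0 \<beta>0 in auto)
  also have "\<dots> = ((kap a * t powr (- 1 / 2)) powr l * (kap a * t powr (- 1 / 2)) powr (1 - l)) * (t powr (- real DIM('a) / 2)) powr l * (\<alpha> powr l * \<beta> powr (1 - l))"
    using \<alpha>0 \<beta>0 by (simp add: powr_mult mult_ac del: powr_powr)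
  also have "(kap a * t powr (- 1 / 2)) powr l * (kap a * t powr (- 1 / 2)) powr (1 - l) = kap a * t powr (- 1 / 2)"
    by (cases "kap a * t powr (- 1 / 2) = 0") (simp_all add: powr_add[symmetric] del: mult_eq_0_iff)
  also have "(t powr (- real DIM('a) / 2)) powr l = t powr (- real DIM('a) * l / 2)"
    by (simp add: powr_powr)
  also have "kap a * t powr (- 1 / 2) * t powr (- real DIM('a) * l / 2) = kap a * t powr (- 1 / 2 - real DIM('a) * l / 2)"
    unfolding mult.assoc by (subst powr_add[symmetric]) simp
  finally show ?thesis .
qed

text \<open>On the first half of the time interval the kernel is regular and the \<open>L\<^sup>1\<close> norm of the forcing is used,
  on the second half the \<open>L\<^sup>1\<close> and \<open>L\<^sup>\<infinity>\<close> norms are interpolated with exponent \<open>l\<close>.\<close>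

lemma
  fixes a :: "'a::euclidean_space"
  assumes j: "jmeas \<phi>" and t: "0 < t" and b: "b < 1" and l: "0 \<le> l" "l \<le> 1" "real DIM('a) * l < 1"
    and \<phi>: "\<And>s. 0 < s \<Longrightarrow> s < t \<Longrightarrow> integrable lborel (\<phi> s)"
    and \<alpha>: "\<And>s. 0 < s \<Longrightarrow> s < t \<Longrightarrow> (\<integral>x. \<bar>\<phi> s x\<bar> \<partial>lborel) \<le> \<alpha> s"
    and \<beta>: "\<And>s x. 0 < s \<Longrightarrow> s < t \<Longrightarrow> \<bar>\<phi> s x\<bar> \<le> \<beta> s"
    and A1: "\<And>s. 0 < s \<Longrightarrow> s < t / 2 \<Longrightarrow> \<alpha> s \<le> A1 * s powr (- b)"
    and A2: "\<And>s. t / 2 \<le> s \<Longrightarrow> s < t \<Longrightarrow> \<alpha> s powr l * \<beta> s powr (1 - l) \<le> A2"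
    and A0: "0 \<le> A1" "0 \<le> A2"
  shows Du_sup_split: "\<bar>Du a \<phi> t x\<bar> \<le> kap a * ((t / 2) powr (- 1 / 2 - real DIM('a) / 2) * A1 * t powr (1 - b) / (1 - b)
      + A2 * t powr ((1 - real DIM('a) * l) / 2) * (2 / (1 - real DIM('a) * l)))" (is "_ \<le> ?R")
    and Du_integrable_split: "integrable lborel (\<lambda>s. indicator {0<..<t} s * conv (dgauss a (t - s)) (\<phi> s) x)"
    and isCont_Du_split: "isCont (Du a \<phi> t) x"
proof -
  let ?n = "real DIM('a)"
  let ?k = "\<lambda>s. kap a * (t / 2) powr (- 1 / 2 - ?n / 2) * A1 * s powr (- b) + kap a * A2 * (t - s) powr (- ((1 + ?n * l) / 2))"
  \<comment> \<open>The singularity at s = t has exponent (1 + n l)/2, which is below 1 because n l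
    < 1.\<close>
  have k: "has_bochner_integral lborel (\<lambda>s. indicator {0<..<t} s * ?k s)
     (kap a * (t / 2) powr (- 1 / 2 - ?n / 2) * A1 * (t powr (1 - b) / (1 - b)) + kap a * A2 * (t powr (1 - (1 + ?n * l) / 2) / (1 - (1 + ?n * l) / 2)))"
    by (rule has_bochner_integral_powr_sum) (use t b l in auto)
  have R: "kap a * (t / 2) powr (- 1 / 2 - ?n / 2) * A1 * (t powr (1 - b) / (1 - b)) + kap a * A2 * (t powr (1 - (1 + ?n * l) / 2) / (1 - (1 + ?n * l) / 2)) = ?R"
  proof -
    have "1 - (1 + ?n * l) / 2 = (1 - ?n * l) / 2" by (simp add: field_simps)
    then show ?thesis by (simp only:) (simp add: algebra_simps)
  qed
  have bd: "\<bar>conv (dgauss a (t - s)) (\<phi> s) x\<bar> \<le> ?k s" if s: "0 < s" "s < t" for s x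
  proof (cases "s < t / 2")
    case True
    have "\<bar>conv (dgauss a (t - s)) (\<phi> s) x\<bar> \<le> kap a * (t - s) powr (- 1 / 2) * (t - s) powr (- ?n / 2) * (\<integral>x. \<bar>\<phi> s x\<bar> \<partial>lborel)"
      by (rule conv_sup_kernel[OF _ dgauss_sup \<phi>[OF s]]) (use s in auto)
    also have "\<dots> = kap a * (t - s) powr (- 1 / 2 - ?n / 2) * (\<integral>x. \<bar>\<phi> s x\<bar> \<partial>lborel)"
      by (simp add: powr_add[symmetric] mult.assoc)
    also have "\<dots> \<le> kap a * (t / 2) powr (- 1 / 2 - ?n / 2) * (A1 * s powr (- b))"
    proof (rule mult_mono)
      show "kap a * (t - s) powr (- 1 / 2 - ?n / 2) \<le> kap a * (t / 2) powr (- 1 / 2 - ?n / 2)"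
        using True s by (intro mult_left_mono powr_mono2') auto
      show "(\<integral>x. \<bar>\<phi> s x\<bar> \<partial>lborel) \<le> A1 * s powr (- b)"
        by (rule order_trans[OF \<alpha>[OF s] A1[OF s(1) True]])
    qed auto
    also have "\<dots> \<le> ?k s" using A0 by simp
    finally show ?thesis .
  next
    case False
    have "\<bar>conv (dgauss a (t - s)) (\<phi> s) x\<bar> \<le> kap a * (t - s) powr (- 1 / 2 - ?n * l / 2) * (\<alpha> s powr l * \<beta> s powr (1 - l))"
      by (rule conv_dgauss_sup) (use s l \<phi>[OF s] \<alpha>[OF s] \<beta>[OF s] in auto)
    also have "\<dots> \<le> kap a * (t - s) powr (- 1 / 2 - ?n * l / 2) * A2"
      using False s by (intro mult_left_mono A2) auto
    also have "- 1 / 2 - ?n * l / 2 = - ((1 + ?n * l) / 2)" by (simp add: field_simps)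
    also have "kap a * (t - s) powr (- ((1 + ?n * l) / 2)) * A2 \<le> ?k s" using A0 by simp
    finally show ?thesis .
  qed
  show "\<bar>Du a \<phi> t x\<bar> \<le> ?R" using Du_bound[OF j bd k] unfolding R .
  show "integrable lborel (\<lambda>s. indicator {0<..<t} s * conv (dgauss a (t - s)) (\<phi> s) x)"
    using Du_integrable[OF j bd k] .
  show "isCont (Du a \<phi> t) x" using isCont_Du[OF j \<phi> bd k] .
qed

subsection \<open>Parabolic bounds\<close>

text \<open>The heat kernel at time t satisfies this with C = 1, and parabolic rescaling to time 1
  removes the power of t (\<open>pbound_scale\<close>). Only the two end-point norms are recorded;
  all other L^q norms follow by interpolation.\<close>

definition pbound :: "real \<Rightarrow> real \<Rightarrow> ('a::euclidean_space \<Rightarrow> real) \<Rightarrow> bool" where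
  "pbound t C \<phi> \<longleftrightarrow> integrable lborel \<phi> \<and> (\<integral>x. \<bar>\<phi> x\<bar> \<partial>lborel) \<le> C \<and> (\<forall>x. \<bar>\<phi> x\<bar> \<le> C * t powr (- real DIM('a) / 2))"

lemma pboundD:
  assumes "pbound t C (\<phi> :: 'a::euclidean_space \<Rightarrow> real)"
  shows "integrable lborel \<phi>" "(\<integral>x. \<bar>\<phi> x\<bar> \<partial>lborel) \<le> C" "\<bar>\<phi> x\<bar> \<le> C * t powr (- real DIM('a) / 2)" "0 \<le> C"
    "\<phi> \<in> borel_measurable borel"
proof -
  have "0 \<le> (\<integral>x. \<bar>\<phi> x\<bar> \<partial>lborel)" by simp
  with assms show "integrable lborel \<phi>" "(\<integral>x. \<bar>\<phi> x\<bar> \<partial>lborel) \<le> C" "\<bar>\<phi> x\<bar> \<le> C * t powr (- real DIM('a) / 2)" "0 \<le> C"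
    "\<phi> \<in> borel_measurable borel"
    using borel_measurable_integrable_lborel[of \<phi>] unfolding pbound_def by (blast intro: order_trans)+
qed

lemma pbound_mono:
  assumes "pbound t C \<phi>" "C \<le> D"
  shows "pbound t D (\<phi> :: 'a::euclidean_space \<Rightarrow> real)"
  using assms mult_right_mono[OF assms(2), of "t powr (- real DIM('a) / 2)"]
  unfolding pbound_def by (meson order_trans powr_ge_zero)

lemma pbound_add:
  assumes 1: "pbound t C \<phi>" and 2: "pbound t D \<psi>"
  shows "pbound t (C + D) (\<lambda>x. \<phi> x + \<psi> x)"
proof -
  have "(\<integral>x. \<bar>\<phi> x + \<psi> x\<bar> \<partial>lborel) \<le> (\<integral>x. \<bar>\<phi> x\<bar> + \<bar>\<psi> x\<bar> \<partial>lborel)"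
    by (rule integral_mono) (use pboundD(1)[OF 1] pboundD(1)[OF 2] in auto)
  also have "\<dots> \<le> C + D" using pboundD(1,2)[OF 1] pboundD(1,2)[OF 2] by simp
  finally show ?thesis
    using pboundD(1)[OF 1] pboundD(1)[OF 2] add_mono[OF pboundD(3)[OF 1] pboundD(3)[OF 2]]
    unfolding pbound_def by (auto simp: distrib_right intro: order_trans[OF abs_triangle_ineq])
qed

lemma pbound_bounded_mult:
  assumes 1: "pbound t C \<phi>" and [measurable]: "g \<in> borel_measurable borel" and g: "\<And>x. \<bar>g x\<bar> \<le> D * \<bar>\<phi> x\<bar>" and D: "0 \<le> D"
  shows "pbound t (D * C) g"
proof -
  have i: "integrable lborel g"
    by (rule Bochner_Integration.integrable_bound[of _ "\<lambda>x. D * \<phi> x"])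
       (use pboundD(1)[OF 1] g D in \<open>auto simp: abs_mult\<close>)
  have "(\<integral>x. \<bar>g x\<bar> \<partial>lborel) \<le> (\<integral>x. D * \<bar>\<phi> x\<bar> \<partial>lborel)"
    by (rule integral_mono) (use pboundD(1)[OF 1] i g in auto)
  also have "\<dots> \<le> D * C" using pboundD(2)[OF 1] D by (simp add: mult_left_mono)
  finally show ?thesis using i mult_left_mono[OF pboundD(3)[OF 1] D] order_trans[OF g]
    unfolding pbound_def by (auto simp: mult.assoc)
qed

lemma pbound_diff:
  assumes "pbound t C \<phi>" "pbound t D \<psi>"
  shows "pbound t (C + D) (\<lambda>x. \<phi> x - \<psi> x)"
  using pbound_add[OF assms(1) pbound_bounded_mult[OF assms(2), of "\<lambda>x. - \<psi> x" 1]] pboundD(5)[OF assms(2)] by simp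

text \<open>The term 2/(1 - b) comes from the first half of the time interval and 4 from the second;
  a factor 2 in each of them and the factor \<open>gcon\<close> pay for replacing t/2 by t.\<close>

definition Dcon :: "'a::euclidean_space \<Rightarrow> real \<Rightarrow> real" where
  "Dcon a b = kap a * gcon TYPE('a) * (2 / (1 - b) + 4)"

lemma
  fixes a :: "'a::euclidean_space"
  assumes j: "jmeas \<phi>" and t: "0 < t" and b: "0 \<le> b" "b < 1"
    and \<phi>: "\<And>s. 0 < s \<Longrightarrow> s < t \<Longrightarrow> pbound s (A * s powr (- b)) (\<phi> s)"
    and A: "0 \<le> A"
  shows pbound_Du: "pbound t (Dcon a b * A * t powr (1 / 2 - b)) (Du a \<phi> t)"
    and pbound_Du_integrable: "integrable lborel (\<lambda>s. indicator {0<..<t} s * conv (dgauss a (t - s)) (\<phi> s) x)"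
    and pbound_Du_isCont: "isCont (Du a \<phi> t) x"
proof -
  let ?n = "real DIM('a)" and ?\<alpha> = "\<lambda>s. A * s powr (- b)" and ?\<beta> = "\<lambda>s. A * s powr (- b) * s powr (- real DIM('a) / 2)"
  \<comment> \<open>On the second half the supremum of the forcing already has the right decay, so
    the interpolation exponent is 0.\<close>
  have A2: "?\<alpha> s powr 0 * ?\<beta> s powr (1 - 0) \<le> A * (t / 2) powr (- b - ?n / 2)" if s: "t / 2 \<le> s" "s < t" for s
  proof -
    have "?\<alpha> s powr 0 * ?\<beta> s powr (1 - 0) \<le> ?\<beta> s" using A by simp
    also have "\<dots> = A * s powr (- b - ?n / 2)" by (simp add: powr_add[symmetric] mult.assoc)
    also have "\<dots> \<le> A * (t / 2) powr (- b - ?n / 2)" using A s t b by (intro mult_left_mono powr_mono2') auto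
    finally show ?thesis .
  qed
  have al: "(\<integral>x. \<bar>\<phi> s x\<bar> \<partial>lborel) \<le> ?\<alpha> s" and be: "\<bar>\<phi> s x\<bar> \<le> ?\<beta> s" and ii: "integrable lborel (\<phi> s)" if "0 < s" "s < t" for s x
    using pboundD[OF \<phi>[OF that]] by auto
  note facts = j t b(2) order.refl zero_le_one _ ii al be _ A2 A
  show "integrable lborel (\<lambda>s. indicator {0<..<t} s * conv (dgauss a (t - s)) (\<phi> s) x)"
    by (rule Du_integrable_split[OF facts]) (use A in auto)
  show "isCont (Du a \<phi> t) x"
    by (rule isCont_Du_split[OF facts]) (use A in auto)
  have 1: "\<bar>Du a \<phi> t x\<bar> \<le> kap a * ((t / 2) powr (- 1 / 2 - ?n / 2) * A * t powr (1 - b) / (1 - b)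
      + (A * (t / 2) powr (- b - ?n / 2)) * t powr ((1 - ?n * 0) / 2) * (2 / (1 - ?n * 0)))" for x
    by (rule Du_sup_split[OF facts]) (use A in auto)
  have n2: "(t / 2) powr (- c) \<le> 2 * gcon TYPE('a) * t powr (- c)" if "c \<le> 1 + ?n / 2" for c
  proof -
    have "(t / 2) powr (- c) = 2 powr c * t powr (- c)" using t by (simp add: powr_divide powr_minus divide_simps)
    also have "\<dots> \<le> 2 powr (1 + ?n / 2) * t powr (- c)" using that by (intro mult_right_mono powr_mono) auto
    finally show ?thesis by (simp add: powr_add)
  qed
  have sup: "\<bar>Du a \<phi> t x\<bar> \<le> Dcon a b * A * t powr (1 / 2 - b) * t powr (- ?n / 2)" for x
  proof -
    have p1: "(t / 2) powr (- 1 / 2 - ?n / 2) \<le> 2 * gcon TYPE('a) * t powr (- 1 / 2 - ?n / 2)" using n2[of "1 / 2 + ?n / 2"] by simp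
    have p2: "(t / 2) powr (- b - ?n / 2) \<le> 2 * gcon TYPE('a) * t powr (- b - ?n / 2)" using n2[of "b + ?n / 2"] b by simp
    note 1[of x]
    also have "kap a * ((t / 2) powr (- 1 / 2 - ?n / 2) * A * t powr (1 - b) / (1 - b)
      + (A * (t / 2) powr (- b - ?n / 2)) * t powr ((1 - ?n * 0) / 2) * (2 / (1 - ?n * 0)))
      \<le> kap a * ((2 * gcon TYPE('a) * t powr (- 1 / 2 - ?n / 2)) * A * t powr (1 - b) / (1 - b)
      + (A * (2 * gcon TYPE('a) * t powr (- b - ?n / 2))) * t powr ((1 - ?n * 0) / 2) * (2 / (1 - ?n * 0)))"
      using p1 p2 A b by (intro mult_left_mono add_mono mult_right_mono divide_right_mono) auto
    also have "\<dots> = kap a * gcon TYPE('a) * A * ((2 / (1 - b)) * (t powr (- 1 / 2 - ?n / 2) * t powr (1 - b)) + 4 * (t powr (- b - ?n / 2) * t powr (1 / 2)))"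
      by (simp add: algebra_simps)
    also have "t powr (- 1 / 2 - ?n / 2) * t powr (1 - b) = t powr (1 / 2 - b) * t powr (- ?n / 2)"
      by (simp add: powr_add[symmetric] algebra_simps)
    also have "t powr (- b - ?n / 2) * t powr (1 / 2) = t powr (1 / 2 - b) * t powr (- ?n / 2)"
      by (simp add: powr_add[symmetric] algebra_simps)
    finally show ?thesis by (simp add: Dcon_def algebra_simps)
  qed
  \<comment> \<open>The L1 bound uses the same split at t/2: the kernel is regular on the first
    half, the forcing on the second.\<close>
  let ?k = "\<lambda>s. (t / 2) powr (- 1 / 2) * A * s powr (- b) + A * (t / 2) powr (- b) * (t - s) powr (- (1 / 2))"
  have k: "has_bochner_integral lborel (\<lambda>s. indicator {0<..<t} s * ?k s)
     ((t / 2) powr (- 1 / 2) * A * (t powr (1 - b) / (1 - b)) + A * (t / 2) powr (- b) * (t powr (1 - 1 / 2) / (1 - 1 / 2)))"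
    by (rule has_bochner_integral_powr_sum) (use t b in auto)
  have kb: "(t - s) powr (- 1 / 2) * (\<integral>x. \<bar>\<phi> s x\<bar> \<partial>lborel) \<le> ?k s" if s: "0 < s" "s < t" for s
  proof (cases "s < t / 2")
    case True
    have "(t - s) powr (- 1 / 2) * (\<integral>x. \<bar>\<phi> s x\<bar> \<partial>lborel) \<le> (t / 2) powr (- 1 / 2) * (A * s powr (- b))"
      using s True al[OF s] by (intro mult_mono powr_mono2') auto
    also have "\<dots> \<le> ?k s" using A by simp
    finally show ?thesis .
  next
    case False
    have "(t - s) powr (- 1 / 2) * (\<integral>x. \<bar>\<phi> s x\<bar> \<partial>lborel) \<le> (t - s) powr (- 1 / 2) * (A * (t / 2) powr (- b))"
      using s False al[OF s] A t b by (intro mult_left_mono order_trans[OF al[OF s]] powr_mono2') auto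
    also have "\<dots> \<le> ?k s" using A by simp
    finally show ?thesis .
  qed
  note L = integrable_Du[OF j ii kb k] Du_L1[OF j ii kb k]
  have "kap a * ((t / 2) powr (- 1 / 2) * A * (t powr (1 - b) / (1 - b)) + A * (t / 2) powr (- b) * (t powr (1 - 1 / 2) / (1 - 1 / 2)))
    \<le> kap a * ((2 * gcon TYPE('a) * t powr (- 1 / 2)) * A * (t powr (1 - b) / (1 - b)) + A * (2 * gcon TYPE('a) * t powr (- b)) * (t powr (1 - 1 / 2) / (1 - 1 / 2)))"
    using n2[of "1/2"] n2[of b] A b by (intro mult_left_mono add_mono mult_right_mono) auto
  also have "\<dots> = kap a * gcon TYPE('a) * A * ((2 / (1 - b)) * (t powr (- 1 / 2) * t powr (1 - b)) + 4 * (t powr (- b) * t powr (1 / 2)))"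
    by (simp add: algebra_simps)
  also have "t powr (- 1 / 2) * t powr (1 - b) = t powr (1 / 2 - b)"
    by (simp add: powr_add[symmetric])
  also have "t powr (- b) * t powr (1 / 2) = t powr (1 / 2 - b)"
    by (simp add: powr_add[symmetric])
  finally have fin: "kap a * ((t / 2) powr (- 1 / 2) * A * (t powr (1 - b) / (1 - b)) + A * (t / 2) powr (- b) * (t powr (1 - 1 / 2) / (1 - 1 / 2)))
     \<le> Dcon a b * A * t powr (1 / 2 - b)" by (simp add: Dcon_def algebra_simps)
  show "pbound t (Dcon a b * A * t powr (1 / 2 - b)) (Du a \<phi> t)"
    unfolding pbound_def using L(1) order_trans[OF L(2) fin] sup by blast
qed

subsection \<open>The nonlinearity\<close>

lemma abs_fnl: "\<bar>fnl p x\<bar> = \<bar>x\<bar> powr p"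
proof (cases "x = 0")
  case False
  have "\<bar>fnl p x\<bar> = \<bar>x\<bar> powr (p - 1) * \<bar>x\<bar> powr 1" using False by (simp add: fnl_def abs_mult)
  also have "\<dots> = \<bar>x\<bar> powr p" unfolding powr_add[symmetric] by simp
  finally show ?thesis .
qed (simp add: fnl_def)

lemma borel_measurable_fnl [measurable (raw)]:
  "g \<in> borel_measurable M \<Longrightarrow> (\<lambda>x. fnl p (g x)) \<in> borel_measurable M"
  unfolding fnl_def by measurable

lemma has_real_derivative_fnl:
  assumes p: "1 < p"
  shows "(fnl p has_real_derivative (p * \<bar>x\<bar> powr (p - 1))) (at x)"
proof -
  consider "0 < x" | "x < 0" | "x = 0" by linarith
  then show ?thesis
  proof cases
    case 1
    have "((\<lambda>x. x powr p) has_real_derivative (p * x powr (p - 1))) (at x)"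
      using 1 by (auto intro!: derivative_eq_intros)
    then have "((\<lambda>x. x powr p) has_real_derivative (p * \<bar>x\<bar> powr (p - 1))) (at x)" using 1 by simp
    then show ?thesis
    proof (rule has_field_derivative_transform_within_open[of _ _ _ "{0<..}"])
      show "y powr p = fnl p y" if "y \<in> {0<..}" for y
        using abs_fnl[of p y] that by (simp add: fnl_def)
    qed (use 1 in auto)
  next
    case 2
    have "((\<lambda>x. - ((- x) powr p)) has_real_derivative (p * (- x) powr (p - 1))) (at x)"
      using 2 by (auto intro!: derivative_eq_intros)
    then have "((\<lambda>x. - ((- x) powr p)) has_real_derivative (p * \<bar>x\<bar> powr (p - 1))) (at x)" using 2 by simp
    then show ?thesis
    proof (rule has_field_derivative_transform_within_open[of _ _ _ "{..<0}"])
      show "- ((- y) powr p) = fnl p y" if "y \<in> {..<0}" for y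
      proof -
        have "fnl p y = - \<bar>fnl p y\<bar>" using that by (simp add: fnl_def abs_mult mult_nonneg_nonpos)
        then show ?thesis using abs_fnl[of p y] that by simp
      qed
    qed (use 2 in auto)
  next
    case 3
    \<comment> \<open>At 0 the difference quotient is exactly |h|^(p - 1), which tends to 0 since p
      > 1.\<close>
    have "((\<lambda>h::real. \<bar>h\<bar> powr (p - 1)) \<longlongrightarrow> \<bar>0\<bar> powr (p - 1)) (at 0)"
      by (rule tendsto_powr'[OF tendsto_rabs[OF tendsto_ident_at] tendsto_const]) (use p in auto)
    then have "((\<lambda>h. \<bar>h\<bar> powr (p - 1)) \<longlongrightarrow> 0) (at (0::real))" by simp
    then have "((\<lambda>h. (fnl p (0 + h) - fnl p 0) / h) \<longlongrightarrow> 0) (at 0)"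
      by (rule Lim_transform_eventually) (auto simp: eventually_at_filter fnl_def)
    then show ?thesis using 3 p by (simp add: DERIV_def)
  qed
qed

lemma deriv_fnl: "1 < p \<Longrightarrow> deriv (fnl p) x = p * \<bar>x\<bar> powr (p - 1)"
  by (rule DERIV_imp_deriv[OF has_real_derivative_fnl])

lemma fnl_lipschitz:
  assumes p: "1 < p" and x: "\<bar>x\<bar> \<le> B" and y: "\<bar>y\<bar> \<le> B"
  shows "\<bar>fnl p x - fnl p y\<bar> \<le> p * B powr (p - 1) * \<bar>x - y\<bar>"
proof -
  have "norm (fnl p x - fnl p y) \<le> p * B powr (p - 1) * norm (x - y)"
  proof (rule field_differentiable_bound[of "{-B..B}" "fnl p" "\<lambda>z. p * \<bar>z\<bar> powr (p - 1)"])
    show "(fnl p has_field_derivative p * \<bar>z\<bar> powr (p - 1)) (at z within {-B..B})" for z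
      by (rule has_field_derivative_at_within[OF has_real_derivative_fnl[OF p]])
    show "norm (p * \<bar>z\<bar> powr (p - 1)) \<le> p * B powr (p - 1)" if "z \<in> {-B..B}" for z
      using that p by (auto simp: abs_mult intro!: mult_left_mono powr_mono2)
  qed (use x y in auto)
  then show ?thesis by simp
qed

subsection \<open>A regular representative of the solution\<close>

text \<open>The set where g exceeds \<open>B\<close> is open, and a nonempty open set is not
  null.\<close>

lemma isCont_AE_le_imp_le:
  fixes g :: "'a::euclidean_space \<Rightarrow> real"
  assumes c: "\<And>x. isCont g x" and ae: "AE x in lborel. g x \<le> B"
  shows "g x \<le> B"
proof (rule ccontr)
  assume "\<not> g x \<le> B"
  have "open {x. B < g x}"
    using c by (intro open_Collect_less continuous_on_const) (auto simp: continuous_at_imp_continuous_on)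
  moreover have "x \<in> {x. B < g x}" using \<open>\<not> g x \<le> B\<close> by simp
  ultimately have "\<not> negligible {x. B < g x}" using open_not_negligible by blast
  moreover have "{x. B < g x} \<in> null_sets lebesgue"
  proof -
    have "AE x in lebesgue. g x \<le> B" using ae by (rule AE_completion)
    then show ?thesis
      using \<open>open {x. B < g x}\<close> by (intro AE_iff_null_sets[THEN iffD2]) (auto simp: not_less)
  qed
  ultimately show False by (simp add: negligible_iff_null_sets)
qed

lemma set_integral_Icc_eq_Ioo:
  fixes F G :: "real \<Rightarrow> real"
  assumes "\<And>s. 0 < s \<Longrightarrow> s < t \<Longrightarrow> F s = G s"
  shows "set_lebesgue_integral lborel {0..t} F = (\<integral>s. indicator {0<..<t} s * G s \<partial>lborel)"
  unfolding set_lebesgue_integral_def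
  by (rule integral_discrete_difference[of "{0, t}"]) (use assms in \<open>auto simp: indicator_def\<close>)

lemma Du_cong:
  assumes "\<And>s. 0 < s \<Longrightarrow> s < t \<Longrightarrow> conv (dgauss a (t - s)) (\<phi> s) = conv (dgauss a (t - s)) (\<psi> s)"
  shows "Du a \<phi> t = Du a \<psi> t"
proof
  fix x
  show "Du a \<phi> t x = Du a \<psi> t x"
    unfolding Du_def by (rule Bochner_Integration.integral_cong) (use assms in \<open>auto simp: indicator_def\<close>)
qed

lemma Lq_norm_1:
  assumes "g \<in> borel_measurable borel"
  shows "Lq_norm 1 g = (\<integral>\<^sup>+x. ennreal \<bar>g x\<bar> \<partial>lborel)"
  by (auto simp: Lq_norm_def Let_def powr_one_gt_zero_iff ennreal_enn2real_if)

lemma Lq_norm_inf_less: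
  assumes "Lq_norm \<infinity> g < ennreal B"
  shows "AE x in lborel. \<bar>g x\<bar> \<le> B"
proof -
  obtain C where C: "AE x in lborel. ennreal \<bar>g x\<bar> \<le> C" "C < ennreal B"
    using assms unfolding Lq_norm_def by (auto simp: Inf_less_iff)
  from C(1) show ?thesis
  proof eventually_elim
    case (elim x)
    then have "ennreal \<bar>g x\<bar> < ennreal B" using C(2) by simp
    then show ?case by (simp add: ennreal_less_iff)
  qed
qed

text \<open>The solution is only known as a continuous curve in L1, with no joint measurability in
  (s, x). Smoothing by the kernel makes the integrand of Duhamel's formula jointly continuous, and
  hence jointly measurable.\<close>

lemma continuous_on_conv_param:
  fixes \<phi> :: "real \<Rightarrow> 'a::euclidean_space \<Rightarrow> real"
  assumes \<phi>: "\<And>s. 0 < s \<Longrightarrow> integrable lborel (\<phi> s)"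
    and c: "\<And>s. 0 < s \<Longrightarrow> ((\<lambda>r. \<integral>x. \<bar>\<phi> r x - \<phi> s x\<bar> \<partial>lborel) \<longlongrightarrow> 0) (at s within {0<..})"
  shows "continuous_on ({0<..} \<times> {0<..} \<times> UNIV) (\<lambda>(t, s, x). conv (dgauss a t) (\<phi> s) x)"
  unfolding continuous_on_sequentially
proof (intro allI ballI impI, elim conjE)
  fix X and z :: "real \<times> real \<times> 'a"
  assume z: "z \<in> {0<..} \<times> {0<..} \<times> UNIV" and XS: "\<forall>n. X n \<in> {0<..} \<times> {0<..} \<times> UNIV" and X: "X \<longlonglongrightarrow> z"
  obtain t s x where zeq: "z = (t, s, x)" by (cases z)
  define T S Y where "T = (\<lambda>n. fst (X n))" and "S = (\<lambda>n. fst (snd (X n)))" and "Y = (\<lambda>n. snd (snd (X n)))"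
  have Xeq: "X n = (T n, S n, Y n)" for n by (simp add: T_def S_def Y_def)
  have t: "0 < t" and s: "0 < s" using z zeq by auto
  have T: "0 < T n" and S: "0 < S n" for n using XS[rule_format, of n] by (auto simp: Xeq)
  have Tl: "T \<longlonglongrightarrow> t" and Sl: "S \<longlonglongrightarrow> s" and Yl: "Y \<longlonglongrightarrow> x"
    using tendsto_fst[OF X] tendsto_fst[OF tendsto_snd[OF X]] tendsto_snd[OF tendsto_snd[OF X]]
    by (simp_all add: zeq T_def S_def Y_def)
  note borel_measurable_integrable_lborel[OF \<phi>, measurable]
  let ?C = "\<lambda>t. kap a * t powr (- 1 / 2) * t powr (- real DIM('a) / 2)"
  have Cl: "(\<lambda>n. ?C (T n)) \<longlonglongrightarrow> ?C t" using t Tl by (auto intro!: tendsto_intros)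
  obtain D where D: "\<And>n. ?C (T n) \<le> D"
    using convergent_imp_Bseq[OF convergentI[OF Cl]] by (auto simp: Bseq_def)
  have 1: "(\<lambda>n. conv (dgauss a (T n)) (\<lambda>y. \<phi> (S n) y - \<phi> s y) (Y n)) \<longlonglongrightarrow> 0"
  proof (rule Lim_null_comparison)
    show "\<forall>\<^sub>F n in sequentially. norm (conv (dgauss a (T n)) (\<lambda>y. \<phi> (S n) y - \<phi> s y) (Y n)) \<le> ?C (T n) * (\<integral>x. \<bar>\<phi> (S n) x - \<phi> s x\<bar> \<partial>lborel)"
      unfolding real_norm_def
      by (intro always_eventually allI conv_sup_kernel dgauss_sup T) (use \<phi> S s in auto)
    have "(\<lambda>n. \<integral>x. \<bar>\<phi> (S n) x - \<phi> s x\<bar> \<partial>lborel) \<longlonglongrightarrow> 0"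
      using continuous_within_tendsto_compose[of s "{0<..}" "\<lambda>r. \<integral>x. \<bar>\<phi> r x - \<phi> s x\<bar> \<partial>lborel" S sequentially] c[OF s] Sl S
      by (simp add: continuous_within)
    from tendsto_mult[OF Cl this] show "(\<lambda>n. ?C (T n) * (\<integral>x. \<bar>\<phi> (S n) x - \<phi> s x\<bar> \<partial>lborel)) \<longlonglongrightarrow> 0" by simp
  qed
  have 2: "(\<lambda>n. conv (dgauss a (T n)) (\<phi> s) (Y n)) \<longlonglongrightarrow> conv (dgauss a t) (\<phi> s) x"
    unfolding conv_def
  proof (rule integral_dominated_convergence)
    show "integrable lborel (\<lambda>y. D * \<bar>\<phi> s y\<bar>)" using \<phi>[OF s] by simp
    show "AE y in lborel. (\<lambda>n. dgauss a (T n) (Y n - y) * \<phi> s y) \<longlonglongrightarrow> dgauss a t (x - y) * \<phi> s y"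
      unfolding dgauss_def gauss_def using t Tl Yl by (auto intro!: tendsto_eq_intros)
    show "AE y in lborel. norm (dgauss a (T n) (Y n - y) * \<phi> s y) \<le> D * \<bar>\<phi> s y\<bar>" for n
      using order_trans[OF dgauss_sup[OF T] D] by (auto simp: abs_mult intro!: mult_right_mono)
  qed (use s in measurable)
  have eq: "conv (dgauss a (T n)) (\<phi> (S n)) (Y n)
    = conv (dgauss a (T n)) (\<lambda>y. \<phi> (S n) y - \<phi> s y) (Y n) + conv (dgauss a (T n)) (\<phi> s) (Y n)" for n
    using conv_diff[of "dgauss a (T n)", OF _ dgauss_sup[OF T] \<phi>[OF S] \<phi>[OF s]] by simp
  show "((\<lambda>(t, s, x). conv (dgauss a t) (\<phi> s) x) \<circ> X) \<longlonglongrightarrow> (\<lambda>(t, s, x). conv (dgauss a t) (\<phi> s) x) z"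
    using tendsto_add[OF 1 2] by (simp add: o_def Xeq zeq eq)
qed

text \<open>What the estimates need from the solution: joint measurability, and the equation and the
  bound by \<open>B\<close> at every point instead of almost everywhere. Taking \<open>B\<close> and
  \<open>M\<close> at least 1 simplifies the handling of constants.\<close>

locale mild_solution =
  fixes a :: "'a::euclidean_space" and p :: real and u0 :: "'a \<Rightarrow> real" and v :: "real \<Rightarrow> 'a \<Rightarrow> real" and B M :: real
  assumes p1: "1 < p" and u0: "integrable lborel u0" and vj: "jmeas v" and B1: "1 \<le> B" and M1: "1 \<le> M"
    and eqn: "\<And>t x. 0 < t \<Longrightarrow> v t x = heat t u0 x + Du a (\<lambda>s y. fnl p (v s y)) t x"
    and vB: "\<And>t x. 0 < t \<Longrightarrow> \<bar>v t x\<bar> \<le> B" and vi: "\<And>t. 0 < t \<Longrightarrow> integrable lborel (v t)"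
    and vM: "\<And>t. 0 < t \<Longrightarrow> (\<integral>x. \<bar>v t x\<bar> \<partial>lborel) \<le> M"

text \<open>The representative is the right-hand side of the integral equation itself. It is jointly
  measurable and continuous in space even though \<open>u\<close> need not be, and it agrees with
  \<open>u\<close> almost everywhere at each positive time.\<close>

lemma regular_solution:
  fixes a :: "'a::euclidean_space"
  assumes p: "1 < p" and u0: "integrable lborel u0" and sol: "global_solution a p u0 u"
  obtains v B M where "mild_solution a p u0 v B M" "\<And>t. 0 < t \<Longrightarrow> AE x in lborel. u t x = v t x"
proof -
  have um: "u t \<in> borel_measurable borel" if "0 < t" for t
    using sol that unfolding global_solution_def by simp
  have ucont: "((\<lambda>s. Lq_norm 1 (\<lambda>x. u s x - u t x)) \<longlongrightarrow> 0) (at t within {0..})" if "0 < t" for t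
    using sol that unfolding global_solution_def by simp
  have sup1: "(SUP t\<in>{0..}. Lq_norm 1 (u t)) < \<infinity>" and supi: "(SUP t\<in>{0<..}. Lq_norm \<infinity> (u t)) < \<infinity>"
    using sol unfolding global_solution_def by auto
  have eq: "AE x in lborel. u t x = heat t u0 x +
         set_lebesgue_integral lborel {0..t} (\<lambda>s. adgrad a (t - s) (\<lambda>y. fnl p (u s y)) x)" if "0 < t" for t
    using sol that unfolding global_solution_def by simp
  define M where "M = max 1 (enn2real (SUP t\<in>{0..}. Lq_norm 1 (u t)))"
  \<comment> \<open>The added 1 makes the inequality for the essential supremum strict, as
    \<open>Lq_norm_inf_less\<close> requires.\<close>
  define B where "B = 1 + enn2real (SUP t\<in>{0<..}. Lq_norm \<infinity> (u t))"
  have M1: "1 \<le> M" and B1: "1 \<le> B" by (auto simp: M_def B_def)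
  have uL1: "(\<integral>\<^sup>+x. ennreal \<bar>u t x\<bar> \<partial>lborel) \<le> ennreal M" if "0 < t" for t
  proof -
    have "Lq_norm 1 (u t) \<le> (SUP t\<in>{0..}. Lq_norm 1 (u t))" using that by (intro SUP_upper) auto
    also have "\<dots> = ennreal (enn2real (SUP t\<in>{0..}. Lq_norm 1 (u t)))" using sup1 by simp
    also have "\<dots> \<le> ennreal M" by (rule ennreal_leI) (simp add: M_def)
    finally show ?thesis using Lq_norm_1[OF um[OF that]] by simp
  qed
  have uB: "AE x in lborel. \<bar>u t x\<bar> \<le> B" if "0 < t" for t
  proof (rule Lq_norm_inf_less)
    have "Lq_norm \<infinity> (u t) \<le> (SUP t\<in>{0<..}. Lq_norm \<infinity> (u t))" using that by (intro SUP_upper) auto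
    also have "\<dots> = ennreal (enn2real (SUP t\<in>{0<..}. Lq_norm \<infinity> (u t)))" using supi by simp
    also have "\<dots> < ennreal B" by (rule ennreal_lessI) (simp_all add: B_def add_pos_nonneg)
    finally show "Lq_norm \<infinity> (u t) < ennreal B" .
  qed
  \<comment> \<open>Truncation makes the bound by \<open>B\<close> hold everywhere, so that the
    Lipschitz bound for \<open>fnl\<close> applies without exceptional points; it changes
    \<open>u t\<close> on a null set only.\<close>
  define tr where "tr = (\<lambda>r. if \<bar>r\<bar> \<le> B then r else (0::real))"
  have tr_m [measurable]: "tr \<in> borel_measurable borel" unfolding tr_def by measurable
  have trB: "\<bar>tr r\<bar> \<le> B" for r using B1 by (auto simp: tr_def)
  have trid: "tr r = r" if "\<bar>r\<bar> \<le> B" for r using that by (simp add: tr_def)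
  have tru: "AE x in lborel. tr (u t x) = u t x" if "0 < t" for t
    using uB[OF that] by eventually_elim (simp add: trid)
  define \<phi> where "\<phi> = (\<lambda>s x. fnl p (tr (u s x)))"
  have \<phi>m: "\<phi> s \<in> borel_measurable borel" if "0 < s" for s
    unfolding \<phi>_def using um[OF that] by measurable
  have ui: "integrable lborel (u t)" if "0 < t" for t
    using uL1[OF that] um[OF that] by (auto simp: integrable_iff_bounded intro: le_less_trans)
  have fnl_le: "\<bar>fnl p (tr r)\<bar> \<le> p * B powr (p - 1) * \<bar>tr r\<bar>" for r
    using fnl_lipschitz[OF p trB[of r], of 0] B1 by (simp add: fnl_def)
  have tri: "integrable lborel (\<lambda>x. tr (u t x))" if "0 < t" for t
    by (rule integrable_cong_AE_imp[OF ui[OF that]]) (use tru[OF that] um[OF that] in auto)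
  have \<phi>i: "integrable lborel (\<phi> s)" if "0 < s" for s
  proof (rule Bochner_Integration.integrable_bound)
    show "integrable lborel (\<lambda>x. p * B powr (p - 1) * tr (u s x))" using tri[OF that] by simp
  qed (use \<phi>m[OF that] fnl_le p in \<open>auto simp: \<phi>_def abs_mult\<close>)
  have c: "((\<lambda>r. \<integral>x. \<bar>\<phi> r x - \<phi> s x\<bar> \<partial>lborel) \<longlongrightarrow> 0) (at s within {0<..})" if s: "0 < s" for s
  proof -
    let ?C = "p * B powr (p - 1)"
    let ?N = "\<lambda>r. enn2real (Lq_norm 1 (\<lambda>x. u r x - u s x))"
    have "((\<lambda>r. Lq_norm 1 (\<lambda>x. u r x - u s x)) \<longlongrightarrow> ennreal 0) (at s within {0<..})"
      using tendsto_within_subset[OF ucont[OF s], of "{0<..}"] by (simp add: subset_eq)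
    then have "(?N \<longlongrightarrow> 0) (at s within {0<..})"
      by (rule tendsto_enn2real) simp
    then have l: "((\<lambda>r. ?C * ?N r) \<longlongrightarrow> 0) (at s within {0<..})"
      using tendsto_mult_right_zero by blast
    show ?thesis
    proof (rule Lim_null_comparison[OF _ l])
      show "\<forall>\<^sub>F r in at s within {0<..}. norm (\<integral>x. \<bar>\<phi> r x - \<phi> s x\<bar> \<partial>lborel) \<le> ?C * ?N r"
        unfolding eventually_at_filter
      proof (intro always_eventually allI impI)
        fix r :: real assume "r \<in> {0<..}"
        then have r: "0 < r" by simp
        note um[OF r, measurable] um[OF s, measurable]
        have i: "integrable lborel (\<lambda>x. \<bar>u r x - u s x\<bar>)" using ui[OF r] ui[OF s] by auto
        have "?N r = enn2real (\<integral>\<^sup>+x. ennreal \<bar>u r x - u s x\<bar> \<partial>lborel)" by (subst Lq_norm_1) auto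
        also have "\<dots> = (\<integral>x. \<bar>u r x - u s x\<bar> \<partial>lborel)" using i by (subst nn_integral_eq_integral) auto
        finally have N: "?N r = (\<integral>x. \<bar>u r x - u s x\<bar> \<partial>lborel)" .
        have "(\<integral>x. \<bar>\<phi> r x - \<phi> s x\<bar> \<partial>lborel) \<le> (\<integral>x. ?C * \<bar>u r x - u s x\<bar> \<partial>lborel)"
        proof (rule integral_mono_AE)
          show "AE x in lborel. \<bar>\<phi> r x - \<phi> s x\<bar> \<le> ?C * \<bar>u r x - u s x\<bar>"
            using tru[OF r] tru[OF s]
            by eventually_elim (use fnl_lipschitz[OF p trB trB] in \<open>metis \<phi>_def\<close>)
        qed (use i \<phi>i[OF r] \<phi>i[OF s] in auto)
        then show "norm (\<integral>x. \<bar>\<phi> r x - \<phi> s x\<bar> \<partial>lborel) \<le> ?C * ?N r" unfolding N by simp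
      qed
    qed
  qed
  \<comment> \<open>Continuity is known for positive times only. The integrand is cut off outside
    this open set and is then Borel measurable on the whole space.\<close>
  define \<Psi> where "\<Psi> = (\<lambda>z::real \<times> real \<times> 'a. indicator ({0<..} \<times> {0<..} \<times> UNIV) z *\<^sub>R (\<lambda>(t, s, x). conv (dgauss a t) (\<phi> s) x) z)"
  have \<Psi>m: "\<Psi> \<in> borel_measurable borel"
    unfolding \<Psi>_def
    by (rule borel_measurable_continuous_on_indicator[OF _ continuous_on_conv_param[OF \<phi>i c]])
       (auto intro!: borel_open open_Times)
  define v where "v = (\<lambda>t x. if 0 < t then heat t u0 x + Du a \<phi> t x else 0)"
  note borel_measurable_integrable_lborel[OF u0, measurable]
  have Dueq: "Du a \<phi> t x = (\<integral>s. indicator {0<..<t} s * \<Psi> (t - s, s, x) \<partial>lborel)" for t x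
    unfolding Du_def by (rule Bochner_Integration.integral_cong) (auto simp: \<Psi>_def indicator_def)
  have vj: "jmeas v"
  proof -
    have [measurable]: "(\<lambda>w. \<Psi> (f w, g w, h w)) \<in> borel_measurable N"
      if [measurable]: "f \<in> borel_measurable N" "g \<in> borel_measurable N" "h \<in> borel_measurable N" for f g h and N :: "((real \<times> 'a) \<times> real) measure"
      by (rule measurable_compose[OF _ \<Psi>m]) (use that in \<open>auto intro!: borel_measurable_Pair\<close>)
    have "(\<lambda>w. \<Psi> (fst (fst w) - snd w, snd w, snd (fst w))) \<in> borel_measurable ((borel \<Otimes>\<^sub>M borel) \<Otimes>\<^sub>M lborel)"
      by measurable
    then have [measurable]: "(\<lambda>w. \<integral>s. indicator {0<..<fst w} s * \<Psi> (fst w - s, s, snd w) \<partial>lborel) \<in> borel_measurable (borel \<Otimes>\<^sub>M borel)"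
      by (intro lborel.borel_measurable_lebesgue_integral) (simp add: case_prod_unfold)
    show ?thesis unfolding v_def Dueq heat_def case_prod_unfold by measurable
  qed
  have veq: "AE x in lborel. u t x = v t x" if t: "0 < t" for t
  proof -
    have "set_lebesgue_integral lborel {0..t} (\<lambda>s. adgrad a (t - s) (\<lambda>y. fnl p (u s y)) x) = Du a \<phi> t x" for x
      unfolding Du_def
    proof (rule set_integral_Icc_eq_Ioo)
      fix s assume s: "0 < s" "s < t"
      have ae: "AE y in lborel. \<phi> s y = fnl p (u s y)"
        using tru[OF s(1)] by eventually_elim (simp add: \<phi>_def)
      have fm: "(\<lambda>y. fnl p (u s y)) \<in> borel_measurable borel" using um[OF s(1)] by measurable
      have "integrable lborel (\<lambda>y. fnl p (u s y))"
        by (rule integrable_cong_AE_imp[OF \<phi>i[OF s(1)]]) (use ae fm in auto)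
      then have "adgrad a (t - s) (\<lambda>y. fnl p (u s y)) x = conv (dgauss a (t - s)) (\<lambda>y. fnl p (u s y)) x"
        by (rule adgrad_eq_conv) (use s in auto)
      also have "conv (dgauss a (t - s)) (\<lambda>y. fnl p (u s y)) = conv (dgauss a (t - s)) (\<phi> s)"
        by (rule conv_cong_AE) (use ae fm \<phi>m[OF s(1)] in auto)
      finally show "adgrad a (t - s) (\<lambda>y. fnl p (u s y)) x = conv (dgauss a (t - s)) (\<phi> s) x" .
    qed
    then show ?thesis using eq[OF t] t by (simp add: v_def)
  qed
  have vm: "v t \<in> borel_measurable borel" for t
    using jmeas_compose[OF vj, of "\<lambda>_. t" borel "\<lambda>x. x"] by simp
  have vi: "integrable lborel (v t)" if t: "0 < t" for t
    by (rule integrable_cong_AE_imp[OF ui[OF t]]) (use veq[OF t] vm um[OF t] in auto)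
  have vM: "(\<integral>x. \<bar>v t x\<bar> \<partial>lborel) \<le> M" if t: "0 < t" for t
  proof -
    have "ennreal (\<integral>x. \<bar>v t x\<bar> \<partial>lborel) = (\<integral>\<^sup>+x. ennreal \<bar>v t x\<bar> \<partial>lborel)"
      using vi[OF t] by (subst nn_integral_eq_integral) auto
    also have "\<dots> = (\<integral>\<^sup>+x. ennreal \<bar>u t x\<bar> \<partial>lborel)"
      by (rule nn_integral_cong_AE) (use veq[OF t] in auto)
    also have "\<dots> \<le> ennreal M" by (rule uL1[OF t])
    finally show ?thesis using M1 by simp
  qed
  have vBae: "AE x in lborel. \<bar>v t x\<bar> \<le> B" if t: "0 < t" for t
    using uB[OF t] veq[OF t] by eventually_elim simp
  define \<psi> where "\<psi> = (\<lambda>s x. fnl p (tr (v s x)))"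
  note jmeas_compose[OF vj, measurable (raw)]
  have \<psi>j: "jmeas \<psi>" unfolding \<psi>_def by measurable
  have \<phi>\<psi>: "AE x in lborel. \<phi> s x = \<psi> s x" if "0 < s" for s
    using veq[OF that] by eventually_elim (simp add: \<phi>_def \<psi>_def)
  have \<psi>m: "\<psi> s \<in> borel_measurable borel" for s unfolding \<psi>_def using vm[of s] by measurable
  have Du\<psi>: "Du a \<phi> t = Du a \<psi> t" for t
    by (rule Du_cong, rule conv_cong_AE) (use \<phi>m \<psi>m \<phi>\<psi> in auto)
  have \<psi>i: "integrable lborel (\<psi> s)" if "0 < s" for s
    by (rule integrable_cong_AE_imp[OF \<phi>i[OF that]]) (use \<phi>\<psi>[OF that] \<psi>m in auto)
  have \<psi>L: "(\<integral>x. \<bar>\<psi> s x\<bar> \<partial>lborel) \<le> p * B powr (p - 1) * M" if "0 < s" for s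
  proof -
    have "(\<integral>x. \<bar>\<psi> s x\<bar> \<partial>lborel) \<le> (\<integral>x. p * B powr (p - 1) * \<bar>v s x\<bar> \<partial>lborel)"
    proof (rule integral_mono)
      show "\<bar>\<psi> s x\<bar> \<le> p * B powr (p - 1) * \<bar>v s x\<bar>" for x
        using fnl_le[of "v s x"] p by (auto simp: \<psi>_def tr_def)
    qed (use \<psi>i[OF that] vi[OF that] in auto)
    also have "\<dots> \<le> p * B powr (p - 1) * M" using vM[OF that] p by (auto intro!: mult_left_mono)
    finally show ?thesis .
  qed
  have \<psi>B: "\<bar>\<psi> s x\<bar> \<le> B powr p" for s x
    unfolding \<psi>_def abs_fnl using trB p by (intro powr_mono2) auto
  have cont: "isCont (v t) x" if t: "0 < t" for t x
  proof -
    have "isCont (Du a \<psi> t) x"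
      by (rule isCont_Du_split[OF \<psi>j t, where b = 0 and l = 0 and \<alpha> = "\<lambda>_. p * B powr (p - 1) * M" and \<beta> = "\<lambda>_. B powr p"
            and ?A1.0 = "p * B powr (p - 1) * M" and ?A2.0 = "B powr p"])
         (use \<psi>i \<psi>L \<psi>B p M1 B1 in auto)
    moreover have "v t = (\<lambda>x. heat t u0 x + Du a \<psi> t x)" using t by (simp add: v_def Du\<psi> fun_eq_iff)
    ultimately show ?thesis using isCont_heat[OF t u0] by simp
  qed
  have vB: "\<bar>v t x\<bar> \<le> B" if t: "0 < t" for t x
    by (rule isCont_AE_le_imp_le[OF _ vBae[OF t]]) (use cont[OF t] in \<open>auto intro!: continuous_intros\<close>)
  have "v t x = heat t u0 x + Du a (\<lambda>s y. fnl p (v s y)) t x" if t: "0 < t" for t x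
  proof -
    have "Du a \<psi> t = Du a (\<lambda>s y. fnl p (v s y)) t"
      by (rule Du_cong) (use vB in \<open>auto simp: \<psi>_def trid\<close>)
    then show ?thesis using t by (simp add: v_def Du\<psi>)
  qed
  then have "mild_solution a p u0 v B M"
    by (intro mild_solution.intro p u0 vj B1 M1 vB vi vM)
  then show ?thesis using that veq by blast
qed

subsection \<open>Energy decay\<close>

text \<open>The mollifier passes under the time integral and is joined with the kernel, so that the
  combined smoothing of the two can be used, as in \<open>conv_dgauss_dgauss_L1\<close>.\<close>

lemma conv_Du:
  fixes m :: "'a::euclidean_space \<Rightarrow> real"
  assumes j: "jmeas \<phi>" and t: "0 < t" and [measurable]: "m \<in> borel_measurable borel" and m: "\<And>x. \<bar>m x\<bar> \<le> Bm"
    and \<phi>: "\<And>s. 0 < s \<Longrightarrow> s < t \<Longrightarrow> integrable lborel (\<phi> s)"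
    and \<alpha>: "\<And>s. 0 < s \<Longrightarrow> s < t \<Longrightarrow> (\<integral>x. \<bar>\<phi> s x\<bar> \<partial>lborel) \<le> \<alpha>"
  shows "conv m (Du a \<phi> t) x = (\<integral>s. indicator {0<..<t} s * conv (conv m (dgauss a (t - s))) (\<phi> s) x \<partial>lborel)"
proof -
  note borel_measurable_conv_param[OF j, measurable (raw)]
  let ?K = "\<lambda>s. conv (dgauss a (t - s)) (\<phi> s)"
  let ?G = "\<lambda>s y. m (x - y) * (indicator {0<..<t} s * ?K s y)"
  have jG: "jmeas ?G" by measurable
  have Bm: "0 \<le> Bm" using m[of 0] by simp
  have bG: "AE s in lborel. integrable lborel (?G s) \<and> (\<integral>y. \<bar>?G s y\<bar> \<partial>lborel)
     \<le> Bm * (kap a * \<alpha>) * (indicator {0<..<t} s * (t - s) powr (- (1 / 2)))"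
  proof (intro AE_I2)
    fix s
    show "integrable lborel (?G s) \<and> (\<integral>y. \<bar>?G s y\<bar> \<partial>lborel)
     \<le> Bm * (kap a * \<alpha>) * (indicator {0<..<t} s * (t - s) powr (- (1 / 2)))"
    proof (cases "0 < s \<and> s < t")
      case True
      then have i: "integrable lborel (?K s)" by (intro integrable_conv integrable_dgauss \<phi>) auto
      have ci: "integrable lborel (\<lambda>y. m (x - y) * ?K s y)"
        by (rule conv_integrand_bounded_kernel[OF _ m i]) simp
      have "(\<integral>y. \<bar>m (x - y) * ?K s y\<bar> \<partial>lborel) \<le> (\<integral>y. Bm * \<bar>?K s y\<bar> \<partial>lborel)"
        by (rule integral_mono[OF integrable_abs[OF ci]]) (use i m in \<open>auto simp: abs_mult intro!: mult_right_mono\<close>)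
      also have "\<dots> = Bm * (\<integral>y. \<bar>?K s y\<bar> \<partial>lborel)" by simp
      also have "\<dots> \<le> Bm * (kap a * (t - s) powr (- 1 / 2) * \<alpha>)"
        using True Bm by (intro mult_left_mono order_trans[OF conv_dgauss_L1] \<phi> \<alpha>) auto
      finally show ?thesis using True ci by (simp add: mult_ac)
    qed auto
  qed
  have iG: "integrable lborel (\<lambda>s. Bm * (kap a * \<alpha>) * (indicator {0<..<t} s * (t - s) powr (- (1 / 2))))"
    using has_bochner_integral_powr_reflect[OF t, of "1/2"] by (auto simp: has_bochner_integral_iff)
  have "conv m (Du a \<phi> t) x = (\<integral>y. (\<integral>s. ?G s y \<partial>lborel) \<partial>lborel)"
    by (simp add: conv_def[of m] Du_def)
  also have "\<dots> = (\<integral>s. (\<integral>y. ?G s y \<partial>lborel) \<partial>lborel)" by (rule fubini_swap[OF jG bG iG])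
  also have "\<dots> = (\<integral>s. indicator {0<..<t} s * conv (conv m (dgauss a (t - s))) (\<phi> s) x \<partial>lborel)"
  proof (rule Bochner_Integration.integral_cong[OF refl])
    fix s
    show "(\<integral>y. ?G s y \<partial>lborel) = indicator {0<..<t} s * conv (conv m (dgauss a (t - s))) (\<phi> s) x"
    proof (cases "0 < s \<and> s < t")
      case True
      then have "conv m (?K s) = conv (conv m (dgauss a (t - s))) (\<phi> s)"
        by (intro conv_assoc[OF _ m] integrable_dgauss \<phi>) auto
      then show ?thesis using True by (simp add: conv_def[of m "?K s", symmetric])
    qed auto
  qed
  finally show ?thesis .
qed

lemma has_bochner_integral_powr_shift:
  fixes t h b :: real
  assumes h: "0 < h" and b: "b < 1"
  shows "has_bochner_integral lborel (\<lambda>s. indicator {t<..<t + h} s * (t + h - s) powr (- b)) (h powr (1 - b) / (1 - b))"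
proof -
  have "(\<lambda>s. indicator {t<..<t + h} (t + 1 * s) * (t + h - (t + 1 * s)) powr (- b)) = (\<lambda>s. indicator {0<..<h} s * (h - s) powr (- b))"
    by (auto simp: indicator_def fun_eq_iff)
  then show ?thesis
    using lborel_has_bochner_integral_real_affine_iff[of "1" "\<lambda>s. indicator {t<..<t + h} s * (t + h - s) powr (- b)" _ t]
      has_bochner_integral_powr_reflect[OF assms] by simp
qed

section \<open>Contraction properties and energy of the heat flow\<close>

lemma heat_sup_L1:
  fixes w :: "'a::euclidean_space \<Rightarrow> real"
  assumes h: "0 < h" and w: "integrable lborel w"
  shows "\<bar>heat h w x\<bar> \<le> h powr (- real DIM('a) / 2) * (\<integral>x. \<bar>w x\<bar> \<partial>lborel)"
  unfolding heat_eq_conv by (rule conv_sup_kernel[OF _ _ w]) (use gauss_le[OF h] in auto)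

lemma heat_sup:
  fixes w :: "'a::euclidean_space \<Rightarrow> real"
  assumes h: "0 < h" and w: "w \<in> borel_measurable borel" and b: "\<And>x. \<bar>w x\<bar> \<le> B"
  shows "\<bar>heat h w x\<bar> \<le> B"
  using conv_sup_fun[OF w b integrable_gauss[OF h]] integral_gauss[OF h, where 'a='a] by (simp add: heat_eq_conv)

lemma
  fixes w :: "'a::euclidean_space \<Rightarrow> real"
  assumes h: "0 < h" and w: "integrable lborel w"
  shows integrable_heat: "integrable lborel (heat h w)"
    and heat_L1: "(\<integral>x. \<bar>heat h w x\<bar> \<partial>lborel) \<le> (\<integral>x. \<bar>w x\<bar> \<partial>lborel)"
  using integrable_conv[OF integrable_gauss[OF h] w] conv_L1[OF integrable_gauss[OF h] w] integral_gauss[OF h, where 'a='a]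
  by (simp_all add: heat_eq_conv)

lemma heat_heat:
  fixes w :: "'a::euclidean_space \<Rightarrow> real"
  assumes h: "0 < h" and k: "0 < k" and w: "integrable lborel w"
  shows "heat h (heat k w) = heat (h + k) w"
  unfolding heat_eq_conv
  using conv_assoc[OF _ _ integrable_gauss[OF k] w, of "gauss h" "h powr (- real DIM('a) / 2)"] gauss_le[OF h, where 'a='a]
  by (simp add: conv_gauss_gauss[OF h k])

lemma conv_dgauss_heat:
  assumes h: "0 < h" and k: "0 < k" and w: "integrable lborel w"
  shows "conv (dgauss a h) (heat k w) = conv (dgauss a (h + k)) w"
  unfolding heat_eq_conv
  using conv_assoc[OF _ dgauss_sup[OF h, of a] integrable_gauss[OF k] w]
  by (simp add: conv_dgauss_gauss[OF h k])

lemma integrable_mult_bounded: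
  fixes f g :: "'a::euclidean_space \<Rightarrow> real"
  assumes f: "integrable lborel f" and [measurable]: "g \<in> borel_measurable borel" and g: "\<And>x. \<bar>g x\<bar> \<le> B"
  shows "integrable lborel (\<lambda>x. g x * f x)"
proof -
  note borel_measurable_integrable_lborel[OF f, measurable]
  show ?thesis
    by (rule Bochner_Integration.integrable_bound[of _ "\<lambda>x. B * f x"])
       (use f g in \<open>auto simp: abs_mult intro!: mult_right_mono order_trans[OF g abs_ge_self]\<close>)
qed

lemma integral_mult_bounded:
  fixes f g :: "'a::euclidean_space \<Rightarrow> real"
  assumes f: "integrable lborel f" and [measurable]: "g \<in> borel_measurable borel" and g: "\<And>x. \<bar>g x\<bar> \<le> B"
  shows "\<bar>\<integral>x. g x * f x \<partial>lborel\<bar> \<le> B * (\<integral>x. \<bar>f x\<bar> \<partial>lborel)"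
proof -
  have "\<bar>\<integral>x. g x * f x \<partial>lborel\<bar> \<le> (\<integral>x. B * \<bar>f x\<bar> \<partial>lborel)"
    by (rule integral_abs_bound_integral[OF integrable_mult_bounded[OF assms]])
       (use f g in \<open>auto simp: abs_mult intro!: mult_right_mono\<close>)
  then show ?thesis by simp
qed

text \<open>The heat semigroup is self-adjoint, so one of the two factors e^(h Delta) can be moved
  to the other side.\<close>

lemma heat_energy_dual:
  fixes w :: "'a::euclidean_space \<Rightarrow> real"
  assumes h: "0 < h" and w: "integrable lborel w" and b: "\<And>x. \<bar>w x\<bar> \<le> B"
  shows "(\<integral>x. (heat h w x)\<^sup>2 \<partial>lborel) = (\<integral>x. heat (2 * h) w x * w x \<partial>lborel)"
proof -
  note borel_measurable_integrable_lborel[OF w, measurable]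
  have "(\<integral>x. heat h w x * conv (gauss h) w x \<partial>lborel) = (\<integral>y. conv (\<lambda>z. gauss h (- z)) (heat h w) y * w y \<partial>lborel)"
    by (rule conv_dual[OF integrable_gauss[OF h] w _ heat_sup[OF h _ b]]) (auto simp: heat_eq_conv)
  then show ?thesis using heat_heat[OF h h w]
    by (simp add: heat_eq_conv[symmetric] power2_eq_square)
qed

text \<open>By duality the energy at the middle time is the inner product of the end points w and
  e^(2h Delta) w; then 2xy <= x^2 + y^2 is integrated.\<close>

lemma heat_energy_midpoint:
  fixes w :: "'a::euclidean_space \<Rightarrow> real"
  assumes h: "0 < h" and w: "integrable lborel w" and b: "\<And>x. \<bar>w x\<bar> \<le> B"
  shows "2 * (\<integral>x. (heat h w x)\<^sup>2 \<partial>lborel) \<le> (\<integral>x. (w x)\<^sup>2 \<partial>lborel) + (\<integral>x. (heat (2 * h) w x)\<^sup>2 \<partial>lborel)"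
proof -
  have h2: "0 < 2 * h" using h by simp
  note borel_measurable_integrable_lborel[OF w, measurable]
  have hw: "integrable lborel (heat (2 * h) w)" by (rule integrable_heat[OF h2 w])
  note borel_measurable_integrable_lborel[OF hw, measurable]
  have i1: "integrable lborel (\<lambda>x. (w x)\<^sup>2)" unfolding power2_eq_square by (rule integrable_mult_bounded[OF w _ b]) simp
  have i2: "integrable lborel (\<lambda>x. (heat (2 * h) w x)\<^sup>2)" unfolding power2_eq_square
    by (rule integrable_mult_bounded[OF hw _ heat_sup[OF h2 _ b]]) auto
  have i3: "integrable lborel (\<lambda>x. heat (2 * h) w x * w x)"
    by (rule integrable_mult_bounded[OF w _ heat_sup[OF h2 _ b]]) auto
  have "2 * (\<integral>x. (heat h w x)\<^sup>2 \<partial>lborel) = (\<integral>x. 2 * (heat (2 * h) w x * w x) \<partial>lborel)"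
    by (simp add: heat_energy_dual[OF assms])
  also have "\<dots> \<le> (\<integral>x. (w x)\<^sup>2 + (heat (2 * h) w x)\<^sup>2 \<partial>lborel)"
  proof (rule integral_mono)
    show "2 * (heat (2 * h) w x * w x) \<le> (w x)\<^sup>2 + (heat (2 * h) w x)\<^sup>2" for x
      using sum_squares_bound[of "w x" "heat (2 * h) w x"] by (simp add: mult_ac)
  qed (use i1 i2 i3 in auto)
  also have "\<dots> = (\<integral>x. (w x)\<^sup>2 \<partial>lborel) + (\<integral>x. (heat (2 * h) w x)\<^sup>2 \<partial>lborel)" using i1 i2 by simp
  finally show ?thesis .
qed

text \<open>Midpoint convexity of the energy along the heat flow replaces the Nash inequality.\<close>

lemma heat_energy_drop:
  fixes w :: "'a::euclidean_space \<Rightarrow> real"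
  assumes h: "0 < h" and w: "integrable lborel w" and b: "\<And>x. \<bar>w x\<bar> \<le> B"
  shows "(\<integral>x. (heat (h / 2 ^ k) w x)\<^sup>2 \<partial>lborel)
    \<le> (\<integral>x. (w x)\<^sup>2 \<partial>lborel) - ((\<integral>x. (w x)\<^sup>2 \<partial>lborel) - (\<integral>x. (heat h w x)\<^sup>2 \<partial>lborel)) / 2 ^ k"
proof (induction k)
  case (Suc k)
  have "2 * (\<integral>x. (heat (h / 2 ^ Suc k) w x)\<^sup>2 \<partial>lborel) \<le> (\<integral>x. (w x)\<^sup>2 \<partial>lborel) + (\<integral>x. (heat (2 * (h / 2 ^ Suc k)) w x)\<^sup>2 \<partial>lborel)"
    by (rule heat_energy_midpoint[OF _ w b]) (use h in simp)
  also have "2 * (h / 2 ^ Suc k) = h / 2 ^ k" by simp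
  finally have "2 * (\<integral>x. (heat (h / 2 ^ Suc k) w x)\<^sup>2 \<partial>lborel) \<le> (\<integral>x. (w x)\<^sup>2 \<partial>lborel) + (\<integral>x. (heat (h / 2 ^ k) w x)\<^sup>2 \<partial>lborel)" .
  moreover have "((\<integral>x. (w x)\<^sup>2 \<partial>lborel) - (\<integral>x. (heat h w x)\<^sup>2 \<partial>lborel)) / 2 ^ Suc k
     = ((\<integral>x. (w x)\<^sup>2 \<partial>lborel) - (\<integral>x. (heat h w x)\<^sup>2 \<partial>lborel)) / 2 ^ k / 2" by simp
  moreover have "X \<le> W - d / 2" if "2 * X \<le> W + Y" "Y \<le> W - d" for X Y W d :: real using that by simp
  ultimately show ?case using Suc by metis
qed simp

lemma heat_energy_le:
  fixes w :: "'a::euclidean_space \<Rightarrow> real"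
  assumes h: "0 < h" and w: "integrable lborel w" and M: "(\<integral>x. \<bar>w x\<bar> \<partial>lborel) \<le> M"
  shows "(\<integral>x. (heat h w x)\<^sup>2 \<partial>lborel) \<le> h powr (- real DIM('a) / 2) * M\<^sup>2"
proof -
  have i: "integrable lborel (heat h w)" by (rule integrable_heat[OF h w])
  have M0: "0 \<le> M" using M by (smt (verit) integral_nonneg_AE AE_I2 abs_ge_zero)
  have s: "\<bar>heat h w x\<bar> \<le> h powr (- real DIM('a) / 2) * M" for x
    by (rule order_trans[OF heat_sup_L1[OF h w]]) (simp add: M mult_left_mono)
  have "\<bar>\<integral>x. heat h w x * heat h w x \<partial>lborel\<bar> \<le> h powr (- real DIM('a) / 2) * M * (\<integral>x. \<bar>heat h w x\<bar> \<partial>lborel)"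
    by (rule integral_mult_bounded[OF i borel_measurable_integrable_lborel[OF i] s])
  also have "\<dots> \<le> h powr (- real DIM('a) / 2) * M * M"
    using M0 by (intro mult_left_mono order_trans[OF heat_L1[OF h w] M]) auto
  finally show ?thesis by (simp add: power2_eq_square)
qed

text \<open>The flux \<open>a \<cdot> \<nabla>f(W)\<close> is a total derivative and hence does no work on \<open>W\<close>.\<close>

lemma heat_flux_orthogonal:
  fixes a :: "'a::euclidean_space" and w :: "'a \<Rightarrow> real"
  assumes p: "1 < p" and h: "0 < h" and w: "integrable lborel w" and b: "\<And>x. \<bar>w x\<bar> \<le> B"
  shows "(\<integral>x. fnl p (heat h w x) * conv (dgauss a h) w x \<partial>lborel) = 0"
proof -
  note borel_measurable_integrable_lborel[OF w, measurable]
  define W where "W = heat h w"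
  define W' where "W' = conv (dgauss a h) w"
  have Wi: "integrable lborel W" unfolding W_def by (rule integrable_heat[OF h w])
  have Wi': "integrable lborel W'" unfolding W'_def by (intro integrable_conv integrable_dgauss h w)
  note borel_measurable_integrable_lborel[OF Wi, measurable] borel_measurable_integrable_lborel[OF Wi', measurable]
  have WB: "\<bar>W x\<bar> \<le> B" for x unfolding W_def by (rule heat_sup[OF h _ b]) simp
  \<comment> \<open>An antiderivative of \<open>fnl p\<close>. Its composition with \<open>W\<close>
    is integrable because \<open>W\<close> is both bounded and integrable.\<close>
  define F where "F = (\<lambda>r::real. \<bar>r\<bar> powr (p + 1) / (p + 1))"
  have dF: "(F has_real_derivative fnl p r) (at r)" for r
  proof -
    have "((\<lambda>r. r * fnl p r) has_real_derivative (r * (p * \<bar>r\<bar> powr (p - 1)) + 1 * fnl p r)) (at r)"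
      using has_real_derivative_fnl[OF p] by (auto intro!: derivative_eq_intros)
    also have "r * (p * \<bar>r\<bar> powr (p - 1)) + 1 * fnl p r = (p + 1) * fnl p r"
      by (simp add: fnl_def algebra_simps)
    finally have "((\<lambda>r. r * fnl p r / (p + 1)) has_real_derivative ((p + 1) * fnl p r / (p + 1))) (at r)"
      by (rule DERIV_cdivide)
    moreover have "(\<lambda>r. r * fnl p r / (p + 1)) = F"
    proof
      fix r
      have "r * fnl p r = \<bar>r\<bar> * \<bar>fnl p r\<bar>" by (simp add: fnl_def abs_mult)
      also have "\<dots> = \<bar>r\<bar> powr 1 * \<bar>r\<bar> powr p" unfolding abs_fnl by simp
      also have "\<dots> = \<bar>r\<bar> powr (p + 1)" unfolding powr_add[symmetric] by (simp add: add.commute)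
      finally show "r * fnl p r / (p + 1) = F r" by (simp add: F_def)
    qed
    ultimately show ?thesis using p by simp
  qed
  have Fb: "\<bar>fnl p (W x)\<bar> \<le> B powr p" for x
    unfolding abs_fnl using WB p by (intro powr_mono2) auto
  have FWi: "integrable lborel (\<lambda>x. F (W x))"
  proof (rule Bochner_Integration.integrable_bound[of _ "\<lambda>x. B powr p * W x"])
    show "AE x in lborel. norm (F (W x)) \<le> norm (B powr p * W x)"
    proof (intro AE_I2)
      fix x
      have "norm (F (W x)) = \<bar>W x\<bar> powr p * \<bar>W x\<bar> / (p + 1)"
        using p by (cases "W x = 0") (auto simp: F_def powr_add)
      also have "\<dots> \<le> \<bar>W x\<bar> powr p * \<bar>W x\<bar> / 1" using p by (intro divide_left_mono) auto
      also have "\<dots> \<le> B powr p * \<bar>W x\<bar>" using Fb[of x] by (auto simp: abs_fnl intro!: mult_right_mono)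
      finally show "norm (F (W x)) \<le> norm (B powr p * W x)" by (simp add: abs_mult)
    qed
  qed (use Wi in \<open>auto simp: F_def\<close>)
  let ?I = "\<integral>x. fnl p (W x) * W' x \<partial>lborel"
  \<comment> \<open>Averaging over the shifts by r a with r in [0, 1] does not change the integral.
    For fixed x the integral over r is F(W(x + a)) - F(W(x)), whose integral over x is 0 by
    translation invariance; this replaces an integration by parts.\<close>
  let ?G = "\<lambda>r x. indicator {0..1::real} r * (fnl p (W (x - r *\<^sub>R (- a))) * W' (x - r *\<^sub>R (- a)))"
  have gi: "integrable lborel (\<lambda>x. fnl p (W x) * W' x)"
    by (rule integrable_mult_bounded[OF Wi' _ Fb]) simp
  have jG: "jmeas ?G" by measurable
  have bG: "AE r in lborel. integrable lborel (?G r) \<and> (\<integral>x. \<bar>?G r x\<bar> \<partial>lborel) \<le> indicator {0..1} r * (\<integral>x. \<bar>fnl p (W x) * W' x\<bar> \<partial>lborel)"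
  proof (intro AE_I2 conjI)
    fix r :: real
    show "integrable lborel (?G r)" using integrable_lborel_shift[OF gi, of "r *\<^sub>R (- a)"] by simp
    show "(\<integral>x. \<bar>?G r x\<bar> \<partial>lborel) \<le> indicator {0..1} r * (\<integral>x. \<bar>fnl p (W x) * W' x\<bar> \<partial>lborel)"
      using integral_lborel_shift[of "\<lambda>x. \<bar>fnl p (W x) * W' x\<bar>" "r *\<^sub>R (- a)"] by (simp add: abs_mult[of "indicator _ _"])
  qed
  have iG: "integrable lborel (\<lambda>r. indicator {0..1::real} r * (\<integral>x. \<bar>fnl p (W x) * W' x\<bar> \<partial>lborel))" by simp
  have cW: "isCont W x" "isCont W' x" for x unfolding W_def W'_def by (rule isCont_heat[OF h w] isCont_conv_dgauss[OF h w])+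
  have eq: "(\<integral>r. ?G r x \<partial>lborel) = F (W (x + a)) - F (W x)" for x
  proof -
    have "(\<integral>r. indicator {0..1::real} r *\<^sub>R (fnl p (W (x + r *\<^sub>R a)) * W' (x + r *\<^sub>R a)) \<partial>lborel)
      = F (W (x + 1 *\<^sub>R a)) - F (W (x + 0 *\<^sub>R a))"
    proof (rule integral_FTC_atLeastAtMost)
      fix r :: real
      have "((\<lambda>r. W (x + r *\<^sub>R a)) has_derivative (\<lambda>s. conv (dgauss (s *\<^sub>R a) h) w (x + r *\<^sub>R a))) (at r within {0..1})"
        unfolding W_def by (rule has_derivative_compose[OF _ has_derivative_heat[OF h w]]) (auto intro!: derivative_eq_intros)
      moreover have "conv (dgauss (s *\<^sub>R a) h) w y = s * W' y" for s y
      proof -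
        have "dgauss (s *\<^sub>R a) h z = s * dgauss a h z" for z by (simp add: dgauss_def)
        then show ?thesis unfolding W'_def conv_def by (simp add: mult.assoc)
      qed
      ultimately have "((\<lambda>r. W (x + r *\<^sub>R a)) has_field_derivative W' (x + r *\<^sub>R a)) (at r within {0..1})"
        by (simp add: has_field_derivative_def mult_commute_abs)
      from DERIV_chain2[OF dF this]
      show "((\<lambda>r. F (W (x + r *\<^sub>R a))) has_vector_derivative fnl p (W (x + r *\<^sub>R a)) * W' (x + r *\<^sub>R a)) (at r within {0..1})"
        by (simp add: has_real_derivative_iff_has_vector_derivative)
    next
      have cf: "isCont (fnl p) r" for r by (rule DERIV_isCont[OF has_real_derivative_fnl[OF p]])
      show "continuous_on {0..1} (\<lambda>r. fnl p (W (x + r *\<^sub>R a)) * W' (x + r *\<^sub>R a))"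
      proof (intro continuous_at_imp_continuous_on ballI)
        fix r :: real
        have c1: "isCont (\<lambda>r. x + r *\<^sub>R a) r" by (intro continuous_intros)
        show "isCont (\<lambda>r. fnl p (W (x + r *\<^sub>R a)) * W' (x + r *\<^sub>R a)) r"
          using isCont_o2[OF isCont_o2[OF c1 cW(1)] cf] isCont_o2[OF c1 cW(2)] by (intro continuous_mult) auto
      qed
    qed simp
    then show ?thesis by simp
  qed
  have "(\<integral>x. (\<integral>r. ?G r x \<partial>lborel) \<partial>lborel) = (\<integral>r. (\<integral>x. ?G r x \<partial>lborel) \<partial>lborel)"
    by (rule fubini_swap[OF jG bG iG])
  also have "(\<integral>r. (\<integral>x. ?G r x \<partial>lborel) \<partial>lborel) = (\<integral>r. indicator {0..1::real} r * ?I \<partial>lborel)"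
    using integral_lborel_shift[of "\<lambda>x. fnl p (W x) * W' x" "_ *\<^sub>R (- a)"] by simp
  also have "\<dots> = ?I" by simp
  also have "(\<integral>x. (\<integral>r. ?G r x \<partial>lborel) \<partial>lborel) = (\<integral>x. F (W (x - (- a))) \<partial>lborel) - (\<integral>x. F (W x) \<partial>lborel)"
    unfolding eq using integrable_lborel_shift[OF FWi, of "- a"] FWi by simp
  also have "\<dots> = 0" using integral_lborel_shift[of "\<lambda>x. F (W x)" "- a"] by (simp add: F_def)
  finally show ?thesis by (simp add: W_def W'_def)
qed

text \<open>If \<open>f\<close> is not integrable, its Bochner integral is 0 while that of the
  majorant is nonnegative; so integrability has to be checked for \<open>k\<close> alone.\<close>

lemma abs_integral_le:
  fixes f k :: "'b \<Rightarrow> real"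
  assumes k: "integrable N k" and b: "\<And>x. \<bar>f x\<bar> \<le> k x"
  shows "\<bar>\<integral>x. f x \<partial>N\<bar> \<le> (\<integral>x. k x \<partial>N)"
proof (cases "integrable N f")
  case True
  have "\<bar>\<integral>x. f x \<partial>N\<bar> \<le> (\<integral>x. \<bar>f x\<bar> \<partial>N)" using integral_norm_bound[of N f] by simp
  also have "\<dots> \<le> (\<integral>x. k x \<partial>N)" by (rule integral_mono) (use True k b in auto)
  finally show ?thesis .
next
  case False
  have "0 \<le> (\<integral>x. k x \<partial>N)" by (rule integral_nonneg_AE) (use b order_trans[OF abs_ge_zero b] in auto)
  then show ?thesis using False by (simp add: not_integrable_integral_eq)
qed

section \<open>Hoelder regularity of the mild solution and the energy inequality over one time
  step\<close>

context mild_solution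
begin

abbreviation F :: "real \<Rightarrow> 'a \<Rightarrow> real" where "F \<equiv> \<lambda>s y. fnl p (v s y)"

text \<open>One constant that dominates both the L1 norm and the supremum of the flux.\<close>

definition CF :: real where "CF = p * B powr (p - 1) * M + B powr p"

lemma CF0: "0 \<le> CF" using p1 M1 by (simp add: CF_def)

lemma vm: "v t \<in> borel_measurable borel"
  using jmeas_compose[OF vj, of "\<lambda>_. t" borel "\<lambda>x. x"] by simp

lemma Fj: "jmeas F"
proof -
  note jmeas_compose[OF vj, measurable (raw)]
  show ?thesis by measurable
qed

lemma Fm [measurable]: "F s \<in> borel_measurable borel"
  using vm[of s] by measurable

lemma F_lipschitz: "0 < t \<Longrightarrow> \<bar>F t x\<bar> \<le> p * B powr (p - 1) * \<bar>v t x\<bar>"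
  using fnl_lipschitz[OF p1 vB[of t x], of 0] B1 by (simp add: fnl_def)

lemma Fi: "0 < t \<Longrightarrow> integrable lborel (F t)"
  by (rule Bochner_Integration.integrable_bound[of _ "\<lambda>x. p * B powr (p - 1) * v t x"])
     (use vi p1 F_lipschitz in \<open>auto simp: abs_mult\<close>)

lemma FL: 
  assumes t: "0 < t" shows "(\<integral>x. \<bar>F t x\<bar> \<partial>lborel) \<le> CF"
proof -
  have "(\<integral>x. \<bar>F t x\<bar> \<partial>lborel) \<le> (\<integral>x. p * B powr (p - 1) * \<bar>v t x\<bar> \<partial>lborel)"
    by (rule integral_mono) (use Fi[OF t] vi[OF t] F_lipschitz[OF t] in auto)
  also have "\<dots> \<le> p * B powr (p - 1) * M" using vM[OF t] p1 by (auto intro!: mult_left_mono)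
  finally show ?thesis unfolding CF_def by (simp add: add_increasing2)
qed

lemma FB: "0 < t \<Longrightarrow> \<bar>F t x\<bar> \<le> CF"
proof -
  assume t: "0 < t"
  have "\<bar>F t x\<bar> \<le> B powr p" unfolding abs_fnl using vB[OF t] p1 by (intro powr_mono2) auto
  then show ?thesis unfolding CF_def using p1 M1 by (simp add: add_increasing)
qed

lemma eqn_fun: "0 < t \<Longrightarrow> v t = (\<lambda>x. heat t u0 x + Du a F t x)"
  using eqn by blast

lemma Du_eq: "0 < t \<Longrightarrow> Du a F t = (\<lambda>x. v t x - heat t u0 x)"
  using eqn by (auto simp: fun_eq_iff)

lemma Du_i: "0 < t \<Longrightarrow> integrable lborel (Du a F t)"
  by (simp add: Du_eq vi integrable_heat u0)

lemma conv_v: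
  assumes t: "0 < t" and m: "m \<in> borel_measurable borel" "\<And>x. \<bar>m x\<bar> \<le> Bm"
  shows "conv m (v t) x = conv m (heat t u0) x + (\<integral>s. indicator {0<..<t} s * conv (conv m (dgauss a (t - s))) (F s) x \<partial>lborel)"
proof -
  have "conv m (v t) x = conv m (heat t u0) x + conv m (Du a F t) x"
    using conv_diff[OF m Du_i[OF t], of "\<lambda>x. - heat t u0 x" x] integrable_heat[OF t u0]
    by (simp add: eqn_fun[OF t] conv_def add.commute)
  also have "conv m (Du a F t) x = (\<integral>s. indicator {0<..<t} s * conv (conv m (dgauss a (t - s))) (F s) x \<partial>lborel)"
    by (rule conv_Du[OF Fj t m]) (use Fi FL in auto)
  finally show ?thesis .
qed

lemma Du_F_integrable:
  assumes t: "0 < t"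
  shows "integrable lborel (\<lambda>s. indicator {0<..<t} s * conv (dgauss a (t - s)) (F s) x)"
  by (rule Du_integrable_split[OF Fj t, where b = 0 and l = 0 and \<alpha> = "\<lambda>_. CF" and \<beta> = "\<lambda>_. CF"
            and ?A1.0 = CF and ?A2.0 = CF]) (use Fi FL FB CF0 in auto)

definition Rem :: "real \<Rightarrow> real \<Rightarrow> 'a \<Rightarrow> real" where
  "Rem t h x = (\<integral>s. indicator {t<..<t + h} s * conv (dgauss a (t + h - s)) (F s) x \<partial>lborel)"

text \<open>Applying the heat flow for time h to Duhamel's formula at t turns the kernel time t - s
  into t + h - s. What is then missing from v(t + h) is the flux emitted after t, which is
  \<open>Rem\<close>.\<close>

lemma
  assumes t: "0 < t" and h: "0 < h"
  shows heat_v: "heat h (v t) x = heat (t + h) u0 x + (\<integral>s. indicator {0<..<t} s * conv (dgauss a (t + h - s)) (F s) x \<partial>lborel)"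
    and heat_v_integrable: "integrable lborel (\<lambda>s. indicator {0<..<t} s * conv (dgauss a (t + h - s)) (F s) x)"
    and restart: "v (t + h) x = heat h (v t) x + Rem t h x"
proof -
  have th: "0 < t + h" using t h by simp
  have gb: "\<bar>gauss h x\<bar> \<le> h powr (- real DIM('a) / 2)" for x :: 'a using gauss_le[OF h] by simp
  have "heat h (v t) x = conv (gauss h) (heat t u0) x + (\<integral>s. indicator {0<..<t} s * conv (conv (gauss h) (dgauss a (t - s))) (F s) x \<partial>lborel)"
    unfolding heat_eq_conv[of h] by (rule conv_v[OF t _ gb]) simp
  also have "conv (gauss h) (heat t u0) x = heat (t + h) u0 x"
    using heat_heat[OF h t u0] by (simp add: heat_eq_conv[of h] add.commute)
  also have "(\<integral>s. indicator {0<..<t} s * conv (conv (gauss h) (dgauss a (t - s))) (F s) x \<partial>lborel)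
      = (\<integral>s. indicator {0<..<t} s * conv (dgauss a (t + h - s)) (F s) x \<partial>lborel)"
  proof (rule Bochner_Integration.integral_cong[OF refl])
    fix s
    show "indicator {0<..<t} s * conv (conv (gauss h) (dgauss a (t - s))) (F s) x = indicator {0<..<t} s * conv (dgauss a (t + h - s)) (F s) x"
      using conv_gauss_dgauss[OF h, of "t - s" a] by (auto simp: indicator_def algebra_simps)
  qed
  finally show 1: "heat h (v t) x = heat (t + h) u0 x + (\<integral>s. indicator {0<..<t} s * conv (dgauss a (t + h - s)) (F s) x \<partial>lborel)" .
  let ?k = "\<lambda>s. conv (dgauss a (t + h - s)) (F s) x"
  have "set_integrable lborel {0<..<t + h} ?k"
    using Du_F_integrable[OF th] by (simp add: set_integrable_def)
  then have i: "set_integrable lborel {0<..<t} ?k" "set_integrable lborel {t<..<t + h} ?k"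
    using t h by (auto elim!: set_integrable_subset)
  show "integrable lborel (\<lambda>s. indicator {0<..<t} s * ?k s)" using i(1) by (simp add: set_integrable_def)
  have "Du a F (t + h) x = (\<integral>s. (indicator {0<..<t} s * ?k s) + (indicator {t<..<t + h} s * ?k s) \<partial>lborel)"
    unfolding Du_def
    by (rule integral_discrete_difference[of "{t}"]) (use t h in \<open>auto simp: indicator_def\<close>)
  also have "\<dots> = (\<integral>s. (indicator {0<..<t} s * ?k s) \<partial>lborel) + Rem t h x"
    unfolding Rem_def using i by (intro Bochner_Integration.integral_add) (auto simp: set_integrable_def)
  finally show "v (t + h) x = heat h (v t) x + Rem t h x" using eqn[OF th] 1 by simp
qed

text \<open>In the dual form the derivative falls on the test function, whose regularity is then
  available. The minus sign appears because the differentiated kernel is odd.\<close>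

lemma
  assumes t: "0 < t" and h: "0 < h"
  shows Rem_L1: "(\<integral>x. \<bar>Rem t h x\<bar> \<partial>lborel) \<le> 2 * kap a * CF * h powr (1 / 2)"
    and Rem_dual: "g \<in> borel_measurable borel \<Longrightarrow> (\<And>x. \<bar>g x\<bar> \<le> D) \<Longrightarrow>
       (\<integral>x. g x * Rem t h x \<partial>lborel) = - (\<integral>s. indicator {t<..<t + h} s * (\<integral>x. conv (dgauss a (t + h - s)) g x * F s x \<partial>lborel) \<partial>lborel)"
proof -
  note borel_measurable_conv_param[OF Fj, measurable (raw)]
  let ?G = "\<lambda>s x. indicator {t<..<t + h} s * conv (dgauss a (t + h - s)) (F s) x"
  have jG: "jmeas ?G" by measurable
  have pos: "0 < s" "0 < t + h - s" if "t < s" "s < t + h" for s using that t by auto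
  have bG: "AE s in lborel. integrable lborel (?G s) \<and> (\<integral>x. \<bar>?G s x\<bar> \<partial>lborel) \<le> kap a * CF * (indicator {t<..<t + h} s * (t + h - s) powr (- (1 / 2)))"
  proof (intro AE_I2)
    fix s
    show "integrable lborel (?G s) \<and> (\<integral>x. \<bar>?G s x\<bar> \<partial>lborel) \<le> kap a * CF * (indicator {t<..<t + h} s * (t + h - s) powr (- (1 / 2)))"
    proof (cases "t < s \<and> s < t + h")
      case True
      then have i: "integrable lborel (conv (dgauss a (t + h - s)) (F s))" 
        using pos by (intro integrable_conv integrable_dgauss Fi) auto
      have "(\<integral>x. \<bar>conv (dgauss a (t + h - s)) (F s) x\<bar> \<partial>lborel) \<le> kap a * (t + h - s) powr (- 1 / 2) * (\<integral>x. \<bar>F s x\<bar> \<partial>lborel)"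
        using True pos by (intro conv_dgauss_L1 Fi) auto
      also have "\<dots> \<le> kap a * (t + h - s) powr (- 1 / 2) * CF"
        using True pos by (intro mult_left_mono FL) auto
      finally show ?thesis using i True by (simp add: mult_ac)
    qed auto
  qed
  have hb: "has_bochner_integral lborel (\<lambda>s. indicator {t<..<t + h} s * (t + h - s) powr (- (1 / 2))) (h powr (1 - 1 / 2) / (1 - 1 / 2))"
    by (rule has_bochner_integral_powr_shift[OF h]) simp
  have iG: "integrable lborel (\<lambda>s. kap a * CF * (indicator {t<..<t + h} s * (t + h - s) powr (- (1 / 2))))"
    using hb by (auto simp: has_bochner_integral_iff)
  show "(\<integral>x. \<bar>Rem t h x\<bar> \<partial>lborel) \<le> 2 * kap a * CF * h powr (1 / 2)"
    using fubini_bound[OF jG bG iG] hb by (simp add: Rem_def has_bochner_integral_iff)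
  assume [measurable]: "g \<in> borel_measurable borel" and D: "\<And>x. \<bar>g x\<bar> \<le> D"
  have D0: "0 \<le> D" using D[of 0] by simp
  let ?H = "\<lambda>s x. g x * ?G s x"
  have jH: "jmeas ?H" by measurable
  have bH: "AE s in lborel. integrable lborel (?H s) \<and> (\<integral>x. \<bar>?H s x\<bar> \<partial>lborel) \<le> D * (kap a * CF * (indicator {t<..<t + h} s * (t + h - s) powr (- (1 / 2))))"
    using bG
  proof eventually_elim
    case (elim s)
    have i: "integrable lborel (?H s)" by (rule integrable_mult_bounded[OF _ _ D]) (use elim in auto)
    have "(\<integral>x. \<bar>?H s x\<bar> \<partial>lborel) \<le> (\<integral>x. D * \<bar>?G s x\<bar> \<partial>lborel)"
      by (rule integral_mono[OF integrable_abs[OF i]]) (use elim D in \<open>auto simp: abs_mult[of "g _"] intro!: mult_right_mono\<close>)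
    also have "\<dots> = D * (\<integral>x. \<bar>?G s x\<bar> \<partial>lborel)" by simp
    also have "\<dots> \<le> D * (kap a * CF * (indicator {t<..<t + h} s * (t + h - s) powr (- (1 / 2))))"
      using elim D0 by (intro mult_left_mono) auto
    finally show ?case using i by simp
  qed
  have iH: "integrable lborel (\<lambda>s. D * (kap a * CF * (indicator {t<..<t + h} s * (t + h - s) powr (- (1 / 2)))))"
    using iG by simp
  have "(\<integral>x. g x * Rem t h x \<partial>lborel) = (\<integral>x. (\<integral>s. ?H s x \<partial>lborel) \<partial>lborel)" by (simp add: Rem_def)
  also have "\<dots> = (\<integral>s. (\<integral>x. ?H s x \<partial>lborel) \<partial>lborel)" by (rule fubini_swap[OF jH bH iH])
  also have "\<dots> = (\<integral>s. - (indicator {t<..<t + h} s * (\<integral>x. conv (dgauss a (t + h - s)) g x * F s x \<partial>lborel)) \<partial>lborel)"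
  proof (rule Bochner_Integration.integral_cong[OF refl])
    fix s
    show "(\<integral>x. ?H s x \<partial>lborel) = - (indicator {t<..<t + h} s * (\<integral>x. conv (dgauss a (t + h - s)) g x * F s x \<partial>lborel))"
    proof (cases "t < s \<and> s < t + h")
      case True
      have "(\<integral>x. g x * conv (dgauss a (t + h - s)) (F s) x \<partial>lborel) = (\<integral>x. conv (\<lambda>z. dgauss a (t + h - s) (- z)) g x * F s x \<partial>lborel)"
        by (rule conv_dual[OF integrable_dgauss Fi _ D]) (use True pos in auto)
      then show ?thesis using True by (simp add: conv_def)
    qed auto
  qed
  finally show "(\<integral>x. g x * Rem t h x \<partial>lborel) = - (\<integral>s. indicator {t<..<t + h} s * (\<integral>x. conv (dgauss a (t + h - s)) g x * F s x \<partial>lborel) \<partial>lborel)"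
    by simp
qed

text \<open>A gradient mollified at time h and bounded by h^(-1/8) corresponds to spatial Hoelder
  exponent 3/4, as (3/4 - 1)/2 = -1/8. In Duhamel's integral two derivatives meet, which
  \<open>conv_dgauss_dgauss_L1\<close> handles; starting at t = 1 avoids the singularity of the heat
  flow at the initial time.\<close>

lemma gradient_estimate:
  assumes T: "1 \<le> T"
  obtains C where "0 \<le> C" "\<And>t h x. 1 \<le> t \<Longrightarrow> t \<le> T \<Longrightarrow> 0 < h \<Longrightarrow> h \<le> 1 \<Longrightarrow> \<bar>conv (dgauss a h) (v t) x\<bar> \<le> C * h powr (- 1 / 8)"
proof
  let ?U = "\<integral>x. \<bar>u0 x\<bar> \<partial>lborel"
  \<comment> \<open>Here 16 is 2 times 8, and 8 = 1/(1 - 7/8) comes from integrating (t -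
    s)^(-7/8).\<close>
  let ?C = "kap a * ?U + 16 * (kap a)\<^sup>2 * CF * T powr (1 / 8)"
  show "0 \<le> ?C" using CF0 by simp
  fix t h :: real and x assume t: "1 \<le> t" "t \<le> T" and h: "0 < h" "h \<le> 1"
  have t0: "0 < t" using t by simp
  note borel_measurable_integrable_lborel[OF u0, measurable]
  have 1: "\<bar>conv (dgauss a h) (heat t u0) x\<bar> \<le> kap a * ?U"
  proof -
    have "\<bar>conv (dgauss a h) (heat t u0) x\<bar> = \<bar>conv (dgauss a (h + t)) u0 x\<bar>" by (simp add: conv_dgauss_heat[OF h(1) t0 u0])
    also have "\<dots> \<le> (kap a * (h + t) powr (- 1 / 2) * (h + t) powr (- real DIM('a) / 2)) * ?U"
      using t h by (intro conv_sup_kernel dgauss_sup u0) auto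
    also have "\<dots> \<le> (kap a * 1 * 1) * ?U"
    proof (intro mult_right_mono mult_mono mult_left_mono)
      show "(h + t) powr (- 1 / 2) \<le> 1" "(h + t) powr (- real DIM('a) / 2) \<le> 1"
        using t h powr_mono2'[of _ 1 "h + t"] by auto
    qed (use CF0 in auto)
    finally show ?thesis by simp
  qed
  have 2: "\<bar>\<integral>s. indicator {0<..<t} s * conv (conv (dgauss a h) (dgauss a (t - s))) (F s) x \<partial>lborel\<bar> \<le> 16 * (kap a)\<^sup>2 * CF * T powr (1 / 8) * h powr (- 1 / 8)"
  proof -
    let ?k = "\<lambda>s. 2 * (kap a)\<^sup>2 * CF * h powr (- 1 / 8) * (indicator {0<..<t} s * (t - s) powr (- (7 / 8)))"
    have k: "has_bochner_integral lborel ?k (2 * (kap a)\<^sup>2 * CF * h powr (- 1 / 8) * (t powr (1 - 7 / 8) / (1 - 7 / 8)))"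
      by (intro has_bochner_integral_mult_right has_bochner_integral_powr_reflect t0) auto
    have b: "norm (indicator {0<..<t} s * conv (conv (dgauss a h) (dgauss a (t - s))) (F s) x) \<le> ?k s" for s
    proof (cases "0 < s \<and> s < t")
      case True
      have "\<bar>conv (conv (dgauss a h) (dgauss a (t - s))) (F s) x\<bar> \<le> CF * (\<integral>y. \<bar>conv (dgauss a h) (dgauss a (t - s)) y\<bar> \<partial>lborel)"
        by (rule conv_sup_fun[OF _ FB]) (use True h in \<open>auto intro!: integrable_conv integrable_dgauss\<close>)
      also have "\<dots> \<le> CF * (2 * (kap a)\<^sup>2 * (h powr (- 1 / 8) * (t - s) powr (- 7 / 8)))"
        using True h CF0 by (intro mult_left_mono conv_dgauss_dgauss_L1) auto
      finally show ?thesis using True by (simp add: mult_ac)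
    qed auto
    have "\<bar>\<integral>s. indicator {0<..<t} s * conv (conv (dgauss a h) (dgauss a (t - s))) (F s) x \<partial>lborel\<bar> \<le> (\<integral>s. ?k s \<partial>lborel)"
      by (rule abs_integral_le) (use b k in \<open>auto simp: has_bochner_integral_iff\<close>)
    also have "\<dots> = 16 * (kap a)\<^sup>2 * CF * h powr (- 1 / 8) * t powr (1 / 8)" using k by (simp add: has_bochner_integral_iff)
    also have "\<dots> \<le> 16 * (kap a)\<^sup>2 * CF * h powr (- 1 / 8) * T powr (1 / 8)" using t CF0 by (intro mult_left_mono powr_mono2) auto
    finally show ?thesis by (simp add: mult_ac)
  qed
  have h8: "1 \<le> h powr (- 1 / 8)" using h by (simp add: powr_minus_divide powr_le1)
  have "\<bar>conv (dgauss a h) (v t) x\<bar> \<le> kap a * ?U + 16 * (kap a)\<^sup>2 * CF * T powr (1 / 8) * h powr (- 1 / 8)"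
    using conv_v[of t "dgauss a h", OF t0 _ dgauss_sup[OF h(1)], of x] 1 2 by simp
  also have "kap a * ?U \<le> kap a * ?U * h powr (- 1 / 8)" using mult_left_mono[OF h8, of "kap a * ?U"] by simp
  finally show "\<bar>conv (dgauss a h) (v t) x\<bar> \<le> ?C * h powr (- 1 / 8)" by (simp add: algebra_simps)
qed

text \<open>The same regularity measured in L1: the exponent 3/8 in time is half of the spatial
  exponent 3/4. The flux part follows from \<open>dgauss_time_L1\<close>, the datum part from
  \<open>gauss_time_L1\<close> at times t >= 1.\<close>

lemma heat_estimate:
  assumes T: "1 \<le> T"
  obtains C where "0 \<le> C" "\<And>t h. 1 \<le> t \<Longrightarrow> t \<le> T \<Longrightarrow> 0 < h \<Longrightarrow> h \<le> 1 \<Longrightarrow>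
     (\<integral>x. \<bar>heat h (v t) x - v t x\<bar> \<partial>lborel) \<le> C * h powr (3 / 8)"
proof
  let ?U = "\<integral>x. \<bar>u0 x\<bar> \<partial>lborel" and ?g = "gcon TYPE('a)"
  let ?c = "4 * norm a * ?g * (1 + ?g\<^sup>2)"
  let ?C = "2 * ?g\<^sup>2 * ?U + 8 * ?c * CF * T powr (1 / 8)"
  show "0 \<le> ?C" using CF0 by simp
  fix t h :: real assume t: "1 \<le> t" "t \<le> T" and h: "0 < h" "h \<le> 1"
  have t0: "0 < t" using t by simp
  note borel_measurable_integrable_lborel[OF u0, measurable]
  note borel_measurable_conv_param[OF Fj, measurable (raw)]
  let ?P = "\<lambda>x. gauss (h + t) x - gauss t (x::'a)"
  let ?D = "\<lambda>s x. indicator {0<..<t} s * (conv (dgauss a (t + h - s)) (F s) x - conv (dgauss a (t - s)) (F s) x)"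
  have eq: "heat h (v t) x - v t x = conv ?P u0 x + (\<integral>s. ?D s x \<partial>lborel)" for x
  proof -
    have "conv ?P u0 x = heat (t + h) u0 x - heat t u0 x"
      unfolding heat_eq_conv
      by (subst conv_diff_kernel[of _ _ "(t + h) powr (- real DIM('a) / 2)" "t powr (- real DIM('a) / 2)"])
         (use gauss_le[of "t + h", where 'a='a] gauss_le[OF t0, where 'a='a] t0 h u0 in \<open>auto simp: add.commute\<close>)
    moreover have "(\<integral>s. ?D s x \<partial>lborel) = (\<integral>s. indicator {0<..<t} s * conv (dgauss a (t + h - s)) (F s) x \<partial>lborel) - Du a F t x"
      unfolding Du_def using heat_v_integrable[OF t0 h(1), of x] Du_F_integrable[OF t0, of x]
      by (simp add: right_diff_distrib)
    ultimately show ?thesis using heat_v[OF t0 h(1), of x] eqn[OF t0, of x] by simp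
  qed
  have Pi: "integrable lborel ?P" using t0 h by (intro integrable_gauss_diff) auto
  have 1: "integrable lborel (conv ?P u0)" by (rule integrable_conv[OF Pi u0])
  have 2: "(\<integral>x. \<bar>conv ?P u0 x\<bar> \<partial>lborel) \<le> 2 * ?g\<^sup>2 * ?U * h powr (3 / 8)"
  proof -
    have "(\<integral>x. \<bar>conv ?P u0 x\<bar> \<partial>lborel) \<le> (\<integral>x. \<bar>?P x\<bar> \<partial>lborel) * ?U" by (rule conv_L1[OF Pi u0])
    also have "\<dots> \<le> (2 * ?g\<^sup>2 * sqrt h * t powr (- 1 / 2)) * ?U"
      using t0 h by (intro mult_right_mono gauss_time_L1) auto
    also have "\<dots> \<le> (2 * ?g\<^sup>2 * h powr (3 / 8) * 1) * ?U"
    proof (intro mult_right_mono mult_mono mult_left_mono)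
      show "t powr (- 1 / 2) \<le> 1" using t powr_mono2'[of _ 1 t] by auto
      show "sqrt h \<le> h powr (3 / 8)" using h powr_mono'[of "3/8" "1/2" h] by (simp add: powr_half_sqrt)
    qed (use h in auto)
    finally show ?thesis by (simp add: mult_ac)
  qed
  have jD: "jmeas ?D" by measurable
  have bD: "AE s in lborel. integrable lborel (?D s) \<and> (\<integral>x. \<bar>?D s x\<bar> \<partial>lborel) \<le> ?c * CF * h powr (3 / 8) * (indicator {0<..<t} s * (t - s) powr (- (7 / 8)))"
  proof (intro AE_I2)
    fix s
    show "integrable lborel (?D s) \<and> (\<integral>x. \<bar>?D s x\<bar> \<partial>lborel) \<le> ?c * CF * h powr (3 / 8) * (indicator {0<..<t} s * (t - s) powr (- (7 / 8)))"
    proof (cases "0 < s \<and> s < t")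
      case True
      let ?K = "\<lambda>x. dgauss a (h + (t - s)) x - dgauss a (t - s) x"
      have Ki: "integrable lborel ?K"
        using True h by (intro Bochner_Integration.integrable_diff integrable_dgauss) auto
      have e: "conv (dgauss a (t + h - s)) (F s) x - conv (dgauss a (t - s)) (F s) x = conv ?K (F s) x" for x
      proof -
        have "h + (t - s) = t + h - s" by simp
        then show ?thesis
          using True h by (simp only:) (subst conv_diff_kernel[OF _ _ dgauss_sup dgauss_sup], auto intro!: Fi)
      qed
      have "(\<integral>x. \<bar>conv ?K (F s) x\<bar> \<partial>lborel) \<le> (\<integral>x. \<bar>?K x\<bar> \<partial>lborel) * (\<integral>x. \<bar>F s x\<bar> \<partial>lborel)"
        using True by (intro conv_L1 Ki Fi) auto
      also have "\<dots> \<le> (?c * (h powr (3 / 8) * (t - s) powr (- 7 / 8))) * CF"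
        using True h CF0 by (intro mult_mono FL dgauss_time_L1) auto
      finally show ?thesis unfolding e using True integrable_conv[OF Ki Fi[of s]] by (simp add: mult_ac)
    qed auto
  qed
  have hb: "has_bochner_integral lborel (\<lambda>s. ?c * CF * h powr (3 / 8) * (indicator {0<..<t} s * (t - s) powr (- (7 / 8)))) (?c * CF * h powr (3 / 8) * (t powr (1 - 7 / 8) / (1 - 7 / 8)))"
    by (intro has_bochner_integral_mult_right has_bochner_integral_powr_reflect t0) auto
  have iD: "integrable lborel (\<lambda>s. ?c * CF * h powr (3 / 8) * (indicator {0<..<t} s * (t - s) powr (- (7 / 8))))"
    using hb by (simp only: has_bochner_integral_iff)
  have hbe: "(\<integral>s. ?c * CF * h powr (3 / 8) * (indicator {0<..<t} s * (t - s) powr (- (7 / 8))) \<partial>lborel) = ?c * CF * h powr (3 / 8) * (t powr (1 - 7 / 8) / (1 - 7 / 8))"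
    using hb by (simp only: has_bochner_integral_iff)
  have 3: "(\<integral>x. \<bar>\<integral>s. ?D s x \<partial>lborel\<bar> \<partial>lborel) \<le> 8 * ?c * CF * T powr (1 / 8) * h powr (3 / 8)"
  proof -
    have "(\<integral>x. \<bar>\<integral>s. ?D s x \<partial>lborel\<bar> \<partial>lborel) \<le> ?c * CF * h powr (3 / 8) * (t powr (1 - 7 / 8) / (1 - 7 / 8))"
      using fubini_bound[OF jD bD iD] unfolding hbe .
    also have "\<dots> = 8 * ?c * CF * h powr (3 / 8) * t powr (1 / 8)" by simp
    also have "\<dots> \<le> 8 * ?c * CF * h powr (3 / 8) * T powr (1 / 8)" using t CF0 by (intro mult_left_mono powr_mono2) auto
    finally show ?thesis by (simp add: mult_ac)
  qed
  have i3: "integrable lborel (\<lambda>x. \<integral>s. ?D s x \<partial>lborel)" by (rule fubini_integrable[OF jD bD iD])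
  have "(\<integral>x. \<bar>heat h (v t) x - v t x\<bar> \<partial>lborel) \<le> (\<integral>x. \<bar>conv ?P u0 x\<bar> + \<bar>\<integral>s. ?D s x \<partial>lborel\<bar> \<partial>lborel)"
    unfolding eq by (rule integral_mono) (use 1 i3 in auto)
  also have "\<dots> = (\<integral>x. \<bar>conv ?P u0 x\<bar> \<partial>lborel) + (\<integral>x. \<bar>\<integral>s. ?D s x \<partial>lborel\<bar> \<partial>lborel)" using 1 i3 by simp
  also have "\<dots> \<le> ?C * h powr (3 / 8)" using 2 3 by (simp add: distrib_right)
  finally show "(\<integral>x. \<bar>heat h (v t) x - v t x\<bar> \<partial>lborel) \<le> ?C * h powr (3 / 8)" .
qed

lemma integral_abs_triangle:
  fixes f g h :: "'a \<Rightarrow> real"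
  assumes "integrable lborel f" "integrable lborel g" "integrable lborel h"
  shows "(\<integral>x. \<bar>f x - h x\<bar> \<partial>lborel) \<le> (\<integral>x. \<bar>f x - g x\<bar> \<partial>lborel) + (\<integral>x. \<bar>g x - h x\<bar> \<partial>lborel)"
proof -
  have "(\<integral>x. \<bar>f x - h x\<bar> \<partial>lborel) \<le> (\<integral>x. \<bar>f x - g x\<bar> + \<bar>g x - h x\<bar> \<partial>lborel)"
    by (rule integral_mono) (use assms in auto)
  also have "\<dots> = (\<integral>x. \<bar>f x - g x\<bar> \<partial>lborel) + (\<integral>x. \<bar>g x - h x\<bar> \<partial>lborel)" using assms by simp
  finally show ?thesis .
qed

text \<open>By \<open>restart\<close> the increment is the step remainder, O(h^(1/2)), plus the
  change under the heat flow, O(h^(3/8)); for h <= 1 the latter order dominates.\<close>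

lemma time_estimate:
  assumes T: "1 \<le> T"
  obtains C where "0 \<le> C" "\<And>t s. 1 \<le> t \<Longrightarrow> t \<le> T \<Longrightarrow> 1 \<le> s \<Longrightarrow> s \<le> T \<Longrightarrow> \<bar>s - t\<bar> \<le> 1 \<Longrightarrow>
     (\<integral>x. \<bar>v s x - v t x\<bar> \<partial>lborel) \<le> C * \<bar>s - t\<bar> powr (3 / 8)"
proof -
  obtain C where C: "0 \<le> C" "\<And>t h. 1 \<le> t \<Longrightarrow> t \<le> T \<Longrightarrow> 0 < h \<Longrightarrow> h \<le> 1 \<Longrightarrow>
     (\<integral>x. \<bar>heat h (v t) x - v t x\<bar> \<partial>lborel) \<le> C * h powr (3 / 8)" using heat_estimate[OF T] by blast
  let ?C = "C + 2 * kap a * CF"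
  have main: "(\<integral>x. \<bar>v s x - v t x\<bar> \<partial>lborel) \<le> ?C * (s - t) powr (3 / 8)" if t: "1 \<le> t" "t < s" "s \<le> T" "s - t \<le> 1" for t s
  proof -
    define h where "h = s - t"
    have h: "0 < h" "h \<le> 1" and s: "s = t + h" and t0: "0 < t" using t by (auto simp: h_def)
    have e: "v s x - heat h (v t) x = Rem t h x" for x using restart[OF t0 h(1), of x] s by simp
    have "(\<integral>x. \<bar>v s x - v t x\<bar> \<partial>lborel) \<le> (\<integral>x. \<bar>v s x - heat h (v t) x\<bar> \<partial>lborel) + (\<integral>x. \<bar>heat h (v t) x - v t x\<bar> \<partial>lborel)"
      using t h by (intro integral_abs_triangle vi integrable_heat) auto
    also have "\<dots> \<le> 2 * kap a * CF * h powr (1 / 2) + C * h powr (3 / 8)"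
      unfolding e using t h by (intro add_mono Rem_L1 C(2)) auto
    also have "\<dots> \<le> 2 * kap a * CF * h powr (3 / 8) + C * h powr (3 / 8)"
      using h CF0 C by (intro add_mono mult_left_mono powr_mono') auto
    finally show ?thesis by (simp add: h_def algebra_simps)
  qed
  show ?thesis
  proof (rule that[of ?C])
    show "0 \<le> ?C" using C CF0 by simp
    fix t s :: real assume ts: "1 \<le> t" "t \<le> T" "1 \<le> s" "s \<le> T" "\<bar>s - t\<bar> \<le> 1"
    consider "t < s" | "s < t" | "s = t" by linarith
    then show "(\<integral>x. \<bar>v s x - v t x\<bar> \<partial>lborel) \<le> ?C * \<bar>s - t\<bar> powr (3 / 8)"
    proof cases
      case 1 then show ?thesis using main[of t s] ts by simp
    next
      case 2 then show ?thesis using main[of s t] ts by (simp add: abs_minus_commute)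
    qed simp
  qed
qed

text \<open>By orthogonality, \<open>F s\<close> may be replaced by its difference to the flux of the mollified \<open>v r\<close>.\<close>

lemma flux_work:
  assumes T: "1 \<le> T"
  obtains C where "0 \<le> C" "\<And>r s h. 1 \<le> r \<Longrightarrow> r \<le> T \<Longrightarrow> 1 \<le> s \<Longrightarrow> s \<le> T \<Longrightarrow> \<bar>s - r\<bar> \<le> 1 \<Longrightarrow> 0 < h \<Longrightarrow> h \<le> 1 \<Longrightarrow>
     \<bar>\<integral>x. conv (dgauss a h) (v r) x * F s x \<partial>lborel\<bar> \<le> C * h powr (- 1 / 8) * (\<bar>s - r\<bar> powr (3 / 8) + h powr (3 / 8))"
proof -
  obtain C1 where C1: "0 \<le> C1" "\<And>t h x. 1 \<le> t \<Longrightarrow> t \<le> T \<Longrightarrow> 0 < h \<Longrightarrow> h \<le> 1 \<Longrightarrow> \<bar>conv (dgauss a h) (v t) x\<bar> \<le> C1 * h powr (- 1 / 8)"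
    using gradient_estimate[OF T] by blast
  obtain C2 where C2: "0 \<le> C2" "\<And>t h. 1 \<le> t \<Longrightarrow> t \<le> T \<Longrightarrow> 0 < h \<Longrightarrow> h \<le> 1 \<Longrightarrow>
     (\<integral>x. \<bar>heat h (v t) x - v t x\<bar> \<partial>lborel) \<le> C2 * h powr (3 / 8)" using heat_estimate[OF T] by blast
  obtain C3 where C3: "0 \<le> C3" "\<And>t s. 1 \<le> t \<Longrightarrow> t \<le> T \<Longrightarrow> 1 \<le> s \<Longrightarrow> s \<le> T \<Longrightarrow> \<bar>s - t\<bar> \<le> 1 \<Longrightarrow>
     (\<integral>x. \<bar>v s x - v t x\<bar> \<partial>lborel) \<le> C3 * \<bar>s - t\<bar> powr (3 / 8)" using time_estimate[OF T] by blast
  let ?L = "p * B powr (p - 1)"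
  have L0: "0 \<le> ?L" using p1 by simp
  show ?thesis
  proof (rule that[of "C1 * (?L * (C2 + C3))"])
    show "0 \<le> C1 * (?L * (C2 + C3))" using C1 C2 C3 p1 by simp
    fix r s h :: real assume r: "1 \<le> r" "r \<le> T" and s: "1 \<le> s" "s \<le> T" "\<bar>s - r\<bar> \<le> 1" and h: "0 < h" "h \<le> 1"
    have r0: "0 < r" and s0: "0 < s" using r s by auto
    let ?W = "heat h (v r)"
    have Wi: "integrable lborel ?W" by (rule integrable_heat[OF h(1) vi[OF r0]])
    note borel_measurable_integrable_lborel[OF Wi, measurable] vm[measurable]
    have WB: "\<bar>?W x\<bar> \<le> B" for x by (rule heat_sup[OF h(1) vm vB[OF r0]])
    have fWb: "\<bar>fnl p (?W x)\<bar> \<le> ?L * \<bar>?W x\<bar>" for x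
      using fnl_lipschitz[OF p1 WB[of x], of 0] B1 by (simp add: fnl_def)
    have fWi: "integrable lborel (\<lambda>x. fnl p (?W x))"
      by (rule Bochner_Integration.integrable_bound[of _ "\<lambda>x. ?L * ?W x"]) (use Wi p1 fWb in \<open>auto simp: abs_mult\<close>)
    have di: "integrable lborel (\<lambda>x. F s x - fnl p (?W x))" using fWi Fi[OF s0] by simp
    have cm [measurable]: "conv (dgauss a h) (v r) \<in> borel_measurable borel" by simp
    have cb: "\<bar>conv (dgauss a h) (v r) x\<bar> \<le> C1 * h powr (- 1 / 8)" for x by (rule C1(2)[OF r h])
    have "(\<integral>x. conv (dgauss a h) (v r) x * F s x \<partial>lborel) = (\<integral>x. conv (dgauss a h) (v r) x * (F s x - fnl p (?W x)) \<partial>lborel)"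
    proof -
      have "(\<integral>x. conv (dgauss a h) (v r) x * (F s x - fnl p (?W x)) \<partial>lborel)
        = (\<integral>x. conv (dgauss a h) (v r) x * F s x \<partial>lborel) - (\<integral>x. conv (dgauss a h) (v r) x * fnl p (?W x) \<partial>lborel)"
        unfolding right_diff_distrib
        by (intro Bochner_Integration.integral_diff integrable_mult_bounded[OF _ cm cb] Fi s0 fWi)
      then show ?thesis using heat_flux_orthogonal[OF p1 h(1) vi[OF r0] vB[OF r0], of a] by (simp add: mult.commute)
    qed
    also have "\<bar>\<dots>\<bar> \<le> C1 * h powr (- 1 / 8) * (\<integral>x. \<bar>F s x - fnl p (?W x)\<bar> \<partial>lborel)"
      by (rule integral_mult_bounded[OF di cm cb])
    also have "\<dots> \<le> C1 * h powr (- 1 / 8) * (?L * ((C2 + C3) * (\<bar>s - r\<bar> powr (3 / 8) + h powr (3 / 8))))"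
    proof (rule mult_left_mono)
      have "(\<integral>x. \<bar>F s x - fnl p (?W x)\<bar> \<partial>lborel) \<le> (\<integral>x. ?L * \<bar>v s x - ?W x\<bar> \<partial>lborel)"
        by (rule integral_mono) (use di vi[OF s0] Wi fnl_lipschitz[OF p1 vB[OF s0] WB] in auto)
      also have "\<dots> = ?L * (\<integral>x. \<bar>v s x - ?W x\<bar> \<partial>lborel)" by simp
      also have "\<dots> \<le> ?L * (C3 * \<bar>s - r\<bar> powr (3 / 8) + C2 * h powr (3 / 8))"
      proof (rule mult_left_mono[OF _ L0])
        have "(\<integral>x. \<bar>v s x - ?W x\<bar> \<partial>lborel) \<le> (\<integral>x. \<bar>v s x - v r x\<bar> \<partial>lborel) + (\<integral>x. \<bar>v r x - ?W x\<bar> \<partial>lborel)"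
          by (rule integral_abs_triangle[OF vi[OF s0] vi[OF r0] Wi])
        also have "(\<integral>x. \<bar>v r x - ?W x\<bar> \<partial>lborel) = (\<integral>x. \<bar>?W x - v r x\<bar> \<partial>lborel)" by (simp add: abs_minus_commute)
        finally show "(\<integral>x. \<bar>v s x - ?W x\<bar> \<partial>lborel) \<le> C3 * \<bar>s - r\<bar> powr (3 / 8) + C2 * h powr (3 / 8)"
          using C2(2)[OF r h] C3(2)[OF r s] by linarith
      qed
      also have "\<dots> \<le> ?L * ((C2 + C3) * (\<bar>s - r\<bar> powr (3 / 8) + h powr (3 / 8)))"
      proof (rule mult_left_mono[OF _ L0])
        have "0 \<le> C2 * \<bar>s - r\<bar> powr (3 / 8)" "0 \<le> C3 * h powr (3 / 8)" using C2 C3 by auto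
        then show "C3 * \<bar>s - r\<bar> powr (3 / 8) + C2 * h powr (3 / 8) \<le> (C2 + C3) * (\<bar>s - r\<bar> powr (3 / 8) + h powr (3 / 8))"
          by (simp add: algebra_simps)
      qed
      finally show "(\<integral>x. \<bar>F s x - fnl p (?W x)\<bar> \<partial>lborel) \<le> ?L * ((C2 + C3) * (\<bar>s - r\<bar> powr (3 / 8) + h powr (3 / 8)))" .
    qed (use C1 in simp)
    finally show "\<bar>\<integral>x. conv (dgauss a h) (v r) x * F s x \<partial>lborel\<bar> \<le> C1 * (?L * (C2 + C3)) * h powr (- 1 / 8) * (\<bar>s - r\<bar> powr (3 / 8) + h powr (3 / 8))"
      by (simp add: mult_ac)
  qed
qed

text \<open>With W the heat flow of v(t), the difference of the energies is the integral of (v(t +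
  h) + W) times \<open>Rem\<close>. In dual form this is an integral over s of flux work at the
  mollification times k = t + h - s and k + h, of size h^(3/8) k^(-1/8) by \<open>flux_work\<close>.
  As k runs through (0, h), the total is of order h^(3/8 + 7/8).\<close>

lemma energy_step:
  assumes T: "1 \<le> T"
  obtains C where "0 \<le> C" "\<And>t h. 1 \<le> t \<Longrightarrow> 0 < h \<Longrightarrow> h \<le> 1 / 2 \<Longrightarrow> t + h \<le> T \<Longrightarrow>
     (\<integral>x. (v (t + h) x)\<^sup>2 \<partial>lborel) \<le> (\<integral>x. (heat h (v t) x)\<^sup>2 \<partial>lborel) + C * h powr (5 / 4)"
proof -
  obtain C where C: "0 \<le> C" "\<And>r s h. 1 \<le> r \<Longrightarrow> r \<le> T \<Longrightarrow> 1 \<le> s \<Longrightarrow> s \<le> T \<Longrightarrow> \<bar>s - r\<bar> \<le> 1 \<Longrightarrow> 0 < h \<Longrightarrow> h \<le> 1 \<Longrightarrow>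
     \<bar>\<integral>x. conv (dgauss a h) (v r) x * F s x \<partial>lborel\<bar> \<le> C * h powr (- 1 / 8) * (\<bar>s - r\<bar> powr (3 / 8) + h powr (3 / 8))"
    using flux_work[OF T] by blast
  show ?thesis
  proof (rule that[of "5 * C * (8 / 7)"])
    \<comment> \<open>The factor 5 = 2 + 3 collects the two parts of the test function, and 8/7 =
      1/(1 - 1/8). The restriction h <= 1/2 keeps the larger mollification time k + h below
      1.\<close>
    show "0 \<le> 5 * C * (8 / 7)" using C by simp
    fix t h :: real assume t: "1 \<le> t" and h: "0 < h" "h \<le> 1 / 2" and T': "t + h \<le> T"
    have t0: "0 < t" and th0: "0 < t + h" using t h by auto
    let ?W = "heat h (v t)"
    let ?g = "\<lambda>x. v (t + h) x + ?W x"
    have Wi: "integrable lborel ?W" by (rule integrable_heat[OF h(1) vi[OF t0]])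
    note borel_measurable_integrable_lborel[OF Wi, measurable] vm[measurable]
    have WB: "\<bar>?W x\<bar> \<le> B" for x by (rule heat_sup[OF h(1) vm vB[OF t0]])
    have gB: "\<bar>?g x\<bar> \<le> 2 * B" for x using WB[of x] vB[OF th0, of x] by linarith
    have gm: "?g \<in> borel_measurable borel" by simp
    have "(\<integral>x. (v (t + h) x)\<^sup>2 \<partial>lborel) - (\<integral>x. (?W x)\<^sup>2 \<partial>lborel) = (\<integral>x. (v (t + h) x)\<^sup>2 - (?W x)\<^sup>2 \<partial>lborel)"
      unfolding power2_eq_square
      by (intro Bochner_Integration.integral_diff[symmetric] integrable_mult_bounded[OF vi[OF th0] _ vB[OF th0]] integrable_mult_bounded[OF Wi _ WB]) auto
    also have "\<dots> = (\<integral>x. ?g x * Rem t h x \<partial>lborel)"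
    proof (rule Bochner_Integration.integral_cong[OF refl])
      fix x
      have "Rem t h x = v (t + h) x - ?W x" using restart[OF t0 h(1), of x] by simp
      then show "(v (t + h) x)\<^sup>2 - (?W x)\<^sup>2 = ?g x * Rem t h x" by (simp only:) (simp add: power2_eq_square algebra_simps)
    qed
    also have "\<dots> = - (\<integral>s. indicator {t<..<t + h} s * (\<integral>x. conv (dgauss a (t + h - s)) ?g x * F s x \<partial>lborel) \<partial>lborel)"
      by (rule Rem_dual[OF t0 h(1) gm gB])
    also have "\<dots> \<le> \<bar>\<integral>s. indicator {t<..<t + h} s * (\<integral>x. conv (dgauss a (t + h - s)) ?g x * F s x \<partial>lborel) \<partial>lborel\<bar>"
      by (rule abs_ge_minus_self)
    also have "\<dots> \<le> (\<integral>s. 5 * C * h powr (3 / 8) * (indicator {t<..<t + h} s * (t + h - s) powr (- (1 / 8))) \<partial>lborel)"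
    proof (rule abs_integral_le)
      show "integrable lborel (\<lambda>s. 5 * C * h powr (3 / 8) * (indicator {t<..<t + h} s * (t + h - s) powr (- (1 / 8))))"
        using has_bochner_integral_powr_shift[OF h(1), of "1/8" t] by (auto simp: has_bochner_integral_iff)
      fix s
      show "\<bar>indicator {t<..<t + h} s * (\<integral>x. conv (dgauss a (t + h - s)) ?g x * F s x \<partial>lborel)\<bar>
         \<le> 5 * C * h powr (3 / 8) * (indicator {t<..<t + h} s * (t + h - s) powr (- (1 / 8)))"
      proof (cases "t < s \<and> s < t + h")
        case True
        define k where "k = t + h - s"
        have k: "0 < k" "k < h" using True by (auto simp: k_def)
        have s0: "0 < s" using True t by simp
        have ceq: "conv (dgauss a k) ?g x = conv (dgauss a k) (v (t + h)) x + conv (dgauss a (k + h)) (v t) x" for x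
        proof -
          have "conv (dgauss a k) ?g x = conv (dgauss a k) (v (t + h)) x - conv (dgauss a k) (\<lambda>x. - ?W x) x"
            using conv_diff[of "dgauss a k", OF _ dgauss_sup[OF k(1)] vi[OF th0], of "\<lambda>x. - ?W x" x] Wi by simp
          also have "conv (dgauss a k) (\<lambda>x. - ?W x) x = - conv (dgauss a k) ?W x" by (simp add: conv_def)
          finally show ?thesis using conv_dgauss_heat[OF k(1) h(1) vi[OF t0], of a] by simp
        qed
        have J: "integrable lborel (\<lambda>x. conv (dgauss a k') (v r) x * F s x)" if "0 < k'" "0 < r" for k' r
        proof (rule integrable_mult_bounded[OF Fi[OF s0]])
          show "\<bar>conv (dgauss a k') (v r) x\<bar> \<le> B * (\<integral>y. \<bar>dgauss a k' y\<bar> \<partial>lborel)" for x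
            by (rule conv_sup_fun[OF vm vB[OF that(2)] integrable_dgauss[OF that(1)]])
        qed simp
        have "(\<integral>x. conv (dgauss a k) ?g x * F s x \<partial>lborel) = (\<integral>x. conv (dgauss a k) (v (t + h)) x * F s x \<partial>lborel) + (\<integral>x. conv (dgauss a (k + h)) (v t) x * F s x \<partial>lborel)"
          unfolding ceq distrib_right using k h t0 th0 by (intro Bochner_Integration.integral_add J) auto
        moreover have "\<bar>\<integral>x. conv (dgauss a k) (v (t + h)) x * F s x \<partial>lborel\<bar> \<le> C * k powr (- 1 / 8) * (2 * h powr (3 / 8))"
        proof -
          have e: "\<bar>s - (t + h)\<bar> = k" using True by (simp add: k_def)
          have "\<bar>\<integral>x. conv (dgauss a k) (v (t + h)) x * F s x \<partial>lborel\<bar> \<le> C * k powr (- 1 / 8) * (\<bar>s - (t + h)\<bar> powr (3 / 8) + k powr (3 / 8))"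
            using True t h T' k e by (intro C(2)) auto
          also have "\<dots> \<le> C * k powr (- 1 / 8) * (2 * h powr (3 / 8))"
          proof (rule mult_left_mono)
            have "k powr (3 / 8) \<le> h powr (3 / 8)" using k by (intro powr_mono2) auto
            then show "\<bar>s - (t + h)\<bar> powr (3 / 8) + k powr (3 / 8) \<le> 2 * h powr (3 / 8)" unfolding e by simp
          qed (use C in simp)
          finally show ?thesis .
        qed
        moreover have "\<bar>\<integral>x. conv (dgauss a (k + h)) (v t) x * F s x \<partial>lborel\<bar> \<le> C * k powr (- 1 / 8) * (3 * h powr (3 / 8))"
        proof -
          have "\<bar>\<integral>x. conv (dgauss a (k + h)) (v t) x * F s x \<partial>lborel\<bar> \<le> C * (k + h) powr (- 1 / 8) * (\<bar>s - t\<bar> powr (3 / 8) + (k + h) powr (3 / 8))"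
            using True t h T' k by (intro C(2)) auto
          also have "\<dots> \<le> C * k powr (- 1 / 8) * (3 * h powr (3 / 8))"
          proof (rule mult_mono)
            show "C * (k + h) powr (- 1 / 8) \<le> C * k powr (- 1 / 8)" using C k h by (intro mult_left_mono powr_mono2') auto
            have "\<bar>s - t\<bar> powr (3 / 8) \<le> h powr (3 / 8)" using True by (intro powr_mono2) auto
            moreover have "(k + h) powr (3 / 8) \<le> (2 * h) powr (3 / 8)" using k h by (intro powr_mono2) auto
            moreover have "(2 * h) powr (3 / 8) \<le> 2 * h powr (3 / 8)"
              using h powr_mono[of "3/8" 1 "2::real"] by (simp add: powr_mult mult_right_mono)
            ultimately show "\<bar>s - t\<bar> powr (3 / 8) + (k + h) powr (3 / 8) \<le> 3 * h powr (3 / 8)" by linarith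
          qed (use C in auto)
          finally show ?thesis .
        qed
        ultimately have "\<bar>\<integral>x. conv (dgauss a k) ?g x * F s x \<partial>lborel\<bar> \<le> C * k powr (- 1 / 8) * (2 * h powr (3 / 8)) + C * k powr (- 1 / 8) * (3 * h powr (3 / 8))"
          by linarith
        also have "\<dots> = 5 * C * h powr (3 / 8) * k powr (- (1 / 8))" by simp
        finally show ?thesis using True unfolding k_def by simp
      qed auto
    qed
    also have "\<dots> = 5 * C * h powr (3 / 8) * (h powr (1 - 1 / 8) / (1 - 1 / 8))"
      using has_bochner_integral_powr_shift[OF h(1), of "1/8" t] by (simp add: has_bochner_integral_iff)
    also have "\<dots> = 5 * C * (8 / 7) * (h powr (3 / 8) * h powr (7 / 8))" by simp
    also have "h powr (3 / 8) * h powr (7 / 8) = h powr (5 / 4)" by (simp add: powr_add[symmetric])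
    finally show "(\<integral>x. (v (t + h) x)\<^sup>2 \<partial>lborel) \<le> (\<integral>x. (?W x)\<^sup>2 \<partial>lborel) + 5 * C * (8 / 7) * h powr (5 / 4)" by simp
  qed
qed

end

section \<open>Algebraic decay of the energy in time\<close>

context mild_solution
begin

lemma v2_le:
  assumes t: "0 < t"
  shows "(\<integral>x. (v t x)\<^sup>2 \<partial>lborel) \<le> B * M"
proof -
  have "\<bar>\<integral>x. v t x * v t x \<partial>lborel\<bar> \<le> B * (\<integral>x. \<bar>v t x\<bar> \<partial>lborel)"
    by (rule integral_mult_bounded[OF vi[OF t] vm vB[OF t]])
  also have "\<dots> \<le> B * M" using B1 vM[OF t] by (intro mult_left_mono) auto
  finally show ?thesis by (simp add: power2_eq_square)
qed

text \<open>With steps h = H/2^k, \<open>heat_energy_drop\<close> lets each step contract the excess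
  of the energy over a level Q by q = 1 - 2^(-k). Time 1 + m H is reached after m 2^k steps, so the
  total contraction is at most exp(-m). Letting k tend to infinity removes the step error, whose
  constant depends on the final time but not on k.\<close>

lemma energy_decay_discrete:
  fixes m :: nat and H :: real
  assumes H: "0 < H"
  shows "(\<integral>x. (v (1 + m * H) x)\<^sup>2 \<partial>lborel) \<le> H powr (- real DIM('a) / 2) * M\<^sup>2 + exp (- real m) * (B * M)"
proof -
  define y where "y = (\<lambda>t. \<integral>x. (v t x)\<^sup>2 \<partial>lborel)"
  define T where "T = 1 + real m * H"
  define Q0 where "Q0 = H powr (- real DIM('a) / 2) * M\<^sup>2"
  have T1: "1 \<le> T" using H by (simp add: T_def)
  obtain C where C: "0 \<le> C" "\<And>t h. 1 \<le> t \<Longrightarrow> 0 < h \<Longrightarrow> h \<le> 1 / 2 \<Longrightarrow> t + h \<le> T \<Longrightarrow>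
     y (t + h) \<le> (\<integral>x. (heat h (v t) x)\<^sup>2 \<partial>lborel) + C * h powr (5 / 4)"
    using energy_step[OF T1] unfolding y_def by metis
  have main: "y T \<le> Q0 + C * H * (H / 2 ^ k) powr (1 / 4) + exp (- real m) * (B * M)" if k: "H / 2 ^ k \<le> 1 / 2" for k :: nat
  proof -
    define h where "h = H / 2 ^ k"
    have h: "0 < h" "h \<le> 1 / 2" using k H by (auto simp: h_def)
    define q where "q = 1 - 1 / (2::real) ^ k"
    have q0: "0 \<le> q" by (simp add: q_def)
    \<comment> \<open>Fixed point of the affine recursion: the bound \<open>Q0\<close> for the
      energy of the heat flow, plus the step error C h^(5/4) divided by 1 - q = 2^(-k).\<close>
    define Q where "Q = Q0 + C * H * h powr (1 / 4)"
    have Q: "0 \<le> Q" using C H by (simp add: Q_def Q0_def)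
    have step: "y (t + h) - Q \<le> q * (y t - Q)" if t: "1 \<le> t" "t + h \<le> T" for t
    proof -
      have t0: "0 < t" using t by simp
      define E where "E = (\<integral>x. (heat H (v t) x)\<^sup>2 \<partial>lborel)"
      have "y (t + h) \<le> (\<integral>x. (heat h (v t) x)\<^sup>2 \<partial>lborel) + C * h powr (5 / 4)" by (rule C(2)[OF t(1) h t(2)])
      moreover have "(\<integral>x. (heat h (v t) x)\<^sup>2 \<partial>lborel) \<le> y t - (y t - E) / 2 ^ k"
        unfolding h_def y_def E_def by (rule heat_energy_drop[OF H vi[OF t0] vB[OF t0]])
      moreover have "E / 2 ^ k \<le> Q0 / 2 ^ k"
        unfolding Q0_def E_def using heat_energy_le[OF H vi[OF t0] vM[OF t0]] by (intro divide_right_mono) auto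
      moreover have "C * h powr (5 / 4) = C * H * h powr (1 / 4) / 2 ^ k"
      proof -
        have "h powr (5 / 4) = h powr (1 / 4) * h powr 1" unfolding powr_add[symmetric] by simp
        then show ?thesis using h H by (simp add: h_def)
      qed
      moreover have "q * (y t - Q) = y t - y t / 2 ^ k - Q + Q0 / 2 ^ k + C * H * h powr (1 / 4) / 2 ^ k"
        by (simp add: q_def Q_def algebra_simps add_divide_distrib)
      ultimately show ?thesis by (simp add: diff_divide_distrib)
    qed
    have it: "y (1 + real j * h) - Q \<le> q ^ j * (y 1 - Q)" if "j \<le> m * 2 ^ k" for j :: nat
      using that
    proof (induction j)
      case (Suc j)
      have "real (Suc j) * h \<le> real (m * 2 ^ k) * h" using Suc.prems h by (intro mult_right_mono of_nat_mono) auto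
      also have "\<dots> = real m * H" by (simp add: h_def)
      finally have le: "1 + real j * h + h \<le> T" by (simp add: T_def algebra_simps)
      have "y (1 + real (Suc j) * h) - Q = y ((1 + real j * h) + h) - Q" by (simp add: algebra_simps)
      also have "\<dots> \<le> q * (y (1 + real j * h) - Q)" by (rule step) (use le h in auto)
      also have "\<dots> \<le> q * (q ^ j * (y 1 - Q))" using Suc q0 by (intro mult_left_mono) auto
      finally show ?case by simp
    qed simp
    have "real (m * 2 ^ k) * h = real m * H" by (simp add: h_def)
    then have "y T - Q \<le> q ^ (m * 2 ^ k) * (y 1 - Q)" using it[of "m * 2 ^ k"] by (simp only: T_def)
    also have "\<dots> \<le> q ^ (m * 2 ^ k) * (B * M)"
      using q0 Q v2_le[of 1] by (intro mult_left_mono) (auto simp: y_def)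
    also have "\<dots> \<le> exp (- real m) * (B * M)"
    proof (rule mult_right_mono)
      have "q \<le> exp (- (1 / 2 ^ k))" unfolding q_def using exp_ge_add_one_self[of "- (1 / 2 ^ k)"] by simp
      then have "q ^ (m * 2 ^ k) \<le> exp (- (1 / 2 ^ k)) ^ (m * 2 ^ k)" using q0 by (rule power_mono)
      also have "\<dots> = exp (- real m)" by (simp add: exp_of_nat_mult[symmetric])
      finally show "q ^ (m * 2 ^ k) \<le> exp (- real m)" .
    qed (use B1 M1 in auto)
    finally show ?thesis by (simp add: Q_def h_def)
  qed
  have hl: "(\<lambda>k. H / 2 ^ k) \<longlonglongrightarrow> 0"
    using tendsto_mult[OF tendsto_const LIMSEQ_power_zero[of "1/2::real"], of H] by (simp add: power_divide)
  have "(\<lambda>k. (H / 2 ^ k) powr (1 / 4)) \<longlonglongrightarrow> 0"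
    by (rule tendsto_zero_powrI[OF hl tendsto_const]) (use H in auto)
  then have lim: "(\<lambda>k. Q0 + C * H * (H / 2 ^ k) powr (1 / 4) + exp (- real m) * (B * M)) \<longlonglongrightarrow> Q0 + C * H * 0 + exp (- real m) * (B * M)"
    by (intro tendsto_intros)
  have "\<forall>\<^sub>F k in sequentially. H / 2 ^ k < 1 / 2" using hl by (rule order_tendstoD) simp
  then have "\<forall>\<^sub>F k in sequentially. y T \<le> Q0 + C * H * (H / 2 ^ k) powr (1 / 4) + exp (- real m) * (B * M)"
    by eventually_elim (rule main, simp)
  from tendsto_lowerbound[OF lim this] show ?thesis by (simp add: y_def T_def Q0_def)
qed

end

lemma decay_shift:
  fixes t \<alpha> :: real
  assumes "0 \<le> \<alpha>" "1 \<le> t"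
  shows "t powr (- \<alpha>) \<le> 2 powr \<alpha> * (1 + t) powr (- \<alpha>)"
proof -
  have "t powr (- \<alpha>) \<le> ((1 + t) / 2) powr (- \<alpha>)" using assms by (intro powr_mono2') auto
  also have "\<dots> = 2 powr \<alpha> * (1 + t) powr (- \<alpha>)" using assms by (simp add: powr_divide powr_minus divide_simps)
  finally show ?thesis .
qed

lemma decay_bounded:
  fixes t T \<alpha> :: real
  assumes "0 \<le> \<alpha>" "0 < t" "t \<le> T"
  shows "1 \<le> (1 + T) powr \<alpha> * (1 + t) powr (- \<alpha>)"
proof -
  have "(1 + t) powr \<alpha> \<le> (1 + T) powr \<alpha>" using assms by (intro powr_mono2) auto
  then show ?thesis using assms by (simp add: powr_minus divide_simps)
qed

context mild_solution
begin

text \<open>Both H and m are taken of order sqrt(t - 1). Then H^(-n/2) is at most of order t^(-1/4)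
  because n >= 1, and exp(-m) is bounded by the same power. The rate is not optimal; some algebraic
  rate is all that the later improvement starts from.\<close>

lemma energy_decay:
  obtains C where "1 \<le> C" "\<And>t. 0 < t \<Longrightarrow> (\<integral>x. (v t x)\<^sup>2 \<partial>lborel) \<le> C * (1 + t) powr (- 1 / 4)"
proof -
  let ?n = "real DIM('a)"
  define C1 where "C1 = 2 powr (?n / 2) * M\<^sup>2 + B * M"
  have C1: "1 \<le> C1"
  proof -
    have "1 * 1 \<le> B * M" using B1 M1 by (intro mult_mono) auto
    then show ?thesis by (simp add: C1_def add_increasing)
  qed
  have big: "(\<integral>x. (v t x)\<^sup>2 \<partial>lborel) \<le> C1 * (t - 1) powr (- 1 / 4)" if t: "2 \<le> t" for t
  proof -
    define r where "r = sqrt (t - 1)"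
    have r1: "1 \<le> r" using t by (simp add: r_def)
    define m where "m = nat \<lceil>r\<rceil>"
    have m: "r \<le> real m" "real m \<le> 2 * r" using r1 by (auto simp: m_def) linarith+
    have m0: "0 < real m" using m r1 by linarith
    define H where "H = (t - 1) / real m"
    have rr: "t - 1 = r * r" using t by (simp add: r_def)
    have H2: "r \<le> 2 * H" unfolding H_def rr using m m0 r1 by (simp add: field_simps)
    have H0: "0 < H" using H2 r1 by linarith
    have teq: "t = 1 + real m * H" using m0 by (simp add: H_def)
    have rp: "r powr (- 1 / 2) = (t - 1) powr (- 1 / 4)"
      using t by (simp add: r_def powr_half_sqrt[symmetric] powr_powr)
    have "H powr (- ?n / 2) = 2 powr (?n / 2) * (2 * H) powr (- ?n / 2)"
      using H0 by (simp add: powr_mult powr_minus divide_simps)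
    also have "\<dots> \<le> 2 powr (?n / 2) * (2 * H) powr (- 1 / 2)"
      using H2 r1 DIM_positive[where 'a='a] by (intro mult_left_mono powr_mono) (auto simp: Suc_le_eq)
    also have "\<dots> \<le> 2 powr (?n / 2) * r powr (- 1 / 2)" using H2 r1 by (intro mult_left_mono powr_mono2') auto
    finally have 1: "H powr (- ?n / 2) \<le> 2 powr (?n / 2) * (t - 1) powr (- 1 / 4)" unfolding rp .
    have "exp (- real m) \<le> exp (- r)" using m by simp
    also have "\<dots> \<le> 1 / r"
    proof -
      have "r \<le> exp r" using exp_ge_add_one_self[of r] by linarith
      then show ?thesis using r1 by (simp add: exp_minus field_simps)
    qed
    also have "\<dots> = r powr (- 1)" using r1 by (simp add: powr_minus_divide)
    also have "\<dots> \<le> r powr (- 1 / 2)" using r1 by (intro powr_mono) auto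
    finally have 2: "exp (- real m) \<le> (t - 1) powr (- 1 / 4)" unfolding rp .
    have "(\<integral>x. (v t x)\<^sup>2 \<partial>lborel) \<le> H powr (- ?n / 2) * M\<^sup>2 + exp (- real m) * (B * M)"
      using energy_decay_discrete[OF H0, of m] teq by simp
    also have "\<dots> \<le> (2 powr (?n / 2) * (t - 1) powr (- 1 / 4)) * M\<^sup>2 + (t - 1) powr (- 1 / 4) * (B * M)"
      using 1 2 B1 M1 by (intro add_mono mult_right_mono) auto
    finally show ?thesis by (simp add: C1_def algebra_simps)
  qed
  show ?thesis
  proof (rule that[of "3 * C1"])
    show "1 \<le> 3 * C1" using C1 by simp
    fix t :: real assume t: "0 < t"
    have c3: "(3::real) powr (1 / 4) \<le> 3" using powr_mono[of "1/4" 1 "3::real"] by simp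
    show "(\<integral>x. (v t x)\<^sup>2 \<partial>lborel) \<le> 3 * C1 * (1 + t) powr (- 1 / 4)"
    proof (cases "2 \<le> t")
      case True
      \<comment> \<open>For t >= 2 one has t - 1 >= (1 + t)/3.\<close>
      have "(t - 1) powr (- 1 / 4) \<le> ((1 + t) / 3) powr (- 1 / 4)" using True by (intro powr_mono2') auto
      also have "\<dots> = 3 powr (1 / 4) * (1 + t) powr (- 1 / 4)" using True by (simp add: powr_divide powr_minus divide_simps)
      also have "\<dots> \<le> 3 * (1 + t) powr (- 1 / 4)" using c3 by (intro mult_right_mono) auto
      finally have "C1 * (t - 1) powr (- 1 / 4) \<le> C1 * (3 * (1 + t) powr (- 1 / 4))" using C1 by (intro mult_left_mono) auto
      then show ?thesis using big[OF True] by simp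
    next
      case False
      have "1 \<le> (1 + 2) powr (1 / 4) * (1 + t) powr (- (1 / 4))" by (rule decay_bounded) (use t False in auto)
      also have "\<dots> \<le> 3 * (1 + t) powr (- 1 / 4)" using c3 by (auto intro!: mult_right_mono)
      finally have "C1 * 1 \<le> C1 * (3 * (1 + t) powr (- 1 / 4))" using C1 by (intro mult_left_mono) auto
      moreover have "B * M \<le> C1" by (simp add: C1_def)
      ultimately show ?thesis using v2_le[OF t] by simp
    qed
  qed
qed

text \<open>The values of v are split at the level R = (1 + t)^(-1/8): below it |v|^p <= R^(p - 1)
  |v| uses the L1 bound, above it |v|^p = |v|^(p - 2) v^2 uses the energy. Both parts are then at
  most of order (1 + t)^(-(p - 1)/8); for the second one, \<open>p \<le> 3\<close> ensures 1/4 >= (p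
  - 1)/8.\<close>

lemma F_L1_decay:
  assumes p3: "p \<le> 3"
  obtains C where "1 \<le> C" "\<And>t. 0 < t \<Longrightarrow> (\<integral>x. \<bar>F t x\<bar> \<partial>lborel) \<le> C * (1 + t) powr (- ((p - 1) / 8))"
proof -
  obtain C where C: "1 \<le> C" "\<And>t. 0 < t \<Longrightarrow> (\<integral>x. (v t x)\<^sup>2 \<partial>lborel) \<le> C * (1 + t) powr (- 1 / 4)"
    using energy_decay by blast
  let ?g = "(p - 1) / 8"
  show ?thesis
  proof (rule that[of "M + (B powr (p - 2) + 1) * C"])
    have "0 \<le> (B powr (p - 2) + 1) * C" using C by simp
    then show "1 \<le> M + (B powr (p - 2) + 1) * C" using M1 by linarith
    fix t :: real assume t: "0 < t"
    define R where "R = (1 + t) powr (- 1 / 8)"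
    have R0: "0 < R" using t by (simp add: R_def)
    have pw: "\<bar>F t x\<bar> \<le> R powr (p - 1) * \<bar>v t x\<bar> + (B powr (p - 2) + R powr (p - 2)) * (v t x)\<^sup>2" for x
    proof (cases "v t x = 0")
      case False
      define r where "r = \<bar>v t x\<bar>"
      have r: "0 < r" "r \<le> B" using False vB[OF t] by (auto simp: r_def)
      have e1: "r powr p = r powr (p - 1) * r" using r powr_add[of r "p - 1" 1] by simp
      have e2: "r powr p = r powr (p - 2) * r\<^sup>2" using r powr_add[of r "p - 2" 2] by (simp add: powr_numeral)
      have "r powr p \<le> R powr (p - 1) * r + (B powr (p - 2) + R powr (p - 2)) * r\<^sup>2"
      proof (cases "r \<le> R")
        case True
        then have "r powr p \<le> R powr (p - 1) * r" unfolding e1 using r p1 by (intro mult_right_mono powr_mono2) auto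
        then show ?thesis by (simp add: add_increasing2)
      next
        case False
        \<comment> \<open>For p >= 2 the power increases and is bounded by that of \<open>B\<close>;
          for p < 2 it decreases and is bounded by that of the level \<open>R\<close>.\<close>
        have "r powr (p - 2) \<le> B powr (p - 2) + R powr (p - 2)"
        proof (cases "p \<ge> 2")
          case True
          then have "r powr (p - 2) \<le> B powr (p - 2)" using r by (intro powr_mono2) auto
          then show ?thesis by (simp add: add_increasing2)
        next
          case p2: False
          then have "r powr (p - 2) \<le> R powr (p - 2)" using False R0 by (intro powr_mono2') auto
          then show ?thesis by (simp add: add_increasing)
        qed
        then have "r powr p \<le> (B powr (p - 2) + R powr (p - 2)) * r\<^sup>2" unfolding e2 by (rule mult_right_mono) simp
        then show ?thesis using r by (simp add: add_increasing)
      qed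
      then show ?thesis unfolding abs_fnl r_def by simp
    qed (simp add: fnl_def)
    have i2: "integrable lborel (\<lambda>x. (v t x)\<^sup>2)" unfolding power2_eq_square by (rule integrable_mult_bounded[OF vi[OF t] vm vB[OF t]])
    have "(\<integral>x. \<bar>F t x\<bar> \<partial>lborel) \<le> (\<integral>x. R powr (p - 1) * \<bar>v t x\<bar> + (B powr (p - 2) + R powr (p - 2)) * (v t x)\<^sup>2 \<partial>lborel)"
      by (rule integral_mono[OF _ _ pw]) (use Fi[OF t] vi[OF t] i2 in auto)
    also have "\<dots> = R powr (p - 1) * (\<integral>x. \<bar>v t x\<bar> \<partial>lborel) + (B powr (p - 2) + R powr (p - 2)) * (\<integral>x. (v t x)\<^sup>2 \<partial>lborel)"
      using vi[OF t] i2 by simp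
    also have "\<dots> \<le> R powr (p - 1) * M + (B powr (p - 2) + R powr (p - 2)) * (C * (1 + t) powr (- 1 / 4))"
      using vM[OF t] C(2)[OF t] by (intro add_mono mult_left_mono) auto
    also have "\<dots> = R powr (p - 1) * M + B powr (p - 2) * C * (1 + t) powr (- 1 / 4) + C * (R powr (p - 2) * (1 + t) powr (- 1 / 4))"
      by (simp add: algebra_simps)
    also have "\<dots> \<le> (1 + t) powr (- ?g) * M + B powr (p - 2) * C * (1 + t) powr (- ?g) + C * (1 + t) powr (- ?g)"
    proof (intro add_mono mult_right_mono mult_left_mono)
      show "R powr (p - 1) \<le> (1 + t) powr (- ?g)" by (simp add: R_def powr_powr)
      show "(1 + t) powr (- 1 / 4) \<le> (1 + t) powr (- ?g)" using t p3 by (intro powr_mono) auto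
      have "R powr (p - 2) * (1 + t) powr (- 1 / 4) = (1 + t) powr (- (p / 8))"
        by (simp add: R_def powr_powr powr_add[symmetric] field_simps)
      also have "\<dots> \<le> (1 + t) powr (- ?g)" using t by (intro powr_mono) auto
      finally show "R powr (p - 2) * (1 + t) powr (- 1 / 4) \<le> (1 + t) powr (- ?g)" .
    qed (use M1 C in auto)
    finally show "(\<integral>x. \<bar>F t x\<bar> \<partial>lborel) \<le> (M + (B powr (p - 2) + 1) * C) * (1 + t) powr (- ?g)"
      by (simp add: algebra_simps)
  qed
qed

end

subsection \<open>Pointwise decay\<close>

lemma half_powr_neg:
  fixes t c :: real
  assumes "0 < t"
  shows "(t / 2) powr (- c) = 2 powr c * t powr (- c)"
  using assms by (simp add: powr_divide powr_minus divide_simps)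

context mild_solution
begin

text \<open>On the second half of the time interval the interpolation exponent satisfies n l = 1 -
  \<alpha>: the time integral costs t^(\<alpha>/2), while the decay of the flux in L1 gains t^(-g
  l). The choice \<alpha> = g/(2n) gives g l = 2\<alpha>(1 - \<alpha>) >= 3\<alpha>/2, so the rate
  \<alpha> remains.\<close>

lemma sup_decay_some:
  assumes p3: "p \<le> 3"
  obtains \<alpha> C where "0 < \<alpha>" "\<alpha> \<le> 1 / 2" "1 \<le> C" "\<And>t x. 0 < t \<Longrightarrow> \<bar>v t x\<bar> \<le> C * (1 + t) powr (- \<alpha>)"
proof -
  let ?n = "real DIM('a)"
  have n1: "1 \<le> ?n" using DIM_positive[where 'a='a] by (simp add: Suc_le_eq)
  define g where "g = (p - 1) / 8"
  have g: "0 < g" "g \<le> 1 / 4" using p1 p3 by (auto simp: g_def)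
  define \<alpha> where "\<alpha> = g / (2 * ?n)"
  have \<alpha>: "0 < \<alpha>" "\<alpha> \<le> 1 / 8" "\<alpha> \<le> g"
  proof -
    show "0 < \<alpha>" using g n1 by (simp add: \<alpha>_def)
    have "\<alpha> \<le> g / 2" unfolding \<alpha>_def using g n1 by (intro divide_left_mono) auto
    then show "\<alpha> \<le> 1 / 8" "\<alpha> \<le> g" using g by auto
  qed
  define l where "l = (1 - \<alpha>) / ?n"
  have nl: "?n * l = 1 - \<alpha>" using n1 by (simp add: l_def)
  have l: "0 \<le> l" "l \<le> 1"
  proof -
    show "0 \<le> l" using \<alpha> n1 by (simp add: l_def)
    have "l \<le> (1 - \<alpha>) / 1" unfolding l_def using \<alpha> n1 by (intro divide_left_mono) auto
    then show "l \<le> 1" using \<alpha> by simp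
  qed
  obtain C where C: "1 \<le> C" "\<And>t. 0 < t \<Longrightarrow> (\<integral>x. \<bar>F t x\<bar> \<partial>lborel) \<le> C * (1 + t) powr (- g)"
    using F_L1_decay[OF p3] unfolding g_def by blast
  let ?U = "\<integral>x. \<bar>u0 x\<bar> \<partial>lborel"
  define D where "D = CF + 1"
  have D1: "1 \<le> D" using CF0 by (simp add: D_def)
  define K where "K = kap a * (2 powr (1 / 2 + ?n / 2) * C / (1 - g) + C * D * 2 powr (g * l) * (2 / \<alpha>))"
  have K0: "0 \<le> K" using C D1 g \<alpha> by (simp add: K_def)
  have big: "\<bar>v t x\<bar> \<le> (?U + K) * t powr (- \<alpha>)" if t: "1 \<le> t" for t x
  proof -
    have t0: "0 < t" using t by simp
    have 1: "\<bar>heat t u0 x\<bar> \<le> ?U * t powr (- \<alpha>)"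
    proof -
      have "\<bar>heat t u0 x\<bar> \<le> t powr (- ?n / 2) * ?U" by (rule heat_sup_L1[OF t0 u0])
      also have "\<dots> \<le> t powr (- \<alpha>) * ?U"
      proof (intro mult_right_mono powr_mono)
        show "- ?n / 2 \<le> - \<alpha>" using \<alpha> n1 by linarith
      qed (use t in auto)
      finally show ?thesis by (simp add: mult.commute)
    qed
    have "\<bar>Du a F t x\<bar> \<le> kap a * ((t / 2) powr (- 1 / 2 - ?n / 2) * C * t powr (1 - g) / (1 - g)
      + (C * D * (t / 2) powr (- (g * l))) * t powr ((1 - ?n * l) / 2) * (2 / (1 - ?n * l)))"
    proof (rule Du_sup_split[OF Fj t0, where \<alpha> = "\<lambda>s. C * (1 + s) powr (- g)" and \<beta> = "\<lambda>s. D"])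
      show "C * (1 + s) powr (- g) \<le> C * s powr (- g)" if "0 < s" "s < t / 2" for s
        using that C g by (intro mult_left_mono powr_mono2') auto
      show "(C * (1 + s) powr (- g)) powr l * D powr (1 - l) \<le> C * D * (t / 2) powr (- (g * l))" if s: "t / 2 \<le> s" "s < t" for s
      proof -
        have "(C * (1 + s) powr (- g)) powr l * D powr (1 - l) = C powr l * D powr (1 - l) * (1 + s) powr (- (g * l))"
          using C by (simp add: powr_mult powr_powr)
        also have "\<dots> \<le> C powr 1 * D powr 1 * (t / 2) powr (- (g * l))"
          using C D1 l s t0 g by (intro mult_mono powr_mono powr_mono2') auto
        finally show ?thesis using C D1 by simp
      qed
      show "\<bar>F s x\<bar> \<le> D" if "0 < s" "s < t" for s x using FB[OF that(1), of x] unfolding D_def by linarith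
    qed (use Fi C D1 l nl g \<alpha> in auto)
    also have "\<dots> = kap a * (2 powr (1 / 2 + ?n / 2) * C / (1 - g) * (t powr (- (1 / 2 + ?n / 2)) * t powr (1 - g))
       + C * D * 2 powr (g * l) * (2 / \<alpha>) * (t powr (- (g * l)) * t powr (\<alpha> / 2)))"
    proof -
      have e: "- 1 / 2 - ?n / 2 = - (1 / 2 + ?n / 2)" "1 - ?n * l = \<alpha>" using nl by auto
      show ?thesis unfolding e half_powr_neg[OF t0] by (simp add: mult_ac)
    qed
    also have "\<dots> \<le> kap a * (2 powr (1 / 2 + ?n / 2) * C / (1 - g) * t powr (- \<alpha>) + C * D * 2 powr (g * l) * (2 / \<alpha>) * t powr (- \<alpha>))"
    proof (intro mult_left_mono add_mono)
      have "t powr (- (1 / 2 + ?n / 2)) * t powr (1 - g) = t powr (1 / 2 - ?n / 2 - g)"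
        unfolding powr_add[symmetric] by (rule arg_cong[where f = "\<lambda>e. t powr e"]) simp
      also have "\<dots> \<le> t powr (- \<alpha>)"
      proof (rule powr_mono)
        show "1 / 2 - ?n / 2 - g \<le> - \<alpha>" using n1 \<alpha> by linarith
      qed (use t in auto)
      finally show "t powr (- (1 / 2 + ?n / 2)) * t powr (1 - g) \<le> t powr (- \<alpha>)" .
      have gl: "g * l = 2 * \<alpha> * (1 - \<alpha>)" using n1 by (simp add: l_def \<alpha>_def)
      have "3 / 2 * \<alpha> \<le> g * l"
      proof -
        have "2 * \<alpha> * (3 / 4) \<le> 2 * \<alpha> * (1 - \<alpha>)" using \<alpha> by (intro mult_left_mono) auto
        then show ?thesis unfolding gl by simp
      qed
      then have "t powr (- (g * l) + \<alpha> / 2) \<le> t powr (- \<alpha>)" using t by (intro powr_mono) auto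
      then show "t powr (- (g * l)) * t powr (\<alpha> / 2) \<le> t powr (- \<alpha>)" by (simp add: powr_add[symmetric])
    qed (use C D1 g \<alpha> in auto)
    also have "\<dots> = K * t powr (- \<alpha>)" by (simp add: K_def algebra_simps)
    finally have 2: "\<bar>Du a F t x\<bar> \<le> K * t powr (- \<alpha>)" .
    show ?thesis using 1 2 eqn[OF t0, of x] by (simp add: algebra_simps)
  qed
  define E where "E = ?U + K + B"
  have "0 \<le> ?U" by simp
  then have E: "1 \<le> E" "?U + K \<le> E" "B \<le> E" using K0 B1 unfolding E_def by linarith+
  show ?thesis
  proof (rule that[of \<alpha> "2 * E"])
    show "1 \<le> 2 * E" using E by simp
    fix t :: real and x assume t: "0 < t"
    have c2: "(2::real) powr \<alpha> \<le> 2" using \<alpha> powr_mono[of \<alpha> 1 "2::real"] by simp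
    show "\<bar>v t x\<bar> \<le> 2 * E * (1 + t) powr (- \<alpha>)"
    proof (cases "1 \<le> t")
      case True
      have "\<bar>v t x\<bar> \<le> (?U + K) * t powr (- \<alpha>)" by (rule big[OF True])
      also have "\<dots> \<le> E * (2 powr \<alpha> * (1 + t) powr (- \<alpha>))"
        using E \<alpha> True by (intro mult_mono decay_shift) auto
      also have "\<dots> \<le> E * (2 * (1 + t) powr (- \<alpha>))"
        using E c2 by (intro mult_left_mono mult_right_mono) auto
      finally show ?thesis by (simp add: mult_ac)
    next
      case False
      have "1 \<le> (1 + 1) powr \<alpha> * (1 + t) powr (- \<alpha>)" by (rule decay_bounded) (use t False \<alpha> in auto)
      also have "\<dots> \<le> 2 * (1 + t) powr (- \<alpha>)" using c2 by (auto intro!: mult_right_mono)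
      finally have "E * 1 \<le> E * (2 * (1 + t) powr (- \<alpha>))" using E by (intro mult_left_mono) auto
      also have "\<dots> = 2 * E * (1 + t) powr (- \<alpha>)" by simp
      finally show ?thesis using vB[OF t, of x] E by linarith
    qed
  qed (use \<alpha> in auto)
qed

text \<open>If v decays at the rate n/2 with constant m, Duhamel's integral returns this rate with a
  surplus and is only linear in m. For this p - 1 = 1/n + r is split: the part 1/n is paid by the
  hypothesis, the part r > 0 by the known rate \<alpha>, which gains \<eta> = \<alpha> r with a
  constant independent of m. This is where p > 1 + 1/n is decisive.\<close>

lemma sup_decay_improve:
  assumes \<rho>: "1 / real DIM('a) < p - 1" "p \<le> 3 / 2 + 1 / real DIM('a)"
  obtains C \<eta> where "0 < \<eta>" "1 \<le> C"
    "\<And>T m t x. 1 \<le> m \<Longrightarrow> (\<And>s x. 0 < s \<Longrightarrow> s \<le> T \<Longrightarrow> \<bar>v s x\<bar> \<le> m * (1 + s) powr (- real DIM('a) / 2)) \<Longrightarrow>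
       1 \<le> t \<Longrightarrow> t \<le> T \<Longrightarrow> \<bar>v t x\<bar> \<le> C * t powr (- real DIM('a) / 2) + C * m * t powr (- real DIM('a) / 2 - \<eta> / 2)"
proof -
  let ?n = "real DIM('a)"
  have n1: "1 \<le> ?n" using DIM_positive[where 'a='a] by (simp add: Suc_le_eq)
  have n1': "1 / ?n \<le> 1" using n1 by simp
  have p3: "p \<le> 3" using \<rho> n1' by linarith
  obtain \<alpha> C0 where \<alpha>: "0 < \<alpha>" "\<alpha> \<le> 1 / 2" and C0: "1 \<le> C0" and V0: "\<And>t x. 0 < t \<Longrightarrow> \<bar>v t x\<bar> \<le> C0 * (1 + t) powr (- \<alpha>)"
    using sup_decay_some[OF p3] by blast
  define r where "r = p - 1 - 1 / ?n"
  have r: "0 < r" "r \<le> 1 / 2" using \<rho> by (auto simp: r_def)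
  define \<eta> where "\<eta> = \<alpha> * r"
  have \<eta>: "0 < \<eta>" "\<eta> \<le> 1 / 4"
  proof -
    show "0 < \<eta>" using \<alpha> r by (simp add: \<eta>_def)
    have "\<alpha> * r \<le> (1 / 2) * (1 / 2)" using \<alpha> r by (intro mult_mono) auto
    then show "\<eta> \<le> 1 / 4" by (simp add: \<eta>_def)
  qed
  \<comment> \<open>Just below 1/n, so that the time integral converges and consumes only
    t^(\<eta>/2) of the gain t^(-\<eta>).\<close>
  define l where "l = (1 - \<eta>) / ?n"
  have nl: "?n * l = 1 - \<eta>" using n1 by (simp add: l_def)
  have l: "0 \<le> l" "l \<le> 1 / ?n" "l \<le> 1"
  proof -
    show "0 \<le> l" using \<eta> n1 by (simp add: l_def)
    show l1: "l \<le> 1 / ?n" unfolding l_def using \<eta> n1 by (intro divide_right_mono) auto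
    show "l \<le> 1" by (rule order_trans[OF l1 n1'])
  qed
  have C0r: "C0 powr e \<le> C0 powr p" if "e \<le> p" for e using that C0 by (intro powr_mono) auto
  have C0p: "1 \<le> C0 powr p" using C0 p1 by (simp add: ge_one_powr_ge_zero)
  let ?U = "\<integral>x. \<bar>u0 x\<bar> \<partial>lborel"
  define K where "K = kap a * (2 powr (1 / 2 + ?n / 2) * (M * C0 powr p) / (1 / 2 - \<eta>) + M * C0 powr p * 2 powr (?n / 2 + \<eta>) * (2 / \<eta>))"
  have K0: "0 \<le> K" using M1 \<eta> by (simp add: K_def)
  have main: "\<bar>v t x\<bar> \<le> ?U * t powr (- ?n / 2) + K * m * t powr (- ?n / 2 - \<eta> / 2)"
    if m: "1 \<le> m" and H: "\<And>s x. 0 < s \<Longrightarrow> s \<le> T \<Longrightarrow> \<bar>v s x\<bar> \<le> m * (1 + s) powr (- ?n / 2)" and t: "1 \<le> t" "t \<le> T" for T m t x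
  proof -
    have t0: "0 < t" using t by simp
    \<comment> \<open>The minimum allows each power of |v| to be estimated by whichever of the two
      decay rates is convenient.\<close>
    define V where "V = (\<lambda>s. min (m * (1 + s) powr (- ?n / 2)) (C0 * (1 + s) powr (- \<alpha>)))"
    have V: "0 < V s" "V s \<le> m * (1 + s) powr (- ?n / 2)" "V s \<le> C0 * (1 + s) powr (- \<alpha>)" if "0 < s" for s
      using that m C0 by (auto simp: V_def)
    have vV: "\<bar>v s x\<bar> \<le> V s" if "0 < s" "s < t" for s x
      using V0[OF that(1), of x] H[of s x] that t by (auto simp: V_def)
    have sn: "s powr (p - 1) = s powr (1 / ?n) * s powr r" for s :: real by (simp add: r_def powr_add[symmetric])
    have FV: "\<bar>F s x\<bar> \<le> V s powr p" if "0 < s" "s < t" for s x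
      unfolding abs_fnl using vV[OF that] p1 by (intro powr_mono2) auto
    have FVL: "(\<integral>x. \<bar>F s x\<bar> \<partial>lborel) \<le> M * V s powr (p - 1)" if s: "0 < s" "s < t" for s
    proof -
      have "(\<integral>x. \<bar>F s x\<bar> \<partial>lborel) \<le> (\<integral>x. V s powr (p - 1) * \<bar>v s x\<bar> \<partial>lborel)"
      proof (rule integral_mono)
        fix x
        have "\<bar>F s x\<bar> = \<bar>v s x\<bar> powr (p - 1) * \<bar>v s x\<bar>" by (simp add: fnl_def abs_mult)
        also have "\<dots> \<le> V s powr (p - 1) * \<bar>v s x\<bar>" using vV[OF s] p1 by (intro mult_right_mono powr_mono2) auto
        finally show "\<bar>F s x\<bar> \<le> V s powr (p - 1) * \<bar>v s x\<bar>" .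
      qed (use Fi[OF s(1)] vi[OF s(1)] in auto)
      also have "\<dots> \<le> V s powr (p - 1) * M" using vM[OF s(1)] by (simp add: mult_left_mono)
      finally show ?thesis by (simp add: mult.commute)
    qed
    have "\<bar>Du a F t x\<bar> \<le> kap a * ((t / 2) powr (- 1 / 2 - ?n / 2) * (M * C0 powr p * m) * t powr (1 - (1 / 2 + \<eta>)) / (1 - (1 / 2 + \<eta>))
      + (M * C0 powr p * m * (t / 2) powr (- (?n / 2 + \<eta>))) * t powr ((1 - ?n * l) / 2) * (2 / (1 - ?n * l)))"
    proof (rule Du_sup_split[OF Fj t0, where \<alpha> = "\<lambda>s. M * V s powr (p - 1)" and \<beta> = "\<lambda>s. V s powr p"])
      fix s :: real assume s: "0 < s" "s < t / 2"
      have "V s powr (p - 1) \<le> (m * (1 + s) powr (- ?n / 2)) powr (1 / ?n) * (C0 * (1 + s) powr (- \<alpha>)) powr r"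
        unfolding sn using V[OF s(1)] r n1 by (intro mult_mono powr_mono2) auto
      also have "\<dots> = m powr (1 / ?n) * C0 powr r * ((1 + s) powr (- (1 / 2)) * (1 + s) powr (- \<eta>))"
        using m C0 n1 by (simp add: powr_mult powr_powr \<eta>_def)
      also have "\<dots> = m powr (1 / ?n) * C0 powr r * (1 + s) powr (- (1 / 2 + \<eta>))"
        by (simp add: powr_add[symmetric])
      also have "\<dots> \<le> m powr 1 * C0 powr p * s powr (- (1 / 2 + \<eta>))"
      proof (intro mult_mono C0r powr_mono powr_mono2')
        have "0 < 1 / ?n" using n1 by simp
        then show "r \<le> p" unfolding r_def by linarith
        show "1 / ?n \<le> 1" by (rule n1')
      qed (use m s \<eta> in auto)
      finally have "M * V s powr (p - 1) \<le> M * (m powr 1 * C0 powr p * s powr (- (1 / 2 + \<eta>)))" using M1 by (intro mult_left_mono) auto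
      then show "M * V s powr (p - 1) \<le> M * C0 powr p * m * s powr (- (1 / 2 + \<eta>))" using m by (simp add: mult_ac)
    next
      fix s :: real assume s: "t / 2 \<le> s" "s < t"
      have s0: "0 < s" using s t by linarith
      have "(M * V s powr (p - 1)) powr l * (V s powr p) powr (1 - l) = M powr l * (V s powr ((p - 1) * l) * V s powr (p * (1 - l)))"
        using M1 by (simp add: powr_mult powr_powr)
      \<comment> \<open>The interpolated exponent is p - l = 1 + (p - 1 - l). One full power takes
        the rate n/2 with constant m; the rest, at least r, takes the rate \<alpha>.\<close>
      also have "V s powr ((p - 1) * l) * V s powr (p * (1 - l)) = V s powr 1 * V s powr (p - 1 - l)"
        unfolding powr_add[symmetric] by (simp add: algebra_simps)
      also have "M powr l * (V s powr 1 * V s powr (p - 1 - l)) \<le> M powr 1 * ((m * (t / 2) powr (- (?n / 2))) * (C0 powr p * (t / 2) powr (- \<eta>)))"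
      proof (intro mult_mono powr_mono)
        have "V s powr 1 \<le> m * (1 + s) powr (- ?n / 2)" using V[OF s0] by simp
        also have "\<dots> \<le> m * (t / 2) powr (- (?n / 2))" using m s t0 powr_mono2'[of "- ?n / 2" "t / 2" "1 + s"] by (intro mult_left_mono) auto
        finally show "V s powr 1 \<le> m * (t / 2) powr (- (?n / 2))" .
        have e: "r \<le> p - 1 - l" using l by (simp add: r_def)
        have "V s powr (p - 1 - l) \<le> (C0 * (1 + s) powr (- \<alpha>)) powr (p - 1 - l)" using V[OF s0] e r by (intro powr_mono2) auto
        also have "\<dots> = C0 powr (p - 1 - l) * (1 + s) powr (- (\<alpha> * (p - 1 - l)))" using C0 by (simp add: powr_mult powr_powr)
        also have "\<dots> \<le> C0 powr p * (1 + s) powr (- \<eta>)"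
        proof (intro mult_mono C0r powr_mono)
          have "\<alpha> * r \<le> \<alpha> * (p - 1 - l)" using e \<alpha> by (intro mult_left_mono) auto
          then show "- (\<alpha> * (p - 1 - l)) \<le> - \<eta>" by (simp add: \<eta>_def)
        qed (use l s0 in auto)
        also have "\<dots> \<le> C0 powr p * (t / 2) powr (- \<eta>)" using s t0 \<eta> by (intro mult_left_mono powr_mono2') auto
        finally show "V s powr (p - 1 - l) \<le> C0 powr p * (t / 2) powr (- \<eta>)" .
      qed (use M1 m l in auto)
      also have "\<dots> = M * C0 powr p * m * ((t / 2) powr (- (?n / 2)) * (t / 2) powr (- \<eta>))" using M1 by simp
      also have "(t / 2) powr (- (?n / 2)) * (t / 2) powr (- \<eta>) = (t / 2) powr (- (?n / 2 + \<eta>))" by (simp add: powr_add[symmetric])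
      finally show "(M * V s powr (p - 1)) powr l * (V s powr p) powr (1 - l) \<le> M * C0 powr p * m * (t / 2) powr (- (?n / 2 + \<eta>))" .
    qed (use FV FVL Fi l nl \<eta> M1 m in auto)
    also have "\<dots> = kap a * m * (2 powr (1 / 2 + ?n / 2) * (M * C0 powr p) / (1 / 2 - \<eta>) * (t powr (- (1 / 2 + ?n / 2)) * t powr (1 / 2 - \<eta>))
       + M * C0 powr p * 2 powr (?n / 2 + \<eta>) * (2 / \<eta>) * (t powr (- (?n / 2 + \<eta>)) * t powr (\<eta> / 2)))"
    proof -
      have e: "- 1 / 2 - ?n / 2 = - (1 / 2 + ?n / 2)" "1 - ?n * l = \<eta>" "1 - (1 / 2 + \<eta>) = 1 / 2 - \<eta>" using nl by auto
      show ?thesis unfolding e half_powr_neg[OF t0] by (simp add: algebra_simps)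
    qed
    also have "\<dots> \<le> kap a * m * (2 powr (1 / 2 + ?n / 2) * (M * C0 powr p) / (1 / 2 - \<eta>) * t powr (- ?n / 2 - \<eta> / 2)
       + M * C0 powr p * 2 powr (?n / 2 + \<eta>) * (2 / \<eta>) * t powr (- ?n / 2 - \<eta> / 2))"
    proof (intro mult_left_mono add_mono)
      have "t powr (- (1 / 2 + ?n / 2) + (1 / 2 - \<eta>)) \<le> t powr (- ?n / 2 - \<eta> / 2)" using t \<eta> by (intro powr_mono) auto
      then show "t powr (- (1 / 2 + ?n / 2)) * t powr (1 / 2 - \<eta>) \<le> t powr (- ?n / 2 - \<eta> / 2)" unfolding powr_add .
      have "t powr (- (?n / 2 + \<eta>) + \<eta> / 2) \<le> t powr (- ?n / 2 - \<eta> / 2)" using t \<eta> by (intro powr_mono) auto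
      then show "t powr (- (?n / 2 + \<eta>)) * t powr (\<eta> / 2) \<le> t powr (- ?n / 2 - \<eta> / 2)" unfolding powr_add .
    qed (use M1 m \<eta> in auto)
    also have "\<dots> = K * m * t powr (- ?n / 2 - \<eta> / 2)" by (simp add: K_def algebra_simps)
    finally have 2: "\<bar>Du a F t x\<bar> \<le> K * m * t powr (- ?n / 2 - \<eta> / 2)" .
    have 1: "\<bar>heat t u0 x\<bar> \<le> ?U * t powr (- ?n / 2)" using heat_sup_L1[OF t0 u0, of x] by (simp add: mult.commute)
    show ?thesis using 1 2 eqn[OF t0, of x] by linarith
  qed
  show ?thesis
  proof (rule that[of \<eta> "1 + ?U + K"])
    have U0: "0 \<le> ?U" by simp
    show "1 \<le> 1 + ?U + K" using U0 K0 by linarith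
    fix T m t :: real and x
    assume a: "1 \<le> m" "\<And>s x. 0 < s \<Longrightarrow> s \<le> T \<Longrightarrow> \<bar>v s x\<bar> \<le> m * (1 + s) powr (- ?n / 2)" "1 \<le> t" "t \<le> T"
    have "\<bar>v t x\<bar> \<le> ?U * t powr (- ?n / 2) + K * m * t powr (- ?n / 2 - \<eta> / 2)" by (rule main[OF a])
    also have "\<dots> \<le> (1 + ?U + K) * t powr (- ?n / 2) + (1 + ?U + K) * m * t powr (- ?n / 2 - \<eta> / 2)"
      using U0 K0 a by (intro add_mono mult_right_mono) auto
    finally show "\<bar>v t x\<bar> \<le> (1 + ?U + K) * t powr (- ?n / 2) + (1 + ?U + K) * m * t powr (- ?n / 2 - \<eta> / 2)" .
  qed (use \<eta> in auto)
qed

text \<open>Beyond a time \<open>t0\<close> the surplus decay makes the coefficient of m at most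
  1/2, and before \<open>t0\<close> the bound by \<open>B\<close> suffices; so a valid constant m
  may be replaced by D + m/2. On each bounded time interval some constant is valid, and iteration
  brings it down to 2D + 1, which no longer depends on the interval.\<close>

lemma sup_decay:
  assumes \<rho>: "1 / real DIM('a) < p - 1" "p \<le> 3 / 2 + 1 / real DIM('a)"
  obtains C where "1 \<le> C" "\<And>t x. 0 < t \<Longrightarrow> \<bar>v t x\<bar> \<le> C * (1 + t) powr (- real DIM('a) / 2)"
proof -
  let ?n = "real DIM('a)"
  obtain C \<eta> where \<eta>: "0 < \<eta>" and C: "1 \<le> C" and
    imp: "\<And>T m t x. 1 \<le> m \<Longrightarrow> (\<And>s x. 0 < s \<Longrightarrow> s \<le> T \<Longrightarrow> \<bar>v s x\<bar> \<le> m * (1 + s) powr (- ?n / 2)) \<Longrightarrow>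
       1 \<le> t \<Longrightarrow> t \<le> T \<Longrightarrow> \<bar>v t x\<bar> \<le> C * t powr (- ?n / 2) + C * m * t powr (- ?n / 2 - \<eta> / 2)"
    using sup_decay_improve[OF \<rho>] by metis
  let ?g = "2 powr (?n / 2)"
  \<comment> \<open>Solves 2^(n/2) C t0^(-\<eta>/2) = 1/2, where 2^(n/2) is the price of passing
    from s to 1 + s.\<close>
  define t0 where "t0 = (2 * ?g * C) powr (2 / \<eta>)"
  have gC: "1 \<le> 2 * ?g * C"
  proof -
    have "1 \<le> ?g" by (simp add: ge_one_powr_ge_zero)
    then have "1 * 1 \<le> ?g * C" using C by (intro mult_mono) auto
    then show ?thesis by simp
  qed
  have t01: "1 \<le> t0" unfolding t0_def using gC \<eta> by (simp add: ge_one_powr_ge_zero)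
  have small: "?g * C * t powr (- \<eta> / 2) \<le> 1 / 2" if t: "t0 \<le> t" for t
  proof -
    have "t powr (- \<eta> / 2) \<le> t0 powr (- \<eta> / 2)" using t t01 \<eta> by (intro powr_mono2') auto
    also have "\<dots> = 1 / (2 * ?g * C)" unfolding t0_def powr_powr using gC \<eta> by (simp add: powr_minus_divide)
    finally have "?g * C * t powr (- \<eta> / 2) \<le> ?g * C * (1 / (2 * ?g * C))" using C by (intro mult_left_mono) auto
    also have "\<dots> = 1 / 2" using C by (simp add: field_simps)
    finally show ?thesis .
  qed
  define D where "D = ?g * C + B * (1 + t0) powr (?n / 2)"
  have gc0: "0 \<le> ?g * C" using C by simp
  have bt: "1 * 1 \<le> B * (1 + t0) powr (?n / 2)" using B1 t01 by (intro mult_mono ge_one_powr_ge_zero) auto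
  have D1: "1 \<le> D" using gc0 bt by (simp add: D_def)
  define S where "S = (\<lambda>T m. \<forall>s x. 0 < s \<longrightarrow> s \<le> T \<longrightarrow> \<bar>v s x\<bar> \<le> m * (1 + s) powr (- ?n / 2))"
  have step: "S T (D + m / 2)" if m: "1 \<le> m" and S: "S T m" for T m
    unfolding S_def
  proof (intro allI impI)
    fix s :: real and x assume s: "0 < s" "s \<le> T"
    show "\<bar>v s x\<bar> \<le> (D + m / 2) * (1 + s) powr (- ?n / 2)"
    proof (cases "t0 \<le> s")
      case True
      have s1: "1 \<le> s" using True t01 by simp
      have sh: "s powr (- ?n / 2) \<le> ?g * (1 + s) powr (- ?n / 2)" using decay_shift[OF _ s1, of "?n / 2"] by simp
      have "\<bar>v s x\<bar> \<le> C * s powr (- ?n / 2) + C * m * s powr (- ?n / 2 - \<eta> / 2)"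
        by (rule imp[OF m _ s1 s(2)]) (use S in \<open>auto simp: S_def\<close>)
      also have "s powr (- ?n / 2 - \<eta> / 2) = s powr (- ?n / 2) * s powr (- \<eta> / 2)" by (simp add: powr_add[symmetric])
      also have "C * s powr (- ?n / 2) + C * m * (s powr (- ?n / 2) * s powr (- \<eta> / 2)) = (C + C * m * s powr (- \<eta> / 2)) * s powr (- ?n / 2)"
        by (simp add: algebra_simps)
      also have "\<dots> \<le> (C + C * m * s powr (- \<eta> / 2)) * (?g * (1 + s) powr (- ?n / 2))" using C m sh by (intro mult_left_mono) auto
      also have "\<dots> = (?g * C + m * (?g * C * s powr (- \<eta> / 2))) * (1 + s) powr (- ?n / 2)" by (simp add: algebra_simps)
      also have "\<dots> \<le> (D + m * (1 / 2)) * (1 + s) powr (- ?n / 2)"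
      proof (intro mult_right_mono add_mono mult_left_mono)
        show "?g * C \<le> D" using bt by (simp add: D_def)
      qed (use small[OF True] m in auto)
      finally show ?thesis by simp
    next
      case False
      have "1 \<le> (1 + t0) powr (?n / 2) * (1 + s) powr (- (?n / 2))" by (rule decay_bounded) (use s False in auto)
      then have "B * 1 \<le> B * ((1 + t0) powr (?n / 2) * (1 + s) powr (- (?n / 2)))" using B1 by (intro mult_left_mono) auto
      also have "\<dots> = B * (1 + t0) powr (?n / 2) * (1 + s) powr (- ?n / 2)" by simp
      also have "\<dots> \<le> (D + m / 2) * (1 + s) powr (- ?n / 2)"
        using gc0 m by (intro mult_right_mono) (auto simp: D_def)
      finally show ?thesis using vB[OF s(1), of x] by simp
    qed
  qed
  show ?thesis
  proof (rule that[of "2 * D + 1"])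
    show "1 \<le> 2 * D + 1" using D1 by simp
    fix t :: real and x assume t: "0 < t"
    \<comment> \<open>A constant that is valid on (0, t] merely because v is bounded by
      \<open>B\<close>.\<close>
    define m0 where "m0 = B * (1 + t) powr (?n / 2)"
    have m0: "0 \<le> m0" using B1 by (simp add: m0_def)
    have it: "S t (2 * D + m0 / 2 ^ k)" for k :: nat
    proof (induction k)
      case 0
      show ?case unfolding S_def
      proof (intro allI impI)
        fix s :: real and x assume s: "0 < s" "s \<le> t"
        have "1 \<le> (1 + t) powr (?n / 2) * (1 + s) powr (- (?n / 2))" by (rule decay_bounded) (use s in auto)
        then have "B * 1 \<le> B * ((1 + t) powr (?n / 2) * (1 + s) powr (- (?n / 2)))" using B1 by (intro mult_left_mono) auto
        also have "\<dots> = m0 * (1 + s) powr (- ?n / 2)" by (simp add: m0_def)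
        also have "\<dots> \<le> (2 * D + m0 / 2 ^ 0) * (1 + s) powr (- ?n / 2)" using D1 by (intro mult_right_mono) auto
        finally show "\<bar>v s x\<bar> \<le> (2 * D + m0 / 2 ^ 0) * (1 + s) powr (- ?n / 2)" using vB[OF s(1), of x] by simp
      qed
    next
      case (Suc k)
      have "0 \<le> m0 / 2 ^ k" using m0 by simp
      then have "S t (D + (2 * D + m0 / 2 ^ k) / 2)" using D1 by (intro step[OF _ Suc]) linarith
      moreover have "D + (2 * D + m0 / 2 ^ k) / 2 = 2 * D + m0 / 2 ^ Suc k" by simp
      ultimately show ?case by simp
    qed
    obtain k :: nat where k: "m0 < 2 ^ k" using real_arch_pow[of 2 m0] by auto
    have "\<bar>v t x\<bar> \<le> (2 * D + m0 / 2 ^ k) * (1 + t) powr (- ?n / 2)" using it[of k] t by (simp add: S_def)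
    also have "\<dots> \<le> (2 * D + 1) * (1 + t) powr (- ?n / 2)" using k by (intro mult_right_mono) (auto simp: field_simps)
    finally show "\<bar>v t x\<bar> \<le> (2 * D + 1) * (1 + t) powr (- ?n / 2)" .
  qed
qed

end

subsection \<open>Self-similarity\<close>

lemma gauss_scale:
  fixes x :: "'a::euclidean_space"
  assumes c: "0 < c"
  shows "gauss (c * t) (sqrt c *\<^sub>R x) = c powr (- real DIM('a) / 2) * gauss t x"
    and "dgauss a (c * t) (sqrt c *\<^sub>R x) = c powr (- 1 / 2) * c powr (- real DIM('a) / 2) * dgauss a t x"
proof -
  have "(4 * pi * (c * t)) powr (- real DIM('a) / 2) = c powr (- real DIM('a) / 2) * (4 * pi * t) powr (- real DIM('a) / 2)"
    using c powr_mult[of c "4 * pi * t" "- real DIM('a) / 2"] by (simp add: mult_ac)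
  moreover have "(norm (sqrt c *\<^sub>R x))\<^sup>2 / (4 * (c * t)) = (norm x)\<^sup>2 / (4 * t)"
    using c by (simp add: power_mult_distrib)
  ultimately show 1: "gauss (c * t) (sqrt c *\<^sub>R x) = c powr (- real DIM('a) / 2) * gauss t x"
    by (simp add: gauss_def)
  have "sqrt c / c = c powr (- 1 / 2)" using c by (simp add: powr_minus_divide powr_half_sqrt field_simps)
  then have "(a \<bullet> (sqrt c *\<^sub>R x)) / (2 * (c * t)) = c powr (- 1 / 2) * ((a \<bullet> x) / (2 * t))"
    by (metis (no_types, lifting) inner_scaleR_right mult.commute mult.left_commute times_divide_times_eq)
  then show "dgauss a (c * t) (sqrt c *\<^sub>R x) = c powr (- 1 / 2) * c powr (- real DIM('a) / 2) * dgauss a t x"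
    unfolding dgauss_def 1 by simp
qed

text \<open>Under y -> sqrt(c) y and s -> c s the kernel contributes c^(-1/2 - n/2), the volume
  c^(n/2) and the time element c, hence the gain of 1/2 over the exponent -e of the forcing.\<close>

lemma Du_scale:
  fixes a :: "'a::euclidean_space"
  assumes c: "0 < c" and m: "\<And>s. \<phi> s \<in> borel_measurable borel"
    and \<phi>: "\<And>s y. 0 < s \<Longrightarrow> s < t \<Longrightarrow> \<phi> (c * s) (sqrt c *\<^sub>R y) = c powr (- e) * \<phi> s y"
  shows "Du a \<phi> (c * t) (sqrt c *\<^sub>R x) = c powr (1 / 2 - e) * Du a \<phi> t x"
proof -
  have cv: "conv (dgauss a (c * t - c * s)) (\<phi> (c * s)) (sqrt c *\<^sub>R x) = c powr (- 1 / 2 - e) * conv (dgauss a (t - s)) (\<phi> s) x"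
    if s: "0 < s" "s < t" for s
  proof -
    have "conv (dgauss a (c * t - c * s)) (\<phi> (c * s)) (sqrt c *\<^sub>R x)
       = \<bar>sqrt c\<bar> ^ DIM('a) * (\<integral>y. dgauss a (c * t - c * s) (sqrt c *\<^sub>R x - (0 + sqrt c *\<^sub>R y)) * \<phi> (c * s) (0 + sqrt c *\<^sub>R y) \<partial>lborel)"
      unfolding conv_def by (rule integral_lborel_affine) (use m c in auto)
    also have "(\<integral>y. dgauss a (c * t - c * s) (sqrt c *\<^sub>R x - (0 + sqrt c *\<^sub>R y)) * \<phi> (c * s) (0 + sqrt c *\<^sub>R y) \<partial>lborel)
       = (\<integral>y. (c powr (- 1 / 2) * c powr (- real DIM('a) / 2) * c powr (- e)) * (dgauss a (t - s) (x - y) * \<phi> s y) \<partial>lborel)"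
    proof (rule Bochner_Integration.integral_cong[OF refl])
      fix y
      have "dgauss a (c * t - c * s) (sqrt c *\<^sub>R x - (0 + sqrt c *\<^sub>R y)) = dgauss a (c * (t - s)) (sqrt c *\<^sub>R (x - y))"
        by (simp add: algebra_simps)
      then show "dgauss a (c * t - c * s) (sqrt c *\<^sub>R x - (0 + sqrt c *\<^sub>R y)) * \<phi> (c * s) (0 + sqrt c *\<^sub>R y)
         = (c powr (- 1 / 2) * c powr (- real DIM('a) / 2) * c powr (- e)) * (dgauss a (t - s) (x - y) * \<phi> s y)"
        using \<phi>[OF s, of y] by (simp only: gauss_scale[OF c] add_0 mult_ac)
    qed
    also have "\<dots> = c powr (- 1 / 2) * c powr (- real DIM('a) / 2) * c powr (- e) * conv (dgauss a (t - s)) (\<phi> s) x"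
      by (simp add: conv_def)
    also have "\<bar>sqrt c\<bar> ^ DIM('a) = c powr (real DIM('a) / 2)"
      using c by (simp add: powr_half_sqrt[symmetric] powr_power)
    also have "c powr (real DIM('a) / 2) * (c powr (- 1 / 2) * c powr (- real DIM('a) / 2) * c powr (- e) * conv (dgauss a (t - s)) (\<phi> s) x)
       = (c powr (real DIM('a) / 2) * c powr (- 1 / 2) * c powr (- real DIM('a) / 2) * c powr (- e)) * conv (dgauss a (t - s)) (\<phi> s) x"
      by simp
    also have "c powr (real DIM('a) / 2) * c powr (- 1 / 2) * c powr (- real DIM('a) / 2) * c powr (- e) = c powr (- 1 / 2 - e)"
      unfolding powr_add[symmetric] by (rule arg_cong[where f = "\<lambda>e. c powr e"]) simp
    finally show ?thesis .
  qed
  have "Du a \<phi> (c * t) (sqrt c *\<^sub>R x) = \<bar>c\<bar> *\<^sub>R (\<integral>s. indicator {0<..<c * t} (0 + c * s) * conv (dgauss a (c * t - (0 + c * s))) (\<phi> (0 + c * s)) (sqrt c *\<^sub>R x) \<partial>lborel)"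
    unfolding Du_def by (rule lborel_integral_real_affine) (use c in simp)
  also have "(\<integral>s. indicator {0<..<c * t} (0 + c * s) * conv (dgauss a (c * t - (0 + c * s))) (\<phi> (0 + c * s)) (sqrt c *\<^sub>R x) \<partial>lborel)
     = (\<integral>s. c powr (- 1 / 2 - e) * (indicator {0<..<t} s * conv (dgauss a (t - s)) (\<phi> s) x) \<partial>lborel)"
  proof (rule Bochner_Integration.integral_cong[OF refl])
    fix s
    show "indicator {0<..<c * t} (0 + c * s) * conv (dgauss a (c * t - (0 + c * s))) (\<phi> (0 + c * s)) (sqrt c *\<^sub>R x)
       = c powr (- 1 / 2 - e) * (indicator {0<..<t} s * conv (dgauss a (t - s)) (\<phi> s) x)"
      using cv[of s] c by (auto simp: indicator_def zero_less_mult_iff)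
  qed
  also have "\<dots> = c powr (- 1 / 2 - e) * Du a \<phi> t x" by (simp add: Du_def)
  also have "\<bar>c\<bar> *\<^sub>R (c powr (- 1 / 2 - e) * Du a \<phi> t x) = (c powr 1 * c powr (- 1 / 2 - e)) * Du a \<phi> t x" using c by simp
  also have "c powr 1 * c powr (- 1 / 2 - e) = c powr (1 / 2 - e)"
    unfolding powr_add[symmetric] by (rule arg_cong[where f = "\<lambda>e. c powr e"]) simp
  finally show ?thesis .
qed

lemma Du_cmult: "Du a (\<lambda>s y. c * \<phi> s y) t x = c * Du a \<phi> t x"
proof -
  have "conv (dgauss a (t - s)) (\<lambda>y. c * \<phi> s y) x = c * conv (dgauss a (t - s)) (\<phi> s) x" for s
    unfolding conv_def using integral_mult_right_zero[of lborel c "\<lambda>y. dgauss a (t - s) (x - y) * \<phi> s y"] by (simp add: mult_ac)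
  then show ?thesis
    unfolding Du_def using integral_mult_right_zero[of lborel c "\<lambda>s. indicator {0<..<t} s * conv (dgauss a (t - s)) (\<phi> s) x"]
    by (simp add: mult_ac)
qed

lemma Du_diff:
  assumes "\<And>s. 0 < s \<Longrightarrow> s < t \<Longrightarrow> integrable lborel (\<phi> s)" "\<And>s. 0 < s \<Longrightarrow> s < t \<Longrightarrow> integrable lborel (\<psi> s)"
    and "integrable lborel (\<lambda>s. indicator {0<..<t} s * conv (dgauss a (t - s)) (\<phi> s) x)"
    and "integrable lborel (\<lambda>s. indicator {0<..<t} s * conv (dgauss a (t - s)) (\<psi> s) x)"
  shows "Du a (\<lambda>s y. \<phi> s y - \<psi> s y) t x = Du a \<phi> t x - Du a \<psi> t x"
proof -
  have "Du a (\<lambda>s y. \<phi> s y - \<psi> s y) t x = (\<integral>s. indicator {0<..<t} s * conv (dgauss a (t - s)) (\<phi> s) x - indicator {0<..<t} s * conv (dgauss a (t - s)) (\<psi> s) x \<partial>lborel)"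
    unfolding Du_def
  proof (rule Bochner_Integration.integral_cong[OF refl])
    fix s
    show "indicator {0<..<t} s * conv (dgauss a (t - s)) (\<lambda>y. \<phi> s y - \<psi> s y) x
      = indicator {0<..<t} s * conv (dgauss a (t - s)) (\<phi> s) x - indicator {0<..<t} s * conv (dgauss a (t - s)) (\<psi> s) x"
    proof (cases "0 < s \<and> s < t")
      case True
      then show ?thesis using conv_diff[of "dgauss a (t - s)", OF _ dgauss_sup assms(1)[of s] assms(2)[of s], of x]
        by (simp add: right_diff_distrib)
    qed auto
  qed
  then show ?thesis unfolding Du_def using assms(3,4) by simp
qed

subsection \<open>Second order expansion of the nonlinearity\<close>

text \<open>For r <= 1 this is subadditivity of the power, for r > 1 the mean value theorem. The
  exponent \<open>min 1 r\<close> serves both cases; it is applied with r = p - 1, which may lie on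
  either side of 1.\<close>

lemma powr_holder:
  fixes x y m r :: real
  assumes r: "0 < r" and x: "\<bar>x\<bar> \<le> m" and y: "\<bar>y\<bar> \<le> m" and m: "0 < m"
  shows "\<bar>\<bar>x\<bar> powr r - \<bar>y\<bar> powr r\<bar> \<le> max 1 r * m powr (r - min 1 r) * \<bar>x - y\<bar> powr (min 1 r)"
proof -
  have main: "X powr r - Y powr r \<le> max 1 r * m powr (r - min 1 r) * (X - Y) powr (min 1 r)"
    if Y: "0 \<le> Y" and YX: "Y < X" and X: "X \<le> m" for X Y
  proof (cases "r \<le> 1")
    case True
    have "X powr r = X powr 1 * X powr (r - 1)" using YX Y unfolding powr_add[symmetric] by simp
    also have "\<dots> = (X - Y) * X powr (r - 1) + Y * X powr (r - 1)" using YX Y by (simp add: algebra_simps)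
    also have "\<dots> \<le> (X - Y) * (X - Y) powr (r - 1) + Y * Y powr (r - 1)"
    proof (rule add_mono)
      show "(X - Y) * X powr (r - 1) \<le> (X - Y) * (X - Y) powr (r - 1)"
        using True Y YX by (intro mult_left_mono powr_mono2') auto
      show "Y * X powr (r - 1) \<le> Y * Y powr (r - 1)"
        using True Y YX by (cases "Y = 0") (auto intro!: mult_left_mono powr_mono2')
    qed
    also have "(X - Y) * (X - Y) powr (r - 1) = (X - Y) powr r" using YX powr_add[of "X - Y" 1 "r - 1"] by simp
    also have "Y * Y powr (r - 1) = Y powr r" using Y r powr_add[of Y 1 "r - 1"] by (cases "Y = 0") auto
    finally have "X powr r - Y powr r \<le> (X - Y) powr r" by simp
    moreover have "max 1 r = 1" "min 1 r = r" using True by auto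
    ultimately show ?thesis using m by simp
  next
    case False
    obtain z where z: "Y < z" "z < X" "X powr r - Y powr r = (X - Y) * (r * z powr (r - 1))"
    proof -
      have "\<exists>l z. Y < z \<and> z < X \<and> DERIV (\<lambda>x. x powr r) z :> l \<and> X powr r - Y powr r = (X - Y) * l"
      proof (rule MVT[OF YX])
        show "continuous_on {Y..X} (\<lambda>x. x powr r)" using Y r by (intro continuous_on_powr' continuous_intros) auto
        show "(\<lambda>x. x powr r) differentiable (at x)" if "Y < x" "x < X" for x
          using that Y has_real_derivative_powr[of x r] by (auto simp: real_differentiable_def)
      qed
      then obtain l z where lz: "Y < z" "z < X" "DERIV (\<lambda>x. x powr r) z :> l" "X powr r - Y powr r = (X - Y) * l" by blast
      have "l = r * z powr (r - 1)" by (rule DERIV_unique[OF lz(3) has_real_derivative_powr]) (use lz Y in simp)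
      then show ?thesis using that lz by blast
    qed
    have "z powr (r - 1) \<le> m powr (r - 1)" using z Y X False by (intro powr_mono2) auto
    then have "X powr r - Y powr r \<le> (X - Y) * (r * m powr (r - 1))" unfolding z(3) using YX r by (intro mult_left_mono) auto
    then show ?thesis using False YX by (simp add: max_def min_def mult_ac)
  qed
  have tri: "(\<bar>X - Y\<bar>) powr (min 1 r) \<le> \<bar>x - y\<bar> powr (min 1 r)" if "\<bar>X - Y\<bar> \<le> \<bar>x - y\<bar>" for X Y
    using that r by (intro powr_mono2) auto
  have c0: "0 \<le> max 1 r * m powr (r - min 1 r)" using r by simp
  have d: "\<bar>\<bar>x\<bar> - \<bar>y\<bar>\<bar> \<le> \<bar>x - y\<bar>" by (rule abs_triangle_ineq3)
  consider "\<bar>y\<bar> < \<bar>x\<bar>" | "\<bar>x\<bar> < \<bar>y\<bar>" | "\<bar>x\<bar> = \<bar>y\<bar>" by linarith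
  then show ?thesis
  proof cases
    case 1
    have "\<bar>y\<bar> powr r \<le> \<bar>x\<bar> powr r" using 1 r by (intro powr_mono2) auto
    then have "\<bar>\<bar>x\<bar> powr r - \<bar>y\<bar> powr r\<bar> \<le> max 1 r * m powr (r - min 1 r) * (\<bar>\<bar>x\<bar> - \<bar>y\<bar>\<bar>) powr (min 1 r)"
      using main[of "\<bar>y\<bar>" "\<bar>x\<bar>"] 1 x by simp
    also have "\<dots> \<le> max 1 r * m powr (r - min 1 r) * \<bar>x - y\<bar> powr (min 1 r)" by (rule mult_left_mono[OF tri[OF d] c0])
    finally show ?thesis .
  next
    case 2
    have "\<bar>x\<bar> powr r \<le> \<bar>y\<bar> powr r" using 2 r by (intro powr_mono2) auto
    then have "\<bar>\<bar>x\<bar> powr r - \<bar>y\<bar> powr r\<bar> \<le> max 1 r * m powr (r - min 1 r) * (\<bar>\<bar>x\<bar> - \<bar>y\<bar>\<bar>) powr (min 1 r)"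
      using main[of "\<bar>x\<bar>" "\<bar>y\<bar>"] 2 y by simp
    also have "\<dots> \<le> max 1 r * m powr (r - min 1 r) * \<bar>x - y\<bar> powr (min 1 r)" by (rule mult_left_mono[OF tri[OF d] c0])
    finally show ?thesis .
  qed (use c0 in simp)
qed

text \<open>Mean value estimate for \<open>fnl p\<close> minus a linear function with the slope at
  c. The derivative of f is only Hoelder continuous when p < 2, so the gain over the first order is
  the power \<open>min 1 (p - 1)\<close> of |b - c|.\<close>

lemma fnl_second_order:
  fixes b c m p :: real
  assumes p: "1 < p" and b: "\<bar>b\<bar> \<le> m" and c: "\<bar>c\<bar> \<le> m" and m: "0 < m"
  shows "\<bar>fnl p b - fnl p c - p * \<bar>c\<bar> powr (p - 1) * (b - c)\<bar>
    \<le> p * max 1 (p - 1) * m powr (p - 1 - min 1 (p - 1)) * \<bar>b - c\<bar> powr (min 1 (p - 1)) * \<bar>b - c\<bar>"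
proof -
  let ?K = "p * (max 1 (p - 1) * m powr (p - 1 - min 1 (p - 1)) * \<bar>b - c\<bar> powr (min 1 (p - 1)))"
  define g where "g = (\<lambda>z. fnl p z - p * \<bar>c\<bar> powr (p - 1) * z)"
  have "norm (g b - g c) \<le> ?K * norm (b - c)"
  proof (rule field_differentiable_bound[of "closed_segment c b" g "\<lambda>z. p * \<bar>z\<bar> powr (p - 1) - p * \<bar>c\<bar> powr (p - 1)"])
    show "(g has_field_derivative p * \<bar>z\<bar> powr (p - 1) - p * \<bar>c\<bar> powr (p - 1)) (at z within closed_segment c b)" for z
      unfolding g_def by (rule has_field_derivative_at_within) (auto intro!: derivative_eq_intros has_real_derivative_fnl[OF p])
    fix z assume z: "z \<in> closed_segment c b"
    have zc: "\<bar>z - c\<bar> \<le> \<bar>b - c\<bar>" using segment_bound1[OF z] by simp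
    have zm: "\<bar>z\<bar> \<le> m" using z b c by (auto simp: closed_segment_eq_real_ivl split: if_splits)
    have "norm (p * \<bar>z\<bar> powr (p - 1) - p * \<bar>c\<bar> powr (p - 1)) = p * \<bar>\<bar>z\<bar> powr (p - 1) - \<bar>c\<bar> powr (p - 1)\<bar>"
      using p by (simp add: abs_mult right_diff_distrib[symmetric])
    also have "\<dots> \<le> p * (max 1 (p - 1) * m powr (p - 1 - min 1 (p - 1)) * \<bar>z - c\<bar> powr (min 1 (p - 1)))"
      using p by (intro mult_left_mono powr_holder zm c m) auto
    also have "\<dots> \<le> ?K" using zc p by (intro mult_left_mono powr_mono2) auto
    finally show "norm (p * \<bar>z\<bar> powr (p - 1) - p * \<bar>c\<bar> powr (p - 1)) \<le> ?K" .
  qed auto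
  then show ?thesis by (simp add: g_def algebra_simps)
qed

subsection \<open>Parabolic bounds of the approximants\<close>

text \<open>This is how \<sigma> enters: since n(p - 1)/2 = \<sigma> + 1/2, a factor of degree p - 1
  in functions of parabolic size is worth s^(-\<sigma> - 1/2).\<close>

lemma powr_sigma:
  assumes "0 \<le> C"
  shows "(C * s powr (- n / 2)) powr (p - 1) = C powr (p - 1) * s powr (- (sigma n p + 1 / 2))"
proof -
  have "- n / 2 * (p - 1) = - (sigma n p + 1 / 2)" by (simp add: sigma_def field_simps)
  then show ?thesis using assms by (simp add: powr_mult powr_powr)
qed

lemma A0_jmeas: "jmeas (A0 u0)"
  unfolding A0_def by measurable

lemma pbound_A0:
  assumes t: "0 < t"
  shows "pbound t \<bar>mass u0\<bar> (A0 u0 t)"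
  unfolding pbound_def A0_def
  using integrable_gauss[OF t, where 'a='a] integral_gauss[OF t, where 'a='a] gauss_le[OF t, where 'a='a]
  by (auto simp: abs_mult intro!: mult_left_mono)

context
  fixes p :: real
  assumes p: "1 < p"
begin

lemma pbound_fnl:
  fixes w :: "'a::euclidean_space \<Rightarrow> real"
  assumes w: "pbound s C w"
  shows "pbound s (C powr (p - 1) * C * s powr (- (sigma (real DIM('a)) p + 1 / 2))) (\<lambda>x. fnl p (w x))"
proof -
  note pboundD(5)[OF w, measurable]
  have "pbound s ((C * s powr (- real DIM('a) / 2)) powr (p - 1) * C) (\<lambda>x. fnl p (w x))"
  proof (rule pbound_bounded_mult[OF w])
    fix x
    have "\<bar>fnl p (w x)\<bar> = \<bar>w x\<bar> powr (p - 1) * \<bar>w x\<bar>" by (simp add: fnl_def abs_mult)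
    also have "\<dots> \<le> (C * s powr (- real DIM('a) / 2)) powr (p - 1) * \<bar>w x\<bar>"
      using pboundD(3)[OF w] p by (intro mult_right_mono powr_mono2) auto
    finally show "\<bar>fnl p (w x)\<bar> \<le> (C * s powr (- real DIM('a) / 2)) powr (p - 1) * \<bar>w x\<bar>" .
  qed auto
  then show ?thesis unfolding powr_sigma[OF pboundD(4)[OF w]] by (simp add: mult_ac)
qed

lemma pbound_fnl_diff:
  fixes w z :: "'a::euclidean_space \<Rightarrow> real"
  assumes w: "pbound s C w" and z: "pbound s C z" and d: "pbound s D (\<lambda>x. w x - z x)"
  shows "pbound s (p * C powr (p - 1) * D * s powr (- (sigma (real DIM('a)) p + 1 / 2))) (\<lambda>x. fnl p (w x) - fnl p (z x))"
proof -
  note pboundD(5)[OF w, measurable] pboundD(5)[OF z, measurable]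
  have "pbound s ((p * (C * s powr (- real DIM('a) / 2)) powr (p - 1)) * D) (\<lambda>x. fnl p (w x) - fnl p (z x))"
    by (rule pbound_bounded_mult[OF d]) (use fnl_lipschitz[OF p pboundD(3)[OF w] pboundD(3)[OF z]] p in auto)
  then show ?thesis unfolding powr_sigma[OF pboundD(4)[OF w]] by (simp add: mult_ac)
qed

lemma pbound_deriv_mult:
  fixes r z :: "'a::euclidean_space \<Rightarrow> real"
  assumes z: "pbound s C z" and r: "pbound s D r"
  shows "pbound s (p * C powr (p - 1) * D * s powr (- (sigma (real DIM('a)) p + 1 / 2))) (\<lambda>x. r x * deriv (fnl p) (z x))"
proof -
  note pboundD(5)[OF r, measurable] pboundD(5)[OF z, measurable]
  have "pbound s ((p * (C * s powr (- real DIM('a) / 2)) powr (p - 1)) * D) (\<lambda>x. r x * deriv (fnl p) (z x))"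
    unfolding deriv_fnl[OF p]
  proof (rule pbound_bounded_mult[OF r])
    fix x
    have "\<bar>r x * (p * \<bar>z x\<bar> powr (p - 1))\<bar> = (p * \<bar>z x\<bar> powr (p - 1)) * \<bar>r x\<bar>" using p by (simp add: abs_mult)
    also have "\<dots> \<le> (p * (C * s powr (- real DIM('a) / 2)) powr (p - 1)) * \<bar>r x\<bar>"
      using pboundD(3)[OF z] p by (intro mult_right_mono mult_left_mono powr_mono2) auto
    finally show "\<bar>r x * (p * \<bar>z x\<bar> powr (p - 1))\<bar> \<le> (p * (C * s powr (- real DIM('a) / 2)) powr (p - 1)) * \<bar>r x\<bar>" .
  qed (use p in auto)
  then show ?thesis unfolding powr_sigma[OF pboundD(4)[OF z]] by (simp add: mult_ac)
qed

text \<open>The explicit power of s is the same as in the first-order estimate. The improvement sits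
  in the additional factor \<open>D powr \<beta>\<close>, because \<open>D\<close> will itself decay
  in s.\<close>

lemma pbound_second_order:
  fixes w z :: "'a::euclidean_space \<Rightarrow> real"
  assumes s: "0 < s" and C: "0 < C" and w: "pbound s C w" and z: "pbound s C z" and d: "pbound s D (\<lambda>x. w x - z x)"
  defines "\<beta> \<equiv> min 1 (p - 1)"
  shows "pbound s (p * max 1 (p - 1) * C powr (p - 1 - \<beta>) * (D powr \<beta> * D) * s powr (- (sigma (real DIM('a)) p + 1 / 2)))
    (\<lambda>x. fnl p (w x) - fnl p (z x) - (w x - z x) * deriv (fnl p) (z x))"
proof -
  let ?n = "real DIM('a)"
  note pboundD(5)[OF w, measurable] pboundD(5)[OF z, measurable]
  have D0: "0 \<le> D" by (rule pboundD(4)[OF d])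
  let ?m = "C * s powr (- ?n / 2)"
  have m0: "0 < ?m" using C s by simp
  have eq: "fnl p (w x) - fnl p (z x) - (w x - z x) * deriv (fnl p) (z x) = fnl p (w x) - fnl p (z x) - p * \<bar>z x\<bar> powr (p - 1) * (w x - z x)" for x
    by (simp add: deriv_fnl[OF p])
  have "pbound s ((p * max 1 (p - 1) * ?m powr (p - 1 - \<beta>) * (D * s powr (- ?n / 2)) powr \<beta>) * D)
    (\<lambda>x. fnl p (w x) - fnl p (z x) - (w x - z x) * deriv (fnl p) (z x))"
    unfolding eq
  proof (rule pbound_bounded_mult[OF d])
    fix x
    have "\<bar>fnl p (w x) - fnl p (z x) - p * \<bar>z x\<bar> powr (p - 1) * (w x - z x)\<bar>
      \<le> p * max 1 (p - 1) * ?m powr (p - 1 - \<beta>) * \<bar>w x - z x\<bar> powr \<beta> * \<bar>w x - z x\<bar>"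
      unfolding \<beta>_def by (rule fnl_second_order[OF p pboundD(3)[OF w] pboundD(3)[OF z] m0])
    also have "\<dots> \<le> p * max 1 (p - 1) * ?m powr (p - 1 - \<beta>) * (D * s powr (- ?n / 2)) powr \<beta> * \<bar>w x - z x\<bar>"
      using pboundD(3)[OF d, of x] p by (intro mult_right_mono mult_left_mono powr_mono2) (auto simp: \<beta>_def)
    finally show "\<bar>fnl p (w x) - fnl p (z x) - p * \<bar>z x\<bar> powr (p - 1) * (w x - z x)\<bar>
      \<le> p * max 1 (p - 1) * ?m powr (p - 1 - \<beta>) * (D * s powr (- ?n / 2)) powr \<beta> * \<bar>w x - z x\<bar>" .
  qed (use p in auto)
  also have "p * max 1 (p - 1) * ?m powr (p - 1 - \<beta>) * (D * s powr (- ?n / 2)) powr \<beta> * D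
    = p * max 1 (p - 1) * C powr (p - 1 - \<beta>) * (D powr \<beta> * D) * (s powr (- ?n / 2 * (p - 1 - \<beta>)) * s powr (- ?n / 2 * \<beta>))"
    using C D0 by (simp add: powr_mult powr_powr mult_ac)
  also have "s powr (- ?n / 2 * (p - 1 - \<beta>)) * s powr (- ?n / 2 * \<beta>) = s powr (- (sigma ?n p + 1 / 2))"
    unfolding powr_add[symmetric] by (rule arg_cong[where f = "\<lambda>e. s powr e"]) (simp add: sigma_def field_simps)
  finally show ?thesis .
qed

lemma fnl_A0_jmeas: "jmeas (\<lambda>s y. fnl p (A0 u0 s y))"
  unfolding A0_def by measurable

lemma pbound_fnl_A0:
  fixes u0 :: "'a::euclidean_space \<Rightarrow> real"
  assumes t: "0 < t"
  shows "pbound t (\<bar>mass u0\<bar> powr (p - 1) * \<bar>mass u0\<bar> * t powr (- (sigma (real DIM('a)) p + 1 / 2))) (\<lambda>y. fnl p (A0 u0 t y))"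
  by (rule pbound_fnl[OF pbound_A0[OF t]])

lemma A01_eq_Du:
  fixes u0 :: "'a::euclidean_space \<Rightarrow> real"
  shows "A01 a p u0 t x = A0 u0 t x + Du a (\<lambda>s y. fnl p (A0 u0 s y)) t x"
proof -
  have "set_lebesgue_integral lborel {0..t} (\<lambda>s. adgrad a (t - s) (\<lambda>y. fnl p (A0 u0 s y)) x) = Du a (\<lambda>s y. fnl p (A0 u0 s y)) t x"
    unfolding Du_def
    by (rule set_integral_Icc_eq_Ioo, rule adgrad_eq_conv) (auto intro: pboundD(1)[OF pbound_fnl_A0])
  then show ?thesis by (simp add: A01_def)
qed

lemma A01_minus_A0: "A01 a p u0 t x - A0 u0 t x = Du a (\<lambda>s y. fnl p (A0 u0 s y)) t x"
  by (simp add: A01_eq_Du)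

lemma A01_jmeas: "jmeas (A01 a p u0)"
proof -
  note borel_measurable_Du[OF fnl_A0_jmeas, measurable (raw)] jmeas_compose[OF A0_jmeas, measurable (raw)]
  show ?thesis unfolding A01_eq_Du by measurable
qed

text \<open>The heat kernel is invariant under parabolic scaling and f is homogeneous of degree p,
  so the first correction is exactly self-similar, with the additional exponent -\<sigma>.\<close>

lemma Du_fnl_A0_scale:
  fixes u0 :: "'a::euclidean_space \<Rightarrow> real"
  assumes c: "0 < c"
  shows "A0 u0 (c * t) (sqrt c *\<^sub>R x) = c powr (- real DIM('a) / 2) * A0 u0 t x"
    and "Du a (\<lambda>s y. fnl p (A0 u0 s y)) (c * t) (sqrt c *\<^sub>R x)
      = c powr (- real DIM('a) / 2 - sigma (real DIM('a)) p) * Du a (\<lambda>s y. fnl p (A0 u0 s y)) t x"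
proof -
  show 1: "A0 u0 (c * t) (sqrt c *\<^sub>R x) = c powr (- real DIM('a) / 2) * A0 u0 t x" for t x
    by (simp add: A0_def gauss_scale[OF c])
  have "Du a (\<lambda>s y. fnl p (A0 u0 s y)) (c * t) (sqrt c *\<^sub>R x) = c powr (1 / 2 - real DIM('a) / 2 * p) * Du a (\<lambda>s y. fnl p (A0 u0 s y)) t x"
  proof (rule Du_scale[OF c])
    show "(\<lambda>y. fnl p (A0 u0 s y)) \<in> borel_measurable borel" for s unfolding A0_def by measurable
    show "fnl p (A0 u0 (c * s) (sqrt c *\<^sub>R y)) = c powr (- (real DIM('a) / 2 * p)) * fnl p (A0 u0 s y)" for s y
    proof -
      have "(c powr (- real DIM('a) / 2)) powr (p - 1) * c powr (- real DIM('a) / 2) = c powr (- (real DIM('a) / 2 * p))"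
        unfolding powr_powr powr_add[symmetric] by (rule arg_cong[where f = "\<lambda>e. c powr e"]) (simp add: algebra_simps)
      then show ?thesis unfolding 1 fnl_def by (simp add: abs_mult powr_mult)
    qed
  qed
  also have "1 / 2 - real DIM('a) / 2 * p = - real DIM('a) / 2 - sigma (real DIM('a)) p"
    by (simp add: sigma_def field_simps)
  finally show "Du a (\<lambda>s y. fnl p (A0 u0 s y)) (c * t) (sqrt c *\<^sub>R x)
      = c powr (- real DIM('a) / 2 - sigma (real DIM('a)) p) * Du a (\<lambda>s y. fnl p (A0 u0 s y)) t x" .
qed

end

text \<open>Its Duhamel integral is the second correction D, and \<open>Rstar\<close> is the value
  of D at time 1 (\<open>Rstar_eq_Du\<close>).\<close>

definition source2 :: "'a::euclidean_space \<Rightarrow> real \<Rightarrow> ('a \<Rightarrow> real) \<Rightarrow> real \<Rightarrow> 'a \<Rightarrow> real" where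
  "source2 a p u0 s y = (A01 a p u0 s y - A0 u0 s y) * deriv (fnl p) (A0 u0 s y)"

context
  fixes p :: real and a :: "'a::euclidean_space"
  assumes p: "1 < p" and sg: "0 < sigma (real DIM('a)) p" "sigma (real DIM('a)) p < 1 / 4"
begin

lemma source2_jmeas: "jmeas (source2 a p u0)"
proof -
  note jmeas_compose[OF A01_jmeas[OF p], measurable (raw)] jmeas_compose[OF A0_jmeas, measurable (raw)]
  show ?thesis unfolding source2_def deriv_fnl[OF p] by measurable
qed

lemma pbound_first_correction:
  obtains K where "0 \<le> K" "\<And>t. 0 < t \<Longrightarrow> pbound t (K * t powr (- sigma (real DIM('a)) p)) (\<lambda>x. A01 a p u0 t x - A0 u0 t x)"
proof
  let ?b = "sigma (real DIM('a)) p + 1 / 2"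
  let ?A = "\<bar>mass u0\<bar> powr (p - 1) * \<bar>mass u0\<bar>"
  show "0 \<le> Dcon a ?b * ?A" using sg by (simp add: Dcon_def)
  fix t :: real assume t: "0 < t"
  have "pbound t (Dcon a ?b * ?A * t powr (1 / 2 - ?b)) (Du a (\<lambda>s y. fnl p (A0 u0 s y)) t)"
    by (rule pbound_Du[OF fnl_A0_jmeas[OF p] t]) (use sg pbound_fnl_A0[OF p] in auto)
  then show "pbound t (Dcon a ?b * ?A * t powr (- sigma (real DIM('a)) p)) (\<lambda>x. A01 a p u0 t x - A0 u0 t x)"
    by (simp add: A01_minus_A0[OF p])
qed

text \<open>The first correction contributes s^(-\<sigma>) and the factor f'(A0) contributes
  s^(-\<sigma> - 1/2). The sum 2\<sigma> + 1/2 is below 1 because \<sigma> < 1/4, so the next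
  Duhamel integral converges at s = 0.\<close>

lemma pbound_source2:
  obtains K where "0 \<le> K" "\<And>s. 0 < s \<Longrightarrow> pbound s (K * s powr (- (2 * sigma (real DIM('a)) p + 1 / 2))) (source2 a p u0 s)"
proof -
  let ?\<sigma> = "sigma (real DIM('a)) p"
  obtain K where K: "0 \<le> K" "\<And>t. 0 < t \<Longrightarrow> pbound t (K * t powr (- ?\<sigma>)) (\<lambda>x. A01 a p u0 t x - A0 u0 t x)"
    using pbound_first_correction by blast
  show ?thesis
  proof (rule that[of "p * \<bar>mass u0\<bar> powr (p - 1) * K"])
    show "0 \<le> p * \<bar>mass u0\<bar> powr (p - 1) * K" using p K by simp
    fix s :: real assume s: "0 < s"
    have "pbound s (p * \<bar>mass u0\<bar> powr (p - 1) * (K * s powr (- ?\<sigma>)) * s powr (- (?\<sigma> + 1 / 2))) (source2 a p u0 s)"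
      unfolding source2_def by (rule pbound_deriv_mult[OF p pbound_A0[OF s] K(2)[OF s]])
    also have "p * \<bar>mass u0\<bar> powr (p - 1) * (K * s powr (- ?\<sigma>)) * s powr (- (?\<sigma> + 1 / 2)) = p * \<bar>mass u0\<bar> powr (p - 1) * K * (s powr (- ?\<sigma>) * s powr (- (?\<sigma> + 1 / 2)))"
      by simp
    also have "s powr (- ?\<sigma>) * s powr (- (?\<sigma> + 1 / 2)) = s powr (- (2 * ?\<sigma> + 1 / 2))"
      unfolding powr_add[symmetric] by simp
    finally show "pbound s (p * \<bar>mass u0\<bar> powr (p - 1) * K * s powr (- (2 * ?\<sigma> + 1 / 2))) (source2 a p u0 s)" .
  qed
qed

lemma Rstar_eq_Du: "Rstar a p u0 x = Du a (source2 a p u0) 1 x"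
proof -
  obtain K where K: "\<And>s. 0 < s \<Longrightarrow> pbound s (K * s powr (- (2 * sigma (real DIM('a)) p + 1 / 2))) (source2 a p u0 s)"
    using pbound_source2 by blast
  show ?thesis
    unfolding Rstar_def Du_def source2_def[symmetric]
    by (rule set_integral_Icc_eq_Ioo, rule adgrad_eq_conv) (auto intro: pboundD(1)[OF K])
qed

text \<open>Exact self-similarity is what produces a limit of the rescaled norms and not merely a
  bound for them.\<close>

lemma Du_source2_scale:
  assumes t: "0 < t"
  shows "Du a (source2 a p u0) t (sqrt t *\<^sub>R x) = t powr (- real DIM('a) / 2 - 2 * sigma (real DIM('a)) p) * Rstar a p u0 x"
proof -
  let ?n = "real DIM('a)" and ?\<sigma> = "sigma (real DIM('a)) p"
  have "Du a (source2 a p u0) (t * 1) (sqrt t *\<^sub>R x) = t powr (1 / 2 - (?n / 2 + 2 * ?\<sigma> + 1 / 2)) * Du a (source2 a p u0) 1 x"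
  proof (rule Du_scale[OF t])
    show "source2 a p u0 s \<in> borel_measurable borel" for s
      using jmeas_compose[OF source2_jmeas, of "\<lambda>_. s" borel "\<lambda>x. x"] by simp
    show "source2 a p u0 (t * s) (sqrt t *\<^sub>R y) = t powr (- (?n / 2 + 2 * ?\<sigma> + 1 / 2)) * source2 a p u0 s y" for s y
    proof -
      have "t powr (- ?n / 2 - ?\<sigma>) * (t powr (- ?n / 2)) powr (p - 1) = t powr (- (?n / 2 + 2 * ?\<sigma> + 1 / 2))"
        unfolding powr_powr powr_add[symmetric] by (rule arg_cong[where f = "\<lambda>e. t powr e"]) (simp add: sigma_def field_simps)
      moreover have "source2 a p u0 s y = Du a (\<lambda>s y. fnl p (A0 u0 s y)) s y * (p * \<bar>A0 u0 s y\<bar> powr (p - 1))" for s y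
        by (simp add: source2_def A01_minus_A0[OF p] deriv_fnl[OF p])
      ultimately show ?thesis by (simp add: Du_fnl_A0_scale[OF p t] abs_mult powr_mult)
    qed
  qed
  also have "1 / 2 - (?n / 2 + 2 * ?\<sigma> + 1 / 2) = - ?n / 2 - 2 * ?\<sigma>" by simp
  finally show ?thesis by (simp add: Rstar_eq_Du)
qed

lemma
  shows pbound_Rstar: "\<exists>C. pbound 1 C (Rstar a p u0)" and isCont_Rstar: "isCont (Rstar a p u0) x"
proof -
  let ?b = "2 * sigma (real DIM('a)) p + 1 / 2"
  obtain K where K: "0 \<le> K" "\<And>s. 0 < s \<Longrightarrow> pbound s (K * s powr (- ?b)) (source2 a p u0 s)"
    using pbound_source2 by blast
  have b: "0 \<le> ?b" "?b < 1" using sg by auto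
  have eq: "Rstar a p u0 = Du a (source2 a p u0) 1" by (rule ext) (rule Rstar_eq_Du)
  show "\<exists>C. pbound 1 C (Rstar a p u0)"
    unfolding eq using pbound_Du[OF source2_jmeas zero_less_one b K(2) K(1)] by blast
  show "isCont (Rstar a p u0) x"
    unfolding eq using pbound_Du_isCont[OF source2_jmeas zero_less_one b K(2) K(1)] by blast
qed

end

subsection \<open>The remainder\<close>

text \<open>The first moment gives t^(-1/2), which is good for t >= 1; near t = 0 only boundedness
  is used. An exponent c between 0 and 1/2 is weak enough in both regimes, so that one bound covers
  all times.\<close>

lemma pbound_heat_minus_A0:
  fixes u0 :: "'a::euclidean_space \<Rightarrow> real"
  assumes u0: "integrable lborel u0" and u1: "integrable lborel (\<lambda>x. norm x * u0 x)" and c: "0 \<le> c" "c \<le> 1 / 2"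
  obtains C where "0 \<le> C" "\<And>t. 0 < t \<Longrightarrow> pbound t (C * t powr (- c)) (\<lambda>x. heat t u0 x - A0 u0 t x)"
proof -
  note borel_measurable_integrable_lborel[OF u0, measurable]
  let ?U = "\<integral>x. \<bar>u0 x\<bar> \<partial>lborel" and ?g = "gcon TYPE('a)"
  define U1 where "U1 = (\<integral>x. norm x * \<bar>u0 x\<bar> \<partial>lborel)"
  have u1': "integrable lborel (\<lambda>x. norm x * \<bar>u0 x\<bar>)" using integrable_abs[OF u1] by (simp add: abs_mult)
  have 1: "pbound t (?g * U1 * t powr (- 1 / 2)) (\<lambda>x. heat t u0 x - A0 u0 t x)" if t: "0 < t" for t
  proof -
    let ?F = "\<lambda>y x. (gauss t (x - y) - gauss t x) * u0 y"
    let ?k = "\<lambda>y. (?g * t powr (- 1 / 2)) * (norm y * \<bar>u0 y\<bar>)"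
    have jF: "jmeas ?F" by measurable
    have gi: "integrable lborel (\<lambda>x::'a. gauss t (x - y) - gauss t x)" for y
      by (intro Bochner_Integration.integrable_diff integrable_gauss integrable_lborel_shift t)
    have bF: "AE y in lborel. integrable lborel (?F y) \<and> (\<integral>x. \<bar>?F y x\<bar> \<partial>lborel) \<le> ?k y"
    proof (intro AE_I2 conjI)
      fix y :: 'a
      show "integrable lborel (?F y)" using gi by simp
      have "(\<integral>x. \<bar>?F y x\<bar> \<partial>lborel) = (\<integral>x. \<bar>gauss t (x - y) - gauss t x\<bar> \<partial>lborel) * \<bar>u0 y\<bar>" by (simp add: abs_mult)
      also have "\<dots> \<le> (norm y * ?g * t powr (- 1 / 2)) * \<bar>u0 y\<bar>" by (intro mult_right_mono gauss_shift_L1 t) simp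
      finally show "(\<integral>x. \<bar>?F y x\<bar> \<partial>lborel) \<le> ?k y" by (simp add: mult_ac)
    qed
    have iF: "integrable lborel ?k" using u1' by simp
    have eq: "heat t u0 x - A0 u0 t x = (\<integral>y. ?F y x \<partial>lborel)" for x
    proof -
      have "integrable lborel (\<lambda>y. gauss t (x - y) * u0 y)"
        by (rule conv_integrand_bounded_kernel[OF _ _ u0, of _ "t powr (- real DIM('a) / 2)"]) (use gauss_le[OF t] in auto)
      then have "(\<integral>y. ?F y x \<partial>lborel) = heat t u0 x - (\<integral>y. gauss t x * u0 y \<partial>lborel)"
        unfolding heat_def left_diff_distrib using u0 by (intro Bochner_Integration.integral_diff) auto
      then show ?thesis by (simp add: A0_def mass_def mult.commute)
    qed
    have L: "(\<integral>x. \<bar>heat t u0 x - A0 u0 t x\<bar> \<partial>lborel) \<le> ?g * U1 * t powr (- 1 / 2)"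
    proof -
      have "(\<integral>y. ?k y \<partial>lborel) = ?g * U1 * t powr (- 1 / 2)" unfolding U1_def by simp
      then show ?thesis using fubini_bound[OF jF bF iF] unfolding eq by (simp only:)
    qed
    have S: "\<bar>heat t u0 x - A0 u0 t x\<bar> \<le> ?g * U1 * t powr (- 1 / 2) * t powr (- real DIM('a) / 2)" for x
    proof -
      have "\<bar>\<integral>y. ?F y x \<partial>lborel\<bar> \<le> (\<integral>y. (?g * t powr (- 1 / 2) * t powr (- real DIM('a) / 2)) * (norm y * \<bar>u0 y\<bar>) \<partial>lborel)"
      proof (rule abs_integral_le)
        show "integrable lborel (\<lambda>y. (?g * t powr (- 1 / 2) * t powr (- real DIM('a) / 2)) * (norm y * \<bar>u0 y\<bar>))" using u1' by simp
        fix y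
        have "\<bar>?F y x\<bar> \<le> (norm y * ?g * t powr (- 1 / 2) * t powr (- real DIM('a) / 2)) * \<bar>u0 y\<bar>"
          unfolding abs_mult by (intro mult_right_mono gauss_shift_sup t) simp
        then show "\<bar>?F y x\<bar> \<le> (?g * t powr (- 1 / 2) * t powr (- real DIM('a) / 2)) * (norm y * \<bar>u0 y\<bar>)" by (simp add: mult_ac)
      qed
      also have "\<dots> = ?g * U1 * t powr (- 1 / 2) * t powr (- real DIM('a) / 2)" unfolding U1_def by simp
      finally show ?thesis unfolding eq .
    qed
    show ?thesis unfolding pbound_def using L S fubini_integrable[OF jF bF iF] by (simp add: eq)
  qed
  have 2: "pbound t (?U + \<bar>mass u0\<bar>) (\<lambda>x. heat t u0 x - A0 u0 t x)" if t: "0 < t" for t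
  proof (rule pbound_diff[OF _ pbound_A0[OF t]])
    show "pbound t ?U (heat t u0)"
      unfolding pbound_def using integrable_heat[OF t u0] heat_L1[OF t u0] heat_sup_L1[OF t u0] by (simp add: mult.commute)
  qed
  have U10: "0 \<le> U1" unfolding U1_def by simp
  have U0: "0 \<le> ?U + \<bar>mass u0\<bar>" by simp
  show ?thesis
  proof (rule that[of "?g * U1 + (?U + \<bar>mass u0\<bar>)"])
    show "0 \<le> ?g * U1 + (?U + \<bar>mass u0\<bar>)" using U10 by simp
    fix t :: real assume t: "0 < t"
    show "pbound t ((?g * U1 + (?U + \<bar>mass u0\<bar>)) * t powr (- c)) (\<lambda>x. heat t u0 x - A0 u0 t x)"
    proof (cases "1 \<le> t")
      case True
      have "?g * U1 * t powr (- 1 / 2) \<le> (?g * U1 + (?U + \<bar>mass u0\<bar>)) * t powr (- c)"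
      proof (rule mult_mono)
        show "t powr (- 1 / 2) \<le> t powr (- c)" using True c by (intro powr_mono) auto
        show "?g * U1 \<le> ?g * U1 + (?U + \<bar>mass u0\<bar>)" using U0 by simp
      qed (use U10 in auto)
      then show ?thesis using pbound_mono[OF 1[OF t]] by blast
    next
      case False
      have "1 powr (- c) \<le> t powr (- c)" using t False c by (intro powr_mono2') auto
      then have "(?U + \<bar>mass u0\<bar>) * 1 \<le> (?g * U1 + (?U + \<bar>mass u0\<bar>)) * t powr (- c)"
        using U10 U0 by (intro mult_mono) auto
      then show ?thesis using pbound_mono[OF 2[OF t]] by simp
    qed
  qed
qed

text \<open>The gain \<delta> over the size of D has two sources: v - A0 enters the Taylor remainder
  of f with the power 1 + \<beta>, and the error of A01 against v carries the forcing exponent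
  3\<sigma> + 1/2 instead of 2\<sigma> + 1/2.\<close>

lemma (in mild_solution) remainder_bound:
  assumes sg: "0 < sigma (real DIM('a)) p" "sigma (real DIM('a)) p < 1 / 4"
    and u1: "integrable lborel (\<lambda>x. norm x * u0 x)"
  obtains C \<delta> where "0 \<le> C" "0 < \<delta>"
    "\<And>t. 0 < t \<Longrightarrow> pbound t (C * t powr (- (2 * sigma (real DIM('a)) p + \<delta>)))
       (\<lambda>x. v t x - A01 a p u0 t x - Du a (source2 a p u0) t x)"
proof -
  let ?n = "real DIM('a)"
  define \<sigma> where "\<sigma> = sigma ?n p"
  have \<sigma>: "0 < \<sigma>" "\<sigma> < 1 / 4" using sg by (auto simp: \<sigma>_def)
  have n1: "1 \<le> ?n" using DIM_positive[where 'a='a] by (simp add: Suc_le_eq)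
  have \<rho>: "1 / ?n < p - 1" "p \<le> 3 / 2 + 1 / ?n"
  proof -
    have e: "?n * (p - 1) = 2 * \<sigma> + 1" by (simp add: \<sigma>_def sigma_def algebra_simps)
    have "1 < ?n * (p - 1)" using \<sigma> unfolding e by simp
    then show "1 / ?n < p - 1" using n1 by (simp add: field_simps)
    have "?n * (p - 1) < 3 / 2" using \<sigma> unfolding e by simp
    also have "\<dots> \<le> ?n * (1 / 2 + 1 / ?n)" using n1 by (simp add: field_simps)
    finally have "p - 1 < 1 / 2 + 1 / ?n" using n1 by (subst (asm) mult_less_cancel_left_pos) auto
    then show "p \<le> 3 / 2 + 1 / ?n" by simp
  qed
  let ?A = "\<lambda>s y. fnl p (A0 u0 s y)" and ?S = "source2 a p u0"
  obtain C0 where C0: "1 \<le> C0" "\<And>t x. 0 < t \<Longrightarrow> \<bar>v t x\<bar> \<le> C0 * (1 + t) powr (- ?n / 2)"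
    using sup_decay[OF \<rho>] by blast
  define K where "K = C0 + M + \<bar>mass u0\<bar>"
  have K: "0 < K" "M \<le> K" "C0 \<le> K" "\<bar>mass u0\<bar> \<le> K" using C0 M1 by (auto simp: K_def)
  have pv: "pbound t K (v t)" if t: "0 < t" for t
    unfolding pbound_def
  proof (intro conjI allI)
    show "integrable lborel (v t)" by (rule vi[OF t])
    show "(\<integral>x. \<bar>v t x\<bar> \<partial>lborel) \<le> K" using vM[OF t] K by simp
    fix x
    have "\<bar>v t x\<bar> \<le> C0 * (1 + t) powr (- ?n / 2)" by (rule C0(2)[OF t])
    also have "\<dots> \<le> K * t powr (- ?n / 2)" using K C0 t by (intro mult_mono powr_mono2') auto
    finally show "\<bar>v t x\<bar> \<le> K * t powr (- ?n / 2)" .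
  qed
  have pA: "pbound t K (A0 u0 t)" if t: "0 < t" for t by (rule pbound_mono[OF pbound_A0[OF t] K(4)])
  define K1 where "K1 = K powr (p - 1) * K"
  have K10: "0 \<le> K1" using K by (simp add: K1_def)
  have pF: "pbound s (K1 * s powr (- (\<sigma> + 1 / 2))) (F s)" if s: "0 < s" for s
    unfolding K1_def \<sigma>_def by (rule pbound_fnl[OF p1 pv[OF s]])
  have pfA: "pbound s (K1 * s powr (- (\<sigma> + 1 / 2))) (?A s)" if s: "0 < s" for s
    unfolding K1_def \<sigma>_def by (rule pbound_fnl[OF p1 pA[OF s]])
  have b1: "0 \<le> \<sigma> + 1 / 2" "\<sigma> + 1 / 2 < 1" and b2: "0 \<le> 2 * \<sigma> + 1 / 2" "2 * \<sigma> + 1 / 2 < 1" using \<sigma> by auto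
  have Aj: "jmeas ?A" by (rule fnl_A0_jmeas[OF p1])
  have Sj: "jmeas ?S" by (rule source2_jmeas[OF p1 sg])
  note jmeas_compose[OF Fj, measurable (raw)] jmeas_compose[OF Aj, measurable (raw)] jmeas_compose[OF Sj, measurable (raw)]
  have Gj: "jmeas (\<lambda>s y. F s y - ?A s y)" by measurable
  have Hj: "jmeas (\<lambda>s y. F s y - ?A s y - ?S s y)" by measurable
  obtain H1 where H1: "0 \<le> H1" "\<And>t. 0 < t \<Longrightarrow> pbound t (H1 * t powr (- \<sigma>)) (\<lambda>x. heat t u0 x - A0 u0 t x)"
    using pbound_heat_minus_A0[OF u0 u1, of \<sigma>] \<sigma> by auto
  define C1 where "C1 = H1 + Dcon a (\<sigma> + 1 / 2) * K1"
  have pvA: "pbound t (C1 * t powr (- \<sigma>)) (\<lambda>x. v t x - A0 u0 t x)" if t: "0 < t" for t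
  proof -
    have "pbound t (Dcon a (\<sigma> + 1 / 2) * K1 * t powr (1 / 2 - (\<sigma> + 1 / 2))) (Du a F t)"
      by (rule pbound_Du[OF Fj t b1 pF K10])
    from pbound_add[OF H1(2)[OF t] this] show ?thesis
      by (simp add: C1_def distrib_right eqn[OF t] algebra_simps)
  qed
  have C10: "0 \<le> C1" using pboundD(4)[OF pvA[of 1]] by simp
  define K2 where "K2 = p * K powr (p - 1) * C1"
  have K20: "0 \<le> K2" using p1 C10 by (simp add: K2_def)
  have sadd: "s powr (- \<sigma>) * s powr (- (\<sigma> + 1 / 2)) = s powr (- (2 * \<sigma> + 1 / 2))" for s :: real
    unfolding powr_add[symmetric] by simp
  have pG: "pbound s (K2 * s powr (- (2 * \<sigma> + 1 / 2))) (\<lambda>y. F s y - ?A s y)" if s: "0 < s" for s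
  proof -
    have "p * K powr (p - 1) * (C1 * s powr (- \<sigma>)) * s powr (- (\<sigma> + 1 / 2)) = K2 * (s powr (- \<sigma>) * s powr (- (\<sigma> + 1 / 2)))"
      by (simp add: K2_def)
    then show ?thesis
      using pbound_fnl_diff[OF p1 pv[OF s] pA[OF s] pvA[OF s]] unfolding \<sigma>_def[symmetric] sadd by (simp only:)
  qed
  have DuG: "Du a (\<lambda>s y. F s y - ?A s y) t x = Du a F t x - Du a ?A t x" if t: "0 < t" for t x
    by (rule Du_diff) (use pboundD(1)[OF pF] pboundD(1)[OF pfA] pbound_Du_integrable[OF Fj t b1 pF K10] pbound_Du_integrable[OF Aj t b1 pfA K10] in auto)
  obtain H2 where H2: "0 \<le> H2" "\<And>t. 0 < t \<Longrightarrow> pbound t (H2 * t powr (- (2 * \<sigma>))) (\<lambda>x. heat t u0 x - A0 u0 t x)"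
    using pbound_heat_minus_A0[OF u0 u1, of "2 * \<sigma>"] \<sigma> by auto
  define C2 where "C2 = H2 + Dcon a (2 * \<sigma> + 1 / 2) * K2"
  have pvA1: "pbound t (C2 * t powr (- (2 * \<sigma>))) (\<lambda>x. v t x - A01 a p u0 t x)" if t: "0 < t" for t
  proof -
    have "pbound t (Dcon a (2 * \<sigma> + 1 / 2) * K2 * t powr (1 / 2 - (2 * \<sigma> + 1 / 2))) (Du a (\<lambda>s y. F s y - ?A s y) t)"
      by (rule pbound_Du[OF Gj t b2 pG K20])
    moreover have "v t x - A01 a p u0 t x = (heat t u0 x - A0 u0 t x) + Du a (\<lambda>s y. F s y - ?A s y) t x" for x
      by (simp add: eqn[OF t] A01_eq_Du[OF p1] DuG[OF t])
    ultimately show ?thesis using pbound_add[OF H2(2)[OF t]] by (simp add: C2_def distrib_right)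
  qed
  have C20: "0 \<le> C2" using pboundD(4)[OF pvA1[of 1]] by simp
  obtain K3 where K3: "0 \<le> K3" "\<And>s. 0 < s \<Longrightarrow> pbound s (K3 * s powr (- (2 * \<sigma> + 1 / 2))) (?S s)"
    using pbound_source2[OF p1 sg] unfolding \<sigma>_def by blast
  define \<beta> where "\<beta> = min 1 (p - 1)"
  have \<beta>: "0 < \<beta>" "\<beta> \<le> 1" using p1 by (auto simp: \<beta>_def)
  \<comment> \<open>At most \<sigma>\<beta>, the gain of the Taylor remainder, and hence at most the
    gain \<sigma> of the linear error, as \<beta> <= 1. At most 1/4 - \<sigma>, which keeps
    2\<sigma> + 1/2 + \<delta> below 1 and 2\<sigma> + \<delta> in the range of
    \<open>pbound_heat_minus_A0\<close>.\<close>
  define \<delta> where "\<delta> = min (\<sigma> * \<beta>) ((1 / 2 - 2 * \<sigma>) / 2)"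
  have \<delta>: "0 < \<delta>" "\<delta> \<le> \<sigma> * \<beta>" "2 * \<sigma> + \<delta> \<le> 1 / 2" "2 * \<sigma> + 1 / 2 + \<delta> < 1"
  proof -
    have d: "\<delta> \<le> 1 / 4 - \<sigma>" by (simp add: \<delta>_def field_simps min_def)
    show "0 < \<delta>" using \<sigma> \<beta> by (simp add: \<delta>_def)
    show "\<delta> \<le> \<sigma> * \<beta>" by (simp add: \<delta>_def)
    show "2 * \<sigma> + \<delta> \<le> 1 / 2" "2 * \<sigma> + 1 / 2 + \<delta> < 1" using d \<sigma> by linarith+
  qed
  define K4 where "K4 = p * max 1 (p - 1) * K powr (p - 1 - \<beta>) * (C1 powr \<beta> * C1) + p * K powr (p - 1) * C2"
  have K40: "0 \<le> K4" using p1 C10 C20 by (simp add: K4_def)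
  define K5 where "K5 = K2 + K3 + K4"
  have K5: "0 \<le> K5" "K2 + K3 \<le> K5" "K4 \<le> K5" using K20 K3 K40 by (auto simp: K5_def)
  have pH: "pbound s (K5 * s powr (- (2 * \<sigma> + 1 / 2 + \<delta>))) (\<lambda>y. F s y - ?A s y - ?S s y)" if s: "0 < s" for s
  proof (cases "1 \<le> s")
    \<comment> \<open>For s < 1 a larger exponent makes the bound weaker, so the separate
      first-order bounds suffice; the expansion is needed for s >= 1 only.\<close>
    case False
    have "pbound s (K2 * s powr (- (2 * \<sigma> + 1 / 2)) + K3 * s powr (- (2 * \<sigma> + 1 / 2))) (\<lambda>y. F s y - ?A s y - ?S s y)"
      by (rule pbound_diff[OF pG[OF s] K3(2)[OF s]])
    moreover have "K2 * s powr (- (2 * \<sigma> + 1 / 2)) + K3 * s powr (- (2 * \<sigma> + 1 / 2)) \<le> K5 * s powr (- (2 * \<sigma> + 1 / 2 + \<delta>))"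
      unfolding distrib_right[symmetric] using s False \<delta> K5 by (intro mult_mono powr_mono') auto
    ultimately show ?thesis by (rule pbound_mono)
  next
    case True
    \<comment> \<open>The term f'(A0)(v - A0) is inserted: \<open>?P1\<close> is the Taylor
      remainder of f between A0 and v, and \<open>?P2\<close> is the error of using A01 in place of
      v in the linear term.\<close>
    let ?P1 = "\<lambda>y. F s y - ?A s y - (v s y - A0 u0 s y) * deriv (fnl p) (A0 u0 s y)"
    let ?P2 = "\<lambda>y. (v s y - A01 a p u0 s y) * deriv (fnl p) (A0 u0 s y)"
    have 1: "pbound s (p * max 1 (p - 1) * K powr (p - 1 - \<beta>) * ((C1 * s powr (- \<sigma>)) powr \<beta> * (C1 * s powr (- \<sigma>))) * s powr (- (\<sigma> + 1 / 2))) ?P1"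
      unfolding \<beta>_def \<sigma>_def by (rule pbound_second_order[OF p1 s K(1) pv[OF s] pA[OF s] pvA[OF s, unfolded \<sigma>_def]])
    have 2: "pbound s (p * K powr (p - 1) * (C2 * s powr (- (2 * \<sigma>))) * s powr (- (\<sigma> + 1 / 2))) ?P2"
      unfolding \<sigma>_def by (rule pbound_deriv_mult[OF p1 pA[OF s] pvA1[OF s, unfolded \<sigma>_def]])
    have e1: "p * max 1 (p - 1) * K powr (p - 1 - \<beta>) * ((C1 * s powr (- \<sigma>)) powr \<beta> * (C1 * s powr (- \<sigma>))) * s powr (- (\<sigma> + 1 / 2))
      = p * max 1 (p - 1) * K powr (p - 1 - \<beta>) * (C1 powr \<beta> * C1) * (s powr (- \<sigma> * \<beta>) * s powr (- \<sigma>) * s powr (- (\<sigma> + 1 / 2)))"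
      using C10 by (simp add: powr_mult powr_powr)
    have e1': "s powr (- \<sigma> * \<beta>) * s powr (- \<sigma>) * s powr (- (\<sigma> + 1 / 2)) \<le> s powr (- (2 * \<sigma> + 1 / 2 + \<delta>))"
      unfolding powr_add[symmetric] using True \<delta> by (intro powr_mono) auto
    have e2: "s powr (- (2 * \<sigma>)) * s powr (- (\<sigma> + 1 / 2)) \<le> s powr (- (2 * \<sigma> + 1 / 2 + \<delta>))"
    proof -
      have "\<sigma> * \<beta> \<le> \<sigma> * 1" using \<sigma> \<beta> by (intro mult_left_mono) auto
      then show ?thesis unfolding powr_add[symmetric] using True \<delta> by (intro powr_mono) auto
    qed
    have "p * max 1 (p - 1) * K powr (p - 1 - \<beta>) * ((C1 * s powr (- \<sigma>)) powr \<beta> * (C1 * s powr (- \<sigma>))) * s powr (- (\<sigma> + 1 / 2))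
       + p * K powr (p - 1) * (C2 * s powr (- (2 * \<sigma>))) * s powr (- (\<sigma> + 1 / 2))
       \<le> p * max 1 (p - 1) * K powr (p - 1 - \<beta>) * (C1 powr \<beta> * C1) * s powr (- (2 * \<sigma> + 1 / 2 + \<delta>)) + p * K powr (p - 1) * C2 * s powr (- (2 * \<sigma> + 1 / 2 + \<delta>))"
    proof (rule add_mono)
      show "p * K powr (p - 1) * (C2 * s powr (- (2 * \<sigma>))) * s powr (- (\<sigma> + 1 / 2)) \<le> p * K powr (p - 1) * C2 * s powr (- (2 * \<sigma> + 1 / 2 + \<delta>))"
        using mult_left_mono[OF e2, of "p * K powr (p - 1) * C2"] p1 C20 by (simp add: mult.assoc)
      show "p * max 1 (p - 1) * K powr (p - 1 - \<beta>) * ((C1 * s powr (- \<sigma>)) powr \<beta> * (C1 * s powr (- \<sigma>))) * s powr (- (\<sigma> + 1 / 2))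
        \<le> p * max 1 (p - 1) * K powr (p - 1 - \<beta>) * (C1 powr \<beta> * C1) * s powr (- (2 * \<sigma> + 1 / 2 + \<delta>))"
        unfolding e1 using p1 C10 by (intro mult_left_mono[OF e1']) auto
    qed
    also have "\<dots> = K4 * s powr (- (2 * \<sigma> + 1 / 2 + \<delta>))" by (simp add: K4_def distrib_right)
    also have "\<dots> \<le> K5 * s powr (- (2 * \<sigma> + 1 / 2 + \<delta>))" using K5 by (intro mult_right_mono) auto
    finally have le: "p * max 1 (p - 1) * K powr (p - 1 - \<beta>) * ((C1 * s powr (- \<sigma>)) powr \<beta> * (C1 * s powr (- \<sigma>))) * s powr (- (\<sigma> + 1 / 2))
       + p * K powr (p - 1) * (C2 * s powr (- (2 * \<sigma>))) * s powr (- (\<sigma> + 1 / 2)) \<le> K5 * s powr (- (2 * \<sigma> + 1 / 2 + \<delta>))" .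
    have eq: "(\<lambda>y. F s y - ?A s y - ?S s y) = (\<lambda>y. ?P1 y + ?P2 y)"
      by (simp add: source2_def algebra_simps)
    show ?thesis unfolding eq by (rule pbound_mono[OF pbound_add[OF 1 2] le])
  qed
  obtain H3 where H3: "0 \<le> H3" "\<And>t. 0 < t \<Longrightarrow> pbound t (H3 * t powr (- (2 * \<sigma> + \<delta>))) (\<lambda>x. heat t u0 x - A0 u0 t x)"
    using pbound_heat_minus_A0[OF u0 u1, of "2 * \<sigma> + \<delta>"] \<sigma> \<delta> by auto
  let ?b = "2 * \<sigma> + 1 / 2 + \<delta>"
  have b3: "0 \<le> ?b" "?b < 1" using \<sigma> \<delta> by auto
  show ?thesis
  proof (rule that[of "H3 + Dcon a ?b * K5" \<delta>])
    show "0 \<le> H3 + Dcon a ?b * K5" using H3 K5 b3 by (simp add: Dcon_def)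
    fix t :: real assume t: "0 < t"
    have DuH: "Du a (\<lambda>s y. F s y - ?A s y - ?S s y) t x = Du a (\<lambda>s y. F s y - ?A s y) t x - Du a ?S t x" for x
      by (rule Du_diff) (use pboundD(1)[OF pG] pboundD(1)[OF K3(2)] pbound_Du_integrable[OF Gj t b2 pG K20] pbound_Du_integrable[OF Sj t b2 K3(2) K3(1)] in auto)
    have "pbound t (Dcon a ?b * K5 * t powr (1 / 2 - ?b)) (Du a (\<lambda>s y. F s y - ?A s y - ?S s y) t)"
      by (rule pbound_Du[OF Hj t b3 pH K5(1)])
    moreover have "1 / 2 - ?b = - (2 * \<sigma> + \<delta>)" by simp
    moreover have "v t x - A01 a p u0 t x - Du a ?S t x = (heat t u0 x - A0 u0 t x) + Du a (\<lambda>s y. F s y - ?A s y - ?S s y) t x" for x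
      by (simp add: eqn[OF t] A01_eq_Du[OF p1] DuG[OF t] DuH)
    ultimately have "pbound t ((H3 + Dcon a ?b * K5) * t powr (- (2 * \<sigma> + \<delta>))) (\<lambda>x. v t x - A01 a p u0 t x - Du a ?S t x)"
      using pbound_add[OF H3(2)[OF t]] by (simp only: distrib_right)
    then show "pbound t ((H3 + Dcon a ?b * K5) * t powr (- (2 * sigma ?n p + \<delta>))) (\<lambda>x. v t x - A01 a p u0 t x - Du a ?S t x)"
      by (simp only: \<sigma>_def)
  qed (use \<delta> in auto)
qed

subsection \<open>Lebesgue norms\<close>

lemma one_le_ereal_cases:
  fixes q :: ereal
  assumes "1 \<le> q"
  obtains "q = \<infinity>" | r where "q = ereal r" "1 \<le> r"
  using assms by (cases q) (auto simp: one_ereal_def)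

lemma Lq_norm_ereal:
  fixes g :: "'a::euclidean_space \<Rightarrow> real"
  assumes r: "1 \<le> r" and i: "integrable lborel (\<lambda>x. \<bar>g x\<bar> powr r)"
  shows "Lq_norm (ereal r) g = ennreal ((\<integral>x. \<bar>g x\<bar> powr r \<partial>lborel) powr (1 / r))"
proof -
  have "(\<integral>\<^sup>+x. ennreal (\<bar>g x\<bar> powr r) \<partial>lborel) = ennreal (\<integral>x. \<bar>g x\<bar> powr r \<partial>lborel)"
    by (rule nn_integral_eq_integral[OF i]) simp
  then show ?thesis by (simp add: Lq_norm_def)
qed

lemma Lq_norm_cong_AE:
  assumes "AE x in lborel. f x = g x"
  shows "Lq_norm q f = Lq_norm q g"
proof -
  have "(\<integral>\<^sup>+x. ennreal (\<bar>f x\<bar> powr r) \<partial>lborel) = (\<integral>\<^sup>+x. ennreal (\<bar>g x\<bar> powr r) \<partial>lborel)" for r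
    by (rule nn_integral_cong_AE) (use assms in auto)
  moreover have "(AE x in lborel. ennreal \<bar>f x\<bar> \<le> C) \<longleftrightarrow> (AE x in lborel. ennreal \<bar>g x\<bar> \<le> C)" for C
    using assms by (auto elim: AE_mp)
  ultimately show ?thesis by (simp add: Lq_norm_def)
qed

text \<open>Interpolation by |g|^r <= (sup |g|)^(r - 1) |g|. At t = 1 it makes every L^q norm at
  most \<open>C\<close> (\<open>Lq_norm_le_pbound\<close>).\<close>

lemma pbound_powr:
  fixes g :: "'a::euclidean_space \<Rightarrow> real"
  assumes g: "pbound t C g" and r: "1 \<le> r"
  shows "integrable lborel (\<lambda>x. \<bar>g x\<bar> powr r)"
    and "(\<integral>x. \<bar>g x\<bar> powr r \<partial>lborel) \<le> (C * t powr (- real DIM('a) / 2)) powr (r - 1) * C"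
proof -
  note pboundD(5)[OF g, measurable]
  let ?D = "(C * t powr (- real DIM('a) / 2)) powr (r - 1)"
  have b: "\<bar>g x\<bar> powr r \<le> ?D * \<bar>g x\<bar>" for x
  proof (cases "g x = 0")
    case False
    have "\<bar>g x\<bar> powr r = \<bar>g x\<bar> powr (r - 1) * \<bar>g x\<bar>" using False powr_add[of "\<bar>g x\<bar>" "r - 1" 1] by simp
    also have "\<dots> \<le> ?D * \<bar>g x\<bar>" using pboundD(3)[OF g] r by (intro mult_right_mono powr_mono2) auto
    finally show ?thesis .
  qed simp
  show i: "integrable lborel (\<lambda>x. \<bar>g x\<bar> powr r)"
    by (rule Bochner_Integration.integrable_bound[of _ "\<lambda>x. ?D * g x"])
       (use pboundD(1)[OF g] b in \<open>auto simp: abs_mult\<close>)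
  have "(\<integral>x. \<bar>g x\<bar> powr r \<partial>lborel) \<le> (\<integral>x. ?D * \<bar>g x\<bar> \<partial>lborel)"
    by (rule integral_mono[OF i _ b]) (use pboundD(1)[OF g] in auto)
  also have "\<dots> \<le> ?D * C" using pboundD(2)[OF g] by (simp add: mult_left_mono)
  finally show "(\<integral>x. \<bar>g x\<bar> powr r \<partial>lborel) \<le> ?D * C" .
qed

lemma Lq_norm_le_pbound:
  fixes g :: "'a::euclidean_space \<Rightarrow> real"
  assumes g: "pbound 1 C g" and q: "1 \<le> q"
  shows "Lq_norm q g \<le> ennreal C"
  using q
proof (cases rule: one_le_ereal_cases)
  case 1
  have "AE x in lborel. ennreal \<bar>g x\<bar> \<le> ennreal C" using pboundD(3)[OF g] by (auto intro!: ennreal_leI)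
  then show ?thesis using 1 by (auto simp: Lq_norm_def intro: Inf_lower)
next
  case (2 r)
  have C0: "0 \<le> C" by (rule pboundD(4)[OF g])
  have "(\<integral>x. \<bar>g x\<bar> powr r \<partial>lborel) powr (1 / r) \<le> (C powr (r - 1) * C) powr (1 / r)"
    using pbound_powr[OF g 2(2)] 2(2) by (intro powr_mono2) auto
  also have "C powr (r - 1) * C = C powr r" using C0 powr_add[of C "r - 1" 1] by (cases "C = 0") auto
  also have "(C powr r) powr (1 / r) = C" using C0 2(2) by (simp add: powr_powr)
  finally show ?thesis
    unfolding 2(1) Lq_norm_ereal[OF 2(2) pbound_powr(1)[OF g 2(2)]] by (rule ennreal_leI)
qed

lemma powr_convex_combination:
  fixes x y l r :: real
  assumes "0 \<le> x" "0 \<le> y" "0 < l" "l < 1" "1 \<le> r"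
  shows "(l * x + (1 - l) * y) powr r \<le> l * x powr r + (1 - l) * y powr r"
proof (cases "x = 0 \<or> y = 0")
  case False
  then show ?thesis
    using convex_onD[OF powr_convex[OF assms(5)], of "1 - l" x y] assms by simp
next
  case True
  \<comment> \<open>With one of the points at 0 the claim reduces to l^r <= l for 0 < l < 1.\<close>
  have le: "l' powr r \<le> l'" if "0 < l'" "l' < 1" for l' :: real
    using powr_mono'[of 1 r l'] that assms by simp
  show ?thesis using True
  proof
    assume x: "x = 0"
    have "(1 - l) powr r * y powr r \<le> (1 - l) * y powr r" using le[of "1 - l"] assms by (intro mult_right_mono) auto
    then show ?thesis using x assms by (simp add: powr_mult)
  next
    assume y: "y = 0"
    have "l powr r * x powr r \<le> l * x powr r" using le[of l] assms by (intro mult_right_mono) auto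
    then show ?thesis using y assms by (simp add: powr_mult)
  qed
qed

text \<open>With A and B the norms of f and g, |f + g|/(A + B) is at most the convex combination of
  |f|/A and |g|/B with weights A/(A + B) and B/(A + B); convexity of the r-th power is then
  integrated. If A or B is 0, that function vanishes almost everywhere.\<close>

lemma minkowski:
  fixes f g :: "'a::euclidean_space \<Rightarrow> real"
  assumes r: "1 \<le> r" and [measurable]: "f \<in> borel_measurable borel" "g \<in> borel_measurable borel"
    and f: "integrable lborel (\<lambda>x. \<bar>f x\<bar> powr r)" and g: "integrable lborel (\<lambda>x. \<bar>g x\<bar> powr r)"
    and fg: "integrable lborel (\<lambda>x. \<bar>f x + g x\<bar> powr r)"
  shows "(\<integral>x. \<bar>f x + g x\<bar> powr r \<partial>lborel) powr (1 / r)
    \<le> (\<integral>x. \<bar>f x\<bar> powr r \<partial>lborel) powr (1 / r) + (\<integral>x. \<bar>g x\<bar> powr r \<partial>lborel) powr (1 / r)"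
proof -
  define A where "A = (\<integral>x. \<bar>f x\<bar> powr r \<partial>lborel) powr (1 / r)"
  define B where "B = (\<integral>x. \<bar>g x\<bar> powr r \<partial>lborel) powr (1 / r)"
  have zero: "(\<integral>x. \<bar>h x\<bar> powr r \<partial>lborel) = 0 \<Longrightarrow> AE x in lborel. h x = 0"
    if "integrable lborel (\<lambda>x. \<bar>h x\<bar> powr r)" for h :: "'a \<Rightarrow> real"
    using integral_nonneg_eq_0_iff_AE[OF that] by auto
  consider "A = 0" | "B = 0" | "0 < A" "0 < B" unfolding A_def B_def by (metis less_eq_real_def powr_ge_zero)
  then show ?thesis
  proof cases
    case 1
    then have "AE x in lborel. f x = 0" using zero[OF f] by (simp add: A_def)
    then have "(\<integral>x. \<bar>f x + g x\<bar> powr r \<partial>lborel) = (\<integral>x. \<bar>g x\<bar> powr r \<partial>lborel)"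
      by (intro integral_cong_AE) auto
    then show ?thesis by simp
  next
    case 2
    then have "AE x in lborel. g x = 0" using zero[OF g] by (simp add: B_def)
    then have "(\<integral>x. \<bar>f x + g x\<bar> powr r \<partial>lborel) = (\<integral>x. \<bar>f x\<bar> powr r \<partial>lborel)"
      by (intro integral_cong_AE) auto
    then show ?thesis by simp
  next
    case 3
    have If: "(\<integral>x. \<bar>f x\<bar> powr r \<partial>lborel) = A powr r" and Ig: "(\<integral>x. \<bar>g x\<bar> powr r \<partial>lborel) = B powr r"
      using r by (auto simp: A_def B_def powr_powr)
    define l where "l = A / (A + B)"
    have l: "0 < l" "l < 1" "1 - l = B / (A + B)" using 3 by (auto simp: l_def field_simps)
    have pw: "\<bar>f x + g x\<bar> powr r \<le> (A + B) powr r * (l * (\<bar>f x\<bar> powr r / A powr r) + (1 - l) * (\<bar>g x\<bar> powr r / B powr r))" for x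
    proof -
      have "\<bar>f x + g x\<bar> \<le> (A + B) * (l * (\<bar>f x\<bar> / A) + (1 - l) * (\<bar>g x\<bar> / B))"
      proof -
        have lA: "(A + B) * l = A" and lB: "(A + B) * (1 - l) = B" unfolding l(3) unfolding l_def using 3 by auto
        have "(A + B) * (l * (\<bar>f x\<bar> / A) + (1 - l) * (\<bar>g x\<bar> / B)) = (A + B) * l * (\<bar>f x\<bar> / A) + (A + B) * (1 - l) * (\<bar>g x\<bar> / B)"
          by (simp only: distrib_left mult.assoc)
        also have "\<dots> = \<bar>f x\<bar> + \<bar>g x\<bar>" unfolding lA lB using 3 by simp
        finally show ?thesis using abs_triangle_ineq[of "f x" "g x"] by simp
      qed
      then have "\<bar>f x + g x\<bar> powr r \<le> ((A + B) * (l * (\<bar>f x\<bar> / A) + (1 - l) * (\<bar>g x\<bar> / B))) powr r"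
        using r by (intro powr_mono2) auto
      also have "\<dots> = (A + B) powr r * (l * (\<bar>f x\<bar> / A) + (1 - l) * (\<bar>g x\<bar> / B)) powr r"
        using 3 l by (simp add: powr_mult)
      also have "\<dots> \<le> (A + B) powr r * (l * (\<bar>f x\<bar> / A) powr r + (1 - l) * (\<bar>g x\<bar> / B) powr r)"
        using 3 l r by (intro mult_left_mono powr_convex_combination) auto
      finally show ?thesis using 3 by (simp add: powr_divide)
    qed
    have "(\<integral>x. \<bar>f x + g x\<bar> powr r \<partial>lborel) \<le> (\<integral>x. (A + B) powr r * (l * (\<bar>f x\<bar> powr r / A powr r) + (1 - l) * (\<bar>g x\<bar> powr r / B powr r)) \<partial>lborel)"
      by (rule integral_mono[OF fg _ pw]) (use f g in auto)
    also have "\<dots> = (A + B) powr r * (l * (A powr r / A powr r) + (1 - l) * (B powr r / B powr r))"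
      using f g by (simp add: If Ig)
    also have "\<dots> = (A + B) powr r" using 3 by simp
    finally have "(\<integral>x. \<bar>f x + g x\<bar> powr r \<partial>lborel) powr (1 / r) \<le> ((A + B) powr r) powr (1 / r)"
      using r by (intro powr_mono2) auto
    also have "\<dots> = A + B" using 3 r by (simp add: powr_powr)
    finally show ?thesis by (simp add: A_def B_def)
  qed
qed

lemma Lq_norm_triangle:
  fixes f g :: "'a::euclidean_space \<Rightarrow> real"
  assumes f: "pbound 1 C f" and g: "pbound 1 D g" and q: "1 \<le> q"
  shows "Lq_norm q (\<lambda>x. f x + g x) \<le> Lq_norm q f + Lq_norm q g"
  using q
proof (cases rule: one_le_ereal_cases)
  case (2 r)
  have fg: "pbound 1 (C + D) (\<lambda>x. f x + g x)" by (rule pbound_add[OF f g])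
  note i = pbound_powr(1)[OF f 2(2)] pbound_powr(1)[OF g 2(2)] pbound_powr(1)[OF fg 2(2)]
  show ?thesis
    unfolding 2(1) Lq_norm_ereal[OF 2(2) i(1)] Lq_norm_ereal[OF 2(2) i(2)] Lq_norm_ereal[OF 2(2) i(3)]
    using minkowski[OF 2(2) pboundD(5)[OF f] pboundD(5)[OF g] i] by (simp add: ennreal_plus[symmetric] del: ennreal_plus)
next
  case 1
  let ?S = "\<lambda>f::'a \<Rightarrow> real. {C::ennreal. AE x in lborel. ennreal \<bar>f x\<bar> \<le> C}"
  \<comment> \<open>Bounds within e/2 of each of the two infima exist because both infima are
    finite.\<close>
  have less_add: "A < A + ennreal e" if "A < top" "0 < e" for A e
    using that by (cases A) (auto simp: ennreal_plus[symmetric] ennreal_less_iff simp del: ennreal_plus)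
  have "Inf (?S (\<lambda>x. f x + g x)) \<le> Inf (?S f) + Inf (?S g)"
  proof (rule ennreal_le_epsilon)
    fix e :: real assume fin: "Inf (?S f) + Inf (?S g) < top" and e: "0 < e"
    have "Inf (?S f) < Inf (?S f) + ennreal (e / 2)" "Inf (?S g) < Inf (?S g) + ennreal (e / 2)"
    proof -
      have ff: "Inf (?S f) < top \<and> Inf (?S g) < top" using fin unfolding ennreal_add_less_top .
      have e2: "0 < e / 2" using e by simp
      show "Inf (?S f) < Inf (?S f) + ennreal (e / 2)" "Inf (?S g) < Inf (?S g) + ennreal (e / 2)"
        using less_add[OF conjunct1[OF ff] e2] less_add[OF conjunct2[OF ff] e2] by auto
    qed
    then obtain C1 C2 where C1: "C1 \<in> ?S f" "C1 < Inf (?S f) + ennreal (e / 2)" and C2: "C2 \<in> ?S g" "C2 < Inf (?S g) + ennreal (e / 2)"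
      unfolding Inf_less_iff by blast
    have "AE x in lborel. ennreal \<bar>f x + g x\<bar> \<le> C1 + C2"
    proof -
      have "AE x in lborel. ennreal \<bar>f x\<bar> \<le> C1" "AE x in lborel. ennreal \<bar>g x\<bar> \<le> C2" using C1 C2 by auto
      then show ?thesis
      proof eventually_elim
        case (elim x)
        have "ennreal \<bar>f x + g x\<bar> \<le> ennreal (\<bar>f x\<bar> + \<bar>g x\<bar>)" by (intro ennreal_leI abs_triangle_ineq)
        also have "\<dots> = ennreal \<bar>f x\<bar> + ennreal \<bar>g x\<bar>" by (rule ennreal_plus) auto
        also have "\<dots> \<le> C1 + C2" using elim by (intro add_mono) auto
        finally show ?case .
      qed
    qed
    then have "Inf (?S (\<lambda>x. f x + g x)) \<le> C1 + C2" by (intro Inf_lower) auto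
    also have "\<dots> \<le> (Inf (?S f) + ennreal (e / 2)) + (Inf (?S g) + ennreal (e / 2))" using C1 C2 by (intro add_mono) auto
    also have "\<dots> = Inf (?S f) + Inf (?S g) + (ennreal (e / 2) + ennreal (e / 2))" by (simp add: ac_simps)
    also have "ennreal (e / 2) + ennreal (e / 2) = ennreal e" using e by (subst ennreal_plus[symmetric]) auto
    finally show "Inf (?S (\<lambda>x. f x + g x)) \<le> Inf (?S f) + Inf (?S g) + ennreal e" .
  qed
  then show ?thesis using 1 by (simp add: Lq_norm_def)
qed

lemma AE_lborel_scale:
  fixes P :: "'a::euclidean_space \<Rightarrow> bool"
  assumes c: "c \<noteq> 0" and P: "Measurable.pred borel P"
  shows "(AE x in lborel. P (c *\<^sub>R x)) \<longleftrightarrow> (AE x in lborel. P x)"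
proof -
  have "(AE x in lborel. P x) \<longleftrightarrow> (AE x in density (distr lborel borel (\<lambda>x. 0 + c *\<^sub>R x)) (\<lambda>_. ennreal (\<bar>c\<bar> ^ DIM('a))). P x)"
    by (rule arg_cong[where f = "\<lambda>N. almost_everywhere N P", OF lborel_affine[OF c, of "0::'a"]])
  also have "\<dots> \<longleftrightarrow> (AE x in lborel. P (c *\<^sub>R x))"
    using P c by (subst AE_density) (auto simp: AE_distr_iff)
  finally show ?thesis by simp
qed

text \<open>The substitution x -> sqrt(t) x contributes t^(-n/(2q)). The weight depending on q thus
  turns into a rescaling that is the same for all q, and one family of rescaled functions serves
  every norm.\<close>

lemma Lq_norm_scale:
  fixes h :: "'a::euclidean_space \<Rightarrow> real"
  assumes t: "0 < t" and [measurable]: "h \<in> borel_measurable borel" and q: "1 \<le> q"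
  shows "ennreal (t powr (real DIM('a) / 2 * (1 - inv_exp q) + s)) * Lq_norm q h
    = Lq_norm q (\<lambda>x. t powr (real DIM('a) / 2 + s) * h (sqrt t *\<^sub>R x))"
  using q
proof (cases rule: one_le_ereal_cases)
  case 1
  let ?k = "t powr (real DIM('a) / 2 + s)"
  have k: "0 < ?k" using t by simp
  let ?S = "\<lambda>f::'a \<Rightarrow> real. {C::ennreal. AE x in lborel. ennreal \<bar>f x\<bar> \<le> C}"
  let ?g = "\<lambda>x. ?k * h (sqrt t *\<^sub>R x)"
  have kk: "ennreal (1 / ?k) * (ennreal ?k * X) = X" "ennreal ?k * (ennreal (1 / ?k) * X) = X" for X
    using k by (auto simp: mult.assoc[symmetric] ennreal_mult[symmetric])
  have iff: "ennreal ?k * C \<in> ?S ?g \<longleftrightarrow> C \<in> ?S h" for C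
  proof -
    have "ennreal ?k * C \<in> ?S ?g \<longleftrightarrow> (AE x in lborel. ennreal \<bar>h (sqrt t *\<^sub>R x)\<bar> \<le> C)"
    proof -
      have "ennreal \<bar>?g x\<bar> \<le> ennreal ?k * C \<longleftrightarrow> ennreal \<bar>h (sqrt t *\<^sub>R x)\<bar> \<le> C" for x
      proof -
        have e: "ennreal \<bar>?g x\<bar> = ennreal ?k * ennreal \<bar>h (sqrt t *\<^sub>R x)\<bar>" by (simp add: abs_mult ennreal_mult)
        show ?thesis unfolding e
          using mult_left_mono[of "ennreal ?k * ennreal \<bar>h (sqrt t *\<^sub>R x)\<bar>" "ennreal ?k * C" "ennreal (1 / ?k)"]
            mult_left_mono[of "ennreal \<bar>h (sqrt t *\<^sub>R x)\<bar>" C "ennreal ?k"] unfolding kk by auto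
      qed
      then show ?thesis by simp
    qed
    also have "\<dots> \<longleftrightarrow> C \<in> ?S h"
      using AE_lborel_scale[of "sqrt t" "\<lambda>x. ennreal \<bar>h x\<bar> \<le> C"] t by simp
    finally show ?thesis .
  qed
  have "ennreal ?k * Inf (?S h) = Inf (?S ?g)"
  proof (rule antisym)
    show "ennreal ?k * Inf (?S h) \<le> Inf (?S ?g)"
    proof (rule Inf_greatest)
      fix C assume "C \<in> ?S ?g"
      then have "ennreal (1 / ?k) * C \<in> ?S h" using iff[of "ennreal (1 / ?k) * C"] unfolding kk by simp
      then have "Inf (?S h) \<le> ennreal (1 / ?k) * C" by (rule Inf_lower)
      then have "ennreal ?k * Inf (?S h) \<le> ennreal ?k * (ennreal (1 / ?k) * C)" by (rule mult_left_mono) simp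
      then show "ennreal ?k * Inf (?S h) \<le> C" unfolding kk .
    qed
    have "ennreal (1 / ?k) * Inf (?S ?g) \<le> Inf (?S h)"
    proof (rule Inf_greatest)
      fix C assume "C \<in> ?S h"
      then have "Inf (?S ?g) \<le> ennreal ?k * C" using iff[of C] by (intro Inf_lower) blast
      then have "ennreal (1 / ?k) * Inf (?S ?g) \<le> ennreal (1 / ?k) * (ennreal ?k * C)" by (rule mult_left_mono) simp
      then show "ennreal (1 / ?k) * Inf (?S ?g) \<le> C" unfolding kk .
    qed
    then have "ennreal ?k * (ennreal (1 / ?k) * Inf (?S ?g)) \<le> ennreal ?k * Inf (?S h)" by (rule mult_left_mono) simp
    then show "Inf (?S ?g) \<le> ennreal ?k * Inf (?S h)" unfolding kk .
  qed
  then show ?thesis using 1 by (simp add: Lq_norm_def inv_exp_def)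
next
  case (2 r)
  let ?k = "t powr (real DIM('a) / 2 + s)"
  define I where "I = (\<integral>\<^sup>+x. ennreal (\<bar>h x\<bar> powr r) \<partial>lborel)"
  define J where "J = (\<integral>\<^sup>+x. ennreal (\<bar>?k * h (sqrt t *\<^sub>R x)\<bar> powr r) \<partial>lborel)"
  have k: "0 < ?k" using t by simp
  have sq: "sqrt t ^ DIM('a) = t powr (real DIM('a) / 2)" using t by (simp add: powr_half_sqrt[symmetric] powr_power)
  have I2: "I = ennreal (t powr (real DIM('a) / 2)) * (\<integral>\<^sup>+x. ennreal (\<bar>h (sqrt t *\<^sub>R x)\<bar> powr r) \<partial>lborel)"
    using nn_integral_lborel_affine[of "\<lambda>x. ennreal (\<bar>h x\<bar> powr r)" "sqrt t" 0] t by (simp add: I_def sq)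
  have "J = (\<integral>\<^sup>+x. ennreal (?k powr r) * ennreal (\<bar>h (sqrt t *\<^sub>R x)\<bar> powr r) \<partial>lborel)"
    unfolding J_def using k by (intro nn_integral_cong) (simp add: abs_mult powr_mult ennreal_mult)
  also have "\<dots> = ennreal (?k powr r) * (\<integral>\<^sup>+x. ennreal (\<bar>h (sqrt t *\<^sub>R x)\<bar> powr r) \<partial>lborel)"
    by (rule nn_integral_cmult) measurable
  also have "(\<integral>\<^sup>+x. ennreal (\<bar>h (sqrt t *\<^sub>R x)\<bar> powr r) \<partial>lborel) = ennreal (t powr (- real DIM('a) / 2)) * I"
    unfolding I2 using t by (simp add: mult.assoc[symmetric] ennreal_mult[symmetric] powr_add[symmetric])
  finally have J: "J = ennreal (?k powr r * t powr (- real DIM('a) / 2)) * I" by (simp add: ennreal_mult mult.assoc)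
  have c0: "0 < ?k powr r * t powr (- real DIM('a) / 2)" using t by simp
  show ?thesis
  proof (cases "I = \<infinity>")
    case True
    then have "J = \<infinity>" using t J by (simp add: ennreal_mult_eq_top_iff)
    then show ?thesis using True t unfolding 2(1) Lq_norm_def I_def J_def
      by (simp add: ennreal_mult_eq_top_iff)
  next
    case False
    then have J': "J \<noteq> \<infinity>" using J by (simp add: ennreal_mult_eq_top_iff)
    have e: "enn2real J = ?k powr r * t powr (- real DIM('a) / 2) * enn2real I" using J by (simp add: enn2real_mult)
    have "enn2real J powr (1 / r) = (?k powr r) powr (1 / r) * (t powr (- real DIM('a) / 2)) powr (1 / r) * enn2real I powr (1 / r)"
      unfolding e using c0 by (simp add: powr_mult del: powr_powr)
    also have "(?k powr r) powr (1 / r) = ?k" using 2(2) k by (simp add: powr_powr)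
    also have "?k * (t powr (- real DIM('a) / 2)) powr (1 / r) = t powr (real DIM('a) / 2 * (1 - 1 / r) + s)"
      unfolding powr_powr powr_add[symmetric] by (rule arg_cong[where f = "\<lambda>e. t powr e"]) (use 2 in \<open>simp add: field_simps\<close>)
    finally have fin: "enn2real J powr (1 / r) = t powr (real DIM('a) / 2 * (1 - 1 / r) + s) * enn2real I powr (1 / r)" .
    have L1: "Lq_norm q h = ennreal (enn2real I powr (1 / r))" using False by (simp add: 2(1) Lq_norm_def I_def)
    have L2: "Lq_norm q (\<lambda>x. ?k * h (sqrt t *\<^sub>R x)) = ennreal (enn2real J powr (1 / r))" using J' by (simp add: 2(1) Lq_norm_def J_def)
    show ?thesis unfolding L1 L2 fin using 2 by (simp add: inv_exp_def ennreal_mult)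
  qed
qed

lemma pbound_scale:
  fixes h :: "'a::euclidean_space \<Rightarrow> real"
  assumes t: "0 < t" and h: "pbound t C h"
  shows "pbound 1 C (\<lambda>x. t powr (real DIM('a) / 2) * h (sqrt t *\<^sub>R x))"
proof -
  note pboundD(5)[OF h, measurable]
  have sq: "sqrt t ^ DIM('a) = t powr (real DIM('a) / 2)" using t by (simp add: powr_half_sqrt[symmetric] powr_power)
  have "integrable lborel (\<lambda>x. h (sqrt t *\<^sub>R x))" using integrable_lborel_affine[OF pboundD(1)[OF h], of "sqrt t" 0] t by simp
  moreover have "(\<integral>x. \<bar>t powr (real DIM('a) / 2) * h (sqrt t *\<^sub>R x)\<bar> \<partial>lborel) \<le> C"
    using integral_lborel_affine[of "\<lambda>x. \<bar>h x\<bar>" "sqrt t" 0] t pboundD(2)[OF h] by (simp add: abs_mult sq)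
  moreover have "\<bar>t powr (real DIM('a) / 2) * h (sqrt t *\<^sub>R x)\<bar> \<le> C" for x
  proof -
    have "\<bar>t powr (real DIM('a) / 2) * h (sqrt t *\<^sub>R x)\<bar> \<le> t powr (real DIM('a) / 2) * (C * t powr (- real DIM('a) / 2))"
      unfolding abs_mult using pboundD(3)[OF h, of "sqrt t *\<^sub>R x"] by (intro mult_mono) auto
    also have "\<dots> = C * (t powr (real DIM('a) / 2) * t powr (- real DIM('a) / 2))" by simp
    also have "t powr (real DIM('a) / 2) * t powr (- real DIM('a) / 2) = 1" using t by (simp add: powr_add[symmetric])
    finally show ?thesis by simp
  qed
  ultimately show ?thesis by (simp add: pbound_def)
qed

subsection \<open>The limit profile\<close>

lemma integral_Ioo_pos:
  fixes f :: "real \<Rightarrow> real"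
  assumes t: "0 < t" and i: "integrable lborel (\<lambda>s. indicator {0<..<t} s * f s)" and f: "\<And>s. 0 < s \<Longrightarrow> s < t \<Longrightarrow> 0 < f s"
  shows "0 < (\<integral>s. indicator {0<..<t} s * f s \<partial>lborel)"
proof -
  have nn: "0 \<le> indicator {0<..<t} s * f s" for s using f[of s] by (auto simp: indicator_def)
  have "(\<integral>s. indicator {0<..<t} s * f s \<partial>lborel) \<noteq> 0"
  proof
    assume "(\<integral>s. indicator {0<..<t} s * f s \<partial>lborel) = 0"
    then have "AE s in lborel. indicator {0<..<t} s * f s = 0"
      using integral_nonneg_eq_0_iff_AE[OF i] nn by simp
    then have "AE s in lborel. s \<notin> {0<..<t}"
      by eventually_elim (use f in \<open>force simp: indicator_def\<close>)
    then have "{0<..<t} \<in> null_sets lborel" by (intro AE_iff_null_sets[THEN iffD2]) auto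
    then have "emeasure lborel {0<..<t} = 0" by (rule null_setsD1)
    then show False using t by simp
  qed
  moreover have "0 \<le> (\<integral>s. indicator {0<..<t} s * f s \<partial>lborel)" by (rule integral_nonneg_AE) (use nn in auto)
  ultimately show ?thesis by simp
qed

text \<open>The p-th power of the Gaussian at time t is a multiple of the Gaussian at time t/p; this
  is the multiple.\<close>

definition gauss_powr_const :: "'a::euclidean_space itself \<Rightarrow> real \<Rightarrow> real \<Rightarrow> real" where
  "gauss_powr_const TYPE('a) p t = ((4 * pi * t) powr (- real DIM('a) / 2)) powr p / (4 * pi * (t / p)) powr (- real DIM('a) / 2)"

lemma gauss_powr:
  fixes z :: "'a::euclidean_space"
  assumes "0 < t" "0 < p"
  shows "gauss t z powr p = gauss_powr_const TYPE('a) p t * gauss (t / p) z"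
proof -
  have "- (norm z)\<^sup>2 / (4 * t) * p = - (norm z)\<^sup>2 / (4 * (t / p))" using assms by (simp add: field_simps)
  then show ?thesis
    using assms by (simp add: gauss_def gauss_powr_const_def powr_mult exp_powr_real)
qed

text \<open>As powers of Gaussians are multiples of Gaussians, the semigroup law yields a closed
  form whose sign can be read off.\<close>

lemma conv_gauss_powr:
  fixes a :: "'a::euclidean_space"
  assumes s: "0 < s" "s < t" and p: "1 < p"
  shows "conv (dgauss a (t - s)) (\<lambda>z. gauss s z powr p) y = gauss_powr_const TYPE('a) p s * dgauss a (t - s + s / p) y"
proof -
  have "conv (dgauss a (t - s)) (\<lambda>z. gauss s z powr p) y = gauss_powr_const TYPE('a) p s * conv (dgauss a (t - s)) (gauss (s / p)) y"
    unfolding conv_def using s p by (simp add: gauss_powr mult.left_commute)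
  then show ?thesis using conv_dgauss_gauss[of "t - s" "s / p" a] s p by simp
qed

context
  fixes p :: real and a :: "'a::euclidean_space"
  assumes p: "1 < p" and sg: "0 < sigma (real DIM('a)) p" "sigma (real DIM('a)) p < 1 / 4"
begin

text \<open>The first correction for unit mass; by homogeneity, A01 - A0 is f(mass) times this
  function.\<close>

definition profile1 :: "real \<Rightarrow> 'a \<Rightarrow> real" where
  "profile1 t y = Du a (\<lambda>s z. gauss s z powr p) t y"

definition profile2 :: "real \<Rightarrow> 'a \<Rightarrow> real" where
  "profile2 t y = gauss t y powr (p - 1) * profile1 t y"

lemma gauss_mult_powr: "gauss s z powr (p - 1) * gauss s z = gauss s z powr p"
  using powr_add[of "gauss s z" "p - 1" 1] gauss_nonneg[of s z] by (cases "gauss s z = 0") auto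

lemma pbound_gauss_powr:
  assumes s: "0 < s"
  shows "pbound s (1 * s powr (- (sigma (real DIM('a)) p + 1 / 2))) (\<lambda>z::'a. gauss s z powr p)"
proof -
  have "pbound s 1 (gauss s :: 'a \<Rightarrow> real)"
    unfolding pbound_def using integrable_gauss[OF s, where 'a='a] integral_gauss[OF s, where 'a='a] gauss_le[OF s, where 'a='a] by simp
  from pbound_fnl[OF p this] show ?thesis by (simp add: fnl_def gauss_mult_powr)
qed

lemma gauss_powr_jmeas: "jmeas (\<lambda>s (z::'a). gauss s z powr p)" by measurable

text \<open>By \<open>conv_gauss_powr\<close> every time slice of the integral is a positive
  multiple of a differentiated Gaussian, so no cancellation occurs.\<close>

lemma profile1_sign:
  assumes t: "0 < t" and y: "a \<bullet> y \<noteq> 0"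
  shows "(a \<bullet> y) * profile1 t y < 0"
proof -
  let ?f = "\<lambda>s. - ((a \<bullet> y) * conv (dgauss a (t - s)) (\<lambda>z. gauss s z powr p) y)"
  have i: "integrable lborel (\<lambda>s. indicator {0<..<t} s * conv (dgauss a (t - s)) (\<lambda>z. gauss s z powr p) y)"
    by (rule pbound_Du_integrable[OF gauss_powr_jmeas t _ _ pbound_gauss_powr]) (use sg in auto)
  have "0 < (\<integral>s. indicator {0<..<t} s * ?f s \<partial>lborel)"
  proof (rule integral_Ioo_pos[OF t])
    show "integrable lborel (\<lambda>s. indicator {0<..<t} s * ?f s)"
      using integrable_mult_right[OF i, of "- (a \<bullet> y)"] by (simp add: mult_ac)
    fix s assume s: "0 < s" "s < t"
    have r: "0 < t - s + s / p" using s p by (simp add: add_pos_pos)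
    have "?f s = gauss_powr_const TYPE('a) p s * ((a \<bullet> y)\<^sup>2 / (2 * (t - s + s / p)) * gauss (t - s + s / p) y)"
      unfolding conv_gauss_powr[OF s p] by (simp add: dgauss_def power2_eq_square)
    also have "\<dots> > 0"
      using s p y r gauss_pos[OF r, of y] by (intro mult_pos_pos divide_pos_pos) (auto simp: gauss_powr_const_def)
    finally show "0 < ?f s" .
  qed
  also have "(\<integral>s. indicator {0<..<t} s * ?f s \<partial>lborel) = (\<integral>s. - (a \<bullet> y) * (indicator {0<..<t} s * conv (dgauss a (t - s)) (\<lambda>z. gauss s z powr p) y) \<partial>lborel)"
    by (rule Bochner_Integration.integral_cong) auto
  also have "\<dots> = - (a \<bullet> y) * profile1 t y" unfolding profile1_def Du_def by (rule integral_mult_right_zero)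
  finally show ?thesis by simp
qed

text \<open>For G >= 0 homogeneity gives f(m G) = f(m) G^p and f'(m G) = f'(m) G^(p - 1), so the
  mass factors out at both levels of the construction.\<close>

lemma source2_eq_profile2:
  "source2 a p u0 s y = (fnl p (mass u0) * deriv (fnl p) (mass u0)) * profile2 s y"
proof -
  have "(\<lambda>s y. fnl p (A0 u0 s y)) = (\<lambda>s y. fnl p (mass u0) * gauss s y powr p)"
    by (intro ext) (simp add: A0_def fnl_def abs_mult powr_mult gauss_mult_powr[symmetric])
  then have "A01 a p u0 s y - A0 u0 s y = fnl p (mass u0) * profile1 s y"
    by (simp add: A01_minus_A0[OF p] Du_cmult profile1_def)
  then show ?thesis
    by (simp add: source2_def profile2_def deriv_fnl[OF p] A0_def abs_mult powr_mult)
qed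

lemma Rstar_eq_profile: "Rstar a p u0 x = fnl p (mass u0) * deriv (fnl p) (mass u0) * Du a profile2 1 x"
  by (simp add: Rstar_eq_Du[OF p sg] source2_eq_profile2[abs_def] Du_cmult)

lemma pbound_profile2:
  obtains K where "0 \<le> K" "\<And>s. 0 < s \<Longrightarrow> pbound s (K * s powr (- (2 * sigma (real DIM('a)) p + 1 / 2))) (profile2 s)"
proof -
  \<comment> \<open>A datum of mass 1, for which f(1) f'(1) = p: the profile is its
    \<open>source2\<close> divided by p and inherits the bounds.\<close>
  let ?u = "gauss 1 :: 'a \<Rightarrow> real"
  have m: "mass ?u = 1" unfolding mass_def by (rule integral_gauss) simp
  obtain K where K: "0 \<le> K" "\<And>s. 0 < s \<Longrightarrow> pbound s (K * s powr (- (2 * sigma (real DIM('a)) p + 1 / 2))) (source2 a p ?u s)"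
    using pbound_source2[OF p sg] by blast
  have c: "fnl p (mass ?u) * deriv (fnl p) (mass ?u) = p" by (simp add: m fnl_def deriv_fnl[OF p])
  have eq: "profile2 s y = (1 / p) * source2 a p ?u s y" for s y unfolding source2_eq_profile2 c using p by simp
  show ?thesis
  proof (rule that[of "(1 / p) * K"])
    show "0 \<le> (1 / p) * K" using K p by simp
    fix s :: real assume s: "0 < s"
    have [measurable]: "source2 a p ?u s \<in> borel_measurable borel" by (rule pboundD(5)[OF K(2)[OF s]])
    have "pbound s ((1 / p) * (K * s powr (- (2 * sigma (real DIM('a)) p + 1 / 2)))) (profile2 s)"
      by (rule pbound_bounded_mult[OF K(2)[OF s]]) (use p in \<open>auto simp: eq[abs_def] abs_mult\<close>)
    then show "pbound s ((1 / p) * K * s powr (- (2 * sigma (real DIM('a)) p + 1 / 2))) (profile2 s)" by simp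
  qed
qed

lemma profile2_jmeas: "jmeas profile2"
proof -
  note borel_measurable_Du[OF gauss_powr_jmeas, measurable (raw)]
  show ?thesis unfolding profile2_def profile1_def by measurable
qed

lemma Rstar_eq_Rstar2: "Rstar a p u0 x = Rstar2 a p u0 x"
proof -
  obtain K where K: "\<And>s. 0 < s \<Longrightarrow> pbound s (K * s powr (- (2 * sigma (real DIM('a)) p + 1 / 2))) (profile2 s)"
    using pbound_profile2 by blast
  have inner: "set_lebesgue_integral lborel {0..t} (\<lambda>s. adgrad a (t - s) (\<lambda>z. gauss s z powr p) y) = profile1 t y" for t y
    unfolding profile1_def Du_def
    by (rule set_integral_Icc_eq_Ioo, rule adgrad_eq_conv) (auto intro: pboundD(1)[OF pbound_gauss_powr])
  have "set_lebesgue_integral lborel {0..1} (\<lambda>\<theta>. adgrad a (1 - \<theta>) (profile2 \<theta>) x) = Du a profile2 1 x"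
    unfolding Du_def
    by (rule set_integral_Icc_eq_Ioo, rule adgrad_eq_conv) (auto intro: pboundD(1)[OF K])
  then show ?thesis
    unfolding Rstar2_def Rstar_eq_profile inner profile2_def[symmetric] by simp
qed

text \<open>All factors of the integrand defining the profile at the origin have a sign, since
  \<open>a \<cdot> \<nabla>\<close> of a centred Gaussian has the sign of \<open>- a \<cdot> y\<close>.\<close>

lemma profile2_conv_origin_neg:
  assumes anz: "a \<noteq> 0" and s: "0 < s" "s < 1"
  shows "conv (dgauss a (1 - s)) (profile2 s) 0 < 0"
proof -
  obtain K where K: "\<And>s. 0 < s \<Longrightarrow> pbound s (K * s powr (- (2 * sigma (real DIM('a)) p + 1 / 2))) (profile2 s)"
    using pbound_profile2 by blast
  have s1: "0 < 1 - s" using s by simp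
  let ?h = "\<lambda>y. - (dgauss a (1 - s) (0 - y) * profile2 s y)"
  have i: "integrable lborel ?h"
    using conv_integrand_bounded_kernel[of "dgauss a (1 - s)", OF _ dgauss_sup[OF s1] pboundD(1)[OF K[OF s(1)]], of 0] by simp
  have eq: "?h y = gauss (1 - s) y / (2 * (1 - s)) * gauss s y powr (p - 1) * - ((a \<bullet> y) * profile1 s y)" for y
    by (simp add: dgauss_def profile2_def)
  have pos: "0 < ?h y" if "a \<bullet> y \<noteq> 0" for y
    unfolding eq using profile1_sign[OF s(1) that] gauss_pos[OF s1, of y] gauss_pos[OF s(1), of y] s1
    by (intro mult_pos_pos divide_pos_pos) auto
  have nn: "0 \<le> ?h y" for y
  proof (cases "a \<bullet> y = 0")
    case True
    then show ?thesis unfolding eq by simp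
  qed (use pos[of y] in simp)
  have "(\<integral>y. ?h y \<partial>lborel) \<noteq> 0"
  proof
    assume "(\<integral>y. ?h y \<partial>lborel) = 0"
    then have "AE y in lborel. ?h y = 0" using integral_nonneg_eq_0_iff_AE[OF i] nn by simp
    \<comment> \<open>Since |a . y| is continuous in y, the bound holds also at y = a, which
      contradicts a \<noteq> 0.\<close>
    then have "AE y in lborel. \<bar>a \<bullet> y\<bar> \<le> 0" by eventually_elim (use pos in force)
    then have "\<bar>a \<bullet> a\<bar> \<le> 0" by (rule isCont_AE_le_imp_le[rotated]) (intro continuous_intros)
    then show False using anz inner_gt_zero_iff[of a] by linarith
  qed
  moreover have "0 \<le> (\<integral>y. ?h y \<partial>lborel)" by (rule integral_nonneg_AE) (use nn in auto)
  ultimately have "0 < (\<integral>y. ?h y \<partial>lborel)" by simp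
  then show ?thesis by (simp add: conv_def)
qed

text \<open>By continuity, an \<open>Rstar\<close> that is zero almost everywhere would vanish at
  the origin; but there the integrand of \<open>Du a profile2 1\<close> is strictly negative at all
  times between 0 and 1.\<close>

lemma Rstar_not_AE_zero:
  assumes anz: "a \<noteq> 0" and c: "fnl p (mass u0) * deriv (fnl p) (mass u0) \<noteq> 0"
  shows "\<not> (AE x in lborel. Rstar a p u0 x = 0)"
proof
  assume "AE x in lborel. Rstar a p u0 x = 0"
  then have "AE x in lborel. \<bar>Rstar a p u0 x\<bar> \<le> 0" by simp
  then have "\<bar>Rstar a p u0 0\<bar> \<le> 0"
    by (rule isCont_AE_le_imp_le[rotated]) (intro continuous_intros isCont_Rstar[OF p sg])
  then have z: "Du a profile2 1 0 = 0" using c by (auto simp: Rstar_eq_profile)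
  obtain K where K: "0 \<le> K" "\<And>s. 0 < s \<Longrightarrow> pbound s (K * s powr (- (2 * sigma (real DIM('a)) p + 1 / 2))) (profile2 s)"
    using pbound_profile2 by blast
  have i: "integrable lborel (\<lambda>s. indicator {0<..<1} s * conv (dgauss a (1 - s)) (profile2 s) 0)"
    by (rule pbound_Du_integrable[OF profile2_jmeas zero_less_one _ _ K(2) K(1)]) (use sg in auto)
  have "0 < (\<integral>s. indicator {0<..<1} s * - conv (dgauss a (1 - s)) (profile2 s) 0 \<partial>lborel)"
    by (rule integral_Ioo_pos[OF zero_less_one]) (use i profile2_conv_origin_neg[OF anz] in auto)
  then show False using z by (simp add: Du_def)
qed

end

text \<open>Convergence in the norms of \<open>pbound\<close> at time 1 implies convergence of every
  L^q norm, by the triangle inequality in both directions. All norms involved are finite, so the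
  comparison can be made in the reals.\<close>

lemma norm_limit_of_pbound:
  fixes w :: "real \<Rightarrow> 'a::euclidean_space \<Rightarrow> real"
  assumes R: "pbound 1 K R" and d: "0 < \<delta>" and w: "\<And>t. 0 < t \<Longrightarrow> pbound 1 (C * t powr (- \<delta>)) (\<lambda>x. w t x - R x)"
    and q: "1 \<le> q"
  shows "((\<lambda>t. enn2real (Lq_norm q (w t))) \<longlongrightarrow> enn2real (Lq_norm q R)) at_top"
    and "\<And>t. 0 < t \<Longrightarrow> Lq_norm q (w t) < top" and "Lq_norm q R < top"
proof -
  have wb: "pbound 1 (K + C * t powr (- \<delta>)) (w t)" if t: "0 < t" for t
    using pbound_add[OF R w[OF t]] by simp
  have Rw: "pbound 1 (C * t powr (- \<delta>)) (\<lambda>x. R x - w t x)" if t: "0 < t" for t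
    using pbound_bounded_mult[OF w[OF t], of "\<lambda>x. R x - w t x" 1] pboundD(5)[OF R] pboundD(5)[OF wb[OF t]] by (simp add: abs_minus_commute)
  show fin: "Lq_norm q (w t) < top" if "0 < t" for t
    using Lq_norm_le_pbound[OF wb[OF that] q] ennreal_less_top le_less_trans by blast
  show finR: "Lq_norm q R < top" using Lq_norm_le_pbound[OF R q] ennreal_less_top le_less_trans by blast
  have le: "\<bar>enn2real (Lq_norm q (w t)) - enn2real (Lq_norm q R)\<bar> \<le> C * t powr (- \<delta>)" if t: "0 < t" for t
  proof -
    have C0: "0 \<le> C * t powr (- \<delta>)" by (rule pboundD(4)[OF w[OF t]])
    have conv_real: "enn2real A \<le> enn2real B + c" if "A \<le> B + D" "D \<le> ennreal c" "B < top" "0 \<le> c" for A B D :: ennreal and c :: real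
    proof -
      have "A \<le> B + ennreal c" using that(1,2) by (meson add_left_mono order_trans)
      also have "\<dots> = ennreal (enn2real B + c)" using that(3,4) by (simp add: ennreal_plus)
      finally show ?thesis using that(4) by (simp add: enn2real_leI)
    qed
    have "Lq_norm q (w t) \<le> Lq_norm q R + Lq_norm q (\<lambda>x. w t x - R x)"
      using Lq_norm_triangle[OF R w[OF t] q] by simp
    then have 1: "enn2real (Lq_norm q (w t)) \<le> enn2real (Lq_norm q R) + C * t powr (- \<delta>)"
      by (rule conv_real[OF _ Lq_norm_le_pbound[OF w[OF t] q] finR C0])
    have "Lq_norm q R \<le> Lq_norm q (w t) + Lq_norm q (\<lambda>x. R x - w t x)"
      using Lq_norm_triangle[OF wb[OF t] Rw[OF t] q] by simp
    then have 2: "enn2real (Lq_norm q R) \<le> enn2real (Lq_norm q (w t)) + C * t powr (- \<delta>)"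
      by (rule conv_real[OF _ Lq_norm_le_pbound[OF Rw[OF t] q] fin[OF t] C0])
    show ?thesis using 1 2 by simp
  qed
  have l0: "((\<lambda>t. C * t powr (- \<delta>)) \<longlongrightarrow> 0) at_top"
    using tendsto_mult_right_zero[OF tendsto_neg_powr[OF _ filterlim_ident, of "- \<delta>"], of C] d by simp
  show "((\<lambda>t. enn2real (Lq_norm q (w t))) \<longlongrightarrow> enn2real (Lq_norm q R)) at_top"
  proof (rule LIM_zero_cancel, rule Lim_null_comparison[OF _ l0])
    show "\<forall>\<^sub>F t in at_top. norm (enn2real (Lq_norm q (w t)) - enn2real (Lq_norm q R)) \<le> C * t powr (- \<delta>)"
      using eventually_gt_at_top[of 0] by eventually_elim (simp add: le)
  qed
qed

lemma Lq_norm_eq_0: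
  fixes g :: "'a::euclidean_space \<Rightarrow> real"
  assumes g: "pbound 1 K g" and q: "1 \<le> q" and 0: "Lq_norm q g = 0"
  shows "AE x in lborel. g x = 0"
  using q
proof (cases rule: one_le_ereal_cases)
  case 1
  have "AE x in lborel. \<forall>n::nat. \<bar>g x\<bar> \<le> 1 / real (Suc n)"
    unfolding AE_all_countable
  proof
    fix n :: nat
    show "AE x in lborel. \<bar>g x\<bar> \<le> 1 / real (Suc n)"
      by (rule Lq_norm_inf_less) (use 0 1 in simp)
  qed
  then show ?thesis
  proof eventually_elim
    case (elim x)
    show ?case
    proof (rule ccontr)
      assume "g x \<noteq> 0"
      then obtain n where "inverse (real (Suc n)) < \<bar>g x\<bar>" using reals_Archimedean[of "\<bar>g x\<bar>"] by auto
      then show False using elim[rule_format, of n] by (simp add: inverse_eq_divide)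
    qed
  qed
next
  case (2 r)
  have i: "integrable lborel (\<lambda>x. \<bar>g x\<bar> powr r)" by (rule pbound_powr(1)[OF g 2(2)])
  have "(\<integral>x. \<bar>g x\<bar> powr r \<partial>lborel) = 0"
    using 0 unfolding 2(1) Lq_norm_ereal[OF 2(2) i] by simp
  then show ?thesis using integral_nonneg_eq_0_iff_AE[OF i] by auto
qed

text \<open>Let w(t) be the parabolically rescaled difference of u and A01, amplified by
  t^(2\<sigma>). Self-similarity of D turns the remainder bound into w(t) - \<open>Rstar\<close> =
  O(t^(-\<delta>)) in L1 and in the supremum, and both limits for all q are read off from this one
  estimate.\<close>

theorem theorem2p5:
  fixes a :: "'a::euclidean_space" and p :: real and u0 :: "'a \<Rightarrow> real"
    and u :: "real \<Rightarrow> 'a \<Rightarrow> real"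
  assumes a_nz: "a \<noteq> 0"
    and p_lo: "1 + 1 / real DIM('a) < p" and p_hi: "p < 1 + 3 / (2 * real DIM('a))"
    and u0_meas: "u0 \<in> borel_measurable lborel"
    and u0_L1: "integrable lborel u0"
    and u0_L11: "\<forall>b\<in>Basis. integrable lborel (\<lambda>x. (x \<bullet> b) * u0 x)"
    and u0_Linf: "\<exists>C. AE x in lborel. \<bar>u0 x\<bar> \<le> C"
    and sol: "global_solution a p u0 u"
  shows "(\<forall>q::ereal. 1 \<le> q \<longrightarrow>
           ((\<lambda>t. ennreal (t powr (real DIM('a) / 2 * (1 - inv_exp q) + 2 * sigma (real DIM('a)) p))
                   * Lq_norm q (\<lambda>x. u t x - A01 a p u0 t x))
             \<longlongrightarrow> Lq_norm q (Rstar a p u0)) at_top)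
       \<and> (AE x in lborel. Rstar a p u0 x = Rstar2 a p u0 x)
       \<and> (fnl p (mass u0) * deriv (fnl p) (mass u0) \<noteq> 0 \<longrightarrow>
           \<not> (AE x in lborel. Rstar a p u0 x = 0) \<and>
           (\<forall>q::ereal. 1 \<le> q \<longrightarrow>
              ((\<lambda>t. (t powr (real DIM('a) / 2 * (1 - inv_exp q))
                       * enn2real (Lq_norm q (\<lambda>x. u t x - A01 a p u0 t x)))
                     / (t powr (- 2 * sigma (real DIM('a)) p) * enn2real (Lq_norm q (Rstar a p u0))))
                \<longlongrightarrow> 1) at_top))"
proof -
  let ?n = "real DIM('a)"
  define \<sigma> where "\<sigma> = sigma ?n p"
  have n1: "0 < ?n" by simp
  have p1: "1 < p" using p_lo n1 by (smt (verit) divide_pos_pos)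
  \<comment> \<open>The window for p is exactly 0 < \<sigma> < 1/4.\<close>
  have sg: "0 < sigma ?n p" "sigma ?n p < 1 / 4"
  proof -
    have "1 / ?n < p - 1" "p - 1 < 3 / (2 * ?n)" using p_lo p_hi by auto
    then have "1 < ?n * (p - 1)" "?n * (p - 1) < 3 / 2" using n1 by (auto simp: field_simps)
    moreover have "sigma ?n p = (?n * (p - 1) - 1) / 2" by (simp add: sigma_def diff_divide_distrib)
    ultimately show "0 < sigma ?n p" "sigma ?n p < 1 / 4" by auto
  qed
  have u1: "integrable lborel (\<lambda>x. norm x * u0 x)"
  proof (rule Bochner_Integration.integrable_bound)
    show "integrable lborel (\<lambda>x. \<Sum>b\<in>Basis. \<bar>(x \<bullet> b) * u0 x\<bar>)" using u0_L11 by auto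
    show "AE x in lborel. norm (norm x * u0 x) \<le> norm (\<Sum>b\<in>Basis. \<bar>(x \<bullet> b) * u0 x\<bar>)"
    proof (intro AE_I2)
      fix x :: 'a
      have "norm (norm x * u0 x) = norm x * \<bar>u0 x\<bar>" by (simp add: abs_mult)
      also have "\<dots> \<le> (\<Sum>b\<in>Basis. \<bar>x \<bullet> b\<bar>) * \<bar>u0 x\<bar>" by (intro mult_right_mono norm_le_l1) simp
      also have "\<dots> = (\<Sum>b\<in>Basis. \<bar>(x \<bullet> b) * u0 x\<bar>)" by (simp add: sum_distrib_right abs_mult)
      finally show "norm (norm x * u0 x) \<le> norm (\<Sum>b\<in>Basis. \<bar>(x \<bullet> b) * u0 x\<bar>)" by simp
    qed
  qed (use u0_meas in simp)
  obtain v B M where sol_v: "mild_solution a p u0 v B M" and uv: "\<And>t. 0 < t \<Longrightarrow> AE x in lborel. u t x = v t x"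
    using regular_solution[OF p1 u0_L1 sol] by blast
  interpret mild_solution a p u0 v B M by (rule sol_v)
  obtain C \<delta> where C: "0 \<le> C" "0 < \<delta>" "\<And>t. 0 < t \<Longrightarrow> pbound t (C * t powr (- (2 * \<sigma> + \<delta>)))
       (\<lambda>x. v t x - A01 a p u0 t x - Du a (source2 a p u0) t x)"
    using remainder_bound[OF sg u1] unfolding \<sigma>_def by blast
  let ?R = "Rstar a p u0"
  obtain K where K: "pbound 1 K ?R" using pbound_Rstar[OF p1 sg] by blast
  define w where "w = (\<lambda>t x. t powr (?n / 2 + 2 * \<sigma>) * (v t (sqrt t *\<^sub>R x) - A01 a p u0 t (sqrt t *\<^sub>R x)))"
  have wR: "pbound 1 (C * t powr (- \<delta>)) (\<lambda>x. w t x - ?R x)" if t: "0 < t" for t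
  proof -
    let ?h = "\<lambda>x. v t x - A01 a p u0 t x - Du a (source2 a p u0) t x"
    have eq: "w t x - ?R x = t powr (2 * \<sigma>) * (t powr (?n / 2) * ?h (sqrt t *\<^sub>R x))" for x
    proof -
      have "t powr (?n / 2 + 2 * \<sigma>) * (t powr (- ?n / 2 - 2 * \<sigma>) * ?R x) = ?R x"
        unfolding mult.assoc[symmetric] powr_add[symmetric] using t by simp
      then have "w t x - ?R x = t powr (?n / 2 + 2 * \<sigma>) * ?h (sqrt t *\<^sub>R x)"
        by (simp add: w_def Du_source2_scale[OF p1 sg t] \<sigma>_def right_diff_distrib)
      then show ?thesis by (simp add: powr_add mult_ac)
    qed
    have s: "pbound 1 (C * t powr (- (2 * \<sigma> + \<delta>))) (\<lambda>x. t powr (?n / 2) * ?h (sqrt t *\<^sub>R x))"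
      by (rule pbound_scale[OF t C(3)[OF t]])
    have "pbound 1 (t powr (2 * \<sigma>) * (C * t powr (- (2 * \<sigma> + \<delta>)))) (\<lambda>x. w t x - ?R x)"
      unfolding eq
    proof (rule pbound_bounded_mult[OF s])
      show "(\<lambda>x. t powr (2 * \<sigma>) * (t powr (?n / 2) * ?h (sqrt t *\<^sub>R x))) \<in> borel_measurable borel"
        by (rule borel_measurable_times[OF borel_measurable_const pboundD(5)[OF s]])
    qed (simp_all only: abs_mult[of "t powr (2 * \<sigma>)"] abs_of_nonneg[OF powr_ge_zero] order.refl powr_ge_zero)
    also have "t powr (2 * \<sigma>) * (C * t powr (- (2 * \<sigma> + \<delta>))) = C * (t powr (2 * \<sigma>) * t powr (- (2 * \<sigma> + \<delta>)))" by simp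
    also have "t powr (2 * \<sigma>) * t powr (- (2 * \<sigma> + \<delta>)) = t powr (- \<delta>)" unfolding powr_add[symmetric] by simp
    finally show ?thesis .
  qed
  have norm_w: "ennreal (t powr (?n / 2 * (1 - inv_exp q) + 2 * \<sigma>)) * Lq_norm q (\<lambda>x. u t x - A01 a p u0 t x) = Lq_norm q (w t)"
    if t: "0 < t" and q: "1 \<le> q" for t q
  proof -
    have "A01 a p u0 t \<in> borel_measurable borel"
      using jmeas_compose[OF A01_jmeas[OF p1], of "\<lambda>_. t" borel "\<lambda>x. x"] by simp
    then have m: "(\<lambda>x. v t x - A01 a p u0 t x) \<in> borel_measurable borel" using vm[of t] by simp
    have "Lq_norm q (\<lambda>x. u t x - A01 a p u0 t x) = Lq_norm q (\<lambda>x. v t x - A01 a p u0 t x)"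
      by (rule Lq_norm_cong_AE) (use uv[OF t] in auto)
    then show ?thesis using Lq_norm_scale[OF t m q, of "2 * \<sigma>"] by (simp add: w_def)
  qed
  note lim = norm_limit_of_pbound[OF K C(2) wR]
  show ?thesis
    unfolding \<sigma>_def[symmetric]
  proof (intro conjI allI impI)
    fix q :: ereal assume q: "1 \<le> q"
    have "((\<lambda>t. ennreal (enn2real (Lq_norm q (w t)))) \<longlongrightarrow> ennreal (enn2real (Lq_norm q ?R))) at_top"
      using lim(1)[OF _ q] by (intro tendsto_ennrealI) auto
    moreover have "ennreal (enn2real (Lq_norm q ?R)) = Lq_norm q ?R" using lim(3)[OF _ q] by simp
    moreover have "\<forall>\<^sub>F t in at_top. ennreal (enn2real (Lq_norm q (w t)))
       = ennreal (t powr (?n / 2 * (1 - inv_exp q) + 2 * \<sigma>)) * Lq_norm q (\<lambda>x. u t x - A01 a p u0 t x)"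
      using eventually_gt_at_top[of 0]
    proof eventually_elim
      case (elim t)
      then show ?case using lim(2)[OF _ q, of t] norm_w[OF elim q] by simp
    qed
    ultimately show "((\<lambda>t. ennreal (t powr (?n / 2 * (1 - inv_exp q) + 2 * \<sigma>)) * Lq_norm q (\<lambda>x. u t x - A01 a p u0 t x)) \<longlongrightarrow> Lq_norm q ?R) at_top"
      using Lim_transform_eventually by force
  next
    show "AE x in lborel. ?R x = Rstar2 a p u0 x" using Rstar_eq_Rstar2[OF p1 sg] by simp
  next
    assume c: "fnl p (mass u0) * deriv (fnl p) (mass u0) \<noteq> 0"
    show "\<not> (AE x in lborel. ?R x = 0)" by (rule Rstar_not_AE_zero[OF p1 sg a_nz c])
  next
    fix q :: ereal assume c: "fnl p (mass u0) * deriv (fnl p) (mass u0) \<noteq> 0" and q: "1 \<le> q"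
    have "Lq_norm q ?R \<noteq> 0" using Lq_norm_eq_0[OF K q] Rstar_not_AE_zero[OF p1 sg a_nz c] by blast
    then have R0: "enn2real (Lq_norm q ?R) \<noteq> 0" using lim(3)[OF _ q] by (simp add: enn2real_eq_0_iff)
    have "((\<lambda>t. enn2real (Lq_norm q (w t)) / enn2real (Lq_norm q ?R)) \<longlongrightarrow> enn2real (Lq_norm q ?R) / enn2real (Lq_norm q ?R)) at_top"
      by (rule tendsto_divide[OF lim(1)[OF _ q] tendsto_const R0])
    moreover have "\<forall>\<^sub>F t in at_top. enn2real (Lq_norm q (w t)) / enn2real (Lq_norm q ?R)
       = (t powr (?n / 2 * (1 - inv_exp q)) * enn2real (Lq_norm q (\<lambda>x. u t x - A01 a p u0 t x)))
           / (t powr (- 2 * \<sigma>) * enn2real (Lq_norm q ?R))"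
      using eventually_gt_at_top[of 0]
    proof eventually_elim
      case (elim t)
      have "enn2real (Lq_norm q (w t)) = t powr (?n / 2 * (1 - inv_exp q) + 2 * \<sigma>) * enn2real (Lq_norm q (\<lambda>x. u t x - A01 a p u0 t x))"
        using norm_w[OF elim q, symmetric] by (simp add: enn2real_mult)
      also have "t powr (?n / 2 * (1 - inv_exp q) + 2 * \<sigma>) = t powr (?n / 2 * (1 - inv_exp q)) / t powr (- 2 * \<sigma>)"
        unfolding powr_diff[symmetric] by simp
      finally show ?case by simp
    qed
    ultimately show "((\<lambda>t. (t powr (?n / 2 * (1 - inv_exp q)) * enn2real (Lq_norm q (\<lambda>x. u t x - A01 a p u0 t x)))
           / (t powr (- 2 * \<sigma>) * enn2real (Lq_norm q ?R))) \<longlongrightarrow> 1) at_top"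
      using R0 Lim_transform_eventually by force
  qed
qed

end
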